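(* For all decorated dimension vectors $(\mathbf d,\mathbf v),(\mathbf d',\mathbf v')\in\mathbb Z_{\ge0}^n\times\mathbb Z_{\ge0}^n$, the functions $$\mathrm{decRep}(\Lambda,\mathbf d,\mathbf v)\to\mathbb Z,\ \mathcal M\mapsto E_\Lambda(\mathcal M,\mathcal M),\qquad \mathrm{decRep}(\Lambda,\mathbf d,\mathbf v)\times\mathrm{decRep}(\Lambda,\mathbf d',\mathbf v')\to\mathbb Z,\ (\mathcal M,\mathcal N)\mapsto E_\Lambda(\mathcal M,\mathcal N)$$ are upper semicontinuous. In particular, if $A$ is a finite-dimensional $\mathbb C$-algebra, then for all dimension vectors $\mathbf d,\mathbf d'\in\mathbb Z_{\ge0}^n$ the functions $$\mathrm{Rep}(A,\mathbf d)\to\mathbb Z,\ M\mapsto\dim\mathrm{Hom}_A(\tau_A^-(M),M),\qquad \mathrm{Rep}(A,\mathbf d)\times\mathrm{Rep}(A,\mathbf d')\to\mathbb Z,\ (M,N)\mapsto\dim\mathrm{Hom}_A(\tau_A^-(N),M),$$ as well as the functions $$\mathrm{Rep}(A,\mathbf d)\to\mathbb Z,\ M\mapsto\dim\mathrm{Hom}_A(M,\tau_A(M)),\qquad \mathrm{Rep}(A,\mathbf d)\times\mathrm{Rep}(A,\mathbf d')\to\mathbb Z,\ (M,N)\mapsto\dim\mathrm{Hom}_A(N,\tau_A(M)),$$ are upper semicontinuous.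
   Context: Let $n\ge1$, $m\ge0$, $[n]=\{1,\dots,n\}$. $Q$ is a finite quiver with vertex set $[n+m]$ all of whose arrows $a\colon s(a)\to t(a)$ have both endpoints in $[n]$; $\mathfrak m$ is the arrow ideal of the complete path algebra $\mathbb C\langle\langle Q\rangle\rangle$; $\mathcal J\subseteq\mathfrak m^2$ is a closed two-sided ideal (in the $\mathfrak m$-adic topology), and $\Lambda=\mathbb C\langle\langle Q\rangle\rangle/\mathcal J$ (not assumed finite-dimensional). For $\mathbf d\in\mathbb Z_{\ge0}^n$, $\mathrm{Rep}(\Lambda,\mathbf d)$ is the affine variety of those $M\in\prod_{a\in Q_1}\mathrm{Hom}_{\mathbb C}(\mathbb C^{d_{s(a)}},\mathbb C^{d_{t(a)}})$ that are (nilpotent and) annihilated by every element of $\mathcal J$, i.e. $\Lambda$-module structures with dimension vector $\mathbf d$, supported in $[n]$. $\mathrm{decRep}(\Lambda,\mathbf d,\mathbf v):=\mathrm{Rep}(\Lambda,\mathbf d)\times\{\mathbf v\}$. All varieties carry the Zariski topology. For $\mathcal N=(N,\mathbf w)$ supported in $[n]$, the $\mathbf g$-vector $\mathbf g_{\mathcal N}^\Lambda=(g_i)_{i=1}^n$ is $g_i=-\dim_{\mathbb C}\mathrm{Hom}_\Lambda(S(i),N)+\dim_{\mathbb C}\mathrm{Ext}^1_\Lambda(S(i),N)+w_i$, where $S(i)$ is the simple at $i$. For $\mathcal M=(M,\mathbf v)$ and $\mathcal N=(N,\mathbf w)$, the $E$-invariant is $E_\Lambda(\mathcal M,\mathcal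 N):=\dim_{\mathbb C}\mathrm{Hom}_\Lambda(M,N)+\langle\underline{\dim}(M),\mathbf g_{\mathcal N}^\Lambda\rangle$, with $\langle\cdot,\cdot\rangle$ the standard dot product. For a finite-dimensional algebra $A$, presented as an admissible quotient of the path algebra of a quiver with $n$ vertices, $\mathrm{Rep}(A,\mathbf d)$ is the affine variety of representations with dimension vector $\mathbf d$, and $\tau_A$, $\tau_A^-$ are the Auslander–Reiten translation and inverse Auslander–Reiten translation. *)

theory Defs
  imports
    "HOL-Analysis.Analysis"
    "HOL-Library.Function_Algebras"
    "Graph_Theory.Arc_Walk"
begin

section \<open>Zariski topology and upper semicontinuity\<close>

text \<open>
  A variety is given by its set \<open>X\<close> of points together with a set \<open>C\<close> of coordinate
  functions; the regular functions used to cut out closed subsets are the polynomials in \<open>C\<close>.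
\<close>

inductive_set polynomials :: "('x \<Rightarrow> complex) set \<Rightarrow> ('x \<Rightarrow> complex) set"
  for C :: "('x \<Rightarrow> complex) set" where
  const: "(\<lambda>_. c) \<in> polynomials C"
| coord: "f \<in> C \<Longrightarrow> f \<in> polynomials C"
| add: "f \<in> polynomials C \<Longrightarrow> g \<in> polynomials C \<Longrightarrow> (\<lambda>x. f x + g x) \<in> polynomials C"
| mult: "f \<in> polynomials C \<Longrightarrow> g \<in> polynomials C \<Longrightarrow> (\<lambda>x. f x * g x) \<in> polynomials C"

definition zariski_open :: "('x \<Rightarrow> complex) set \<Rightarrow> 'x set \<Rightarrow> 'x set \<Rightarrow> bool" where
  "zariski_open C X U \<longleftrightarrow>
     (\<exists>S \<subseteq> polynomials C. U = X - {x \<in> X. \<forall>f\<in>S. f x = 0})"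

lemma istopology_zariski_open: "istopology (zariski_open C X)"
proof -
  have 1: "zariski_open C X (U \<inter> V)" if U: "zariski_open C X U" and V: "zariski_open C X V" for U V
  proof -
    from U obtain S where S: "S \<subseteq> polynomials C" and US: "U = X - {x \<in> X. \<forall>f\<in>S. f x = 0}"
      unfolding zariski_open_def by (elim exE conjE)
    from V obtain T where T: "T \<subseteq> polynomials C" and VT: "V = X - {x \<in> X. \<forall>f\<in>T. f x = 0}"
      unfolding zariski_open_def by (elim exE conjE)
    define P where "P = (\<Union>f\<in>S. \<Union>g\<in>T. {\<lambda>x. f x * g x})"
    have "P \<subseteq> polynomials C"
      unfolding P_def using S T by (intro UN_least) (simp add: polynomials.mult subset_iff)
    moreover have "U \<inter> V = X - {x \<in> X. \<forall>h\<in>P. h x = 0}"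
    proof (rule set_eqI)
      fix x
      have "(\<forall>h\<in>P. h x = 0) \<longleftrightarrow> (\<forall>f\<in>S. \<forall>g\<in>T. f x * g x = 0)"
        unfolding P_def by simp
      also have "\<dots> \<longleftrightarrow> (\<forall>f\<in>S. f x = 0) \<or> (\<forall>g\<in>T. g x = 0)"
        unfolding mult_eq_0_iff by blast
      finally show "x \<in> U \<inter> V \<longleftrightarrow> x \<in> X - {x \<in> X. \<forall>h\<in>P. h x = 0}"
        unfolding US VT by simp blast
    qed
    ultimately show ?thesis unfolding zariski_open_def by (intro exI[of _ P] conjI)
  qed
  have 2: "zariski_open C X (\<Union>\<K>)" if K: "\<forall>U\<in>\<K>. zariski_open C X U" for \<K>
  proof -
    let ?P = "\<lambda>U S. S \<subseteq> polynomials C \<and> U = X - {x \<in> X. \<forall>f\<in>S. f x = 0}"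
    define S where "S U = (SOME S. ?P U S)" for U
    have S: "?P U (S U)" if "U \<in> \<K>" for U
    proof -
      have "\<exists>S. ?P U S" using K that unfolding zariski_open_def by (rule bspec)
      then show ?thesis unfolding S_def by (rule someI_ex)
    qed
    have sub: "(\<Union>U\<in>\<K>. S U) \<subseteq> polynomials C"
      by (rule UN_least) (rule S[THEN conjunct1])
    have eq: "\<Union>\<K> = X - {x \<in> X. \<forall>f\<in>(\<Union>U\<in>\<K>. S U). f x = 0}"
    proof (intro equalityI subsetI)
      fix x assume "x \<in> \<Union>\<K>"
      then obtain U where U: "U \<in> \<K>" "x \<in> U" by (rule UnionE)
      have "x \<in> X - {x \<in> X. \<forall>f\<in>S U. f x = 0}"
        by (subst S[OF U(1), THEN conjunct2, symmetric]) (rule U(2))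
      with U(1) show "x \<in> X - {x \<in> X. \<forall>f\<in>(\<Union>U\<in>\<K>. S U). f x = 0}" by auto
    next
      fix x assume "x \<in> X - {x \<in> X. \<forall>f\<in>(\<Union>U\<in>\<K>. S U). f x = 0}"
      then obtain U f where U: "x \<in> X" "U \<in> \<K>" "f \<in> S U" "f x \<noteq> 0" by auto
      then have "x \<in> X - {x \<in> X. \<forall>f\<in>S U. f x = 0}" by auto
      then have "x \<in> U" by (subst S[OF U(2), THEN conjunct2])
      with U(2) show "x \<in> \<Union>\<K>" by (rule UnionI)
    qed
    show ?thesis unfolding zariski_open_def by (intro exI[of _ "\<Union>U\<in>\<K>. S U"] conjI sub eq)
  qed
  show ?thesis unfolding istopology_def using 1 2 by simp
qed

definition zariski_topology :: "('x \<Rightarrow> complex) set \<Rightarrow> 'x set \<Rightarrow> 'x topology" where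
  "zariski_topology C X = topology (zariski_open C X)"

lemma openin_zariski_topology: "openin (zariski_topology C X) U \<longleftrightarrow> zariski_open C X U"
  by (simp add: zariski_topology_def topology_inverse' istopology_zariski_open)

lemma topspace_zariski_topology: "topspace (zariski_topology C X) = X"
proof
  show "topspace (zariski_topology C X) \<subseteq> X"
    using openin_topspace[of "zariski_topology C X"]
    unfolding openin_zariski_topology zariski_open_def by blast
  have "zariski_open C X X"
    unfolding zariski_open_def
    by (rule exI[of _ "{\<lambda>_. 1}"]) (auto intro: polynomials.const)
  then show "X \<subseteq> topspace (zariski_topology C X)"
    by (simp add: openin_zariski_topology openin_subset)
qed

definition upper_semicontinuous :: "'x topology \<Rightarrow> ('x \<Rightarrow> int) \<Rightarrow> bool" where
  "upper_semicontinuous T f \<longleftrightarrow> (\<forall>k. openin T {x \<in> topspace T. f x < k})"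

text \<open>
  Coordinates of a product of varieties. Its Zariski topology is that of the product variety,
  which is finer than the product of the two Zariski topologies.
\<close>

definition prod_coords ::
    "('x \<Rightarrow> complex) set \<Rightarrow> ('y \<Rightarrow> complex) set \<Rightarrow> ('x \<times> 'y \<Rightarrow> complex) set" where
  "prod_coords C D = (\<lambda>f. f \<circ> fst) ` C \<union> (\<lambda>g. g \<circ> snd) ` D"


section \<open>Spaces of complex-valued functions\<close>

definition cscale :: "complex \<Rightarrow> ('x \<Rightarrow> complex) \<Rightarrow> 'x \<Rightarrow> complex" where
  "cscale c f = (\<lambda>x. c * f x)"

lemma vector_space_cscale: "vector_space cscale"
  by standard (auto simp: cscale_def fun_eq_iff algebra_simps)

abbreviation cdim :: "('x \<Rightarrow> complex) set \<Rightarrow> nat" where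
  "cdim \<equiv> vector_space.dim cscale"


section \<open>Quivers and (complete) path algebras\<close>

text \<open>
  A quiver is a \<open>pre_digraph\<close> (loops and multiple arrows allowed); an arrow \<open>a\<close> goes from
  \<open>tail Q a\<close> to \<open>head Q a\<close>. In \<open>quiver n m Q\<close> the last \<open>m\<close> vertices are isolated.
\<close>

definition quiver :: "nat \<Rightarrow> nat \<Rightarrow> (nat, 'a) pre_digraph \<Rightarrow> bool" where
  "quiver n m Q \<longleftrightarrow> fin_digraph Q \<and> verts Q = {1..n+m} \<and>
     (\<forall>a \<in> arcs Q. tail Q a \<in> {1..n} \<and> head Q a \<in> {1..n})"

text \<open>
  A path is a pair of its starting vertex and the list of its arrows in the order in which they
  are traversed; \<open>(u, [])\<close> is the trivial path at \<open>u\<close>.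
\<close>

type_synonym 'a qpath = "nat \<times> 'a list"

definition qpaths :: "(nat, 'a) pre_digraph \<Rightarrow> 'a qpath set" where
  "qpaths Q = {(u, p). \<exists>v. pre_digraph.awalk Q u p v}"

definition complete_path_algebra :: "(nat, 'a) pre_digraph \<Rightarrow> ('a qpath \<Rightarrow> complex) set" where
  "complete_path_algebra Q = {x. \<forall>p. p \<notin> qpaths Q \<longrightarrow> x p = 0}"

definition path_algebra :: "(nat, 'a) pre_digraph \<Rightarrow> ('a qpath \<Rightarrow> complex) set" where
  "path_algebra Q = {x \<in> complete_path_algebra Q. finite {p. x p \<noteq> 0}}"

text \<open>
  Paths are composed like maps: in \<open>pmult Q x y\<close> the paths of \<open>y\<close> are traversed first, so that
  representations are left modules.
\<close>

definition pmult :: "(nat, 'a) pre_digraph \<Rightarrow>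
    ('a qpath \<Rightarrow> complex) \<Rightarrow> ('a qpath \<Rightarrow> complex) \<Rightarrow> 'a qpath \<Rightarrow> complex" where
  "pmult Q x y = (\<lambda>(u, p). \<Sum>k\<le>length p.
     x (last (pre_digraph.awalk_verts Q u (take k p)), drop k p) * y (u, take k p))"

definition pone :: "(nat, 'a) pre_digraph \<Rightarrow> 'a qpath \<Rightarrow> complex" where
  "pone Q = (\<lambda>(u, p). if u \<in> verts Q \<and> p = [] then 1 else 0)"

text \<open>
  In the following, \<open>R\<close> is the complete path algebra or the path algebra. Since \<open>R\<close> contains the
  scalar multiples of its unit, ideals are automatically closed under scalars and negation.
\<close>

definition two_sided_ideal :: "(nat, 'a) pre_digraph \<Rightarrow>
    ('a qpath \<Rightarrow> complex) set \<Rightarrow> ('a qpath \<Rightarrow> complex) set \<Rightarrow> bool" where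
  "two_sided_ideal Q R I \<longleftrightarrow> I \<subseteq> R \<and> 0 \<in> I \<and> (\<forall>x\<in>I. \<forall>y\<in>I. x + y \<in> I) \<and>
     (\<forall>r\<in>R. \<forall>x\<in>I. pmult Q r x \<in> I \<and> pmult Q x r \<in> I)"

definition arrow_ideal :: "('a qpath \<Rightarrow> complex) set \<Rightarrow> ('a qpath \<Rightarrow> complex) set" where
  "arrow_ideal R = {x \<in> R. \<forall>u. x (u, []) = 0}"

definition ideal_prod :: "(nat, 'a) pre_digraph \<Rightarrow>
    ('a qpath \<Rightarrow> complex) set \<Rightarrow> ('a qpath \<Rightarrow> complex) set \<Rightarrow> ('a qpath \<Rightarrow> complex) set" where
  "ideal_prod Q I J =
     {\<Sum>i<k. pmult Q (x i) (y i) | (k::nat) x y. \<forall>i<k. x i \<in> I \<and> y i \<in> J}"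

primrec ideal_power :: "(nat, 'a) pre_digraph \<Rightarrow> ('a qpath \<Rightarrow> complex) set \<Rightarrow>
    ('a qpath \<Rightarrow> complex) set \<Rightarrow> nat \<Rightarrow> ('a qpath \<Rightarrow> complex) set" where
  "ideal_power Q R I 0 = R"
| "ideal_power Q R I (Suc k) = ideal_prod Q I (ideal_power Q R I k)"

definition adic_open :: "(nat, 'a) pre_digraph \<Rightarrow> ('a qpath \<Rightarrow> complex) set \<Rightarrow> bool" where
  "adic_open Q U \<longleftrightarrow> U \<subseteq> complete_path_algebra Q \<and>
     (\<forall>x\<in>U. \<exists>k. \<forall>y\<in>complete_path_algebra Q.
        y - x \<in> ideal_power Q (complete_path_algebra Q) (arrow_ideal (complete_path_algebra Q)) k
          \<longrightarrow> y \<in> U)"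

lemma pmult_in_complete_path_algebra:
  assumes Q: "wf_digraph Q" and x: "x \<in> complete_path_algebra Q" and y: "y \<in> complete_path_algebra Q"
  shows "pmult Q x y \<in> complete_path_algebra Q"
proof -
  interpret wf_digraph Q by (rule Q)
  have "pmult Q x y (u, p) = 0" if "(u, p) \<notin> qpaths Q" for u p
  proof -
    have "x (last (awalk_verts u (take k p)), drop k p) * y (u, take k p) = 0" for k
    proof (rule ccontr)
      assume "\<not> ?thesis"
      then have 1: "(last (awalk_verts u (take k p)), drop k p) \<in> qpaths Q"
        and 2: "(u, take k p) \<in> qpaths Q"
        using x y unfolding complete_path_algebra_def by auto
      then obtain v where "awalk u (take k p) v" unfolding qpaths_def by auto
      moreover from this have "last (awalk_verts u (take k p)) = v" by auto
      ultimately obtain w where "awalk u (take k p @ drop k p) w"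
        using 1 awalk_appendI unfolding qpaths_def by blast
      with that show False unfolding qpaths_def by auto
    qed
    then show ?thesis unfolding pmult_def by (simp only: prod.case sum.neutral_const)
  qed
  then show ?thesis unfolding complete_path_algebra_def by auto
qed

lemma istopology_adic_open:
  assumes Q: "wf_digraph Q"
  shows "istopology (adic_open Q)"
proof -
  let ?R = "complete_path_algebra Q"
  let ?m = "ideal_power Q ?R (arrow_ideal ?R)"
  have sum: "(\<Sum>i<k. f i) \<in> ?R" if "\<And>i. i < k \<Longrightarrow> f i \<in> ?R" for f and k :: nat
    using that by (induction k) (auto simp: complete_path_algebra_def)
  have step: "?m (Suc k) \<subseteq> ?m k" for k
  proof (induction k)
    case 0
    show ?case
    proof
      fix z assume "z \<in> ?m (Suc 0)"
      then obtain j :: nat and x y where z: "z = (\<Sum>i<j. pmult Q (x i) (y i))"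
        and xy: "\<forall>i<j. x i \<in> arrow_ideal ?R \<and> y i \<in> ?R"
        unfolding ideal_power.simps ideal_prod_def by blast
      then have "pmult Q (x i) (y i) \<in> ?R" if "i < j" for i
        using that unfolding arrow_ideal_def
        by (blast intro: pmult_in_complete_path_algebra[OF Q])
      then have "z \<in> ?R" unfolding z by (rule sum)
      then show "z \<in> ?m 0" by simp
    qed
  next
    case (Suc k)
    have "ideal_prod Q I A \<subseteq> ideal_prod Q I B" if "A \<subseteq> B" for I A B
      using that unfolding ideal_prod_def by blast
    from this[OF Suc] show ?case by simp
  qed
  have antimono: "?m l \<subseteq> ?m k" if "k \<le> l" for k l
    using lift_Suc_antimono_le[of ?m, OF step that] .
  have "adic_open Q (U \<inter> V)" if U: "adic_open Q U" and V: "adic_open Q V" for U V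
    unfolding adic_open_def
  proof (intro conjI ballI)
    show "U \<inter> V \<subseteq> ?R" using U unfolding adic_open_def by blast
    fix x assume x: "x \<in> U \<inter> V"
    obtain k where k: "\<forall>y\<in>?R. y - x \<in> ?m k \<longrightarrow> y \<in> U"
      using U x unfolding adic_open_def by blast
    obtain l where l: "\<forall>y\<in>?R. y - x \<in> ?m l \<longrightarrow> y \<in> V"
      using V x unfolding adic_open_def by blast
    have "?m (max k l) \<subseteq> ?m k" "?m (max k l) \<subseteq> ?m l"
      by (rule antimono, simp)+
    with k l show "\<exists>k. \<forall>y\<in>?R. y - x \<in> ?m k \<longrightarrow> y \<in> U \<inter> V"
      by blast
  qed
  moreover have "adic_open Q (\<Union>\<K>)" if K: "\<forall>U\<in>\<K>. adic_open Q U" for \<K>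
    unfolding adic_open_def
  proof (intro conjI ballI)
    show "\<Union>\<K> \<subseteq> ?R" using K unfolding adic_open_def by blast
    fix x assume "x \<in> \<Union>\<K>"
    then obtain U where U: "U \<in> \<K>" "x \<in> U" by blast
    then obtain k where "\<forall>y\<in>?R. y - x \<in> ?m k \<longrightarrow> y \<in> U"
      using K unfolding adic_open_def by blast
    then show "\<exists>k. \<forall>y\<in>?R. y - x \<in> ?m k \<longrightarrow> y \<in> \<Union>\<K>"
      using U(1) by blast
  qed
  ultimately show ?thesis unfolding istopology_def by blast
qed

definition adic_topology :: "(nat, 'a) pre_digraph \<Rightarrow> ('a qpath \<Rightarrow> complex) topology" where
  "adic_topology Q = topology (adic_open Q)"


section \<open>Representations\<close>

text \<open>
  Vectors in \<open>\<int>\<^sub>\<ge>\<^sub>0\<close> to the power \<open>n\<close>, extended by \<open>0\<close> to all natural numbers. Dimension vectors of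
  this form express that representations are supported in the vertices \<open>1, \<dots>, n\<close>.
\<close>

definition nat_vectors :: "nat \<Rightarrow> (nat \<Rightarrow> nat) set" where
  "nat_vectors n = {d. \<forall>i. i \<notin> {1..n} \<longrightarrow> d i = 0}"

text \<open>
  \<open>M (a, r, c)\<close> is the entry in row \<open>r\<close> and column \<open>c\<close> (counted from \<open>0\<close>) of the matrix
  of the linear map at the arrow \<open>a\<close>; entries outside the matrix are \<open>0\<close>.
\<close>

type_synonym 'a rep = "'a \<times> nat \<times> nat \<Rightarrow> complex"

definition rep_space :: "(nat, 'a) pre_digraph \<Rightarrow> (nat \<Rightarrow> nat) \<Rightarrow> (nat \<Rightarrow> nat) \<Rightarrow> 'a rep set" where
  "rep_space Q d e = {M. \<forall>a r c. M (a, r, c) \<noteq> 0 \<longrightarrow>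
     a \<in> arcs Q \<and> r < e (head Q a) \<and> c < d (tail Q a)}"

fun path_matrix ::
    "(nat, 'a) pre_digraph \<Rightarrow> (nat \<Rightarrow> nat) \<Rightarrow> 'a rep \<Rightarrow> nat \<Rightarrow> 'a list \<Rightarrow> nat \<Rightarrow> nat \<Rightarrow> complex" where
  "path_matrix Q d M u [] = (\<lambda>r c. if r = c \<and> r < d u then 1 else 0)"
| "path_matrix Q d M u (a # p) =
     (\<lambda>r c. \<Sum>j<d (head Q a). path_matrix Q d M (head Q a) p r j * M (a, j, c))"

definition nilpotent_rep :: "(nat, 'a) pre_digraph \<Rightarrow> (nat \<Rightarrow> nat) \<Rightarrow> 'a rep \<Rightarrow> bool" where
  "nilpotent_rep Q d M \<longleftrightarrow> (\<exists>k. \<forall>u p v. pre_digraph.awalk Q u p v \<and> k \<le> length p \<longrightarrow>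
     path_matrix Q d M u p = 0)"

text \<open>
  The block from vertex \<open>u\<close> to vertex \<open>v\<close> of the action of \<open>x\<close> on \<open>M\<close>. The index set is finite
  if \<open>M\<close> is nilpotent or \<open>x\<close> lies in the (uncompleted) path algebra.
\<close>

definition rep_act :: "(nat, 'a) pre_digraph \<Rightarrow> (nat \<Rightarrow> nat) \<Rightarrow> 'a rep \<Rightarrow> ('a qpath \<Rightarrow> complex) \<Rightarrow>
    nat \<Rightarrow> nat \<Rightarrow> nat \<Rightarrow> nat \<Rightarrow> complex" where
  "rep_act Q d M x u v r c =
     (\<Sum>p | pre_digraph.awalk Q u p v \<and> x (u, p) \<noteq> 0 \<and> path_matrix Q d M u p \<noteq> 0.
        x (u, p) * path_matrix Q d M u p r c)"

definition annihilates :: "(nat, 'a) pre_digraph \<Rightarrow> (nat \<Rightarrow> nat) \<Rightarrow> ('a qpath \<Rightarrow> complex) set \<Rightarrow>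
    'a rep \<Rightarrow> bool" where
  "annihilates Q d I M \<longleftrightarrow> (\<forall>x\<in>I. \<forall>u v r c. rep_act Q d M x u v r c = 0)"

text \<open>\<open>Rep(\<Lambda>, d)\<close> for the quotient \<open>\<Lambda>\<close> of the complete path algebra by \<open>J\<close>.\<close>

definition Rep_complete ::
    "(nat, 'a) pre_digraph \<Rightarrow> ('a qpath \<Rightarrow> complex) set \<Rightarrow> (nat \<Rightarrow> nat) \<Rightarrow> 'a rep set" where
  "Rep_complete Q J d =
     {M \<in> rep_space Q d d. nilpotent_rep Q d M \<and> annihilates Q d J M}"

text \<open>\<open>Rep(A, d)\<close> for the quotient \<open>A\<close> of the path algebra by \<open>I\<close>.\<close>

definition Rep_fd ::
    "(nat, 'a) pre_digraph \<Rightarrow> ('a qpath \<Rightarrow> complex) set \<Rightarrow> (nat \<Rightarrow> nat) \<Rightarrow> 'a rep set" where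
  "Rep_fd Q I d = {M \<in> rep_space Q d d. annihilates Q d I M}"

definition rep_coords :: "('a rep \<Rightarrow> complex) set" where
  "rep_coords = range (\<lambda>k M. M k)"

definition decRep :: "(nat, 'a) pre_digraph \<Rightarrow> ('a qpath \<Rightarrow> complex) set \<Rightarrow>
    (nat \<Rightarrow> nat) \<Rightarrow> (nat \<Rightarrow> nat) \<Rightarrow> ('a rep \<times> (nat \<Rightarrow> nat)) set" where
  "decRep Q J d v = Rep_complete Q J d \<times> {v}"

text \<open>The decoration is constant on \<open>decRep\<close>, so it contributes no coordinates.\<close>

definition decRep_coords :: "('a rep \<times> (nat \<Rightarrow> nat) \<Rightarrow> complex) set" where
  "decRep_coords = prod_coords rep_coords {}"


section \<open>Homomorphisms, extensions and the E-invariant\<close>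

text \<open>
  Families of matrices \<open>f (i, r, c)\<close> indexed by the vertices \<open>i\<close>, mapping spaces of dimensions
  \<open>d\<close> to spaces of dimensions \<open>e\<close>.
\<close>

definition vertex_maps :: "(nat, 'a) pre_digraph \<Rightarrow> (nat \<Rightarrow> nat) \<Rightarrow> (nat \<Rightarrow> nat) \<Rightarrow>
    (nat \<times> nat \<times> nat \<Rightarrow> complex) set" where
  "vertex_maps Q d e = {f. \<forall>i r c. f (i, r, c) \<noteq> 0 \<longrightarrow> i \<in> verts Q \<and> r < e i \<and> c < d i}"

text \<open>\<open>f\<^bsub>head a\<^esub> M\<^bsub>a\<^esub> - N\<^bsub>a\<^esub> f\<^bsub>tail a\<^esub>\<close> for all arrows \<open>a\<close>\<close>

definition commutator :: "(nat, 'a) pre_digraph \<Rightarrow> (nat \<Rightarrow> nat) \<Rightarrow> 'a rep \<Rightarrow> (nat \<Rightarrow> nat) \<Rightarrow> 'a rep \<Rightarrow>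
    (nat \<times> nat \<times> nat \<Rightarrow> complex) \<Rightarrow> 'a rep" where
  "commutator Q d M e N f = (\<lambda>(a, r, c). if a \<in> arcs Q then
     (\<Sum>j<d (head Q a). f (head Q a, r, j) * M (a, j, c)) -
     (\<Sum>j<e (tail Q a). N (a, r, j) * f (tail Q a, j, c)) else 0)"

definition rep_hom :: "(nat, 'a) pre_digraph \<Rightarrow> (nat \<Rightarrow> nat) \<Rightarrow> 'a rep \<Rightarrow> (nat \<Rightarrow> nat) \<Rightarrow> 'a rep \<Rightarrow>
    (nat \<times> nat \<times> nat \<Rightarrow> complex) set" where
  "rep_hom Q d M e N = {f \<in> vertex_maps Q d e. commutator Q d M e N f = 0}"

text \<open>
  \<open>Ext\<^sup>1(M, N)\<close> is the space of short exact sequences \<open>0 \<rightarrow> N \<rightarrow> E \<rightarrow> M \<rightarrow> 0\<close> up to equivalence.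
  Splitting the sequence of vector spaces underlying it, every such sequence is equivalent to one
  whose middle term has the block matrices \<open>(N\<^bsub>a\<^esub>, \<xi>\<^bsub>a\<^esub>; 0, M\<^bsub>a\<^esub>)\<close>. Here \<open>\<xi>\<close> is subject to the
  condition that the middle term is a \<open>\<Lambda>\<close>-module; these \<open>\<xi>\<close> are the cocycles, and their addition
  induces the Baer sum. Two sequences of this form are equivalent, by an isomorphism with blocks
  \<open>(1, h; 0, 1)\<close>, iff the two \<open>\<xi>\<close> differ by the coboundary of some \<open>h\<close>.
\<close>

definition extension_rep :: "(nat, 'a) pre_digraph \<Rightarrow> 'a rep \<Rightarrow> (nat \<Rightarrow> nat) \<Rightarrow> 'a rep \<Rightarrow>
    'a rep \<Rightarrow> 'a rep" where
  "extension_rep Q M e N \<xi> = (\<lambda>(a, r, c).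
     if r < e (head Q a)
     then (if c < e (tail Q a) then N (a, r, c) else \<xi> (a, r, c - e (tail Q a)))
     else (if c < e (tail Q a) then 0 else M (a, r - e (head Q a), c - e (tail Q a))))"

definition ext_cocycles :: "(nat, 'a) pre_digraph \<Rightarrow> ('a qpath \<Rightarrow> complex) set \<Rightarrow>
    (nat \<Rightarrow> nat) \<Rightarrow> 'a rep \<Rightarrow> (nat \<Rightarrow> nat) \<Rightarrow> 'a rep \<Rightarrow> 'a rep set" where
  "ext_cocycles Q J d M e N =
     {\<xi> \<in> rep_space Q d e. extension_rep Q M e N \<xi> \<in> Rep_complete Q J (e + d)}"

definition ext_coboundaries :: "(nat, 'a) pre_digraph \<Rightarrow>
    (nat \<Rightarrow> nat) \<Rightarrow> 'a rep \<Rightarrow> (nat \<Rightarrow> nat) \<Rightarrow> 'a rep \<Rightarrow> 'a rep set" where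
  "ext_coboundaries Q d M e N = commutator Q d M e N ` vertex_maps Q d e"

definition ext1_dim :: "(nat, 'a) pre_digraph \<Rightarrow> ('a qpath \<Rightarrow> complex) set \<Rightarrow>
    (nat \<Rightarrow> nat) \<Rightarrow> 'a rep \<Rightarrow> (nat \<Rightarrow> nat) \<Rightarrow> 'a rep \<Rightarrow> int" where
  "ext1_dim Q J d M e N =
     int (cdim (ext_cocycles Q J d M e N)) - int (cdim (ext_coboundaries Q d M e N))"

text \<open>The simple representation at \<open>i\<close> has dimension vector \<open>simple_dim i\<close> and zero matrices.\<close>

definition simple_dim :: "nat \<Rightarrow> nat \<Rightarrow> nat" where
  "simple_dim i = (\<lambda>j. if j = i then 1 else 0)"

definition g_vector :: "(nat, 'a) pre_digraph \<Rightarrow> ('a qpath \<Rightarrow> complex) set \<Rightarrow>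
    (nat \<Rightarrow> nat) \<Rightarrow> 'a rep \<times> (nat \<Rightarrow> nat) \<Rightarrow> nat \<Rightarrow> int" where
  "g_vector Q J e = (\<lambda>(N, w) i.
     - int (cdim (rep_hom Q (simple_dim i) 0 e N)) + ext1_dim Q J (simple_dim i) 0 e N
     + int (w i))"

definition E_invariant :: "nat \<Rightarrow> (nat, 'a) pre_digraph \<Rightarrow> ('a qpath \<Rightarrow> complex) set \<Rightarrow>
    (nat \<Rightarrow> nat) \<Rightarrow> 'a rep \<times> (nat \<Rightarrow> nat) \<Rightarrow> (nat \<Rightarrow> nat) \<Rightarrow> 'a rep \<times> (nat \<Rightarrow> nat) \<Rightarrow> int" where
  "E_invariant n Q J d M e N = int (cdim (rep_hom Q d (fst M) e (fst N)))
     + (\<Sum>i = 1..n. int (d i) * g_vector Q J e N i)"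


section \<open>Finite-dimensional algebras and their modules\<close>

definition fd_algebra :: "(complex \<Rightarrow> 'b::ring_1 \<Rightarrow> 'b) \<Rightarrow> bool" where
  "fd_algebra smul \<longleftrightarrow> (\<exists>B. finite_dimensional_vector_space smul B) \<and>
     (\<forall>c x y. smul c (x * y) = smul c x * y \<and> smul c (x * y) = x * smul c y)"

definition presentation_kernel ::
    "(nat, 'a) pre_digraph \<Rightarrow> (('a qpath \<Rightarrow> complex) \<Rightarrow> 'b::ring_1) \<Rightarrow> ('a qpath \<Rightarrow> complex) set" where
  "presentation_kernel Q \<pi> = {x \<in> path_algebra Q. \<pi> x = 0}"

text \<open>
  The surjective algebra homomorphism \<open>\<pi>\<close> (relevant only on the path algebra) presents the algebra
  as the quotient of the path algebra by the admissible ideal \<open>presentation_kernel Q \<pi>\<close>.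
\<close>

definition admissible_presentation :: "(complex \<Rightarrow> 'b::ring_1 \<Rightarrow> 'b) \<Rightarrow>
    (nat, 'a) pre_digraph \<Rightarrow> (('a qpath \<Rightarrow> complex) \<Rightarrow> 'b) \<Rightarrow> bool" where
  "admissible_presentation smul Q \<pi> \<longleftrightarrow>
     (\<forall>x\<in>path_algebra Q. \<forall>y\<in>path_algebra Q.
        \<pi> (x + y) = \<pi> x + \<pi> y \<and> \<pi> (pmult Q x y) = \<pi> x * \<pi> y) \<and>
     (\<forall>c. \<forall>x\<in>path_algebra Q. \<pi> (cscale c x) = smul c (\<pi> x)) \<and>
     \<pi> (pone Q) = 1 \<and>
     \<pi> ` path_algebra Q = UNIV \<and>
     (\<exists>k\<ge>2. ideal_power Q (path_algebra Q) (arrow_ideal (path_algebra Q)) k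
              \<subseteq> presentation_kernel Q \<pi>) \<and>
     presentation_kernel Q \<pi> \<subseteq> ideal_power Q (path_algebra Q) (arrow_ideal (path_algebra Q)) 2"

text \<open>
  To treat left and right modules simultaneously, the multiplication \<open>mu\<close> of the algebra is a
  parameter: left modules for \<open>op_mult\<close> are right modules for \<open>times\<close>.
\<close>

definition op_mult :: "'b::ring_1 \<Rightarrow> 'b \<Rightarrow> 'b" where
  "op_mult = (\<lambda>a b. b * a)"

record ('b, 'v) amod =
  carr :: "'v set"
  scal :: "complex \<Rightarrow> 'v \<Rightarrow> 'v"
  act :: "'b \<Rightarrow> 'v \<Rightarrow> 'v"

text \<open>\<open>M\<close> is a finite-dimensional module.\<close>

definition amodule :: "(complex \<Rightarrow> 'b::ring_1 \<Rightarrow> 'b) \<Rightarrow> ('b \<Rightarrow> 'b \<Rightarrow> 'b) \<Rightarrow>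
    ('b, 'v::ab_group_add) amod \<Rightarrow> bool" where
  "amodule smul mu M \<longleftrightarrow>
     vector_space (scal M) \<and> (\<exists>B. finite B \<and> carr M = module.span (scal M) B) \<and>
     (\<forall>a. \<forall>x\<in>carr M. act M a x \<in> carr M) \<and>
     (\<forall>a. \<forall>x\<in>carr M. \<forall>y\<in>carr M. act M a (x + y) = act M a x + act M a y) \<and>
     (\<forall>a b. \<forall>x\<in>carr M. act M (a + b) x = act M a x + act M b x) \<and>
     (\<forall>c a. \<forall>x\<in>carr M. act M (smul c a) x = scal M c (act M a x) \<and>
                        act M a (scal M c x) = scal M c (act M a x)) \<and>
     (\<forall>a b. \<forall>x\<in>carr M. act M (mu a b) x = act M a (act M b x)) \<and>
     (\<forall>x\<in>carr M. act M 1 x = x)"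

text \<open>Homomorphisms are extended by \<open>0\<close> outside the carrier.\<close>

definition amod_hom :: "('b, 'v::ab_group_add) amod \<Rightarrow> ('b, 'w::ab_group_add) amod \<Rightarrow> ('v \<Rightarrow> 'w) set" where
  "amod_hom M N = {f. f ` carr M \<subseteq> carr N \<and>
     (\<forall>x\<in>carr M. \<forall>y\<in>carr M. f (x + y) = f x + f y) \<and>
     (\<forall>c. \<forall>x\<in>carr M. f (scal M c x) = scal N c (f x)) \<and>
     (\<forall>a. \<forall>x\<in>carr M. f (act M a x) = act N a (f x)) \<and>
     (\<forall>x. x \<notin> carr M \<longrightarrow> f x = 0)}"

definition amod_hom_dim :: "('b, 'v::ab_group_add) amod \<Rightarrow> ('b, 'w::ab_group_add) amod \<Rightarrow> nat" where
  "amod_hom_dim M N = vector_space.dim (\<lambda>c f x. scal N c (f x)) (amod_hom M N)"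

definition hom_kernel :: "('b, 'v::ab_group_add) amod \<Rightarrow> ('v \<Rightarrow> 'w::ab_group_add) \<Rightarrow> 'v set" where
  "hom_kernel M f = {x \<in> carr M. f x = 0}"

definition submodule :: "('b, 'v::ab_group_add) amod \<Rightarrow> 'v set \<Rightarrow> bool" where
  "submodule M U \<longleftrightarrow>
     U \<subseteq> carr M \<and> module.subspace (scal M) U \<and> (\<forall>a. \<forall>x\<in>U. act M a x \<in> U)"

text \<open>Every finite-dimensional module has an isomorphic copy on the type \<open>nat \<Rightarrow> complex\<close>.\<close>

type_synonym 'b fdmod = "('b, nat \<Rightarrow> complex) amod"

definition projective_module :: "(complex \<Rightarrow> 'b::ring_1 \<Rightarrow> 'b) \<Rightarrow> ('b \<Rightarrow> 'b \<Rightarrow> 'b) \<Rightarrow> 'b fdmod \<Rightarrow> bool" where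
  "projective_module smul mu P \<longleftrightarrow> amodule smul mu P \<and>
     (\<forall>(X :: 'b fdmod) (Y :: 'b fdmod). amodule smul mu X \<and> amodule smul mu Y \<longrightarrow>
        (\<forall>p \<in> amod_hom X Y. p ` carr X = carr Y \<longrightarrow>
           (\<forall>f \<in> amod_hom P Y. \<exists>g \<in> amod_hom P X. \<forall>x\<in>carr P. p (g x) = f x)))"

text \<open>Epimorphism from a projective module with superfluous kernel\<close>

definition projective_cover :: "(complex \<Rightarrow> 'b::ring_1 \<Rightarrow> 'b) \<Rightarrow> ('b \<Rightarrow> 'b \<Rightarrow> 'b) \<Rightarrow>
    'b fdmod \<Rightarrow> ('b, 'v::ab_group_add) amod \<Rightarrow> ((nat \<Rightarrow> complex) \<Rightarrow> 'v) \<Rightarrow> bool" where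
  "projective_cover smul mu P M p \<longleftrightarrow>
     projective_module smul mu P \<and> p \<in> amod_hom P M \<and> p ` carr P = carr M \<and>
     (\<forall>U. submodule P U \<and> {x + y | x y. x \<in> U \<and> y \<in> hom_kernel P p} = carr P \<longrightarrow> U = carr P)"

text \<open>\<open>P1 \<rightarrow> P0 \<rightarrow> M \<rightarrow> 0\<close> is a minimal projective presentation with maps \<open>f\<close> and \<open>g\<close>.\<close>

definition minimal_projective_presentation :: "(complex \<Rightarrow> 'b::ring_1 \<Rightarrow> 'b) \<Rightarrow> ('b \<Rightarrow> 'b \<Rightarrow> 'b) \<Rightarrow>
    ('b, 'v::ab_group_add) amod \<Rightarrow> 'b fdmod \<Rightarrow> 'b fdmod \<Rightarrow>
    ((nat \<Rightarrow> complex) \<Rightarrow> nat \<Rightarrow> complex) \<Rightarrow> ((nat \<Rightarrow> complex) \<Rightarrow> 'v) \<Rightarrow> bool" where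
  "minimal_projective_presentation smul mu M P1 P0 f g \<longleftrightarrow>
     projective_cover smul mu P0 M g \<and>
     projective_cover smul mu P1 (P0\<lparr>carr := hom_kernel P0 g\<rparr>) f"

definition regular_module :: "(complex \<Rightarrow> 'b::ring_1 \<Rightarrow> 'b) \<Rightarrow> ('b \<Rightarrow> 'b \<Rightarrow> 'b) \<Rightarrow> ('b, 'b) amod" where
  "regular_module smul mu = \<lparr>carr = UNIV, scal = smul, act = mu\<rparr>"

text \<open>\<open>Hom\<^sub>A(P, A)\<close>, a module on the opposite side\<close>

definition star_module :: "(complex \<Rightarrow> 'b::ring_1 \<Rightarrow> 'b) \<Rightarrow> ('b \<Rightarrow> 'b \<Rightarrow> 'b) \<Rightarrow>
    ('b, 'v::ab_group_add) amod \<Rightarrow> ('b, 'v \<Rightarrow> 'b) amod" where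
  "star_module smul mu P = \<lparr>carr = amod_hom P (regular_module smul mu),
     scal = (\<lambda>c f x. smul c (f x)), act = (\<lambda>b f x. mu (f x) b)\<rparr>"

text \<open>The dual space \<open>D M = Hom\<^sub>\<complex>(M, \<complex>)\<close>, a module on the opposite side\<close>

definition dual_module :: "('b, 'v::ab_group_add) amod \<Rightarrow> ('b, 'v \<Rightarrow> complex) amod" where
  "dual_module M =
     \<lparr>carr = {\<phi>. (\<forall>x\<in>carr M. \<forall>y\<in>carr M. \<phi> (x + y) = \<phi> x + \<phi> y) \<and>
                 (\<forall>c. \<forall>x\<in>carr M. \<phi> (scal M c x) = c * \<phi> x) \<and>
                 (\<forall>x. x \<notin> carr M \<longrightarrow> \<phi> x = 0)},
      scal = cscale,
      act = (\<lambda>a \<phi> x. if x \<in> carr M then \<phi> (act M a x) else 0)\<rparr>"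

text \<open>\<open>T\<close> is a cokernel of \<open>h : X \<rightarrow> Y\<close>.\<close>

definition is_cokernel :: "('b, 'v::ab_group_add) amod \<Rightarrow> ('b, 'w::ab_group_add) amod \<Rightarrow>
    ('v \<Rightarrow> 'w) \<Rightarrow> ('b, 'u::ab_group_add) amod \<Rightarrow> bool" where
  "is_cokernel X Y h T \<longleftrightarrow>
     (\<exists>q \<in> amod_hom Y T. q ` carr Y = carr T \<and> hom_kernel Y q = h ` carr X)"

text \<open>
  The transpose \<open>Tr M\<close> of an \<open>mu\<close>-module is the cokernel of \<open>Hom\<^sub>A(f, A)\<close>, where \<open>f : P1 \<rightarrow> P0\<close> belongs
  to a minimal projective presentation of \<open>M\<close>. It is a module on the opposite side, and unique up
  to isomorphism.
\<close>

definition is_transpose :: "(complex \<Rightarrow> 'b::ring_1 \<Rightarrow> 'b) \<Rightarrow> ('b \<Rightarrow> 'b \<Rightarrow> 'b) \<Rightarrow>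
    ('b, 'v::ab_group_add) amod \<Rightarrow> 'b fdmod \<Rightarrow> bool" where
  "is_transpose smul mu M T \<longleftrightarrow> amodule smul (\<lambda>a b. mu b a) T \<and>
     (\<exists>P1 P0 f g. minimal_projective_presentation smul mu M P1 P0 f g \<and>
        is_cokernel (star_module smul mu P0) (star_module smul mu P1) (\<lambda>\<phi>. \<phi> \<circ> f) T)"

definition transpose_module :: "(complex \<Rightarrow> 'b::ring_1 \<Rightarrow> 'b) \<Rightarrow> ('b \<Rightarrow> 'b \<Rightarrow> 'b) \<Rightarrow>
    ('b, 'v::ab_group_add) amod \<Rightarrow> 'b fdmod" where
  "transpose_module smul mu M = (SOME T. is_transpose smul mu M T)"

text \<open>The Auslander--Reiten translations \<open>\<tau> = D Tr\<close> and \<open>\<tau>\<^sup>- = Tr D\<close> of left modules\<close>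

definition AR_translate :: "(complex \<Rightarrow> 'b::ring_1 \<Rightarrow> 'b) \<Rightarrow>
    ('b, 'v::ab_group_add) amod \<Rightarrow> ('b, (nat \<Rightarrow> complex) \<Rightarrow> complex) amod" where
  "AR_translate smul M = dual_module (transpose_module smul times M)"

definition AR_translate_inv :: "(complex \<Rightarrow> 'b::ring_1 \<Rightarrow> 'b) \<Rightarrow>
    ('b, 'v::ab_group_add) amod \<Rightarrow> 'b fdmod" where
  "AR_translate_inv smul M = transpose_module smul op_mult (dual_module M)"

text \<open>
  The left module on \<open>\<Oplus>\<^sub>i \<complex>\<^bsup>d\<^sub>i\<^esup>\<close> defined by a representation; an element of the
  algebra acts through any of its preimages in the path algebra.
\<close>

definition rep_module :: "(nat, 'a) pre_digraph \<Rightarrow> (('a qpath \<Rightarrow> complex) \<Rightarrow> 'b::ring_1) \<Rightarrow>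
    (nat \<Rightarrow> nat) \<Rightarrow> 'a rep \<Rightarrow> ('b, nat \<times> nat \<Rightarrow> complex) amod" where
  "rep_module Q \<pi> d M =
     \<lparr>carr = {x. \<forall>i k. x (i, k) \<noteq> 0 \<longrightarrow> i \<in> verts Q \<and> k < d i},
      scal = cscale,
      act = (\<lambda>b x (v, r). if v \<in> verts Q \<and> r < d v then \<Sum>u\<in>verts Q. \<Sum>c<d u.
               rep_act Q d M (inv_into (path_algebra Q) \<pi> b) u v r c * x (u, c) else 0)\<rparr>"

end

theory Submission
  imports Defs
begin

text \<open>
  The dimension of the solution space of a finite system of linear equations is an upper
  semicontinuous function of its coefficients, as Gaussian elimination
  with a nonvanishing pivot shows. It remains to express the functions in question, up to constants, as nonnegative
  combinations of such dimensions.

  \<open>Hom(S(i), N)\<close> is the kernel of the coboundary map from \<open>\<complex>\<^bsup>e\<^sub>i\<^esup>\<close> to the space of cocycles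
  \<open>Z(S(i), N)\<close>, so that \<open>g\<^sub>i = dim Z(S(i), N) - e\<^sub>i + w\<^sub>i\<close>. As the length of the paths acting
  nontrivially is bounded in terms of the dimension vector alone, cocycles are the solutions of
  linear equations with coefficients polynomial in \<open>N\<close>.

  For the algebra \<open>A\<close> with radical \<open>r\<close>, applying \<open>Hom(-, Y)\<close> to a minimal projective presentation
  \<open>P1 \<rightarrow> P0 \<rightarrow> X \<rightarrow> 0\<close> gives
  \<open>dim Hom(Y, D Tr X) = dim Hom(X, Y) + \<Sum>\<^sub>i dim e\<^sub>iY (dim Hom(X, D(e\<^sub>ir)) - dim e\<^sub>iX)\<close>,
  since the multiplicity of \<open>A e\<^sub>i\<close> in \<open>P1\<close> minus that in \<open>P0\<close> is \<open>dim Hom(X, D(e\<^sub>ir)) - dim e\<^sub>iX\<close>.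
  The statements on \<open>Tr D\<close> follow by duality from the opposite algebra.
\<close>

section \<open>Linear algebra\<close>

text \<open>\<open>transpose_module\<close> is an arbitrary choice, so no presentation of the
  transpose varies algebraically with the point. The formula trades it for Hom dimensions between
  modules with polynomial matrices and for the fixed modules \<open>D(e_i r)\<close>. Its correction
  term counts tops: \<open>A e_i\<close> occurs \<open>dim e_i P - dim e_i rad P\<close> times in a
  projective \<open>P\<close>. With \<open>W\<close> the kernel of \<open>P0 -> X\<close>,
  minimality of \<open>P1 -> W\<close> identifies the tops of \<open>P1\<close> and
  \<open>W\<close>, so the multiplicity in \<open>P1\<close> minus that in \<open>P0\<close> is
  \<open>dim e_i rad P0 - dim e_i rad W - dim e_i X\<close>. The first two terms are the dimension
  of the space of functionals on \<open>e_i rad P0\<close> that vanish on \<open>e_i rad W\<close>,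
  and this space is \<open>Hom(X, D(e_i r))\<close>. Semicontinuity survives because dimension
  vectors are constant: what is subtracted is constant, and every varying dimension has a
  nonnegative constant factor. Modules are carried by subsets of function types, and projectives and
  transposes must live on \<open>nat => complex\<close>; hence linear algebra is relative to
  finitely spanned subspaces, and quotients are rebuilt from coordinates.\<close>

definition fd_subspace :: "(complex \<Rightarrow> 'v \<Rightarrow> 'v) \<Rightarrow> 'v::ab_group_add set \<Rightarrow> bool" where
  "fd_subspace s S \<longleftrightarrow> (\<exists>B. finite B \<and> S = module.span s B)"

text \<open>Linearity is demanded on \<open>S\<close> alone, because maps between modules are
  controlled only on the carrier and follow a default value elsewhere.\<close>

definition lin_on :: "(complex \<Rightarrow> 'v \<Rightarrow> 'v) \<Rightarrow> (complex \<Rightarrow> 'w \<Rightarrow> 'w) \<Rightarrow> 'v::ab_group_add set \<Rightarrow>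
    ('v \<Rightarrow> 'w::ab_group_add) \<Rightarrow> bool" where
  "lin_on s t S f \<longleftrightarrow> (\<forall>x\<in>S. \<forall>y\<in>S. f (x + y) = f x + f y) \<and> (\<forall>c. \<forall>x\<in>S. f (s c x) = t c (f x))"

lemma lin_onI:
  assumes "\<And>x y. x \<in> S \<Longrightarrow> y \<in> S \<Longrightarrow> f (x + y) = f x + f y" "\<And>c x. x \<in> S \<Longrightarrow> f (s c x) = t c (f x)"
  shows "lin_on s t S f"
  using assms by (simp add: lin_on_def)

context vector_space_pair begin

text \<open>This is the bridge from maps that are linear on a subspace to globally linear ones:
  prescribe the values on a basis of \<open>S\<close> and extend.\<close>

lemma lin_on_extend:
  assumes S: "vs1.subspace S" and f: "\<And>x y. x \<in> S \<Longrightarrow> y \<in> S \<Longrightarrow> f (x + y) = f x + f y"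
    "\<And>c x. x \<in> S \<Longrightarrow> f (s1 c x) = s2 c (f x)"
  shows "\<exists>g. Vector_Spaces.linear s1 s2 g \<and> (\<forall>x\<in>S. g x = f x)"
proof -
  obtain B where B: "B \<subseteq> S" "vs1.independent B" "S \<subseteq> vs1.span B"
    by (rule vs1.basis_exists[of S]) (rule that)
  let ?g = "construct B f"
  have l: "Vector_Spaces.linear s1 s2 ?g" by (rule linear_construct) fact
  interpret g: Vector_Spaces.linear s1 s2 ?g by (rule l)
  \<comment> \<open>Membership in \<open>S\<close> is carried through the induction because
    \<open>f\<close> is additive and homogeneous only there.\<close>
  have "x \<in> S \<and> ?g x = f x" if "x \<in> vs1.span B" for x
    using that
  proof (induction rule: vs1.span_induct_alt)
    case base
    have "f 0 = 0" using f(1)[of 0 0] vs1.subspace_0[OF S] by simp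
    then show ?case using vs1.subspace_0[OF S] by simp
  next
    case (step c x y)
    then have "x \<in> S" using B by blast
    with step show ?case
      by (simp add: g.add g.scale construct_basis[OF B(2)] f vs1.subspace_add[OF S] vs1.subspace_scale[OF S])
  qed
  then show ?thesis using l B(3) by blast
qed

lemma dim_linear_inj:
  assumes l: "Vector_Spaces.linear s1 s2 f" and S: "vs1.subspace S" and i: "inj_on f S"
  shows "vs2.dim (f ` S) = vs1.dim S"
proof -
  interpret f: Vector_Spaces.linear s1 s2 f by (rule l)
  obtain B where B: "B \<subseteq> S" "vs1.independent B" "S \<subseteq> vs1.span B" "card B = vs1.dim S"
    by (rule vs1.basis_exists[of S]) (rule that)
  then have sB: "vs1.span B = S" using S vs1.span_minimal by blast
  have "vs2.independent (f ` B)"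
    using f.independent_injective_image[OF B(2)] i sB by simp
  moreover have "f ` S \<subseteq> vs2.span (f ` B)" using f.span_image sB by auto
  ultimately have "card (f ` B) = vs2.dim (f ` S)"
    using B(1) sB by (intro vs2.basis_card_eq_dim) auto
  moreover have "card (f ` B) = card B"
    using i B(1) by (meson card_image inj_on_subset)
  ultimately show ?thesis using B(4) by simp
qed

end

lemma lin_on_linear:
  assumes "vector_space s" "vector_space t" "module.subspace s S" "lin_on s t S f"
  obtains g where "Vector_Spaces.linear s t g" "\<And>x. x \<in> S \<Longrightarrow> g x = f x"
proof -
  interpret vector_space_pair s t using assms by (simp add: vector_space_pair_def)
  show ?thesis using lin_on_extend[OF assms(3), of f] assms(4) that unfolding lin_on_def by blast
qed

lemma subspace_fd: assumes "vector_space s" "fd_subspace s S" shows "module.subspace s S"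
proof -
  interpret vector_space s by fact
  show ?thesis using assms(2) unfolding fd_subspace_def by auto
qed

text \<open>A basis \<open>B\<close> of \<open>U\<close> is enlarged by \<open>C\<close> to a basis
  of \<open>S\<close>. The set \<open>C\<close> then stands for a basis of \<open>S / U\<close>, so
  that arguments about the quotient need no quotient space.\<close>

lemma fd_basis_pair:
  assumes "vector_space s" "fd_subspace s S" "module.subspace s U" "U \<subseteq> S"
  obtains B C where "finite B" "finite C" "B \<inter> C = {}" "\<not> module.dependent s (B \<union> C)"
    "module.span s B = U" "module.span s (B \<union> C) = S" "card B = vector_space.dim s U"
    "card B + card C = vector_space.dim s S"
proof -
  interpret vector_space s by fact
  obtain F where F: "finite F" "S = span F" using assms(2) unfolding fd_subspace_def by blast
  obtain B where B: "B \<subseteq> U" "independent B" "U \<subseteq> span B" "card B = dim U"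
    by (rule basis_exists[of U]) (rule that)
  obtain D where D: "B \<subseteq> D" "D \<subseteq> S" "independent D" "S \<subseteq> span D"
    by (rule maximal_independent_subset_extend[of B S]) (use B assms(4) in auto)
  have fD: "finite D" using independent_span_bound[OF F(1) D(3)] D(2) F(2) by simp
  have "card D = dim S" using D by (intro basis_card_eq_dim)
  moreover have "card D = card B + card (D - B)"
    using card_Un_disjoint[of B "D - B"] fD D(1) finite_subset[OF D(1)] by (simp add: Un_absorb1)
  moreover have "span B = U" using B assms(3) by (intro span_subspace)
  moreover have "span D = S" using D subspace_fd[OF assms(1,2)] by (intro span_subspace)
  moreover have "B \<union> (D - B) = D" using D(1) by auto
  moreover have "finite B" using fD D(1) finite_subset by blast
  ultimately show ?thesis
    using that[of B "D - B"] fD D(3) B(4) by simp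
qed

lemma fd_basis:
  assumes "vector_space s" "fd_subspace s S"
  obtains B where "finite B" "\<not> module.dependent s B" "module.span s B = S" "card B = vector_space.dim s S"
proof -
  interpret vector_space s by fact
  have U: "subspace {0}" "{0} \<subseteq> S" using subspace_fd[OF assms] subspace_0 by auto
  show ?thesis
  proof (rule fd_basis_pair[OF assms U])
    fix B C assume "finite B" "finite C" "B \<inter> C = {}" "independent (B \<union> C)" "span (B \<union> C) = S"
      "card B + card C = dim S"
    then show thesis using that[of "B \<union> C"] by (simp add: card_Un_disjoint)
  qed
qed

lemma fd_subset:
  assumes "vector_space s" "fd_subspace s S" "module.subspace s U" "U \<subseteq> S"
  shows "fd_subspace s U" "vector_space.dim s U \<le> vector_space.dim s S"
proof -
  obtain B C where B: "finite B" "finite C" "B \<inter> C = {}" "\<not> module.dependent s (B \<union> C)"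
    "module.span s B = U" "module.span s (B \<union> C) = S" "card B = vector_space.dim s U"
    "card B + card C = vector_space.dim s S"
    by (rule fd_basis_pair[OF assms(1-4)])
  show "fd_subspace s U" unfolding fd_subspace_def by (rule exI[of _ B]) (simp add: B)
  show "vector_space.dim s U \<le> vector_space.dim s S" using B by simp
qed

lemma fd_dim_eq:
  assumes "vector_space s" "fd_subspace s S" "module.subspace s U" "U \<subseteq> S"
    "vector_space.dim s U = vector_space.dim s S"
  shows "U = S"
proof -
  obtain B C where B: "finite B" "finite C" "B \<inter> C = {}" "\<not> module.dependent s (B \<union> C)"
    "module.span s B = U" "module.span s (B \<union> C) = S" "card B = vector_space.dim s U"
    "card B + card C = vector_space.dim s S"
    by (rule fd_basis_pair[OF assms(1-4)])
  then have "C = {}" using assms(5) by simp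
  with B show ?thesis by simp
qed

lemma subspace_image_lin_on:
  assumes "vector_space s" "vector_space t" "module.subspace s S" "lin_on s t S f"
  shows "module.subspace t (f ` S)" "module.subspace s {x \<in> S. f x = 0}"
    "fd_subspace s S \<Longrightarrow> fd_subspace t (f ` S)"
proof -
  obtain g where g: "Vector_Spaces.linear s t g" "\<And>x. x \<in> S \<Longrightarrow> g x = f x"
    by (rule lin_on_linear[OF assms]) (rule that)
  interpret g: Vector_Spaces.linear s t g by (rule g)
  have i: "f ` S = g ` S" using g(2) by auto
  show "module.subspace t (f ` S)" unfolding i by (rule g.subspace_image[OF assms(3)])
  have "{x \<in> S. f x = 0} = S \<inter> {x. g x = 0}" using g(2) by auto
  then show "module.subspace s {x \<in> S. f x = 0}"
    using g.subspace_kernel assms(3) by (simp add: g.vs1.subspace_inter)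
  show "fd_subspace t (f ` S)" if fd: "fd_subspace s S"
  proof -
    obtain B where "finite B" "S = module.span s B" using fd unfolding fd_subspace_def by blast
    then have "f ` S = module.span t (g ` B)" unfolding i by (simp add: g.span_image)
    with \<open>finite B\<close> show ?thesis unfolding fd_subspace_def by blast
  qed
qed

lemma dim_inj_lin_on:
  assumes "vector_space s" "vector_space t" "module.subspace s S" "lin_on s t S f" "inj_on f S"
  shows "vector_space.dim t (f ` S) = vector_space.dim s S"
proof -
  obtain g where g: "Vector_Spaces.linear s t g" "\<And>x. x \<in> S \<Longrightarrow> g x = f x"
    by (rule lin_on_linear[OF assms(1-4)]) (rule that)
  interpret vector_space_pair s t using assms by (simp add: vector_space_pair_def)
  have "inj_on g S" using assms(5) g(2) by (simp add: inj_on_def)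
  moreover have "g ` S = f ` S" using g(2) by auto
  ultimately show ?thesis using dim_linear_inj[OF g(1) assms(3)] by simp
qed

text \<open>With \<open>B\<close> a basis of the kernel and \<open>C\<close> completing it to a
  basis of \<open>S\<close>, the map is injective on the span of \<open>C\<close> and has the same
  image there as on \<open>S\<close>.\<close>

lemma rank_nullity:
  assumes "vector_space s" "vector_space t" "fd_subspace s S" "lin_on s t S f"
  shows "vector_space.dim s S = vector_space.dim t (f ` S) + vector_space.dim s {x \<in> S. f x = 0}"
proof -
  have S: "module.subspace s S" by (rule subspace_fd) fact+
  obtain g where g: "Vector_Spaces.linear s t g" "\<And>x. x \<in> S \<Longrightarrow> g x = f x"
    by (rule lin_on_linear[OF assms(1,2) S assms(4)]) (rule that)
  interpret vector_space_pair s t using assms by (simp add: vector_space_pair_def)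
  interpret g: Vector_Spaces.linear s t g by (rule g)
  let ?K = "{x \<in> S. f x = 0}"
  obtain B C where B: "finite B" "finite C" "B \<inter> C = {}" "vs1.independent (B \<union> C)"
    "vs1.span B = ?K" "vs1.span (B \<union> C) = S" "card B = vs1.dim ?K" "card B + card C = vs1.dim S"
    by (rule fd_basis_pair[OF assms(1,3) subspace_image_lin_on(2)[OF assms(1,2) S assms(4)]]) blast
  have iC: "vs1.independent C" using B(4) by (rule vs1.independent_mono) auto
  have CS: "vs1.span C \<subseteq> S" using B(6) vs1.span_mono[of C "B \<union> C"] by simp
  have img: "f ` S = g ` vs1.span C"
  proof
    show "g ` vs1.span C \<subseteq> f ` S" using CS g(2) by force
    show "f ` S \<subseteq> g ` vs1.span C"
    proof
      fix y assume "y \<in> f ` S"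
      then obtain x where x: "x \<in> vs1.span (B \<union> C)" "y = f x" using B(6) by auto
      then obtain b c where bc: "x = b + c" "b \<in> vs1.span B" "c \<in> vs1.span C"
        unfolding vs1.span_Un by blast
      then have "g b = 0" using B(5) g(2) by auto
      then have "y = g c" using x bc B(6) g(2) by (metis add_0 g.add)
      then show "y \<in> g ` vs1.span C" using bc by blast
    qed
  qed
  have "inj_on g (vs1.span C)"
  proof (rule inj_onI)
    fix x y assume xy: "x \<in> vs1.span C" "y \<in> vs1.span C" "g x = g y"
    then have d: "x - y \<in> vs1.span C" "g (x - y) = 0" by (auto simp: vs1.span_diff g.diff)
    then have "x - y \<in> vs1.span B" using B(5) CS g(2) by auto
    with d have "x - y \<in> vs1.span B \<inter> vs1.span C" by blast
    \<comment> \<open>A common vector has one representation in \<open>B \<union> C\<close>,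
      supported both in \<open>B\<close> and in the disjoint set \<open>C\<close>, hence
      zero.\<close>
    moreover have "vs1.span B \<inter> vs1.span C = {0}"
    proof -
      have "z = 0" if z: "z \<in> vs1.span B" "z \<in> vs1.span C" for z
      proof -
        let ?r = "vs1.representation (B \<union> C)"
        have "?r z = vs1.representation B z" "?r z = vs1.representation C z"
          using B(4) z by (auto intro!: vs1.representation_extend)
        then have "?r z v = 0" for v
          using vs1.representation_ne_zero[of B z v] vs1.representation_ne_zero[of C z v] B(3) by auto
        moreover have "z \<in> vs1.span (B \<union> C)" using z vs1.span_mono[of B "B \<union> C"] by auto
        ultimately show ?thesis
          using vs1.sum_nonzero_representation_eq[OF B(4), of z] by simp
      qed
      then show ?thesis using vs1.span_zero by auto
    qed
    ultimately show "x = y" by auto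
  qed
  then have "vs2.dim (f ` S) = vs1.dim (vs1.span C)"
    unfolding img by (intro dim_linear_inj g(1)) auto
  also have "\<dots> = card C" using iC by (simp add: vs1.dim_eq_card_independent)
  finally show ?thesis using B(7,8) by simp
qed

text \<open>The inverse map on the image is linear again, so it carries a finite spanning set of the
  image back to \<open>S\<close>.\<close>

lemma fd_inj:
  assumes "vector_space s" "vector_space t" "module.subspace s S" "lin_on s t S f" "inj_on f S"
    and T: "fd_subspace t T" "f ` S \<subseteq> T"
  shows "fd_subspace s S"
proof -
  have fd: "fd_subspace t (f ` S)"
    using fd_subset[OF assms(2) T(1) subspace_image_lin_on(1)[OF assms(1-4)] T(2)] by blast
  let ?g = "the_inv_into S f"
  interpret s: vector_space s by fact
  have gf: "?g (f x) = x" if "x \<in> S" for x using assms(5) that by (rule the_inv_into_f_f)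
  have "lin_on t s (f ` S) ?g"
  proof (rule lin_onI)
    fix x y assume "x \<in> f ` S" "y \<in> f ` S"
    then obtain a b where ab: "a \<in> S" "b \<in> S" "x = f a" "y = f b" by blast
    moreover have "f a + f b = f (a + b)" using assms(4) ab unfolding lin_on_def by simp
    ultimately show "?g (x + y) = ?g x + ?g y"
      using gf s.subspace_add[OF assms(3)] by simp
  next
    fix c x assume "x \<in> f ` S"
    then obtain a where ab: "a \<in> S" "x = f a" by blast
    moreover have "t c (f a) = f (s c a)" using assms(4) ab unfolding lin_on_def by simp
    ultimately show "?g (t c x) = s c (?g x)"
      using gf s.subspace_scale[OF assms(3)] by simp
  qed
  then have "fd_subspace s (?g ` f ` S)"
    using subspace_image_lin_on(3)[OF assms(2,1) subspace_fd[OF assms(2) fd]] fd by blast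
  moreover have "?g ` f ` S = S" using gf by force
  ultimately show ?thesis by simp
qed

lemma dim_iso:
  assumes "vector_space s" "vector_space t" "module.subspace s S" "lin_on s t S f"
    and "\<And>x. x \<in> S \<Longrightarrow> f x \<in> T" "\<And>y. y \<in> T \<Longrightarrow> g y \<in> S" "\<And>x. x \<in> S \<Longrightarrow> g (f x) = x" "\<And>y. y \<in> T \<Longrightarrow> f (g y) = y"
  shows "vector_space.dim s S = vector_space.dim t T"
proof -
  have "inj_on f S" using assms(7) by (metis inj_on_inverseI)
  moreover have "f ` S = T" using assms(5,6,8) by force
  ultimately show ?thesis using dim_inj_lin_on[OF assms(1-4)] by simp
qed

section \<open>Coordinate spaces of complex functions\<close>

interpretation cf: vector_space cscale by (rule vector_space_cscale)

text \<open>The coordinate space with index set \<open>K\<close>, kept inside the full function type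
  so that matrices, representations and solution vectors of different sizes share one type.\<close>

definition supp_on :: "'k set \<Rightarrow> ('k \<Rightarrow> complex) set" where
  "supp_on K = {f. \<forall>k. k \<notin> K \<longrightarrow> f k = 0}"

lemma subspace_supp_on: "cf.subspace (supp_on K)"
  by (rule cf.subspaceI) (auto simp: supp_on_def cscale_def)

lemma cscale_apply: "cscale c f x = c * f x" by (simp add: cscale_def)

lemma sum_fun_apply [simp]: "sum f A x = (\<Sum>a\<in>A. f a x)"
  by (induction A rule: infinite_finite_induct) auto

lemma supp_on_finite:
  assumes "finite K"
  shows "fd_subspace cscale (supp_on K)" "cdim (supp_on K) = card K"
proof -
  define u :: "'a \<Rightarrow> 'a \<Rightarrow> complex" where "u k = (\<lambda>j. if j = k then 1 else 0)" for k
  have inj: "inj_on u K" unfolding u_def inj_on_def fun_eq_iff by (metis zero_neq_one)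
  have rep: "f = (\<Sum>k\<in>K. cscale (f k) (u k))" if "f \<in> supp_on K" for f
  proof
    fix j
    have "(\<Sum>k\<in>K. cscale (f k) (u k)) j = (\<Sum>k\<in>K. if j = k then f k else 0)"
      by (auto simp: u_def cscale_apply intro!: sum.cong)
    also have "\<dots> = f j" using assms that by (auto simp: supp_on_def sum.delta')
    finally show "f j = (\<Sum>k\<in>K. cscale (f k) (u k)) j" by simp
  qed
  have "u ` K \<subseteq> supp_on K" by (auto simp: u_def supp_on_def)
  moreover have sp: "supp_on K \<subseteq> cf.span (u ` K)"
  proof
    fix f :: "'a \<Rightarrow> complex" assume "f \<in> supp_on K"
    then show "f \<in> cf.span (u ` K)"
      using rep[of f] by (metis (no_types, lifting) cf.span_base cf.span_scale cf.span_sum imageI)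
  qed
  moreover have "cf.independent (u ` K)"
  proof (rule cf.independent_if_scalars_zero)
    fix g :: "('a \<Rightarrow> complex) \<Rightarrow> complex" and x assume z: "(\<Sum>x\<in>u ` K. cscale (g x) x) = 0" "x \<in> u ` K"
    then obtain k where k: "k \<in> K" "x = u k" by blast
    have "0 = (\<Sum>x\<in>u ` K. cscale (g x) x) k" using z by simp
    also have "\<dots> = (\<Sum>j\<in>K. g (u j) * u j k)"
      by (simp add: sum.reindex[OF inj] cscale_apply)
    also have "\<dots> = (\<Sum>j\<in>K. if k = j then g (u j) else 0)" by (auto simp: u_def intro!: sum.cong)
    also have "\<dots> = g x" using k assms by (simp add: sum.delta')
    finally show "g x = 0" by simp
  qed (use assms in auto)
  ultimately have "cdim (supp_on K) = card (u ` K)" by (intro cf.basis_card_eq_dim[symmetric])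
  then show "cdim (supp_on K) = card K" using inj by (simp add: card_image)
  have "cf.span (u ` K) = supp_on K"
    using sp \<open>u ` K \<subseteq> supp_on K\<close> by (intro cf.span_subspace subspace_supp_on)
  then show "fd_subspace cscale (supp_on K)" using assms unfolding fd_subspace_def by (metis finite_imageI)
qed

section \<open>Regular functions and semicontinuity\<close>

definition regular_on :: "('x \<Rightarrow> complex) set \<Rightarrow> 'x set \<Rightarrow> ('x \<Rightarrow> complex) \<Rightarrow> bool" where
  "regular_on C X g \<longleftrightarrow> (\<exists>f\<in>polynomials C. \<forall>x\<in>X. g x = f x)"

lemma regular_const [simp, intro]: "regular_on C X (\<lambda>_. c)"
  unfolding regular_on_def using polynomials.const by fastforce

lemma regular_coord: "f \<in> C \<Longrightarrow> regular_on C X f"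
  unfolding regular_on_def using polynomials.coord by fastforce

lemma regular_add: "regular_on C X f \<Longrightarrow> regular_on C X g \<Longrightarrow> regular_on C X (\<lambda>x. f x + g x)"
  unfolding regular_on_def by (elim bexE, rule_tac x="\<lambda>x. fa x + faa x" in bexI) (auto intro: polynomials.add)

lemma regular_mult: "regular_on C X f \<Longrightarrow> regular_on C X g \<Longrightarrow> regular_on C X (\<lambda>x. f x * g x)"
  unfolding regular_on_def by (elim bexE, rule_tac x="\<lambda>x. fa x * faa x" in bexI) (auto intro: polynomials.mult)

lemma regular_diff:
  assumes "regular_on C X f" "regular_on C X g" shows "regular_on C X (\<lambda>x. f x - g x)"
  using regular_add[OF assms(1) regular_mult[OF regular_const[of C X "-1"] assms(2)]] by simp

lemma regular_sum:
  assumes "\<And>i. i \<in> I \<Longrightarrow> regular_on C X (f i)" shows "regular_on C X (\<lambda>x. \<Sum>i\<in>I. f i x)"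
  using assms by (induction I rule: infinite_finite_induct) (auto intro: regular_add)

lemma openin_regular_nonzero:
  assumes "regular_on C X f" shows "openin (zariski_topology C X) {x \<in> X. f x \<noteq> 0}"
proof -
  obtain g where "g \<in> polynomials C" "\<forall>x\<in>X. f x = g x" using assms unfolding regular_on_def by blast
  then show ?thesis unfolding openin_zariski_topology zariski_open_def
    by (intro exI[of _ "{g}"]) auto
qed

abbreviation usc_on :: "('x \<Rightarrow> complex) set \<Rightarrow> 'x set \<Rightarrow> ('x \<Rightarrow> int) \<Rightarrow> bool" where
  "usc_on C X \<equiv> upper_semicontinuous (zariski_topology C X)"

lemma usc_on_iff: "usc_on C X f \<longleftrightarrow> (\<forall>k. openin (zariski_topology C X) {x \<in> X. f x < k})"
  by (simp add: upper_semicontinuous_def topspace_zariski_topology)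

lemma usc_cong:
  assumes "\<And>x. x \<in> X \<Longrightarrow> f x = g x" shows "usc_on C X f \<longleftrightarrow> usc_on C X g"
proof -
  have "{x \<in> X. f x < k} = {x \<in> X. g x < k}" for k using assms by auto
  then show ?thesis by (simp add: usc_on_iff)
qed

lemma usc_const: "usc_on C X (\<lambda>_. c)"
  unfolding usc_on_iff
proof
  fix k
  show "openin (zariski_topology C X) {x \<in> X. c < k}"
    using openin_topspace[of "zariski_topology C X"] by (cases "c < k") (simp_all add: topspace_zariski_topology)
qed

lemma usc_add:
  assumes "usc_on C X f" "usc_on C X g" shows "usc_on C X (\<lambda>x. f x + g x)"
  unfolding usc_on_iff
proof
  fix k
  \<comment> \<open>The index \<open>i\<close> ranges over the possible values of
    \<open>f x\<close>. For integers \<open>f x < i + 1\<close> means \<open>f x \<le> i\<close>,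
    and together with \<open>g x < k - i\<close> this bounds the sum strictly by
    \<open>k\<close>.\<close>
  have "{x \<in> X. f x + g x < k} = (\<Union>i. {x \<in> X. f x < i + 1} \<inter> {x \<in> X. g x < k - i})"
  proof (intro equalityI subsetI)
    fix x assume "x \<in> {x \<in> X. f x + g x < k}"
    then show "x \<in> (\<Union>i. {x \<in> X. f x < i + 1} \<inter> {x \<in> X. g x < k - i})"
      by (intro UN_I[of "f x"]) auto
  qed auto
  moreover have "openin (zariski_topology C X) \<dots>"
    using assms unfolding usc_on_iff by (intro openin_Union) (auto simp del: zle_add1_eq_le simp: less_le_not_le[symmetric] intro!: openin_Int)
  ultimately show "openin (zariski_topology C X) {x \<in> X. f x + g x < k}" by simp
qed

lemma usc_sum:
  assumes "\<And>i. i \<in> I \<Longrightarrow> usc_on C X (f i)" shows "usc_on C X (\<lambda>x. \<Sum>i\<in>I. f i x)"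
  using assms by (induction I rule: infinite_finite_induct) (auto intro: usc_add usc_const)

text \<open>The factor is a natural number since a negative one would reverse semicontinuity; all
  later formulas are arranged to meet this restriction.\<close>

lemma usc_nat_mult:
  assumes "usc_on C X f" shows "usc_on C X (\<lambda>x. int c * f x)"
  by (induction c) (auto simp: algebra_simps intro: usc_add usc_const assms)

section \<open>Solution spaces of linear systems with parameters\<close>

definition linear_solutions :: "'k set \<Rightarrow> 'j set \<Rightarrow> ('j \<Rightarrow> 'k \<Rightarrow> complex) \<Rightarrow> ('k \<Rightarrow> complex) set" where
  "linear_solutions K R L = {\<xi> \<in> supp_on K. \<forall>j\<in>R. (\<Sum>k\<in>K. L j k * \<xi> k) = 0}"

lemma subspace_linear_solutions: "cf.subspace (linear_solutions K R L)"
  by (rule cf.subspaceI)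
     (auto simp: linear_solutions_def supp_on_def cscale_apply algebra_simps sum.distrib simp flip: sum_distrib_left)

text \<open>Gaussian elimination with pivot \<open>L \<rho> \<kappa>\<close>. The rows are
  multiplied by the pivot instead of divided by it, which keeps the new coefficients polynomial in
  the old ones. The pivot row itself becomes the zero equation, so the set \<open>R\<close> of rows
  can stay unchanged.\<close>

lemma dim_eliminate:
  assumes K: "finite K" "\<kappa> \<in> K" and r: "\<rho> \<in> R" "L \<rho> \<kappa> \<noteq> 0"
  shows "cdim (linear_solutions K R L) =
    cdim (linear_solutions (K - {\<kappa>}) R (\<lambda>j k. L \<rho> \<kappa> * L j k - L j \<kappa> * L \<rho> k))"
    (is "_ = cdim ?V'")
proof (rule dim_iso[OF vector_space_cscale vector_space_cscale subspace_linear_solutions])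
  let ?K = "K - {\<kappa>}" and ?a = "L \<rho> \<kappa>"
  \<comment> \<open>The inverse of forgetting the coordinate \<open>\<kappa>\<close>: the pivot
    equation is solved for it.\<close>
  let ?g = "\<lambda>\<eta>. \<eta>(\<kappa> := - (\<Sum>k\<in>?K. L \<rho> k * \<eta> k) / ?a)"
  have split: "(\<Sum>k\<in>K. L j k * \<xi> k) = L j \<kappa> * \<xi> \<kappa> + (\<Sum>k\<in>?K. L j k * \<xi> k)" for j \<xi>
    using K by (simp add: sum.remove)
  have row: "(\<Sum>k\<in>?K. (?a * L j k - L j \<kappa> * L \<rho> k) * \<xi> k) =
      ?a * (\<Sum>k\<in>?K. L j k * \<xi> k) - L j \<kappa> * (\<Sum>k\<in>?K. L \<rho> k * \<xi> k)" for j \<xi>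
    by (simp add: algebra_simps sum_subtractf sum_distrib_left)
  have upd: "(\<Sum>k\<in>?K. c k * (\<xi>(\<kappa> := z)) k) = (\<Sum>k\<in>?K. c k * \<xi> k)" for c \<xi> z
    by (rule sum.cong) auto
  show "lin_on cscale cscale (linear_solutions K R L) (\<lambda>\<xi>. \<xi>(\<kappa> := 0))"
    by (rule lin_onI) (auto simp: fun_eq_iff cscale_apply)
  fix \<xi> assume x: "\<xi> \<in> linear_solutions K R L"
  then have e: "L j \<kappa> * \<xi> \<kappa> + (\<Sum>k\<in>?K. L j k * \<xi> k) = 0" if "j \<in> R" for j
    using that split unfolding linear_solutions_def by auto
  then have e': "(\<Sum>k\<in>?K. L j k * \<xi> k) = - L j \<kappa> * \<xi> \<kappa>" if "j \<in> R" for j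
    using that by (simp add: add_eq_0_iff)
  show "\<xi>(\<kappa> := 0) \<in> ?V'"
    using x unfolding linear_solutions_def row upd by (auto simp: supp_on_def e' r)
  have "\<xi> \<kappa> = - (\<Sum>k\<in>?K. L \<rho> k * \<xi> k) / ?a"
    using e'[OF r(1)] r(2) by simp
  then show "?g (\<xi>(\<kappa> := 0)) = \<xi>" unfolding upd by (metis fun_upd_triv fun_upd_upd)
next
  let ?K = "K - {\<kappa>}" and ?a = "L \<rho> \<kappa>"
  let ?g = "\<lambda>\<eta>. \<eta>(\<kappa> := - (\<Sum>k\<in>?K. L \<rho> k * \<eta> k) / ?a)"
  have split: "(\<Sum>k\<in>K. L j k * \<xi> k) = L j \<kappa> * \<xi> \<kappa> + (\<Sum>k\<in>?K. L j k * \<xi> k)" for j \<xi>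
    using K by (simp add: sum.remove)
  have row: "(\<Sum>k\<in>?K. (?a * L j k - L j \<kappa> * L \<rho> k) * \<xi> k) =
      ?a * (\<Sum>k\<in>?K. L j k * \<xi> k) - L j \<kappa> * (\<Sum>k\<in>?K. L \<rho> k * \<xi> k)" for j \<xi>
    by (simp add: algebra_simps sum_subtractf sum_distrib_left)
  have upd: "(\<Sum>k\<in>?K. c k * (\<xi>(\<kappa> := z)) k) = (\<Sum>k\<in>?K. c k * \<xi> k)" for c \<xi> z
    by (rule sum.cong) auto
  fix \<eta> assume y: "\<eta> \<in> ?V'"
  then have e: "?a * (\<Sum>k\<in>?K. L j k * \<eta> k) = L j \<kappa> * (\<Sum>k\<in>?K. L \<rho> k * \<eta> k)" if "j \<in> R" for j
    using that unfolding linear_solutions_def row by auto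
  have "(\<Sum>k\<in>K. L j k * ?g \<eta> k) = 0" if "j \<in> R" for j
    unfolding split upd using e[OF that] r(2) by (simp add: field_simps)
  then show "?g \<eta> \<in> linear_solutions K R L"
    using y K unfolding linear_solutions_def by (auto simp: supp_on_def)
  show "(?g \<eta>)(\<kappa> := 0) = \<eta>" using y unfolding linear_solutions_def supp_on_def by auto
qed

text \<open>Induction on the number of unknowns, local at a point \<open>x0\<close> of the set. If
  some coefficient is nonzero at \<open>x0\<close>, it stays so on an open neighbourhood, and there
  elimination with this pivot gives the same dimension with one unknown fewer.\<close>

lemma openin_dim_linear_solutions:
  assumes "finite K" "\<And>j \<kappa>. j \<in> R \<Longrightarrow> \<kappa> \<in> K \<Longrightarrow> regular_on C X (\<lambda>x. L x j \<kappa>)"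
  shows "openin (zariski_topology C X) {x \<in> X. cdim (linear_solutions K R (L x)) < k}"
  using assms
proof (induction "card K" arbitrary: K L)
  case (0 K L)
  then have "K = {}" by simp
  then have "linear_solutions K R (L x) = supp_on K" for x by (simp add: linear_solutions_def)
  then show ?case using openin_topspace[of "zariski_topology C X"]
    by (cases "cdim (supp_on K) < k") (simp_all only: topspace_zariski_topology simp_thms Collect_mem_eq empty_Collect_eq openin_empty Collect_empty_eq[symmetric] empty_def[symmetric])
next
  case (Suc n K L)
  let ?T = "zariski_topology C X"
  show ?case
  proof (subst openin_subopen, intro ballI)
    fix x0 assume x0: "x0 \<in> {x \<in> X. cdim (linear_solutions K R (L x)) < k}"
    show "\<exists>T. openin ?T T \<and> x0 \<in> T \<and> T \<subseteq> {x \<in> X. cdim (linear_solutions K R (L x)) < k}"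
    proof (cases "\<exists>\<rho>\<in>R. \<exists>\<kappa>\<in>K. L x0 \<rho> \<kappa> \<noteq> 0")
      case True
      then obtain \<rho> \<kappa> where r: "\<rho> \<in> R" "\<kappa> \<in> K" "L x0 \<rho> \<kappa> \<noteq> 0" by blast
      let ?L = "\<lambda>x j k. L x \<rho> \<kappa> * L x j k - L x j \<kappa> * L x \<rho> k"
      have eq: "cdim (linear_solutions K R (L x)) = cdim (linear_solutions (K - {\<kappa>}) R (?L x))"
        if "L x \<rho> \<kappa> \<noteq> 0" for x
        by (rule dim_eliminate[OF Suc.prems(1) r(2,1), of "L x", OF that])
      have "openin ?T {x \<in> X. cdim (linear_solutions (K - {\<kappa>}) R (?L x)) < k}"
        using Suc.hyps(2) Suc.prems r
        by (intro Suc.hyps(1)) (auto intro!: regular_diff regular_mult)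
      then have "openin ?T ({x \<in> X. L x \<rho> \<kappa> \<noteq> 0} \<inter> {x \<in> X. cdim (linear_solutions (K - {\<kappa>}) R (?L x)) < k})"
        using Suc.prems(2)[OF r(1,2)] by (intro openin_Int openin_regular_nonzero)
      then show ?thesis using x0 r(3) eq
        by (intro exI[of _ "{x \<in> X. L x \<rho> \<kappa> \<noteq> 0} \<inter> {x \<in> X. cdim (linear_solutions (K - {\<kappa>}) R (?L x)) < k}"]) auto
    next
      \<comment> \<open>All equations are trivial at \<open>x0\<close>, so the dimension there is
        \<open>card K\<close>, the largest possible. The bound \<open>k\<close> therefore holds on
        the whole of \<open>X\<close>.\<close>
      case False
      then have "linear_solutions K R (L x0) = supp_on K" by (auto simp: linear_solutions_def)
      then have "card K < k" using x0 by (simp add: supp_on_finite(2)[OF Suc.prems(1)])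
      moreover have "cdim (linear_solutions K R (L x)) \<le> card K" for x
        using fd_subset(2)[OF vector_space_cscale supp_on_finite(1)[OF Suc.prems(1)] subspace_linear_solutions, of K R "L x"]
          unfolding supp_on_finite(2)[OF Suc.prems(1)] by (auto simp: linear_solutions_def)
      ultimately have "{x \<in> X. cdim (linear_solutions K R (L x)) < k} = X"
        by (auto intro: le_less_trans)
      then show ?thesis using x0 openin_topspace[of ?T] by (auto simp: topspace_zariski_topology)
    qed
  qed
qed

lemma usc_dim_linear_solutions:
  assumes "finite K" "\<And>j \<kappa>. j \<in> R \<Longrightarrow> \<kappa> \<in> K \<Longrightarrow> regular_on C X (\<lambda>x. L x j \<kappa>)"
  shows "usc_on C X (\<lambda>x. int (cdim (linear_solutions K R (L x))))"
  unfolding usc_on_iff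
proof
  fix k
  show "openin (zariski_topology C X) {x \<in> X. int (cdim (linear_solutions K R (L x))) < k}"
  proof (cases "k \<le> 0")
    case False
    then have "{x \<in> X. int (cdim (linear_solutions K R (L x))) < k} =
      {x \<in> X. cdim (linear_solutions K R (L x)) < nat k}" by auto
    then show ?thesis using openin_dim_linear_solutions[OF assms] by simp
  qed (auto intro: openin_subopen[THEN iffD2])
qed

lemma supp_on_expand:
  assumes "finite K" "\<xi> \<in> supp_on K"
  shows "\<xi> = (\<Sum>k\<in>K. cscale (\<xi> k) (indicator {k}))"
proof
  fix j
  have "(\<Sum>k\<in>K. cscale (\<xi> k) (indicator {k})) j = (\<Sum>k\<in>K. if j = k then \<xi> k else 0)"
    by (auto simp: cscale_apply indicator_def intro!: sum.cong)
  also have "\<dots> = \<xi> j" using assms by (auto simp: supp_on_def sum.delta')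
  finally show "\<xi> j = (\<Sum>k\<in>K. cscale (\<xi> k) (indicator {k})) j" by simp
qed

lemma lin_on_sum:
  assumes "vector_space s" "module.subspace s S" "vector_space t" "lin_on s t S f" "\<And>k. k \<in> K \<Longrightarrow> v k \<in> S"
  shows "f (\<Sum>k\<in>K. s (c k) (v k)) = (\<Sum>k\<in>K. t (c k) (f (v k)))"
proof -
  interpret s: vector_space s by fact
  interpret t: vector_space t by fact
  have z: "f 0 = 0" using assms(4) s.subspace_0[OF assms(2)] unfolding lin_on_def
    by (metis add_cancel_right_right add_0)
  have "(\<Sum>k\<in>K. s (c k) (v k)) \<in> S \<and> f (\<Sum>k\<in>K. s (c k) (v k)) = (\<Sum>k\<in>K. t (c k) (f (v k)))"
    using assms(5)
  proof (induction K rule: infinite_finite_induct)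
    case (insert x F)
    then have "s (c x) (v x) \<in> S" "(\<Sum>k\<in>F. s (c k) (v k)) \<in> S"
      using s.subspace_scale[OF assms(2)] by auto
    then show ?case using insert assms(4) s.subspace_add[OF assms(2)] unfolding lin_on_def by auto
  qed (use z s.subspace_0[OF assms(2)] in auto)
  then show ?thesis by blast
qed

lemma vector_space_times: "vector_space ((*) :: complex \<Rightarrow> complex \<Rightarrow> complex)"
  by standard (auto simp: algebra_simps)

text \<open>The coefficient matrix consists of the values of the forms \<open>F x j\<close> on unit
  vectors, so regularity has to be checked only for a fixed vector \<open>\<xi>\<close>. The index
  set \<open>R\<close> is arbitrary, which allows one equation for every element of an ideal or of
  an algebra.\<close>

lemma usc_dim_solutions:
  assumes K: "finite K"
    and lin: "\<And>x j. x \<in> X \<Longrightarrow> j \<in> R \<Longrightarrow> lin_on cscale (*) (supp_on K) (F x j)"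
    and reg: "\<And>j \<xi>. j \<in> R \<Longrightarrow> \<xi> \<in> supp_on K \<Longrightarrow> regular_on C X (\<lambda>x. F x j \<xi>)"
  shows "usc_on C X (\<lambda>x. int (cdim {\<xi> \<in> supp_on K. \<forall>j\<in>R. F x j \<xi> = 0}))"
proof -
  let ?L = "\<lambda>x j k. F x j (indicator {k})"
  have ind: "indicator {k} \<in> supp_on K" if "k \<in> K" for k
    using that by (auto simp: supp_on_def indicator_def)
  have "{\<xi> \<in> supp_on K. \<forall>j\<in>R. F x j \<xi> = 0} = linear_solutions K R (?L x)" if x: "x \<in> X" for x
  proof -
    have "F x j \<xi> = (\<Sum>k\<in>K. ?L x j k * \<xi> k)" if "j \<in> R" "\<xi> \<in> supp_on K" for j \<xi>
    proof -
      have "F x j \<xi> = F x j (\<Sum>k\<in>K. cscale (\<xi> k) (indicator {k}))"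
        using supp_on_expand[OF K that(2)] by simp
      also have "\<dots> = (\<Sum>k\<in>K. \<xi> k * ?L x j k)"
        by (rule lin_on_sum[OF vector_space_cscale subspace_supp_on vector_space_times lin[OF x that(1)] ind])
      finally show ?thesis by (simp add: mult.commute)
    qed
    then show ?thesis by (auto simp: linear_solutions_def)
  qed
  moreover have "usc_on C X (\<lambda>x. int (cdim (linear_solutions K R (?L x))))"
    by (rule usc_dim_linear_solutions[OF K]) (use reg ind in auto)
  ultimately show ?thesis by (subst usc_cong) auto
qed

section \<open>Homomorphisms and nilpotency of representations\<close>

lemma rep_space_eq_supp_on:
  "rep_space Q d e = supp_on {(a, r, c). a \<in> arcs Q \<and> r < e (head Q a) \<and> c < d (tail Q a)}"
  by (auto simp: rep_space_def supp_on_def)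

lemma vertex_maps_eq_supp_on:
  "vertex_maps Q d e = supp_on {(i, r, c). i \<in> verts Q \<and> r < e i \<and> c < d i}"
  by (auto simp: vertex_maps_def supp_on_def)

lemma finite_index_triples:
  assumes "finite A" shows "finite {(a, r, c). a \<in> A \<and> r < (f a :: nat) \<and> c < (g a :: nat)}"
proof -
  have "{(a, r, c). a \<in> A \<and> r < f a \<and> c < g a} = Sigma A (\<lambda>a. {..<f a} \<times> {..<g a})" by auto
  then show ?thesis using assms by simp
qed

lemma lin_on_commutator: "lin_on cscale cscale S (commutator Q d M e N)"
  by (rule lin_onI)
    (auto simp: commutator_def fun_eq_iff cscale_apply algebra_simps sum.distrib sum_distrib_left)

lemma usc_dim_rep_hom:
  assumes Q: "fin_digraph Q"
    and M: "\<And>k. regular_on C X (\<lambda>x. M x k)" and N: "\<And>k. regular_on C X (\<lambda>x. N x k)"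
  shows "usc_on C X (\<lambda>x. int (cdim (rep_hom Q d (M x) e (N x))))"
proof -
  interpret fin_digraph Q by fact
  let ?K = "{(i, r, c). i \<in> verts Q \<and> r < e i \<and> c < d i}"
  have "rep_hom Q d (M x) e (N x) = {f \<in> supp_on ?K. \<forall>j\<in>UNIV. commutator Q d (M x) e (N x) f j = 0}" for x
    unfolding rep_hom_def vertex_maps_eq_supp_on by (auto simp: fun_eq_iff)
  moreover have "usc_on C X (\<lambda>x. int (cdim {f \<in> supp_on ?K. \<forall>j\<in>UNIV. commutator Q d (M x) e (N x) f j = 0}))"
  proof (rule usc_dim_solutions)
    show "finite ?K" by (rule finite_index_triples) simp
    show "lin_on cscale (*) (supp_on ?K) (\<lambda>f. commutator Q d (M x) e (N x) f j)" for x j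
      using lin_on_commutator[of "supp_on ?K" Q d "M x" e "N x"]
      unfolding lin_on_def by (simp add: cscale_apply)
    show "regular_on C X (\<lambda>x. commutator Q d (M x) e (N x) f j)" for f j
      by (cases j, cases "fst j \<in> arcs Q") (auto simp: commutator_def intro!: regular_diff regular_sum regular_mult M N)
  qed
  ultimately show ?thesis by simp
qed

lemma regular_path_matrix:
  assumes "\<And>k. regular_on C X (\<lambda>x. M x k)"
  shows "regular_on C X (\<lambda>x. path_matrix Q d (M x) u p r c)"
  by (induction p arbitrary: u c) (auto intro!: regular_sum regular_mult assms)

text \<open>Let \<open>V k\<close> be the span of all rows of matrices of paths of length at least
  \<open>k\<close>. These spaces decrease inside a space of dimension
  \<open>\<Sum>i\<in>verts Q. e i\<close>. Once \<open>V k = V (k + 1)\<close> the chain is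
  constant, hence zero by nilpotency, so it drops strictly until it vanishes. The resulting bound on
  path lengths is the same for all points of the variety.\<close>

lemma nilpotent_bound:
  assumes Q: "fin_digraph Q" and nil: "nilpotent_rep Q e N"
    and p: "pre_digraph.awalk Q u p v" "(\<Sum>i\<in>verts Q. e i) \<le> length p"
    and N: "N \<in> rep_space Q e e"
  shows "path_matrix Q e N u p = 0"
proof -
  interpret fin_digraph Q by fact
  define K where "K = {(i, r). i \<in> verts Q \<and> r < e i}"
  \<comment> \<open>The row is placed in the block of the starting vertex, so that paths from
    different vertices share one ambient space.\<close>
  define row where "row u p r = (\<lambda>(w, c). if w = u then path_matrix Q e N u p r c else 0)" for u :: nat and p and r :: nat
  define S where "S k = {row u p r | u p r v. awalk u p v \<and> k \<le> length p}" for k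
  define V where "V k = cf.span (S k)" for k
  \<comment> \<open>Right multiplication by the matrix of \<open>a\<close>, which on rows amounts to
    prepending the arrow \<open>a\<close> to the path.\<close>
  define B where "B a y = (\<lambda>(w, c). if w = tail Q a then \<Sum>j<e (head Q a). y (head Q a, j) * N (a, j, c) else 0)"
    for a and y :: "nat \<times> nat \<Rightarrow> complex"
  have K: "K = Sigma (verts Q) (\<lambda>i. {..<e i})" unfolding K_def by auto
  have cK: "finite K" "card K = (\<Sum>i\<in>verts Q. e i)" unfolding K by auto
  have pm0: "path_matrix Q e N u p r c = 0" if "awalk u p v" "\<not> c < e u" for u p v r c
    using that
  proof (cases p)
    case (Cons a q)
    then have "u = tail Q a" using that(1) by (simp add: awalk_Cons_iff)
    then have "N (a, j, c) = 0" for j using N that(2) unfolding rep_space_def by auto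
    then show ?thesis using Cons by simp
  qed auto
  have S_I: "row u p r \<in> S k" if "awalk u p v" "k \<le> length p" for u p v r k
    unfolding S_def using that by blast
  have V_I: "x \<in> V k" if "x \<in> S k" for x k
    unfolding V_def by (rule cf.span_base[OF that])
  have zero_V: "0 \<in> V k" for k unfolding V_def by (rule cf.span_zero)
  have V_eq0: "V k = {0}" if "V k \<subseteq> {0}" for k
    by (rule subset_antisym[OF that]) (intro insert_subsetI zero_V empty_subsetI)
  have rowK: "row u p r \<in> supp_on K" if "awalk u p v" for u p v r
    using pm0[OF that] awalk_hd_in_verts[OF that] by (auto simp: row_def supp_on_def K_def)
  have SK: "S k \<subseteq> supp_on K" for k unfolding S_def using rowK by auto
  then have VK: "V k \<subseteq> supp_on K" for k
    unfolding V_def by (intro cf.span_minimal subspace_supp_on)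
  have fdV: "fd_subspace cscale (V k)" for k
    by (rule fd_subset(1)[OF vector_space_cscale supp_on_finite(1)[OF cK(1)] _ VK])
      (simp add: V_def)
  have mono: "V l \<subseteq> V k" if "k \<le> l" for k l
    unfolding V_def S_def using that by (intro cf.span_mono) (auto intro: order_trans)
  have Brow: "row (tail Q a) (a # p) r = B a (row (head Q a) p r)" for a p r
    by (auto simp: row_def B_def fun_eq_iff)
  have linB: "Vector_Spaces.linear cscale cscale (B a)" for a
    unfolding Vector_Spaces.linear_iff
    by (auto simp: B_def fun_eq_iff cscale_apply algebra_simps sum.distrib sum_distrib_left
        vector_space_cscale)
  \<comment> \<open>A path of length at least \<open>k + 1\<close> has the form
    \<open>a # q\<close>. The row of \<open>q\<close> lies in \<open>V k\<close>, hence in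
    \<open>V (k + 1)\<close> by assumption, and \<open>B a\<close> maps \<open>V (k + 1)\<close>
    into \<open>V (k + 2)\<close>.\<close>
  have step: "V (Suc k) \<subseteq> V (Suc (Suc k))" if sub: "V k \<subseteq> V (Suc k)" for k
  proof -
    have "row u p r \<in> V (Suc (Suc k))" if w: "awalk u p v" "Suc k \<le> length p" for u p v r
    proof -
      obtain a q where p: "p = a # q" using w(2) by (cases p) auto
      then have a: "a \<in> arcs Q" "u = tail Q a" "awalk (head Q a) q v" using w(1) by (auto simp: awalk_Cons_iff)
      interpret B: Vector_Spaces.linear cscale cscale "B a" by (rule linB)
      have "row (head Q a) q r \<in> S k" using a(3) w(2) p by (intro S_I) auto
      then have "row (head Q a) q r \<in> V (Suc k)" by (intro subsetD[OF sub] V_I)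
      then have "B a (row (head Q a) q r) \<in> cf.span (B a ` S (Suc k))"
        unfolding V_def B.span_image by blast
      moreover have "B a ` S (Suc k) \<subseteq> V (Suc (Suc k))"
      proof
        fix z assume "z \<in> B a ` S (Suc k)"
        then obtain u' p' r' v' where z: "z = B a (row u' p' r')" "awalk u' p' v'" "Suc k \<le> length p'"
          unfolding S_def by blast
        show "z \<in> V (Suc (Suc k))"
        proof (cases "u' = head Q a")
          case True
          then have "z = row (tail Q a) (a # p') r'" using z(1) Brow by simp
          moreover have "awalk (tail Q a) (a # p') v'" using True z(2) a(1) by (simp add: awalk_Cons_iff)
          ultimately show ?thesis using z(3) by (auto simp del: path_matrix.simps intro!: V_I S_I[where p="a # p'"])
        next
          case False
          then have "z = 0" unfolding z(1) by (auto simp: B_def row_def fun_eq_iff)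
          then show ?thesis by (simp add: zero_V)
        qed
      qed
      then have "cf.span (B a ` S (Suc k)) \<subseteq> V (Suc (Suc k))"
        unfolding V_def by (rule cf.span_minimal[OF _ cf.subspace_span])
      ultimately have "B a (row (head Q a) q r) \<in> V (Suc (Suc k))"
        by (rule rev_subsetD)
      moreover have "row u p r = B a (row (head Q a) q r)" unfolding p a(2) by (rule Brow)
      ultimately show ?thesis by (simp only:)
    qed
    then have "S (Suc k) \<subseteq> V (Suc (Suc k))" unfolding S_def by auto
    then show ?thesis unfolding V_def by (rule cf.span_minimal[OF _ cf.subspace_span])
  qed
  obtain k0 where k0: "\<And>u p v. awalk u p v \<Longrightarrow> k0 \<le> length p \<Longrightarrow> path_matrix Q e N u p = 0"
    using nil unfolding nilpotent_rep_def by blast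
  have V0: "V l = {0}" if "k0 \<le> l" for l
  proof -
    have "row u p r = 0" if "awalk u p v" "l \<le> length p" for u p r v
      using k0[OF that(1)] that(2) \<open>k0 \<le> l\<close> by (simp add: row_def fun_eq_iff)
    then have "S l \<subseteq> {0}" unfolding S_def by auto
    then have "V l \<subseteq> {0}" unfolding V_def by (rule cf.span_minimal[OF _ cf.subspace_single_0])
    then show ?thesis by (rule V_eq0)
  qed
  have stable: "V k = {0}" if stab: "V k \<subseteq> V (Suc k)" for k
  proof -
    have 1: "V (k + l) \<subseteq> V (Suc (k + l))" for l
    proof (induction l)
      case (Suc l)
      from step[OF Suc] show ?case by (simp only: add_Suc_right)
    qed (simp add: stab)
    have "V k \<subseteq> V (k + l)" for l
    proof (induction l)
      case (Suc l)
      from order_trans[OF Suc 1] show ?case by (simp only: add_Suc_right)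
    qed simp
    from this[of k0] show ?thesis using V_eq0[of k] V0[of "k + k0"] by (simp only: le_add2)
  qed
  have res: "P \<or> R \<Longrightarrow> \<not> P \<Longrightarrow> R" for P R by blast
  \<comment> \<open>Every strict inclusion costs at least one dimension; for
    \<open>k = card K\<close> nothing is left.\<close>
  have dec: "V k = {0} \<or> cdim (V k) + k \<le> card K" for k
  proof (induction k)
    case 0
    have "cdim (V 0) \<le> cdim (supp_on K)"
      by (rule fd_subset(2)[OF vector_space_cscale supp_on_finite(1)[OF cK(1)] _ VK]) (simp add: V_def)
    then show ?case using supp_on_finite(2)[OF cK(1)] by simp
  next
    case (Suc k)
    show ?case
    proof (cases "V k \<subseteq> V (Suc k)")
      case True
      have "V (Suc k) \<subseteq> V k" by (rule mono) simp
      then have "V (Suc k) = {0}" unfolding stable[OF True] by (rule V_eq0)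
      then show ?thesis by (rule disjI1)
    next
      case False
      have ne: "V k \<noteq> {0}"
      proof
        assume "V k = {0}"
        then have "V k \<subseteq> V (Suc k)" using zero_V by (simp only: insert_subset empty_subsetI simp_thms)
        with False show False by (rule notE)
      qed
      have sV: "cf.subspace (V (Suc k))" by (simp add: V_def)
      have "cdim (V (Suc k)) \<le> cdim (V k)"
        by (rule fd_subset(2)[OF vector_space_cscale fdV sV mono]) simp
      moreover have "cdim (V (Suc k)) \<noteq> cdim (V k)"
      proof
        assume "cdim (V (Suc k)) = cdim (V k)"
        then have "V (Suc k) = V k" by (intro fd_dim_eq[OF vector_space_cscale fdV sV mono]) auto
        with False show False by (simp only: subset_refl simp_thms)
      qed
      moreover have "cdim (V k) + k \<le> card K" by (rule res[OF Suc ne])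
      ultimately have "cdim (V (Suc k)) + Suc k \<le> card K" by linarith
      then show ?thesis by (rule disjI2)
    qed
  qed
  have "V (card K) = {0}"
  proof (rule ccontr)
    assume ne: "V (card K) \<noteq> {0}"
    have "cdim (V (card K)) + card K \<le> card K" by (rule res[OF dec ne])
    then have d1: "cdim (V (card K)) = 0" by linarith
    have sub: "{0} \<subseteq> V (card K)" by (intro insert_subsetI zero_V empty_subsetI)
    have d2: "cdim ({0} :: (nat \<times> nat \<Rightarrow> complex) set) = 0"
      using cf.dim_eq_card[OF _ cf.independent_empty, of "{0}"] by (metis card.empty cf.span_insert_0)
    have "{0} = V (card K)"
      by (rule fd_dim_eq[OF vector_space_cscale fdV cf.subspace_single_0 sub]) (simp only: d1 d2)
    with ne show False by simp
  qed
  have r0: "row u p r = 0" for r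
  proof -
    have "row u p r \<in> S (card K)" unfolding cK(2) using p by (rule S_I)
    then have "row u p r \<in> V (card K)" by (rule V_I)
    then show ?thesis unfolding \<open>V (card K) = {0}\<close> by (rule singletonD)
  qed
  have "path_matrix Q e N u p r c = 0" for r c
  proof -
    have "row u p r (u, c) = 0" unfolding r0 by simp
    then show ?thesis by (simp add: row_def)
  qed
  then show ?thesis by (auto simp: fun_eq_iff)
qed

section \<open>Cocycles and the E-invariant\<close>

text \<open>The columns \<open>c < e w\<close> belong to the subrepresentation \<open>N\<close>,
  which is preserved by every arrow of the extension; this gives the left blocks of the path
  matrices.\<close>

lemma path_matrix_extension_sub:
  assumes "fin_digraph Q" "pre_digraph.awalk Q w p v" "c < e w"
  shows "path_matrix Q (e + d) (extension_rep Q 0 e N \<xi>) w p r c =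
    (if r < e v then path_matrix Q e N w p r c else 0)"
  using assms(2,3)
proof (induction p arbitrary: w c)
  interpret fin_digraph Q by fact
  case Nil
  then show ?case by (auto simp: awalk_Nil_iff)
next
  interpret fin_digraph Q by fact
  case (Cons a p)
  let ?E = "extension_rep Q 0 e N \<xi>" and ?h = "head Q a"
  have a: "w = tail Q a" "awalk ?h p v" using Cons.prems(1) by (auto simp: awalk_Cons_iff)
  have "path_matrix Q (e + d) ?E w (a # p) r c =
      (\<Sum>j<(e + d) ?h. path_matrix Q (e + d) ?E ?h p r j * ?E (a, j, c))" by simp
  also have "\<dots> = (\<Sum>j<e ?h. path_matrix Q (e + d) ?E ?h p r j * ?E (a, j, c))"
    by (rule sum.mono_neutral_right) (use Cons.prems(2) a(1) in \<open>auto simp: extension_rep_def\<close>)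
  also have "\<dots> = (\<Sum>j<e ?h. (if r < e v then path_matrix Q e N ?h p r j else 0) * N (a, j, c))"
  proof (rule sum.cong[OF refl])
    fix j assume "j \<in> {..<e ?h}"
    then have j: "j < e ?h" by simp
    then have "?E (a, j, c) = N (a, j, c)" using Cons.prems(2) a(1) by (simp add: extension_rep_def)
    then show "path_matrix Q (e + d) ?E ?h p r j * ?E (a, j, c) =
        (if r < e v then path_matrix Q e N ?h p r j else 0) * N (a, j, c)"
      unfolding Cons.IH[OF a(2) j] by (rule arg_cong)
  qed
  also have "\<dots> = (if r < e v then path_matrix Q e N w (a # p) r c else 0)" by simp
  finally show ?case .
qed

text \<open>The upper right block of a path in an extension of a module with zero matrices by
  \<open>N\<close>. A path can leave the quotient only through \<open>\<xi>\<close>, and since all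
  arrows act as zero on the quotient, this must happen at the first arrow. The block is therefore
  linear in \<open>\<xi>\<close>.\<close>

definition connecting_block :: "(nat, 'a) pre_digraph \<Rightarrow> (nat \<Rightarrow> nat) \<Rightarrow> 'a rep \<Rightarrow> 'a rep \<Rightarrow>
    'a list \<Rightarrow> nat \<Rightarrow> nat \<Rightarrow> complex" where
  "connecting_block Q e N \<xi> p r c = (case p of [] \<Rightarrow> 0
     | a # q \<Rightarrow> \<Sum>j<e (head Q a). path_matrix Q e N (head Q a) q r j * \<xi> (a, j, c))"

text \<open>A nontrivial path acts as zero on the quotient, so the lower right block vanishes. The
  trivial path acts there as the identity and follows a different formula.\<close>

lemma path_matrix_extension:
  assumes "fin_digraph Q" "pre_digraph.awalk Q w p v" "p \<noteq> []"
  shows "path_matrix Q (e + d) (extension_rep Q 0 e N \<xi>) w p r c =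
    (if r < e v then if c < e w then path_matrix Q e N w p r c
       else connecting_block Q e N \<xi> p r (c - e w) else 0)"
proof -
  interpret fin_digraph Q by fact
  let ?E = "extension_rep Q 0 e N \<xi>"
  obtain a q where p: "p = a # q" using assms(3) by (cases p) auto
  let ?h = "head Q a"
  have a: "w = tail Q a" "awalk ?h q v" using assms(2) p by (auto simp: awalk_Cons_iff)
  show ?thesis
  proof (cases "c < e w")
    case True
    then show ?thesis using path_matrix_extension_sub[OF assms(1,2)] by simp
  next
    case False
    have "path_matrix Q (e + d) ?E w p r c =
        (\<Sum>j<(e + d) ?h. path_matrix Q (e + d) ?E ?h q r j * ?E (a, j, c))" by (simp add: p)
    also have "\<dots> = (\<Sum>j<e ?h. path_matrix Q (e + d) ?E ?h q r j * ?E (a, j, c))"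
      by (rule sum.mono_neutral_right) (use False a(1) in \<open>auto simp: extension_rep_def\<close>)
    also have "\<dots> = (\<Sum>j<e ?h. (if r < e v then path_matrix Q e N ?h q r j else 0) * \<xi> (a, j, c - e w))"
    proof (rule sum.cong[OF refl])
      fix j assume "j \<in> {..<e ?h}"
      then have j: "j < e ?h" by simp
      then have "?E (a, j, c) = \<xi> (a, j, c - e w)" using False a(1) by (simp add: extension_rep_def)
      then show "path_matrix Q (e + d) ?E ?h q r j * ?E (a, j, c) =
          (if r < e v then path_matrix Q e N ?h q r j else 0) * \<xi> (a, j, c - e w)"
        unfolding path_matrix_extension_sub[OF assms(1) a(2), where e=e, OF j] by (rule arg_cong)
    qed
    also have "\<dots> = (if r < e v then connecting_block Q e N \<xi> p r (c - e w) else 0)"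
      by (simp add: p connecting_block_def)
    finally show ?thesis using False by simp
  qed
qed

lemma finite_bounded_walks:
  assumes "fin_digraph Q" shows "finite {p. pre_digraph.awalk Q u p v \<and> length p \<le> D}"
proof -
  interpret fin_digraph Q by fact
  have "{p. awalk u p v \<and> length p \<le> D} \<subseteq> {p. set p \<subseteq> arcs Q \<and> length p \<le> D}"
    by (auto simp: awalk_def)
  then show ?thesis using finite_lists_length_le[of "arcs Q" D] finite_subset finite_arcs by blast
qed

text \<open>The index set in \<open>rep_act\<close> varies with \<open>M\<close>. Summing over one
  fixed finite set of paths instead exhibits the action as a polynomial in the entries of
  \<open>M\<close>.\<close>

lemma rep_act_bounded:
  assumes "fin_digraph Q"
    and "\<And>p. pre_digraph.awalk Q u p v \<Longrightarrow> x (u, p) \<noteq> 0 \<Longrightarrow> D < length p \<Longrightarrow> path_matrix Q d M u p = 0"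
  shows "rep_act Q d M x u v r c =
    (\<Sum>p | pre_digraph.awalk Q u p v \<and> length p \<le> D. x (u, p) * path_matrix Q d M u p r c)"
  unfolding rep_act_def
proof (rule sum.mono_neutral_left)
  show "finite {p. pre_digraph.awalk Q u p v \<and> length p \<le> D}" by (rule finite_bounded_walks) fact
  show "{p. pre_digraph.awalk Q u p v \<and> x (u, p) \<noteq> 0 \<and> path_matrix Q d M u p \<noteq> 0} \<subseteq>
      {p. pre_digraph.awalk Q u p v \<and> length p \<le> D}"
  proof (intro subsetI, simp, elim conjE)
    fix p assume "pre_digraph.awalk Q u p v" "x (u, p) \<noteq> 0" "path_matrix Q d M u p \<noteq> 0"
    then show "length p \<le> D" using assms(2)[of p] by (cases "length p \<le> D") auto
  qed
qed (auto simp: fun_eq_iff)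

text \<open>The trivial component of a product is the product of the trivial components, and the
  first factors here have none. This is applied both to \<open>J\<close> and to the kernel of an
  admissible presentation.\<close>

lemma arrow_square_no_trivial:
  assumes "x \<in> ideal_power Q R (arrow_ideal R) 2" shows "x (u, []) = 0"
proof -
  have "x \<in> ideal_prod Q (arrow_ideal R) (ideal_power Q R (arrow_ideal R) 1)"
    using assms by (simp add: numeral_2_eq_2)
  then obtain k :: nat and y z where x: "x = (\<Sum>i<k. pmult Q (y i) (z i))" and "\<forall>i<k. y i \<in> arrow_ideal R"
    unfolding ideal_prod_def by blast
  then have "y i (w, []) = 0" if "i < k" for i w using that unfolding arrow_ideal_def by auto
  then show ?thesis unfolding x by (simp add: pmult_def)
qed

text \<open>Nilpotency of the middle term is automatic, since a path uses \<open>\<xi>\<close> at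
  most once and otherwise runs in \<open>N\<close>. Annihilation by \<open>J\<close> already holds
  on the diagonal blocks, so only the connecting blocks impose conditions, and these are linear in
  \<open>\<xi>\<close> with coefficients polynomial in \<open>N\<close>.\<close>

lemma ext_cocycles_eq_solutions:
  assumes Q: "fin_digraph Q" and J: "\<forall>x\<in>J. \<forall>u. x (u, []) = 0"
    and N: "N \<in> Rep_complete Q J e"
  shows "ext_cocycles Q J d 0 e N =
    {\<xi> \<in> supp_on {(a, r, c). a \<in> arcs Q \<and> r < e (head Q a) \<and> c < d (tail Q a)}.
      \<forall>(x, u, v, r, c) \<in> {(x, u, v, r, c). x \<in> J \<and> r < e v}.
        (\<Sum>p | pre_digraph.awalk Q u p v \<and> length p \<le> (\<Sum>i\<in>verts Q. e i).
           x (u, p) * connecting_block Q e N \<xi> p r c) = 0}"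
proof -
  interpret fin_digraph Q by fact
  let ?D = "\<Sum>i\<in>verts Q. e i"
  have Nr: "N \<in> rep_space Q e e" and Nn: "nilpotent_rep Q e N" and Na: "annihilates Q e J N"
    using N unfolding Rep_complete_def by auto
  have N0: "path_matrix Q e N u p = 0" if "awalk u p v" "?D \<le> length p" for u p v
    by (rule nilpotent_bound[OF Q Nn that Nr])
  \<comment> \<open>The first arrow is spent on \<open>\<xi>\<close>, so the remaining path is one
    shorter; this is why the length bound is strict here.\<close>
  have blk0: "connecting_block Q e N \<xi> p r c = 0" if "awalk u p v" "?D < length p" for \<xi> u p v r c
  proof (cases p)
    case (Cons a q)
    then have "awalk (head Q a) q v" "?D \<le> length q" using that by (auto simp: awalk_Cons_iff)
    then show ?thesis using N0 Cons by (simp add: connecting_block_def)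
  qed (use that in auto)
  have "extension_rep Q 0 e N \<xi> \<in> Rep_complete Q J (e + d) \<longleftrightarrow>
     (\<forall>x u v r c. x \<in> J \<longrightarrow> r < e v \<longrightarrow>
        (\<Sum>p | awalk u p v \<and> length p \<le> ?D. x (u, p) * connecting_block Q e N \<xi> p r c) = 0)"
    (is "?L \<longleftrightarrow> ?R")
    if \<xi>: "\<xi> \<in> rep_space Q d e" for \<xi>
  proof -
    let ?E = "extension_rep Q 0 e N \<xi>"
    have Er: "?E \<in> rep_space Q (e + d) (e + d)"
      unfolding rep_space_def
    proof (clarify, goal_cases)
      case (1 a r c)
      have "r < e (head Q a)" using 1 by (auto simp: extension_rep_def split: if_splits)
      moreover have "N (a, r, c) \<noteq> 0 \<or> c \<ge> e (tail Q a) \<and> \<xi> (a, r, c - e (tail Q a)) \<noteq> 0"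
        using 1 by (auto simp: extension_rep_def split: if_splits)
      moreover have "N (a, r, c) \<noteq> 0 \<Longrightarrow> a \<in> arcs Q \<and> c < e (tail Q a)"
        using Nr unfolding rep_space_def by blast
      moreover have "\<xi> (a, r, c') \<noteq> 0 \<Longrightarrow> a \<in> arcs Q \<and> c' < d (tail Q a)" for c'
        using \<xi> unfolding rep_space_def by blast
      ultimately show ?case by fastforce
    qed
    have E0: "path_matrix Q (e + d) ?E u p = 0" if w: "awalk u p v" "?D < length p" for u p v
    proof -
      have "p \<noteq> []" using w(2) by auto
      moreover have "path_matrix Q e N u p = 0" using w by (intro N0) auto
      ultimately have "path_matrix Q (e + d) ?E u p r c = 0" for r c
        unfolding path_matrix_extension[OF Q w(1) \<open>p \<noteq> []\<close>] using blk0[OF w] by simp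
      then show ?thesis by (intro ext) simp
    qed
    then have En: "nilpotent_rep Q (e + d) ?E"
      unfolding nilpotent_rep_def by (intro exI[of _ "Suc ?D"]) auto
    have act: "rep_act Q (e + d) ?E x u v r c = (if r < e v \<and> c \<ge> e u then
        (\<Sum>p | awalk u p v \<and> length p \<le> ?D. x (u, p) * connecting_block Q e N \<xi> p r (c - e u)) else 0)"
      if x: "x \<in> J" for x u v r c
    proof -
      have "rep_act Q (e + d) ?E x u v r c =
          (\<Sum>p | awalk u p v \<and> length p \<le> ?D. x (u, p) * path_matrix Q (e + d) ?E u p r c)"
        by (rule rep_act_bounded[OF Q]) (rule E0)
      also have "\<dots> = (\<Sum>p | awalk u p v \<and> length p \<le> ?D. x (u, p) *
          (if r < e v then if c < e u then path_matrix Q e N u p r c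
            else connecting_block Q e N \<xi> p r (c - e u) else 0))"
      proof (rule sum.cong[OF refl])
        fix p assume "p \<in> {p. awalk u p v \<and> length p \<le> ?D}"
        then have w: "awalk u p v" by blast
        show "x (u, p) * path_matrix Q (e + d) ?E u p r c = x (u, p) *
          (if r < e v then if c < e u then path_matrix Q e N u p r c
            else connecting_block Q e N \<xi> p r (c - e u) else 0)"
        \<comment> \<open>The formula for path matrices of the extension fails for the trivial path,
          but elements of \<open>J\<close> have coefficient zero there.\<close>
        proof (cases "p = []")
          case False
          show ?thesis unfolding path_matrix_extension[OF Q _ False, of u v, OF w] by (rule refl)
        qed (use J x in simp)
      qed
      also have "\<dots> = (if r < e v then if c < e u
          then (\<Sum>p | awalk u p v \<and> length p \<le> ?D. x (u, p) * path_matrix Q e N u p r c)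
          else (\<Sum>p | awalk u p v \<and> length p \<le> ?D. x (u, p) * connecting_block Q e N \<xi> p r (c - e u)) else 0)"
        by simp
      also have "(\<Sum>p | awalk u p v \<and> length p \<le> ?D. x (u, p) * path_matrix Q e N u p r c) =
          rep_act Q e N x u v r c"
        by (rule rep_act_bounded[symmetric, OF Q]) (rule N0, auto)
      also have "\<dots> = 0" using Na x unfolding annihilates_def by blast
      finally have "rep_act Q (e + d) ?E x u v r c = (if r < e v then if c < e u then 0
          else (\<Sum>p | awalk u p v \<and> length p \<le> ?D. x (u, p) * connecting_block Q e N \<xi> p r (c - e u)) else 0)" .
      then show ?thesis by (rule trans) auto
    qed
    have "?L \<longleftrightarrow> annihilates Q (e + d) J ?E" using Er En by (simp add: Rep_complete_def)
    also have "\<dots> \<longleftrightarrow> ?R"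
    proof
      assume an: "annihilates Q (e + d) J ?E"
      show ?R
      proof (intro allI impI)
        fix x u v r c assume x: "x \<in> J" "r < e v"
        \<comment> \<open>Column \<open>e u + c\<close> of the extension is column \<open>c\<close>
          of the part coming from the quotient.\<close>
        have "rep_act Q (e + d) ?E x u v r (e u + c) = 0" using an x(1) unfolding annihilates_def by blast
        then show "(\<Sum>p | awalk u p v \<and> length p \<le> ?D. x (u, p) * connecting_block Q e N \<xi> p r c) = 0"
          unfolding act[OF x(1)] using x(2) by simp
      qed
    next
      assume ?R
      then show "annihilates Q (e + d) J ?E" unfolding annihilates_def by (simp add: act)
    qed
    finally show ?thesis .
  qed
  then show ?thesis unfolding ext_cocycles_def rep_space_eq_supp_on by auto
qed

lemma usc_dim_ext_cocycles:
  assumes Q: "fin_digraph Q" and J: "\<forall>x\<in>J. \<forall>u. x (u, []) = 0"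
    and reg: "\<And>k. regular_on C X (\<lambda>x. N x k)" and N: "\<And>x. x \<in> X \<Longrightarrow> N x \<in> Rep_complete Q J e"
  shows "usc_on C X (\<lambda>x. int (cdim (ext_cocycles Q J d 0 e (N x))))"
proof -
  interpret fin_digraph Q by fact
  let ?K = "{(a, r, c). a \<in> arcs Q \<and> r < e (head Q a) \<and> c < d (tail Q a)}"
  let ?F = "\<lambda>x (y, u, v, r, c) \<xi>. (\<Sum>p | awalk u p v \<and> length p \<le> (\<Sum>i\<in>verts Q. e i).
           y (u, p) * connecting_block Q e (N x) \<xi> p r c)"
  let ?R = "{(x, u, v, r, c). x \<in> J \<and> r < e v}"
  have "usc_on C X (\<lambda>x. int (cdim {\<xi> \<in> supp_on ?K. \<forall>j\<in>?R. ?F x j \<xi> = 0}))"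
  proof (rule usc_dim_solutions)
    show "finite ?K" by (rule finite_index_triples) simp
    have lin: "connecting_block Q e M (\<xi> + \<eta>) p r c = connecting_block Q e M \<xi> p r c + connecting_block Q e M \<eta> p r c"
      "connecting_block Q e M (cscale z \<xi>) p r c = z * connecting_block Q e M \<xi> p r c" for M \<xi> \<eta> p r c z
      by (auto simp: connecting_block_def cscale_apply algebra_simps sum.distrib sum_distrib_left split: list.split)
    show "lin_on cscale (*) (supp_on ?K) (?F x j)" for x j
      by (cases j, rule lin_onI) (auto simp: lin algebra_simps sum.distrib sum_distrib_left)
    show "regular_on C X (\<lambda>x. ?F x j \<xi>)" for j \<xi>
    proof -
      have "regular_on C X (\<lambda>x. connecting_block Q e (N x) \<xi> p r c)" for p r c
        by (cases p) (auto simp: connecting_block_def intro!: regular_sum regular_mult regular_path_matrix reg)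
      then show ?thesis by (cases j) (auto intro!: regular_sum regular_mult)
    qed
  qed
  moreover have "ext_cocycles Q J d 0 e (N x) = {\<xi> \<in> supp_on ?K. \<forall>j\<in>?R. ?F x j \<xi> = 0}" if "x \<in> X" for x
    unfolding ext_cocycles_eq_solutions[where Q=Q and J=J and N="N x" and e=e, OF Q J N[OF that]]
    by (intro Collect_cong conj_cong refl ball_cong) auto
  ultimately show ?thesis by (subst usc_cong) auto
qed

lemma g_vector_eq:
  assumes "fin_digraph Q" "i \<in> verts Q"
  shows "g_vector Q J e (N, w) i =
    int (cdim (ext_cocycles Q J (simple_dim i) 0 e N)) - int (e i) + int (w i)"
proof -
  interpret fin_digraph Q by fact
  let ?V = "vertex_maps Q (simple_dim i) e"
  let ?K = "{(j, r, c). j \<in> verts Q \<and> r < e j \<and> c < simple_dim i j}"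
  have fK: "finite ?K" by (rule finite_index_triples) simp
  have "?K = (\<lambda>r. (i, r, 0)) ` {..<e i}"
    using assms(2) by (auto simp: simple_dim_def split: if_splits)
  moreover have "inj_on (\<lambda>r. (i, r, 0 :: nat)) {..<e i}" by (auto simp: inj_on_def)
  ultimately have cK: "card ?K = e i" by (simp add: card_image)
  have "cdim ?V = cdim (commutator Q (simple_dim i) 0 e N ` ?V) +
      cdim {f \<in> ?V. commutator Q (simple_dim i) 0 e N f = 0}"
    unfolding vertex_maps_eq_supp_on
    by (rule rank_nullity[OF vector_space_cscale vector_space_cscale supp_on_finite(1)[OF fK] lin_on_commutator])
  moreover have "cdim ?V = e i"
    unfolding vertex_maps_eq_supp_on supp_on_finite(2)[OF fK] by (rule cK)
  ultimately have "e i = cdim (ext_coboundaries Q (simple_dim i) 0 e N) + cdim (rep_hom Q (simple_dim i) 0 e N)"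
    by (simp only: ext_coboundaries_def rep_hom_def)
  then show ?thesis by (simp add: g_vector_def ext1_dim_def)
qed

text \<open>Two families \<open>M\<close> and \<open>N\<close> over one variety \<open>X\<close>
  cover both the product and the diagonal. In the dot product the entries of \<open>d\<close> are
  nonnegative constants, and within the g-vector only the dimension of the cocycle space
  varies.\<close>

lemma usc_E_invariant:
  assumes Q: "fin_digraph Q" "{1..n} \<subseteq> verts Q"
    and J: "J \<subseteq> ideal_power Q (complete_path_algebra Q) (arrow_ideal (complete_path_algebra Q)) 2"
    and M: "\<And>k. regular_on C X (\<lambda>x. M x k)"
    and N: "\<And>k. regular_on C X (\<lambda>x. N x k)" "\<And>x. x \<in> X \<Longrightarrow> N x \<in> Rep_complete Q J e"
    and w: "\<And>x. x \<in> X \<Longrightarrow> w x = w0"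
  shows "usc_on C X (\<lambda>x. E_invariant n Q J d (M x, v x) e (N x, w x))"
proof -
  have J': "\<forall>x\<in>J. \<forall>u. x (u, []) = 0"
    using J by (auto intro!: arrow_square_no_trivial)
  let ?f = "\<lambda>x. int (cdim (rep_hom Q d (M x) e (N x))) + (\<Sum>i = 1..n. int (d i) *
     (int (cdim (ext_cocycles Q J (simple_dim i) 0 e (N x))) + (- int (e i) + int (w0 i))))"
  have "usc_on C X ?f"
    by (intro usc_add usc_sum usc_nat_mult usc_const usc_dim_rep_hom[OF Q(1) M N(1)]
        usc_dim_ext_cocycles[OF Q(1) J' N(1,2)])
  moreover have "E_invariant n Q J d (M x, v x) e (N x, w x) = ?f x" if "x \<in> X" for x
  proof -
    have "g_vector Q J e (N x, w x) i =
        int (cdim (ext_cocycles Q J (simple_dim i) 0 e (N x))) + (- int (e i) + int (w0 i))"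
      if "i \<in> {1..n}" for i
    proof -
      have "i \<in> verts Q" using that Q(2) by (rule rev_subsetD)
      from g_vector_eq[OF Q(1) this] show ?thesis using w[OF \<open>x \<in> X\<close>] by simp
    qed
    then show ?thesis unfolding E_invariant_def by simp
  qed
  ultimately show ?thesis by (subst usc_cong) auto
qed

section \<open>Modules over finite-dimensional algebras\<close>

definition pointwise_scale :: "(complex \<Rightarrow> 'w \<Rightarrow> 'w) \<Rightarrow> complex \<Rightarrow> ('k \<Rightarrow> 'w) \<Rightarrow> 'k \<Rightarrow> 'w" where
  "pointwise_scale t = (\<lambda>c f x. t c (f x))"

lemma vector_space_pointwise_scale:
  assumes "vector_space t" shows "vector_space (pointwise_scale t :: complex \<Rightarrow> ('k \<Rightarrow> 'w::ab_group_add) \<Rightarrow> _)"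
proof -
  interpret vector_space t by fact
  show ?thesis
    by standard (auto simp: pointwise_scale_def fun_eq_iff scale_right_distrib scale_left_distrib)
qed

lemma dim_zero_space: assumes "vector_space s" shows "vector_space.dim s {0} = 0"
proof -
  interpret vector_space s by fact
  have "span {} = span {0}" by simp
  from dim_eq_card[OF this independent_empty] show ?thesis by simp
qed

lemma fd_zero_space: assumes "vector_space s" shows "fd_subspace s {0}"
proof -
  interpret vector_space s by fact
  show ?thesis unfolding fd_subspace_def by (rule exI[of _ "{}"]) simp
qed

definition fun_space :: "'k set \<Rightarrow> ('k \<Rightarrow> 'w::zero set) \<Rightarrow> ('k \<Rightarrow> 'w) set" where
  "fun_space K S = {g. (\<forall>k\<in>K. g k \<in> S k) \<and> (\<forall>k. k \<notin> K \<longrightarrow> g k = 0)}"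

text \<open>Induction on \<open>K\<close>: evaluation at the new index \<open>k\<close> maps onto
  \<open>S k\<close>, and its kernel is the space for the smaller index set.\<close>

lemma fun_space_finite:
  fixes K :: "'k set" and S :: "'k \<Rightarrow> 'w::ab_group_add set"
  assumes t: "vector_space t" and K: "finite K" and S: "\<And>k. k \<in> K \<Longrightarrow> fd_subspace t (S k)"
  shows "fd_subspace (pointwise_scale t) (fun_space K S) \<and>
    vector_space.dim (pointwise_scale t) (fun_space K S) = (\<Sum>k\<in>K. vector_space.dim t (S k))"
  using K S
proof (induction K)
  interpret p: vector_space "pointwise_scale t :: complex \<Rightarrow> ('k \<Rightarrow> 'w) \<Rightarrow> 'k \<Rightarrow> 'w"
    by (rule vector_space_pointwise_scale[OF t])
  case empty
  have "fun_space {} S = {0}" by (auto simp: fun_space_def)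
  then show ?case
    using dim_zero_space[OF p.vector_space_axioms] fd_zero_space[OF p.vector_space_axioms] by simp
next
  interpret t: vector_space t by (rule t)
  interpret p: vector_space "pointwise_scale t :: complex \<Rightarrow> ('k \<Rightarrow> 'w) \<Rightarrow> 'k \<Rightarrow> 'w"
    by (rule vector_space_pointwise_scale[OF t])
  case (insert k K)
  let ?P = "pointwise_scale t"
  let ?s = "\<lambda>x j. if j = k then x else 0"
  have lin: "Vector_Spaces.linear t ?P ?s"
    unfolding Vector_Spaces.linear_iff
    using t.vector_space_axioms p.vector_space_axioms
    by (auto simp: pointwise_scale_def fun_eq_iff)
  interpret s: Vector_Spaces.linear t ?P ?s by (rule lin)
  obtain B where B: "finite B" "fun_space K S = p.span B"
    using insert unfolding fd_subspace_def by auto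
  obtain D where D: "finite D" "S k = t.span D"
    using insert.prems[of k] unfolding fd_subspace_def by auto
  have sk: "t.subspace (S k)" using D(2) by simp
  have "fun_space (insert k K) S = p.span (B \<union> ?s ` D)"
  proof -
    have "p.span (B \<union> ?s ` D) = {x + y | x y. x \<in> fun_space K S \<and> y \<in> ?s ` S k}"
      unfolding p.span_Un s.span_image B(2) D(2) ..
    also have "\<dots> = fun_space (insert k K) S"
    proof (intro equalityI subsetI)
      fix g assume "g \<in> {x + y | x y. x \<in> fun_space K S \<and> y \<in> ?s ` S k}"
      then show "g \<in> fun_space (insert k K) S"
        using insert.hyps(2) by (auto simp: fun_space_def)
    next
      fix g assume g: "g \<in> fun_space (insert k K) S"
      have "g = g(k := 0) + ?s (g k)" by (auto simp: fun_eq_iff)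
      moreover have "g(k := 0) \<in> fun_space K S" using g insert.hyps(2) by (auto simp: fun_space_def)
      moreover have "?s (g k) \<in> ?s ` S k" using g by (auto simp: fun_space_def)
      ultimately show "g \<in> {x + y | x y. x \<in> fun_space K S \<and> y \<in> ?s ` S k}" by blast
    qed
    finally show ?thesis by simp
  qed
  then have fd: "fd_subspace ?P (fun_space (insert k K) S)"
    unfolding fd_subspace_def using B(1) D(1) by (intro exI[of _ "B \<union> ?s ` D"]) simp
  have "p.dim (fun_space (insert k K) S) =
      t.dim ((\<lambda>g. g k) ` fun_space (insert k K) S) + p.dim {g \<in> fun_space (insert k K) S. g k = 0}"
    by (rule rank_nullity[OF p.vector_space_axioms t fd]) (rule lin_onI, auto simp: pointwise_scale_def)
  also have "(\<lambda>g. g k) ` fun_space (insert k K) S = S k"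
  proof (intro equalityI subsetI)
    fix x assume x: "x \<in> S k"
    have "?s x \<in> fun_space (insert k K) S"
    proof -
      have "0 \<in> S j" if "j \<in> K" for j
        using subspace_fd[OF t insert.prems[of j]] that t.subspace_0 by auto
      then show ?thesis using x by (auto simp: fun_space_def)
    qed
    then have "(\<lambda>g. g k) (?s x) \<in> (\<lambda>g. g k) ` fun_space (insert k K) S" by (rule imageI)
    then show "x \<in> (\<lambda>g. g k) ` fun_space (insert k K) S" by simp
  qed (auto simp: fun_space_def)
  also have "{g \<in> fun_space (insert k K) S. g k = 0} = fun_space K S"
    using insert.hyps(2) t.subspace_0[OF sk] by (auto simp: fun_space_def)
  finally show ?case using fd insert by simp
qed

text \<open>Needed to read off the coefficient of an idempotent modulo \<open>r\<close>, and to
  build a maximal submodule that avoids a given element outside the radical.\<close>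

lemma separating_functional:
  assumes s: "vector_space s" and U: "module.subspace s U" and z: "z \<notin> U"
  obtains l :: "'v::ab_group_add \<Rightarrow> complex" where "Vector_Spaces.linear s (*) l" "\<forall>u\<in>U. l u = 0" "l z = 1"
proof -
  interpret vector_space_pair s "(*) :: complex \<Rightarrow> complex \<Rightarrow> complex"
    using s vector_space_times by (simp add: vector_space_pair_def)
  obtain B where B: "B \<subseteq> U" "vs1.independent B" "U \<subseteq> vs1.span B"
    by (rule vs1.basis_exists[of U])
  have spB: "vs1.span B = U" using B U by (intro vs1.span_subspace)
  have i: "vs1.independent (insert z B)" using B(2) z spB by (intro vs1.independent_insertI) auto
  obtain l where l: "Vector_Spaces.linear s (*) l" "\<forall>x\<in>insert z B. l x = (if x = z then 1 else 0)"
    using linear_independent_extend[OF i, of "\<lambda>x. if x = z then 1 else 0"] by auto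
  interpret l: Vector_Spaces.linear s "(*)" l by (rule l)
  have "l u = 0" if "u \<in> U" for u
    by (rule l.eq_0_on_span[of B]) (use l(2) z B(1) that spB in auto)
  then show ?thesis using that l by auto
qed

text \<open>A model of the dual of \<open>S / U\<close> without the quotient. The value zero outside
  \<open>S\<close> makes each functional a unique function.\<close>

definition functionals :: "(complex \<Rightarrow> 'v \<Rightarrow> 'v) \<Rightarrow> 'v::ab_group_add set \<Rightarrow> 'v set \<Rightarrow> ('v \<Rightarrow> complex) set" where
  "functionals s S U = {\<phi>. lin_on s (*) S \<phi> \<and> (\<forall>x. x \<notin> S \<longrightarrow> \<phi> x = 0) \<and> (\<forall>u\<in>U. \<phi> u = 0)}"

text \<open>If \<open>C\<close> completes a basis of \<open>U\<close> to one of \<open>S\<close>, a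
  functional vanishing on \<open>U\<close> is determined by its values on \<open>C\<close>, and
  these are arbitrary.\<close>

lemma dim_functionals:
  assumes s: "vector_space s" and S: "fd_subspace s S" and U: "module.subspace s U" "U \<subseteq> S"
  shows "cdim (functionals s S U) + vector_space.dim s U = vector_space.dim s S"
    and "fd_subspace cscale (functionals s S U)"
proof -
  interpret vector_space_pair s "(*) :: complex \<Rightarrow> complex \<Rightarrow> complex"
    using s vector_space_times by (simp add: vector_space_pair_def)
  have subS: "vs1.subspace S" by (rule subspace_fd[OF s S])
  obtain B C where B: "finite B" "finite C" "B \<inter> C = {}" "vs1.independent (B \<union> C)"
    "vs1.span B = U" "vs1.span (B \<union> C) = S" "card B = vs1.dim U" "card B + card C = vs1.dim S"
    by (rule fd_basis_pair[OF s S U])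
  have BC: "B \<subseteq> U" "C \<subseteq> S" using B(5,6) vs1.span_superset[of B] vs1.span_superset[of "B \<union> C"] by auto
  let ?F = "functionals s S U"
  let ?r = "\<lambda>\<phi> x. if x \<in> C then \<phi> x else 0"
  have F: "cf.subspace ?F"
    by (rule cf.subspaceI) (auto simp: functionals_def lin_on_def cscale_apply algebra_simps)
  have lin: "lin_on cscale cscale ?F ?r"
    by (rule lin_onI) (auto simp: cscale_apply fun_eq_iff)
  have ext: "\<exists>\<phi>\<in>?F. ?r \<phi> = f" if f: "f \<in> supp_on C" for f
  proof -
    obtain l where l: "Vector_Spaces.linear s (*) l" "\<forall>x\<in>B \<union> C. l x = f x"
      using linear_independent_extend[OF B(4), of f] by auto
    interpret l: Vector_Spaces.linear s "(*)" l by (rule l)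
    let ?\<phi> = "\<lambda>x. if x \<in> S then l x else 0"
    have "l u = 0" if "u \<in> U" for u
      by (rule l.eq_0_on_span[of B]) (use l(2) f B(3,5) that in \<open>auto simp: supp_on_def\<close>)
    then have "?\<phi> \<in> ?F"
      using U(2) by (auto simp: functionals_def lin_on_def l.add l.scale vs1.subspace_add[OF subS] vs1.subspace_scale[OF subS])
    moreover have "?r ?\<phi> = f" using l(2) f BC by (auto simp: fun_eq_iff supp_on_def)
    ultimately show ?thesis by (intro bexI[of _ ?\<phi>])
  qed
  have inj: "\<phi> = \<psi>" if p: "\<phi> \<in> ?F" "\<psi> \<in> ?F" "?r \<phi> = ?r \<psi>" for \<phi> \<psi>
  proof
    fix x
    show "\<phi> x = \<psi> x"
    proof (cases "x \<in> S")
      case True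
      let ?E = "{x \<in> S. \<phi> x = \<psi> x}"
      have z: "\<phi> 0 = 0" "\<psi> 0 = 0"
        using p vs1.subspace_0[OF U(1)] by (auto simp: functionals_def)
      have "vs1.subspace ?E"
        using p z by (intro vs1.subspaceI)
          (auto simp: functionals_def lin_on_def vs1.subspace_add[OF subS] vs1.subspace_scale[OF subS] vs1.subspace_0[OF subS])
      moreover have "B \<union> C \<subseteq> ?E"
      proof
        fix y assume "y \<in> B \<union> C"
        then show "y \<in> ?E"
        proof
          assume "y \<in> C"
          then show ?thesis using fun_cong[OF p(3), of y] BC by auto
        qed (use p BC U in \<open>auto simp: functionals_def\<close>)
      qed
      ultimately have "vs1.span (B \<union> C) \<subseteq> ?E" by (intro vs1.span_minimal)
      then show ?thesis using True B(6) by auto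
    qed (use p in \<open>auto simp: functionals_def\<close>)
  qed
  have injr: "inj_on ?r ?F" by (rule inj_onI) (rule inj)
  have img: "?r ` ?F = supp_on C" using ext by (auto simp: supp_on_def image_iff) 
  have "cdim ?F = cdim (supp_on C)"
    using dim_inj_lin_on[OF vector_space_cscale vector_space_cscale F lin injr] img by simp
  then show "cdim ?F + vs1.dim U = vs1.dim S" using B supp_on_finite(2)[OF B(2)] by simp
  show "fd_subspace cscale ?F"
    by (rule fd_inj[OF vector_space_cscale vector_space_cscale F lin injr supp_on_finite(1)[OF B(2)]])
       (simp add: img)
qed

section \<open>Elementary properties of modules and homomorphisms\<close>

lemma amodule_vector_space: "amodule smul mu M \<Longrightarrow> vector_space (scal M)"
  and amodule_fd: "amodule smul mu M \<Longrightarrow> fd_subspace (scal M) (carr M)"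
  and amodule_closed: "amodule smul mu M \<Longrightarrow> x \<in> carr M \<Longrightarrow> act M a x \<in> carr M"
  and amodule_add: "amodule smul mu M \<Longrightarrow> x \<in> carr M \<Longrightarrow> y \<in> carr M \<Longrightarrow> act M a (x + y) = act M a x + act M a y"
  and amodule_add_alg: "amodule smul mu M \<Longrightarrow> x \<in> carr M \<Longrightarrow> act M (a + b) x = act M a x + act M b x"
  and amodule_scale_alg: "amodule smul mu M \<Longrightarrow> x \<in> carr M \<Longrightarrow> act M (smul c a) x = scal M c (act M a x)"
  and amodule_scale: "amodule smul mu M \<Longrightarrow> x \<in> carr M \<Longrightarrow> act M a (scal M c x) = scal M c (act M a x)"
  and amodule_mult: "amodule smul mu M \<Longrightarrow> x \<in> carr M \<Longrightarrow> act M (mu a b) x = act M a (act M b x)"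
  and amodule_one: "amodule smul mu M \<Longrightarrow> x \<in> carr M \<Longrightarrow> act M 1 x = x"
  unfolding amodule_def fd_subspace_def by blast+

lemma amoduleI:
  assumes "vector_space (scal M)" "fd_subspace (scal M) (carr M)"
    "\<And>a x. x \<in> carr M \<Longrightarrow> act M a x \<in> carr M"
    "\<And>a x y. x \<in> carr M \<Longrightarrow> y \<in> carr M \<Longrightarrow> act M a (x + y) = act M a x + act M a y"
    "\<And>a b x. x \<in> carr M \<Longrightarrow> act M (a + b) x = act M a x + act M b x"
    "\<And>a c x. x \<in> carr M \<Longrightarrow> act M (smul c a) x = scal M c (act M a x)"
    "\<And>a c x. x \<in> carr M \<Longrightarrow> act M a (scal M c x) = scal M c (act M a x)"
    "\<And>a b x. x \<in> carr M \<Longrightarrow> act M (mu a b) x = act M a (act M b x)"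
    "\<And>x. x \<in> carr M \<Longrightarrow> act M 1 x = x"
  shows "amodule smul mu M"
  using assms unfolding amodule_def fd_subspace_def by simp

lemma amodule_subspace: "amodule smul mu M \<Longrightarrow> module.subspace (scal M) (carr M)"
  by (rule subspace_fd[OF amodule_vector_space amodule_fd])

lemma amodule_lin_on: "amodule smul mu M \<Longrightarrow> lin_on (scal M) (scal M) (carr M) (act M a)"
  by (rule lin_onI) (simp_all add: amodule_add amodule_scale)

lemma subspace_sum_closed:
  assumes "vector_space s" "module.subspace s S" "\<And>k. k \<in> K \<Longrightarrow> f k \<in> S" shows "(\<Sum>k\<in>K. f k) \<in> S"
proof -
  interpret vector_space s by fact
  show ?thesis using subspace_sum[OF assms(2,3)] .
qed

lemma vs_subspaceD:
  assumes "vector_space s" "module.subspace s S"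
  shows "0 \<in> S" "x \<in> S \<Longrightarrow> y \<in> S \<Longrightarrow> x + y \<in> S" "x \<in> S \<Longrightarrow> y \<in> S \<Longrightarrow> x - y \<in> S" "x \<in> S \<Longrightarrow> s c x \<in> S"
    "x \<in> S \<Longrightarrow> - x \<in> S"
proof -
  interpret vector_space s by fact
  show "0 \<in> S" "x \<in> S \<Longrightarrow> y \<in> S \<Longrightarrow> x + y \<in> S" "x \<in> S \<Longrightarrow> y \<in> S \<Longrightarrow> x - y \<in> S" "x \<in> S \<Longrightarrow> s c x \<in> S"
    "x \<in> S \<Longrightarrow> - x \<in> S"
    using assms(2) by (auto simp: subspace_0 subspace_add subspace_diff subspace_scale subspace_neg)
qed

lemma lin_on_props:
  assumes "vector_space s" "vector_space t" "module.subspace s S" "lin_on s t S f"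
  shows "f 0 = 0" "x \<in> S \<Longrightarrow> y \<in> S \<Longrightarrow> f (x + y) = f x + f y" "x \<in> S \<Longrightarrow> f (s c x) = t c (f x)"
    "x \<in> S \<Longrightarrow> y \<in> S \<Longrightarrow> f (x - y) = f x - f y" "(\<And>k. k \<in> K \<Longrightarrow> v k \<in> S) \<Longrightarrow> f (\<Sum>k\<in>K. v k) = (\<Sum>k\<in>K. f (v k))"
proof -
  obtain g where g: "Vector_Spaces.linear s t g" "\<And>x. x \<in> S \<Longrightarrow> g x = f x"
    by (rule lin_on_linear[OF assms]) (rule that)
  interpret g: Vector_Spaces.linear s t g by (rule g)
  note S = vs_subspaceD[OF assms(1,3)]
  show "f 0 = 0" using g.zero g(2)[OF S(1)] by simp
  show "f (x + y) = f x + f y" if "x \<in> S" "y \<in> S"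
    using g.add[of x y] g(2)[OF S(2)[OF that]] that g(2) by simp
  show "f (s c x) = t c (f x)" if "x \<in> S"
    using g.scale[of c x] g(2)[OF S(4)[OF that]] that g(2) by simp
  show "f (x - y) = f x - f y" if "x \<in> S" "y \<in> S"
    using g.diff[of x y] g(2)[OF S(3)[OF that]] that g(2) by simp
  show "f (\<Sum>k\<in>K. v k) = (\<Sum>k\<in>K. f (v k))" if "\<And>k. k \<in> K \<Longrightarrow> v k \<in> S"
  proof -
    have "f (\<Sum>k\<in>K. v k) = g (\<Sum>k\<in>K. v k)"
      by (rule g(2)[symmetric]) (rule subspace_sum_closed[OF assms(1,3) that])
    also have "\<dots> = (\<Sum>k\<in>K. g (v k))" by (rule g.sum)
    also have "\<dots> = (\<Sum>k\<in>K. f (v k))" by (rule sum.cong[OF refl]) (rule g(2)[OF that])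
    finally show ?thesis .
  qed
qed

lemma amod_homD:
  assumes "f \<in> amod_hom M N"
  shows "x \<in> carr M \<Longrightarrow> f x \<in> carr N" "lin_on (scal M) (scal N) (carr M) f"
    "x \<in> carr M \<Longrightarrow> f (act M a x) = act N a (f x)" "x \<notin> carr M \<Longrightarrow> f x = 0"
  using assms unfolding amod_hom_def lin_on_def by auto

lemma amod_homI:
  assumes "\<And>x. x \<in> carr M \<Longrightarrow> f x \<in> carr N"
    "\<And>x y. x \<in> carr M \<Longrightarrow> y \<in> carr M \<Longrightarrow> f (x + y) = f x + f y"
    "\<And>c x. x \<in> carr M \<Longrightarrow> f (scal M c x) = scal N c (f x)"
    "\<And>a x. x \<in> carr M \<Longrightarrow> f (act M a x) = act N a (f x)" "\<And>x. x \<notin> carr M \<Longrightarrow> f x = 0"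
  shows "f \<in> amod_hom M N"
  using assms unfolding amod_hom_def by auto

lemma amod_hom_sum:
  assumes "amodule smul mu M" "amodule smul' mu' N" "f \<in> amod_hom M N" "\<And>k. k \<in> K \<Longrightarrow> v k \<in> carr M"
  shows "f (\<Sum>k\<in>K. v k) = (\<Sum>k\<in>K. f (v k))"
  by (rule lin_on_props(5)[OF amodule_vector_space[OF assms(1)] amodule_vector_space[OF assms(2)]
     amodule_subspace[OF assms(1)] amod_homD(2)[OF assms(3)]]) (rule assms(4))

lemma amod_hom_zero:
  assumes "amodule smul mu M" "amodule smul' mu' N" "f \<in> amod_hom M N" shows "f 0 = 0"
  by (rule lin_on_props(1)[OF amodule_vector_space[OF assms(1)] amodule_vector_space[OF assms(2)]
     amodule_subspace[OF assms(1)] amod_homD(2)[OF assms(3)]])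

lemma act_sum:
  assumes "amodule smul mu M" "\<And>k. k \<in> K \<Longrightarrow> v k \<in> carr M"
  shows "act M a (\<Sum>k\<in>K. v k) = (\<Sum>k\<in>K. act M a (v k))"
  by (rule lin_on_props(5)[OF amodule_vector_space[OF assms(1)] amodule_vector_space[OF assms(1)]
     amodule_subspace[OF assms(1)] amodule_lin_on[OF assms(1)]]) (rule assms(2))

lemma act_zero:
  assumes "amodule smul mu M" shows "act M a 0 = 0"
  by (rule lin_on_props(1)[OF amodule_vector_space[OF assms(1)] amodule_vector_space[OF assms(1)]
     amodule_subspace[OF assms(1)] amodule_lin_on[OF assms(1)]])

lemma act_diff:
  assumes "amodule smul mu M" "x \<in> carr M" "y \<in> carr M" shows "act M a (x - y) = act M a x - act M a y"
  by (rule lin_on_props(4)[OF amodule_vector_space[OF assms(1)] amodule_vector_space[OF assms(1)]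
     amodule_subspace[OF assms(1)] amodule_lin_on[OF assms(1)]]) fact+

lemma amod_hom_dim_eq: "amod_hom_dim M N = vector_space.dim (pointwise_scale (scal N)) (amod_hom M N)"
  by (simp add: amod_hom_dim_def pointwise_scale_def)

text \<open>Restriction to a finite spanning set \<open>B\<close> of the source embeds the
  homomorphisms into a finite product of copies of \<open>carr N\<close>.\<close>

lemma amod_hom_fd:
  assumes M: "amodule smul mu M" and N: "amodule smul' mu' N"
  shows "fd_subspace (pointwise_scale (scal N)) (amod_hom M N)"
proof -
  interpret vector_space_pair "scal M" "scal N"
    using assms by (simp add: vector_space_pair_def amodule_vector_space)
  have vp: "vector_space (pointwise_scale (scal N))"
    by (rule vector_space_pointwise_scale) unfold_locales
  interpret p: vector_space "pointwise_scale (scal N)" by (rule vp)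
  note MD = vs_subspaceD[OF vs1.vector_space_axioms amodule_subspace[OF M]]
  note ND = vs_subspaceD[OF vs2.vector_space_axioms amodule_subspace[OF N]]
  obtain B where B: "finite B" "carr M = vs1.span B"
    using amodule_fd[OF M] unfolding fd_subspace_def by blast
  have BM: "B \<subseteq> carr M" unfolding B(2) by (rule vs1.span_superset)
  let ?r = "\<lambda>f x. if x \<in> B then f x else 0"
  have sub: "p.subspace (amod_hom M N)"
  proof (rule p.subspaceI)
    show "0 \<in> amod_hom M N" using ND act_zero[OF N] by (intro amod_homI) auto
    fix f g assume f: "f \<in> amod_hom M N" and g: "g \<in> amod_hom M N"
    show "f + g \<in> amod_hom M N"
      using f g ND MD amodule_add[OF N] unfolding amod_hom_def
      by (auto simp: algebra_simps vs2.scale_right_distrib image_subset_iff)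
  next
    fix c f assume f: "f \<in> amod_hom M N"
    show "pointwise_scale (scal N) c f \<in> amod_hom M N"
      using f ND MD amodule_scale[OF N] unfolding amod_hom_def pointwise_scale_def
      by (auto simp: algebra_simps vs2.scale_right_distrib image_subset_iff)
  qed
  have lin: "lin_on (pointwise_scale (scal N)) (pointwise_scale (scal N)) (amod_hom M N) ?r"
    by (rule lin_onI) (auto simp: pointwise_scale_def fun_eq_iff)
  have inj: "f = g" if f: "f \<in> amod_hom M N" and g: "g \<in> amod_hom M N" and e: "?r f = ?r g" for f g
  proof
    fix x
    show "f x = g x"
    proof (cases "x \<in> carr M")
      case True
      have "vs1.subspace {x \<in> carr M. f x = g x}"
        using MD lin_on_props[OF vs1.vector_space_axioms vs2.vector_space_axioms amodule_subspace[OF M] amod_homD(2)[OF f]]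
          lin_on_props[OF vs1.vector_space_axioms vs2.vector_space_axioms amodule_subspace[OF M] amod_homD(2)[OF g]]
        by (intro vs1.subspaceI) auto
      moreover have "B \<subseteq> {x \<in> carr M. f x = g x}"
      proof
        fix y assume "y \<in> B" then show "y \<in> {x \<in> carr M. f x = g x}" using fun_cong[OF e, of y] BM by auto
      qed
      ultimately have "vs1.span B \<subseteq> {x \<in> carr M. f x = g x}" by (intro vs1.span_minimal)
      then show ?thesis using True B(2) by auto
    qed (simp add: amod_homD(4)[OF f] amod_homD(4)[OF g])
  qed
  have fds: "fd_subspace (pointwise_scale (scal N)) (fun_space B (\<lambda>_. carr N))"
    using fun_space_finite[OF vs2.vector_space_axioms B(1), of "\<lambda>_. carr N"] amodule_fd[OF N] by blast
  show ?thesis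
  proof (rule fd_inj[OF vp vp sub lin _ fds])
    show "inj_on ?r (amod_hom M N)" by (rule inj_onI) (rule inj)
    show "?r ` amod_hom M N \<subseteq> fun_space B (\<lambda>_. carr N)"
      using BM by (auto simp: fun_space_def amod_homD)
  qed
qed

lemma submodule_amodule:
  assumes M: "amodule smul mu M" and U: "submodule M U" shows "amodule smul mu (M\<lparr>carr := U\<rparr>)"
proof -
  have UM: "x \<in> carr M" if "x \<in> U" for x using U that by (auto simp: submodule_def)
  show ?thesis
    using U fd_subset(1)[OF amodule_vector_space[OF M] amodule_fd[OF M], of U]
      amodule_vector_space[OF M] amodule_add[OF M] amodule_add_alg[OF M] amodule_scale[OF M] amodule_scale_alg[OF M]
      amodule_mult[OF M] amodule_one[OF M]
    by (intro amoduleI) (auto simp: submodule_def UM)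
qed

lemma submodule_hom_kernel:
  assumes M: "amodule smul mu M" and N: "amodule smul' mu' N" and f: "f \<in> amod_hom M N"
  shows "submodule M (hom_kernel M f)"
  unfolding submodule_def hom_kernel_def
  using subspace_image_lin_on(2)[OF amodule_vector_space[OF M] amodule_vector_space[OF N]
      amodule_subspace[OF M] amod_homD(2)[OF f]] amodule_closed[OF M] amod_homD(3)[OF f] act_zero[OF N]
  by auto

lemma submodule_hom_image:
  assumes M: "amodule smul mu M" and N: "amodule smul' mu' N" and f: "f \<in> amod_hom M N" 
  shows "submodule N (f ` carr M)"
  unfolding submodule_def
proof (intro conjI allI ballI)
  show "f ` carr M \<subseteq> carr N" using amod_homD(1)[OF f] by auto
  show "module.subspace (scal N) (f ` carr M)"
    by (rule subspace_image_lin_on(1)[OF amodule_vector_space[OF M] amodule_vector_space[OF N]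
      amodule_subspace[OF M] amod_homD(2)[OF f]])
  fix a y assume "y \<in> f ` carr M"
  then obtain x where x: "x \<in> carr M" "y = f x" by blast
  then show "act N a y \<in> f ` carr M"
    using amod_homD(3)[OF f x(1), of a] amodule_closed[OF M x(1), of a] by (metis imageI)
qed

text \<open>Quotient modules are realised on coordinate spaces, in order to stay within the type
  \<open>nat \<Rightarrow> complex\<close>.\<close>

lemma quotient_module_exists:
  fixes Y :: "('b::ring_1, 'v::ab_group_add) amod"
  assumes Y: "amodule smul mu Y" and U: "submodule Y U"
  obtains T :: "'b fdmod" and q where "amodule smul mu T" "q \<in> amod_hom Y T" "q ` carr Y = carr T"
    "hom_kernel Y q = U"
proof -
  interpret vector_space_pair "scal Y" cscale
    using amodule_vector_space[OF Y] vector_space_cscale by (simp add: vector_space_pair_def)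
  have UY: "vs1.subspace U" "U \<subseteq> carr Y" "\<And>a x. x \<in> U \<Longrightarrow> act Y a x \<in> U"
    using U by (auto simp: submodule_def)
  note YD = vs_subspaceD[OF vs1.vector_space_axioms amodule_subspace[OF Y]]
  obtain B C where B: "finite B" "finite C" "B \<inter> C = {}" "vs1.independent (B \<union> C)"
    "vs1.span B = U" "vs1.span (B \<union> C) = carr Y" "card B = vs1.dim U" "card B + card C = vs1.dim (carr Y)"
    by (rule fd_basis_pair[OF vs1.vector_space_axioms amodule_fd[OF Y] UY(1,2)])
  obtain h where h: "bij_betw h {..<card C} C"
    using ex_bij_betw_nat_finite[OF B(2)] by (auto simp: atLeast0LessThan)
  let ?K = "{..<card C}"
  let ?ind = "\<lambda>c j. if j \<in> ?K \<and> h j = c then 1 else 0 :: complex"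
  \<comment> \<open>In coordinates numbered by \<open>h\<close>, this is the projection to the
    quotient: it kills the basis \<open>B\<close> of \<open>U\<close> and sends \<open>C\<close> to
    the standard basis.\<close>
  obtain g where g: "Vector_Spaces.linear (scal Y) cscale g" "\<forall>x\<in>B \<union> C. g x = (if x \<in> C then ?ind x else 0)"
    using linear_independent_extend[OF B(4), of "\<lambda>x. if x \<in> C then ?ind x else 0"] by blast
  interpret g: Vector_Spaces.linear "scal Y" cscale g by (rule g)
  have gB: "g x = 0" if "x \<in> U" for x
  proof (rule g.eq_0_on_span)
    show "x \<in> vs1.span B" using B(5) that by simp
    show "g x = 0" if "x \<in> B" for x using g(2) that B(3) by auto
  qed
  \<comment> \<open>A section of \<open>g\<close>, with values in the span of
    \<open>C\<close>.\<close>
  define s where "s t = (\<Sum>j\<in>?K. scal Y (t j) (h j))" for t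
  have hC: "h j \<in> C" if "j \<in> ?K" for j using h that by (auto simp: bij_betw_def)
  have CY: "C \<subseteq> carr Y" using vs1.span_superset[of "B \<union> C"] B(6) by auto
  have sY: "s t \<in> carr Y" for t
    unfolding s_def by (intro subspace_sum_closed[OF vs1.vector_space_axioms amodule_subspace[OF Y]] YD(4)) (use hC CY in blast)
  have gs: "g (s t) = t" if "t \<in> supp_on ?K" for t
  proof
    fix i
    have "g (s t) i = (\<Sum>j\<in>?K. t j * g (h j) i)"
      unfolding s_def by (simp add: g.sum g.scale cscale_apply)
    also have "\<dots> = (\<Sum>j\<in>?K. if i = j then t j else 0)"
    proof (rule sum.cong[OF refl])
      fix j assume j: "j \<in> ?K"
      have "g (h j) = ?ind (h j)" using g(2) hC[OF j] by simp
      moreover have "i \<in> ?K \<and> h i = h j \<longleftrightarrow> i = j"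
        using h j by (auto simp: bij_betw_def inj_on_def)
      ultimately show "t j * g (h j) i = (if i = j then t j else 0)" by simp
    qed
    also have "\<dots> = t i" using that by (simp add: sum.delta' supp_on_def)
    finally show "g (s t) i = t i" .
  qed
  have dec: "\<exists>t\<in>supp_on ?K. y - s t \<in> U" if y: "y \<in> carr Y" for y
  proof -
    obtain b c where bc: "y = b + c" "b \<in> vs1.span B" "c \<in> vs1.span C"
      using y unfolding B(6)[symmetric] vs1.span_Un by blast
    obtain u where u: "c = (\<Sum>v\<in>C. scal Y (u v) v)"
      using bc(3) unfolding vs1.span_finite[OF B(2)] by blast
    let ?t = "\<lambda>j. if j \<in> ?K then u (h j) else 0"
    have "s ?t = c" unfolding s_def u
      by (subst sum.reindex_bij_betw[OF h, symmetric]) (rule sum.cong, auto)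
    moreover have "?t \<in> supp_on ?K" by (simp add: supp_on_def)
    moreover have "y - c \<in> U" using bc B(5) by simp
    ultimately show ?thesis by (intro bexI[of _ ?t]) simp_all
  qed
  have gK: "g y \<in> supp_on ?K" and g0: "g y = 0 \<Longrightarrow> y \<in> U" if y: "y \<in> carr Y" for y
  proof -
    obtain t where t: "t \<in> supp_on ?K" "y - s t \<in> U" using dec[OF y] by blast
    have gy: "g y = t"
    proof -
      have "g y - g (s t) = 0" using gB[OF t(2)] by (simp add: g.diff)
      then show ?thesis using gs[OF t(1)] by simp
    qed
    then show "g y \<in> supp_on ?K" using t(1) by simp
    assume "g y = 0"
    then have "t = 0" using gy by simp
    then have "s t = 0" by (simp add: s_def)
    then show "y \<in> U" using t(2) by simp
  qed
  define q where "q y = (if y \<in> carr Y then g y else 0)" for y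
  \<comment> \<open>The quotient action: lift by \<open>s\<close>, act in \<open>Y\<close>, project
    by \<open>g\<close>.\<close>
  define T :: "'b fdmod" where "T = \<lparr>carr = supp_on ?K, scal = cscale, act = \<lambda>a t. g (act Y a (s t))\<rparr>"
  have Tsel [simp]: "carr T = supp_on ?K" "scal T = cscale" by (simp_all add: T_def)
  \<comment> \<open>The action does not depend on the lift, since \<open>s (g y)\<close> and
    \<open>y\<close> differ by an element of the submodule \<open>U\<close>.\<close>
  have actT: "act T a (g y) = g (act Y a y)" if y: "y \<in> carr Y" for a y
  proof -
    have "g (s (g y) - y) = 0" using gs[OF gK[OF y]] by (simp add: g.diff)
    then have "s (g y) - y \<in> U" using g0 YD(3) sY y by blast
    then have "g (act Y a (s (g y) - y)) = 0" using UY(3) gB by blast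
    then show ?thesis using act_diff[OF Y sY y, of a] by (simp add: T_def g.diff)
  qed
  have lift: "\<exists>y\<in>carr Y. t = g y" if "t \<in> supp_on ?K" for t
    using gs[OF that] sY by metis
  have T: "amodule smul mu T"
  proof (rule amoduleI)
    show "vector_space (scal T)" by (simp add: vector_space_cscale)
    show "fd_subspace (scal T) (carr T)" by (simp add: supp_on_finite)
  next
    fix a x assume "x \<in> carr T"
    then obtain y where y: "y \<in> carr Y" "x = g y" using lift by auto
    note ya = amodule_closed[OF Y y(1)]
    show "act T a x \<in> carr T" using gK[OF ya] by (simp add: y(2) actT[OF y(1)])
    show "act T 1 x = x" by (simp add: y(2) actT[OF y(1)] amodule_one[OF Y y(1)])
    show "act T (a + b) x = act T a x + act T b x" for b
      by (simp add: y(2) actT[OF y(1)] amodule_add_alg[OF Y y(1)] g.add)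
    show "act T (smul c a) x = scal T c (act T a x)" for c
      by (simp add: y(2) actT[OF y(1)] amodule_scale_alg[OF Y y(1)] g.scale)
    show "act T a (scal T c x) = scal T c (act T a x)" for c
      using actT[OF YD(4)[OF y(1)], of a c]
      by (simp add: y(2) actT[OF y(1)] amodule_scale[OF Y y(1)] g.scale)
    show "act T (mu a b) x = act T a (act T b x)" for b
      by (simp add: y(2) actT[OF y(1)] amodule_mult[OF Y y(1)] actT[OF ya])
    fix x' assume "x' \<in> carr T"
    then obtain y' where y': "y' \<in> carr Y" "x' = g y'" using lift by auto
    show "act T a (x + x') = act T a x + act T a x'"
      using actT[OF YD(2)[OF y(1) y'(1)], of a]
      by (simp add: y(2) y'(2) actT[OF y(1)] actT[OF y'(1)] amodule_add[OF Y y(1) y'(1)] g.add)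
  qed
  have "q \<in> amod_hom Y T"
    by (rule amod_homI) (simp_all add: q_def gK YD g.add g.scale amodule_closed[OF Y] actT)
  moreover have "q ` carr Y = carr T"
    using gK lift by (force simp: q_def)
  moreover have "hom_kernel Y q = U"
    using g0 gB UY(2) by (auto simp: hom_kernel_def q_def)
  ultimately show ?thesis using that T by blast
qed

section \<open>Basic algebras and projective covers\<close>

text \<open>Stated as the vanishing of coefficients, because it is applied to relations between
  generators that hold only modulo the radical.\<close>

lemma independent_modulo:
  assumes "vector_space s" "finite B" "finite C" "B \<inter> C = {}" "\<not> module.dependent s (B \<union> C)"
    "(\<Sum>c\<in>C. s (u c) c) \<in> module.span s B" "c \<in> C"
  shows "u c = 0"
proof -
  interpret vector_space s by fact
  obtain w where w: "(\<Sum>c\<in>C. s (u c) c) = (\<Sum>b\<in>B. s (w b) b)"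
    using assms(6) unfolding span_finite[OF assms(2)] by blast
  let ?t = "\<lambda>x. if x \<in> C then u x else - w x"
  have "(\<Sum>x\<in>B \<union> C. s (?t x) x) = (\<Sum>x\<in>B. s (?t x) x) + (\<Sum>x\<in>C. s (?t x) x)"
    by (rule sum.union_disjoint) fact+
  also have "(\<Sum>x\<in>B. s (?t x) x) = (\<Sum>x\<in>B. - s (w x) x)"
    by (rule sum.cong[OF refl]) (use assms(4) in auto)
  also have "(\<Sum>x\<in>C. s (?t x) x) = (\<Sum>x\<in>C. s (u x) x)"
    by (rule sum.cong[OF refl]) simp
  finally have "(\<Sum>x\<in>B \<union> C. s (?t x) x) = 0" by (simp add: w sum_negf)
  then have "?t c = 0"
    using independentD[OF assms(5), of "B \<union> C" ?t c] assms(2,3,7) by auto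
  then show ?thesis using assms(7) by simp
qed

text \<open>The assumptions say that \<open>r\<close> is a nilpotent ideal and that
  \<open>A / r\<close> is a product of copies of the complex numbers, one for each idempotent
  \<open>e i\<close>. The multiplication is a parameter so that the opposite algebra is a further
  instance and right modules need no separate theory.\<close>

locale basic_algebra =
  fixes smul :: "complex \<Rightarrow> 'b::ring_1 \<Rightarrow> 'b" and mu :: "'b \<Rightarrow> 'b \<Rightarrow> 'b"
    and V :: "nat set" and e :: "nat \<Rightarrow> 'b" and r :: "'b set"
  assumes smul_vs: "vector_space smul" and alg_fd: "fd_subspace smul UNIV"
    and mu_add_left: "mu (a + b) c = mu a c + mu b c" and mu_add_right: "mu a (b + c) = mu a b + mu a c"
    and mu_smul_left: "mu (smul z a) b = smul z (mu a b)" and mu_smul_right: "mu a (smul z b) = smul z (mu a b)"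
    and mu_assoc: "mu (mu a b) c = mu a (mu b c)" and mu_one_left: "mu 1 a = a" and mu_one_right: "mu a 1 = a"
    and finite_V: "finite V" and e_idem: "i \<in> V \<Longrightarrow> mu (e i) (e i) = e i"
    and e_orth: "i \<in> V \<Longrightarrow> j \<in> V \<Longrightarrow> i \<noteq> j \<Longrightarrow> mu (e i) (e j) = 0" and e_sum: "(\<Sum>i\<in>V. e i) = 1"
    and r_subspace: "module.subspace smul r"
    and r_left: "\<rho> \<in> r \<Longrightarrow> mu a \<rho> \<in> r" and r_right: "\<rho> \<in> r \<Longrightarrow> mu \<rho> a \<in> r"
    and e_notin_r: "i \<in> V \<Longrightarrow> e i \<notin> r"
    and alg_decomp: "\<exists>c. a - (\<Sum>i\<in>V. smul (c i) (e i)) \<in> r"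
    and r_nilpotent: "\<exists>k. \<forall>as. length as = k \<and> set as \<subseteq> r \<longrightarrow> foldr mu as 1 = 0"
begin

sublocale alg: vector_space smul by (rule smul_vs)

abbreviation reg where "reg \<equiv> regular_module smul mu"

lemma reg_simps [simp]: "carr reg = UNIV" "scal reg = smul" "act reg = mu"
  by (simp_all add: regular_module_def)

lemma reg_amodule: "amodule smul mu reg"
  by (rule amoduleI)
     (simp_all add: smul_vs alg_fd mu_add_left mu_add_right mu_smul_left mu_smul_right mu_assoc mu_one_left)

lemma mu_zero_left [simp]: "mu 0 a = 0" using mu_add_left[of 0 0 a] by simp
lemma mu_zero_right [simp]: "mu a 0 = 0" using mu_add_right[of a 0 0] by simp
lemma mu_diff_left: "mu (a - b) c = mu a c - mu b c"
  using mu_add_left[of "a - b" b c] by (simp add: algebra_simps)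
lemma mu_diff_right: "mu a (b - c) = mu a b - mu a c"
  using mu_add_right[of a "b - c" c] by (simp add: algebra_simps)
lemma mu_sum_left: "mu (\<Sum>i\<in>I. f i) c = (\<Sum>i\<in>I. mu (f i) c)"
  by (induction I rule: infinite_finite_induct) (simp_all add: mu_add_left)
lemma mu_sum_right: "mu c (\<Sum>i\<in>I. f i) = (\<Sum>i\<in>I. mu c (f i))"
  by (induction I rule: infinite_finite_induct) (simp_all add: mu_add_right)

lemma e_mu_e: "i \<in> V \<Longrightarrow> j \<in> V \<Longrightarrow> mu (e i) (e j) = (if i = j then e i else 0)"
  using e_idem e_orth by auto

lemma r_zero: "0 \<in> r" and r_add: "a \<in> r \<Longrightarrow> b \<in> r \<Longrightarrow> a + b \<in> r" and r_diff: "a \<in> r \<Longrightarrow> b \<in> r \<Longrightarrow> a - b \<in> r"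
  and r_smul: "a \<in> r \<Longrightarrow> smul c a \<in> r"
  using vs_subspaceD[OF smul_vs r_subspace] by auto

text \<open>Modulo \<open>r\<close> an element is a combination of the orthogonal
  \<open>e j\<close>, of which multiplication by \<open>e i\<close> leaves only one term. This is
  locality of \<open>e i\<close>, in a form that can be computed with.\<close>

lemma e_left_decomp:
  assumes i: "i \<in> V" obtains c \<rho> where "\<rho> \<in> r" "mu (e i) a = smul c (e i) + \<rho>"
proof -
  obtain c where c: "a - (\<Sum>j\<in>V. smul (c j) (e j)) \<in> r" using alg_decomp by blast
  have "mu (e i) (\<Sum>j\<in>V. smul (c j) (e j)) = (\<Sum>j\<in>V. if j = i then smul (c i) (e i) else 0)"
    unfolding mu_sum_right by (rule sum.cong[OF refl]) (use i in \<open>auto simp: mu_smul_right e_mu_e\<close>)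
  then have "mu (e i) (\<Sum>j\<in>V. smul (c j) (e j)) = smul (c i) (e i)"
    using i finite_V by simp
  then have "mu (e i) a = smul (c i) (e i) + mu (e i) (a - (\<Sum>j\<in>V. smul (c j) (e j)))"
    by (simp add: mu_diff_right)
  then show ?thesis using that r_left[OF c] by blast
qed

lemma e_right_decomp:
  assumes i: "i \<in> V" obtains c \<rho> where "\<rho> \<in> r" "mu a (e i) = smul c (e i) + \<rho>"
proof -
  obtain c where c: "a - (\<Sum>j\<in>V. smul (c j) (e j)) \<in> r" using alg_decomp by blast
  have "mu (\<Sum>j\<in>V. smul (c j) (e j)) (e i) = (\<Sum>j\<in>V. if j = i then smul (c i) (e i) else 0)"
    unfolding mu_sum_left by (rule sum.cong[OF refl]) (use i in \<open>auto simp: mu_smul_left e_mu_e\<close>)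
  then have "mu (\<Sum>j\<in>V. smul (c j) (e j)) (e i) = smul (c i) (e i)"
    using i finite_V by simp
  then have "mu a (e i) = smul (c i) (e i) + mu (a - (\<Sum>j\<in>V. smul (c j) (e j))) (e i)"
    by (simp add: mu_diff_left)
  then show ?thesis using that r_right[OF c] by blast
qed

section \<open>The radical of a module and Nakayama's lemma\<close>

abbreviation md :: "('b, 'v::ab_group_add) amod \<Rightarrow> bool" where "md X \<equiv> amodule smul mu X"

lemma act_zero_alg: assumes "md X" "x \<in> carr X" shows "act X 0 x = 0"
  using amodule_add_alg[OF assms, of 0 0] by simp

lemma act_sum_alg: assumes "md X" "x \<in> carr X" shows "act X (\<Sum>i\<in>I. f i) x = (\<Sum>i\<in>I. act X (f i) x)"
  by (induction I rule: infinite_finite_induct) (simp_all add: act_zero_alg[OF assms] amodule_add_alg[OF assms])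

lemma e_split: assumes "md X" "x \<in> carr X" shows "x = (\<Sum>i\<in>V. act X (e i) x)"
  using act_sum_alg[OF assms, of e V] amodule_one[OF assms] by (simp add: e_sum)

definition rad :: "('b, 'v::ab_group_add) amod \<Rightarrow> 'v set" where
  "rad X = module.span (scal X) {act X \<rho> x | \<rho> x. \<rho> \<in> r \<and> x \<in> carr X}"

lemma rad_subspace: assumes "md X" shows "module.subspace (scal X) (rad X)"
proof -
  interpret vector_space "scal X" by (rule amodule_vector_space[OF assms])
  show ?thesis by (simp add: rad_def)
qed

lemma rad_induct:
  assumes X: "md X" and S: "module.subspace (scal X) S" and "\<And>\<rho> x. \<rho> \<in> r \<Longrightarrow> x \<in> carr X \<Longrightarrow> act X \<rho> x \<in> S"
  shows "rad X \<subseteq> S"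
proof -
  interpret vector_space "scal X" by (rule amodule_vector_space[OF assms(1)])
  show ?thesis unfolding rad_def by (rule span_minimal[OF _ S]) (use assms(3) in auto)
qed

lemma rad_gen: assumes "md X" "\<rho> \<in> r" "x \<in> carr X" shows "act X \<rho> x \<in> rad X"
proof -
  interpret vector_space "scal X" by (rule amodule_vector_space[OF assms(1)])
  show ?thesis unfolding rad_def by (rule span_base) (use assms in blast)
qed

lemma rad_sub: assumes "md X" shows "rad X \<subseteq> carr X"
  by (rule rad_induct[OF assms amodule_subspace[OF assms]]) (rule amodule_closed[OF assms])

lemma rad_submodule: assumes X: "md X" shows "submodule X (rad X)"
proof -
  interpret vector_space "scal X" by (rule amodule_vector_space[OF X])
  note RD = vs_subspaceD[OF vector_space_axioms rad_subspace[OF X]]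
  note XD = vs_subspaceD[OF vector_space_axioms amodule_subspace[OF X]]
  have "rad X \<subseteq> {x \<in> carr X. act X a x \<in> rad X}" for a
  proof (rule rad_induct[OF X])
    show "module.subspace (scal X) {x \<in> carr X. act X a x \<in> rad X}"
      by (rule subspaceI) (auto simp: XD RD act_zero[OF X] amodule_add[OF X] amodule_scale[OF X])
    show "act X \<rho> x \<in> {x \<in> carr X. act X a x \<in> rad X}" if "\<rho> \<in> r" "x \<in> carr X" for \<rho> x
      using that rad_gen[OF X r_left[OF that(1), of a] that(2)]
      by (simp add: amodule_closed[OF X] amodule_mult[OF X])
  qed
  then show ?thesis using rad_sub[OF X] rad_subspace[OF X] by (auto simp: submodule_def)
qed

lemma rad_hom:
  assumes X: "md X" and Y: "md Y" and f: "f \<in> amod_hom X Y" and x: "x \<in> rad X" shows "f x \<in> rad Y"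
proof -
  interpret X: vector_space "scal X" by (rule amodule_vector_space[OF X])
  note RD = vs_subspaceD[OF amodule_vector_space[OF Y] rad_subspace[OF Y]]
  note XD = vs_subspaceD[OF X.vector_space_axioms amodule_subspace[OF X]]
  note fD = lin_on_props[OF amodule_vector_space[OF X] amodule_vector_space[OF Y] amodule_subspace[OF X] amod_homD(2)[OF f]]
  have "rad X \<subseteq> {x \<in> carr X. f x \<in> rad Y}"
  proof (rule rad_induct[OF X])
    show "module.subspace (scal X) {x \<in> carr X. f x \<in> rad Y}"
      by (rule X.subspaceI) (auto simp: XD RD fD)
    show "act X \<rho> x \<in> {x \<in> carr X. f x \<in> rad Y}" if "\<rho> \<in> r" "x \<in> carr X" for \<rho> x
      using that by (simp add: amodule_closed[OF X] amod_homD[OF f] rad_gen[OF Y])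
  qed
  then show ?thesis using x by blast
qed

lemma rad_hom_surj:
  assumes X: "md X" and Y: "md Y" and f: "f \<in> amod_hom X Y" "f ` carr X = carr Y" shows "f ` rad X = rad Y"
proof
  show "f ` rad X \<subseteq> rad Y" using rad_hom[OF X Y f(1)] by blast
  have sub: "lin_on (scal X) (scal Y) (rad X) f"
    using amod_homD(2)[OF f(1)] rad_sub[OF X] unfolding lin_on_def by blast
  show "rad Y \<subseteq> f ` rad X"
  proof (rule rad_induct[OF Y])
    show "module.subspace (scal Y) (f ` rad X)"
      by (rule subspace_image_lin_on(1)[OF amodule_vector_space[OF X] amodule_vector_space[OF Y] rad_subspace[OF X] sub])
    fix \<rho> y assume "\<rho> \<in> r" "y \<in> carr Y"
    then obtain x where "x \<in> carr X" "y = f x" using f(2) by blast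
    then have "act Y \<rho> y = f (act X \<rho> x)" "act X \<rho> x \<in> rad X"
      using amod_homD(3)[OF f(1)] rad_gen[OF X \<open>\<rho> \<in> r\<close>] by auto
    then show "act Y \<rho> y \<in> f ` rad X" by blast
  qed
qed

lemma foldr_mu_append: "foldr mu (as @ [\<rho>]) 1 = mu (foldr mu as 1) \<rho>"
  by (induction as) (simp_all add: mu_one_left mu_one_right mu_assoc)

text \<open>The property \<open>P k\<close> says that products of \<open>k\<close> elements of
  \<open>r\<close> map \<open>X\<close> into \<open>U\<close>. Since \<open>X = U + r X\<close>, it
  descends from \<open>k + 1\<close> to \<open>k\<close>; nilpotency starts the descent, and
  \<open>P 0\<close> concerns the empty product \<open>1\<close>.\<close>

lemma nakayama:
  assumes X: "md X" and U: "submodule X U" and gen: "\<And>x. x \<in> carr X \<Longrightarrow> \<exists>u\<in>U. x - u \<in> rad X"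
  shows "U = carr X"
proof -
  interpret vector_space "scal X" by (rule amodule_vector_space[OF X])
  have sU: "subspace U" "U \<subseteq> carr X" "\<And>a x. x \<in> U \<Longrightarrow> act X a x \<in> U" using U by (auto simp: submodule_def)
  note UD = vs_subspaceD[OF vector_space_axioms sU(1)]
  note XD = vs_subspaceD[OF vector_space_axioms amodule_subspace[OF X]]
  define P where "P k \<longleftrightarrow> (\<forall>as. length as = k \<longrightarrow> set as \<subseteq> r \<longrightarrow> (\<forall>y\<in>carr X. act X (foldr mu as 1) y \<in> U))" for k
  have step: "P k" if "P (Suc k)" for k
    unfolding P_def
  proof (intro allI impI ballI)
    fix as y assume as: "length as = k" "set as \<subseteq> r" and y: "y \<in> carr X"
    let ?a = "foldr mu as 1"
    obtain u where u: "u \<in> U" "y - u \<in> rad X" using gen[OF y] by blast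
    \<comment> \<open>On a generator \<open>act X \<rho> x\<close> of the radical, a product of
      \<open>k\<close> factors becomes a product of \<open>k + 1\<close> factors.\<close>
    have "rad X \<subseteq> {w \<in> carr X. act X ?a w \<in> U}"
    proof (rule rad_induct[OF X])
      show "subspace {w \<in> carr X. act X ?a w \<in> U}"
        by (rule subspaceI) (auto simp: XD UD act_zero[OF X] amodule_add[OF X] amodule_scale[OF X])
      fix \<rho> x assume \<rho>: "\<rho> \<in> r" "x \<in> carr X"
      then have "act X (foldr mu (as @ [\<rho>]) 1) x \<in> U"
        using that as unfolding P_def by (metis (no_types, lifting) length_append_singleton list.set(1) list.simps(15) set_append Un_insert_right insert_subset sup_bot.right_neutral)
      then show "act X \<rho> x \<in> {w \<in> carr X. act X ?a w \<in> U}"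
        using \<rho> by (simp only: foldr_mu_append amodule_mult[OF X \<rho>(2)] mem_Collect_eq amodule_closed[OF X])
    qed
    then have "act X ?a (y - u) \<in> U" using u(2) by blast
    moreover have "u \<in> carr X" using u(1) sU(2) by blast
    ultimately have "act X ?a y - act X ?a u \<in> U" using act_diff[OF X y] by simp
    from UD(2)[OF this sU(3)[OF u(1), of ?a]] show "act X ?a y \<in> U" by simp
  qed
  obtain k0 where k0: "\<forall>as. length as = k0 \<and> set as \<subseteq> r \<longrightarrow> foldr mu as 1 = 0" using r_nilpotent by blast
  have "P k0" unfolding P_def using k0 act_zero_alg[OF X] UD(1) by auto
  then have "P 0" using step by (induction k0) auto
  then have P0: "act X (foldr mu [] 1) y \<in> U" if "y \<in> carr X" for y
    using that unfolding P_def by (elim allE[of _ "[]"] impE) auto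
  have "carr X \<subseteq> U"
  proof
    fix y assume y: "y \<in> carr X"
    from P0[OF y] show "y \<in> U" by (simp add: amodule_one[OF X y])
  qed
  then show ?thesis using sU(2) by (rule subset_antisym[rotated])
qed

section \<open>Parts cut out by idempotents, and sums of the modules \<open>A e_i\<close>\<close>

definition epart :: "('b, 'v::ab_group_add) amod \<Rightarrow> 'v set \<Rightarrow> nat \<Rightarrow> 'v set" where
  "epart X S i = {x \<in> S. act X (e i) x = x}"

lemma epart_subspace:
  assumes X: "md X" and S: "module.subspace (scal X) S" "S \<subseteq> carr X"
  shows "module.subspace (scal X) (epart X S i)" "fd_subspace (scal X) (epart X S i)" "epart X S i \<subseteq> carr X"
proof -
  interpret vector_space "scal X" by (rule amodule_vector_space[OF X])
  note SD = vs_subspaceD[OF vector_space_axioms S(1)]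
  show "epart X S i \<subseteq> carr X" using S(2) by (auto simp: epart_def)
  show "module.subspace (scal X) (epart X S i)"
    unfolding epart_def
    by (rule subspaceI) (use S(2) in \<open>auto simp: SD act_zero[OF X] amodule_add[OF X] amodule_scale[OF X] subset_iff\<close>)
  then show "fd_subspace (scal X) (epart X S i)"
    using fd_subset(1)[OF vector_space_axioms amodule_fd[OF X]] \<open>epart X S i \<subseteq> carr X\<close> by blast
qed

lemma e_act_epart:
  assumes X: "md X" and S: "submodule X S" and i: "i \<in> V" and x: "x \<in> S" shows "act X (e i) x \<in> epart X S i"
proof -
  have "x \<in> carr X" "act X (e i) x \<in> S" using S x by (auto simp: submodule_def)
  then show ?thesis using amodule_mult[OF X, of x "e i" "e i"] e_idem[OF i] by (auto simp: epart_def)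
qed

lemma submodule_carr: "md X \<Longrightarrow> submodule X (carr X)"
  by (simp add: submodule_def amodule_subspace amodule_closed)

text \<open>A dual basis for \<open>P\<close> as the direct sum of the modules
  \<open>A e(\<iota> k)\<close>: the \<open>\<epsilon> k\<close> are generators and the
  \<open>\<alpha> k\<close> the coordinate maps, with values in \<open>A e(\<iota> k)\<close>. Maps
  from \<open>P\<close> to \<open>Y\<close> then correspond to choices of elements of
  \<open>e(\<iota> k) Y\<close>, and every computation with projectives reduces to
  coordinates.\<close>

definition free_on :: "('b, 'v::ab_group_add) amod \<Rightarrow> nat \<Rightarrow> (nat \<Rightarrow> nat) \<Rightarrow> (nat \<Rightarrow> 'v) \<Rightarrow> (nat \<Rightarrow> 'v \<Rightarrow> 'b) \<Rightarrow> bool" where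
  "free_on P N \<iota> \<epsilon> \<alpha> \<longleftrightarrow> md P \<and>
     (\<forall>k<N. \<iota> k \<in> V \<and> \<epsilon> k \<in> carr P \<and> act P (e (\<iota> k)) (\<epsilon> k) = \<epsilon> k \<and> \<alpha> k \<in> amod_hom P reg \<and>
        (\<forall>x\<in>carr P. mu (\<alpha> k x) (e (\<iota> k)) = \<alpha> k x) \<and>
        (\<forall>l<N. \<alpha> k (\<epsilon> l) = (if k = l then e (\<iota> k) else 0))) \<and>
     (\<forall>x\<in>carr P. x = (\<Sum>k<N. act P (\<alpha> k x) (\<epsilon> k)))"

lemma free_onD:
  assumes "free_on P N \<iota> \<epsilon> \<alpha>"
  shows "md P" "k < N \<Longrightarrow> \<iota> k \<in> V" "k < N \<Longrightarrow> \<epsilon> k \<in> carr P" "k < N \<Longrightarrow> act P (e (\<iota> k)) (\<epsilon> k) = \<epsilon> k"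
    "k < N \<Longrightarrow> \<alpha> k \<in> amod_hom P reg" "k < N \<Longrightarrow> x \<in> carr P \<Longrightarrow> mu (\<alpha> k x) (e (\<iota> k)) = \<alpha> k x"
    "k < N \<Longrightarrow> l < N \<Longrightarrow> \<alpha> k (\<epsilon> l) = (if k = l then e (\<iota> k) else 0)"
    "x \<in> carr P \<Longrightarrow> (\<Sum>k<N. act P (\<alpha> k x) (\<epsilon> k)) = x"
  using assms unfolding free_on_def by (blast, blast, blast, blast, blast, blast, blast, simp)

definition free_lift where
  "free_lift P N \<alpha> Y y = (\<lambda>x. if x \<in> carr P then \<Sum>k<N. act Y (\<alpha> k x) (y k) else 0)"

lemma free_lift:
  assumes F: "free_on P N \<iota> \<epsilon> \<alpha>" and Y: "md Y" and y: "\<And>k. k < N \<Longrightarrow> y k \<in> epart Y (carr Y) (\<iota> k)"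
  shows "free_lift P N \<alpha> Y y \<in> amod_hom P Y" "l < N \<Longrightarrow> free_lift P N \<alpha> Y y (\<epsilon> l) = y l"
proof -
  note FD = free_onD[OF F]
  interpret Y: vector_space "scal Y" by (rule amodule_vector_space[OF Y])
  note PD = vs_subspaceD[OF amodule_vector_space[OF FD(1)] amodule_subspace[OF FD(1)]]
  have yc: "y k \<in> carr Y" "act Y (e (\<iota> k)) (y k) = y k" if "k < N" for k using y[OF that] by (auto simp: epart_def)
  note aD = amod_homD[OF FD(5)]
  have a_add: "\<alpha> k (x + x') = \<alpha> k x + \<alpha> k x'" if "k < N" "x \<in> carr P" "x' \<in> carr P" for k x x'
    using aD(2)[OF that(1)] that unfolding lin_on_def by blast
  have a_scale: "\<alpha> k (scal P c x) = smul c (\<alpha> k x)" if "k < N" "x \<in> carr P" for k x c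
    using aD(2)[OF that(1)] that unfolding lin_on_def by simp
  have cl: "(\<Sum>k<N. act Y (\<alpha> k x) (y k)) \<in> carr Y" for x
    by (rule subspace_sum_closed[OF Y.vector_space_axioms amodule_subspace[OF Y]]) (simp add: yc amodule_closed[OF Y])
  show "free_lift P N \<alpha> Y y \<in> amod_hom P Y"
  proof (rule amod_homI)
    fix x assume x: "x \<in> carr P"
    then show "free_lift P N \<alpha> Y y x \<in> carr Y" by (simp add: free_lift_def cl)
    show "free_lift P N \<alpha> Y y (scal P c x) = scal Y c (free_lift P N \<alpha> Y y x)" for c
      using x by (auto simp: free_lift_def PD a_scale amodule_scale_alg[OF Y] yc Y.scale_sum_right intro!: sum.cong)
    show "free_lift P N \<alpha> Y y (act P a x) = act Y a (free_lift P N \<alpha> Y y x)" for a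
    proof -
      have "(\<Sum>k<N. act Y (\<alpha> k (act P a x)) (y k)) = (\<Sum>k<N. act Y a (act Y (\<alpha> k x) (y k)))"
        by (rule sum.cong[OF refl]) (use x in \<open>simp add: aD(3) amodule_mult[OF Y] yc\<close>)
      also have "\<dots> = act Y a (\<Sum>k<N. act Y (\<alpha> k x) (y k))"
        by (rule act_sum[OF Y, symmetric]) (simp add: yc amodule_closed[OF Y])
      finally show ?thesis using x by (simp add: free_lift_def amodule_closed[OF FD(1)])
    qed
    fix x' assume x': "x' \<in> carr P"
    show "free_lift P N \<alpha> Y y (x + x') = free_lift P N \<alpha> Y y x + free_lift P N \<alpha> Y y x'"
      using x x' by (auto simp: free_lift_def PD a_add amodule_add_alg[OF Y] yc sum.distrib[symmetric] intro!: sum.cong)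
  qed (simp add: free_lift_def)
  assume l: "l < N"
  have "(\<Sum>k<N. act Y (\<alpha> k (\<epsilon> l)) (y k)) = (\<Sum>k<N. if k = l then y l else 0)"
    by (rule sum.cong[OF refl]) (use l in \<open>auto simp: FD(7) yc act_zero_alg[OF Y]\<close>)
  then show "free_lift P N \<alpha> Y y (\<epsilon> l) = y l" using l FD(3) by (simp add: free_lift_def)
qed

lemma hom_free_unique:
  assumes F: "free_on P N \<iota> \<epsilon> \<alpha>" and Y: "md Y" and h: "h \<in> amod_hom P Y" and x: "x \<in> carr P"
  shows "h x = (\<Sum>k<N. act Y (\<alpha> k x) (h (\<epsilon> k)))"
proof -
  note FD = free_onD[OF F]
  have "h x = h (\<Sum>k<N. act P (\<alpha> k x) (\<epsilon> k))" using FD(8)[OF x] by simp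
  also have "\<dots> = (\<Sum>k<N. h (act P (\<alpha> k x) (\<epsilon> k)))"
    by (rule amod_hom_sum[OF FD(1) Y h]) (simp add: amodule_closed[OF FD(1)] FD(3))
  also have "\<dots> = (\<Sum>k<N. act Y (\<alpha> k x) (h (\<epsilon> k)))"
    by (rule sum.cong[OF refl]) (simp add: amod_homD(3)[OF h] FD(3))
  finally show ?thesis .
qed

lemma free_iso:
  assumes F: "free_on P N \<iota> \<epsilon> \<alpha>" and T: "md T" and q: "q \<in> amod_hom P T" and s: "s \<in> amod_hom T P"
    and qs: "\<And>t. t \<in> carr T \<Longrightarrow> q (s t) = t" and sq: "\<And>x. x \<in> carr P \<Longrightarrow> s (q x) = x"
  shows "free_on T N \<iota> (\<lambda>k. q (\<epsilon> k)) (\<lambda>k t. \<alpha> k (s t))"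
  unfolding free_on_def
proof (intro conjI allI impI ballI)
  note FD = free_onD[OF F]
  show "md T" by fact
  fix k assume k: "k < N"
  show "\<iota> k \<in> V" using FD(2)[OF k] .
  show "q (\<epsilon> k) \<in> carr T" using amod_homD(1)[OF q] FD(3)[OF k] by blast
  show "act T (e (\<iota> k)) (q (\<epsilon> k)) = q (\<epsilon> k)"
    using amod_homD(3)[OF q FD(3)[OF k], of "e (\<iota> k)"] FD(4)[OF k] by simp
  have a: "\<alpha> k \<in> amod_hom P reg" by (rule FD(5)[OF k])
  show "(\<lambda>t. \<alpha> k (s t)) \<in> amod_hom T reg"
  proof (rule amod_homI)
    have z: "\<alpha> k 0 = 0" by (rule amod_hom_zero[OF FD(1) reg_amodule a])
    show "\<alpha> k (s x) = 0" if "x \<notin> carr T" for x using amod_homD(4)[OF s that] z by simp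
  qed (use amod_homD(2)[OF a] amod_homD(2)[OF s] amod_homD(1,3)[OF s] amod_homD(3)[OF a] in \<open>auto simp: lin_on_def\<close>)
  show "mu (\<alpha> k (s t)) (e (\<iota> k)) = \<alpha> k (s t)" if "t \<in> carr T" for t
    using FD(6)[OF k amod_homD(1)[OF s that]] .
  show "\<alpha> k (s (q (\<epsilon> l))) = (if k = l then e (\<iota> k) else 0)" if "l < N" for l
    using FD(7)[OF k that] sq[OF FD(3)[OF that]] by simp
next
  note FD = free_onD[OF F]
  fix t assume t: "t \<in> carr T"
  have "t = q (\<Sum>k<N. act P (\<alpha> k (s t)) (\<epsilon> k))" using qs[OF t] FD(8)[OF amod_homD(1)[OF s t]] by simp
  also have "\<dots> = (\<Sum>k<N. q (act P (\<alpha> k (s t)) (\<epsilon> k)))"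
    by (rule amod_hom_sum[OF FD(1) T q]) (simp add: amodule_closed[OF FD(1)] FD(3))
  also have "\<dots> = (\<Sum>k<N. act T (\<alpha> k (s t)) (q (\<epsilon> k)))"
    by (rule sum.cong[OF refl]) (simp add: amod_homD(3)[OF q] FD(3))
  finally show "t = (\<Sum>k<N. act T (\<alpha> k (s t)) (q (\<epsilon> k)))" .
qed

lemma iso_inverse:
  assumes P: "md P" and T: "md T" and q: "q \<in> amod_hom P T" "q ` carr P = carr T" "hom_kernel P q = {0}"
  obtains s where "s \<in> amod_hom T P" "\<And>t. t \<in> carr T \<Longrightarrow> q (s t) = t" "\<And>x. x \<in> carr P \<Longrightarrow> s (q x) = x"
proof -
  note PD = vs_subspaceD[OF amodule_vector_space[OF P] amodule_subspace[OF P]]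
  note TD = vs_subspaceD[OF amodule_vector_space[OF T] amodule_subspace[OF T]]
  note qD = lin_on_props[OF amodule_vector_space[OF P] amodule_vector_space[OF T] amodule_subspace[OF P] amod_homD(2)[OF q(1)]]
  have inj: "x = y" if "x \<in> carr P" "y \<in> carr P" "q x = q y" for x y
  proof -
    have "x - y \<in> hom_kernel P q" using that PD(3) qD(4) by (simp add: hom_kernel_def)
    then show ?thesis using q(3) by simp
  qed
  define s where "s t = (if t \<in> carr T then SOME x. x \<in> carr P \<and> q x = t else 0)" for t
  have sT: "s t \<in> carr P \<and> q (s t) = t" if "t \<in> carr T" for t
  proof -
    have "t \<in> q ` carr P" using that q(2) by simp
    then have "\<exists>x. x \<in> carr P \<and> q x = t" by auto
    from someI_ex[OF this] show ?thesis using that by (simp add: s_def)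
  qed
  have sq: "s (q x) = x" if "x \<in> carr P" for x
    by (rule inj) (use sT[OF amod_homD(1)[OF q(1) that]] that in auto)
  have "s \<in> amod_hom T P"
  proof (rule amod_homI)
    fix x assume x: "x \<in> carr T"
    then show "s x \<in> carr P" using sT by blast
    show "s (scal T c x) = scal P c (s x)" for c
      using sT[OF x] sq[of "scal P c (s x)"] PD(4) qD(3) by auto
    show "s (act T a x) = act P a (s x)" for a
      using sT[OF x] sq[of "act P a (s x)"] amodule_closed[OF P] amod_homD(3)[OF q(1)] by auto
    fix y assume y: "y \<in> carr T"
    show "s (x + y) = s x + s y" using sT[OF x] sT[OF y] sq[of "s x + s y"] PD(2) qD(2) by auto
  qed (simp add: s_def)
  then show ?thesis by (rule that) (simp_all add: sT sq)
qed

text \<open>The evident model consists of functions from \<open>nat\<close> to the algebra. Its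
  quotient by the zero submodule is an isomorphic copy on \<open>nat => complex\<close>, the type
  required of projective modules.\<close>

lemma free_exists:
  assumes i: "\<And>k. k < N \<Longrightarrow> \<iota> k \<in> V"
  obtains F :: "'b fdmod" and \<epsilon> \<alpha> where "free_on F N \<iota> \<epsilon> \<alpha>"
proof -
  let ?S = "\<lambda>k. {a. mu a (e (\<iota> k)) = a}"
  define G where "G = \<lparr>carr = fun_space {..<N} ?S, scal = pointwise_scale smul, act = \<lambda>b a (k::nat). mu b (a k)\<rparr>"
  have Gs [simp]: "carr G = fun_space {..<N} ?S" "scal G = pointwise_scale smul" "act G = (\<lambda>b a k. mu b (a k))"
    by (simp_all add: G_def)
  have S: "alg.subspace (?S k)" for k
    by (rule alg.subspaceI) (simp_all add: mu_add_left mu_smul_left)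
  have fdS: "fd_subspace smul (?S k)" for k
    by (rule fd_subset(1)[OF smul_vs alg_fd S]) simp
  have G: "md G"
  proof (rule amoduleI)
    show "vector_space (scal G)" by (simp add: vector_space_pointwise_scale[OF smul_vs])
    show "fd_subspace (scal G) (carr G)"
      using fun_space_finite[OF smul_vs, of "{..<N}" ?S] fdS by simp
  qed (auto simp: fun_space_def fun_eq_iff pointwise_scale_def mu_add_left mu_add_right mu_smul_left mu_smul_right mu_assoc mu_one_left)
  let ?\<epsilon> = "\<lambda>k j. if j = k then e (\<iota> k) else 0"
  let ?\<alpha> = "\<lambda>k a. if a \<in> carr G then a k else 0"
  have GD: "x + y \<in> carr G" "scal G c x \<in> carr G" "act G a x \<in> carr G" if "x \<in> carr G" "y \<in> carr G" for x y c a
  proof -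
    note D = vs_subspaceD[OF amodule_vector_space[OF G] amodule_subspace[OF G]]
    show "x + y \<in> carr G" by (rule D(2)[OF that])
    show "scal G c x \<in> carr G" by (rule D(4)[OF that(1)])
    show "act G a x \<in> carr G" by (rule amodule_closed[OF G that(1)])
  qed
  have "free_on G N \<iota> ?\<epsilon> ?\<alpha>"
    unfolding free_on_def
  proof (intro conjI allI impI ballI)
    show "md G" by (rule G)
    fix k assume k: "k < N"
    show "\<iota> k \<in> V" by (rule i[OF k])
    show ec: "?\<epsilon> k \<in> carr G" using k i by (auto simp: fun_space_def e_idem)
    show "act G (e (\<iota> k)) (?\<epsilon> k) = ?\<epsilon> k" using i[OF k] by (auto simp: e_idem)
    show "?\<alpha> k \<in> amod_hom G reg"
    proof (rule amod_homI)
      show "?\<alpha> k (x + y) = ?\<alpha> k x + ?\<alpha> k y" if "x \<in> carr G" "y \<in> carr G" for x y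
        using GD(1)[OF that] that by simp
      show "?\<alpha> k (scal G c x) = scal reg c (?\<alpha> k x)" if "x \<in> carr G" for c x
        using GD(2)[OF that that, of c] that by (simp add: pointwise_scale_def)
      show "?\<alpha> k (act G a x) = act reg a (?\<alpha> k x)" if "x \<in> carr G" for a x
        using GD(3)[OF that that, of a] that by simp
    qed simp_all
    show "mu (?\<alpha> k x) (e (\<iota> k)) = ?\<alpha> k x" if "x \<in> carr G" for x
      using that k by (simp add: fun_space_def)
    show "?\<alpha> k (?\<epsilon> l) = (if k = l then e (\<iota> k) else 0)" if "l < N" for l
    proof -
      have "?\<epsilon> l \<in> carr G" using that i by (auto simp: fun_space_def e_idem)
      then show ?thesis by simp
    qed
  next
    fix x assume x: "x \<in> carr G"
    show "x = (\<Sum>k<N. act G (?\<alpha> k x) (?\<epsilon> k))"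
    proof
      fix j
      have "(\<Sum>k<N. act G (?\<alpha> k x) (?\<epsilon> k)) j = (\<Sum>k<N. if j = k then mu (x k) (e (\<iota> k)) else 0)"
        unfolding sum_fun_apply by (rule sum.cong[OF refl]) (use x in simp)
      also have "\<dots> = (if j < N then mu (x j) (e (\<iota> j)) else 0)" by (simp add: sum.delta')
      also have "\<dots> = x j" using x by (simp add: fun_space_def)
      finally show "x j = (\<Sum>k<N. act G (?\<alpha> k x) (?\<epsilon> k)) j" by simp
    qed
  qed
  note free = this
  interpret Gv: vector_space "scal G" by (rule amodule_vector_space[OF G])
  have "submodule G {0}"
    using vs_subspaceD(1)[OF amodule_vector_space[OF G] amodule_subspace[OF G]] act_zero[OF G]
    by (simp add: submodule_def Gv.subspace_single_0 del: Gs)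
  then obtain T :: "'b fdmod" and q where T: "md T" "q \<in> amod_hom G T" "q ` carr G = carr T" "hom_kernel G q = {0}"
    by (rule quotient_module_exists[OF G])
  obtain s where s: "s \<in> amod_hom T G" "\<And>t. t \<in> carr T \<Longrightarrow> q (s t) = t" "\<And>x. x \<in> carr G \<Longrightarrow> s (q x) = x"
    by (rule iso_inverse[OF G T]) (rule that)
  have "free_on T N \<iota> (\<lambda>k. q (?\<epsilon> k)) (\<lambda>k t. ?\<alpha> k (s t))"
    by (rule free_iso[OF free T(1,2) s(1)]) (rule s(2,3), assumption)+
  then show ?thesis by (rule that)
qed

lemma free_projective:
  fixes P :: "'b fdmod"
  assumes F: "free_on P N \<iota> \<epsilon> \<alpha>" shows "projective_module smul mu P"
  unfolding projective_module_def
proof (intro conjI allI impI ballI)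
  note FD = free_onD[OF F]
  show "md P" by (rule FD(1))
  fix X Y :: "'b fdmod" and p f
  assume XY: "md X \<and> md Y" and p: "p \<in> amod_hom X Y" "p ` carr X = carr Y" and f: "f \<in> amod_hom P Y"
  then have X: "md X" and Y: "md Y" by auto
  \<comment> \<open>Any preimage of \<open>f (\<epsilon> k)\<close> is multiplied by
    \<open>e (\<iota> k)\<close>; it stays a preimage because \<open>\<epsilon> k\<close> is fixed
    by this idempotent.\<close>
  have "\<forall>k<N. \<exists>y. y \<in> epart X (carr X) (\<iota> k) \<and> p y = f (\<epsilon> k)"
  proof (intro allI impI)
    fix k assume k: "k < N"
    have "f (\<epsilon> k) \<in> carr Y" using amod_homD(1)[OF f FD(3)[OF k]] .
    then obtain x where x: "x \<in> carr X" "p x = f (\<epsilon> k)" using p(2) by (metis imageE)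
    have "p (act X (e (\<iota> k)) x) = act Y (e (\<iota> k)) (f (\<epsilon> k))" using amod_homD(3)[OF p(1) x(1)] x(2) by simp
    also have "\<dots> = f (\<epsilon> k)" using amod_homD(3)[OF f FD(3)[OF k], of "e (\<iota> k)"] FD(4)[OF k] by simp
    finally show "\<exists>y. y \<in> epart X (carr X) (\<iota> k) \<and> p y = f (\<epsilon> k)"
      using e_act_epart[OF X submodule_carr[OF X] FD(2)[OF k] x(1)] by blast
  qed
  then obtain y where y: "\<And>k. k < N \<Longrightarrow> y k \<in> epart X (carr X) (\<iota> k) \<and> p (y k) = f (\<epsilon> k)" by metis
  let ?g = "free_lift P N \<alpha> X y"
  have g: "?g \<in> amod_hom P X" "\<And>k. k < N \<Longrightarrow> ?g (\<epsilon> k) = y k"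
    using free_lift[OF F X, of y] y by blast+
  have yc: "y k \<in> carr X" if "k < N" for k using y[OF that] by (simp add: epart_def)
  have "p (?g x) = f x" if x: "x \<in> carr P" for x
  proof -
    have "p (?g x) = p (\<Sum>k<N. act X (\<alpha> k x) (y k))" using x by (simp add: free_lift_def)
    also have "\<dots> = (\<Sum>k<N. p (act X (\<alpha> k x) (y k)))"
      by (rule amod_hom_sum[OF X Y p(1)]) (simp add: amodule_closed[OF X] yc)
    also have "\<dots> = (\<Sum>k<N. act Y (\<alpha> k x) (f (\<epsilon> k)))"
      by (rule sum.cong[OF refl]) (simp add: amod_homD(3)[OF p(1)] yc y)
    also have "\<dots> = f x" using hom_free_unique[OF F Y f x] by simp
    finally show ?thesis .
  qed
  then show "\<exists>g\<in>amod_hom P X. \<forall>x\<in>carr P. p (g x) = f x" using g(1) by blast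
qed

end

section \<open>Minimal generators and projective covers\<close>

context basic_algebra begin

text \<open>A basis of \<open>X / rad X\<close>, lifted vertex by vertex: at \<open>i\<close> one
  takes a complement of the basis of \<open>e_i rad X\<close> in a basis of \<open>e_i X\<close>.
  The two last clauses say that the lifts span and are independent modulo the radical.\<close>

lemma minimal_generators:
  fixes X :: "('b, 'v::ab_group_add) amod"
  assumes X: "md X"
  shows "\<exists>(N :: nat) \<iota> x. (\<forall>k<N. \<iota> k \<in> V \<and> x k \<in> epart X (carr X) (\<iota> k)) \<and>
    (\<forall>U y. submodule X U \<longrightarrow> (\<forall>k<N. x k \<in> U) \<longrightarrow> y \<in> carr X \<longrightarrow> (\<exists>u\<in>U. y - u \<in> rad X)) \<and>
    (\<forall>c. (\<Sum>k<N. scal X (c k) (x k)) \<in> rad X \<longrightarrow> (\<forall>k<N. c k = 0))"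
proof -
  interpret vector_space "scal X" by (rule amodule_vector_space[OF X])
  let ?E = "\<lambda>i. epart X (carr X) i" and ?R = "\<lambda>i. epart X (rad X) i"
  note ES = epart_subspace[OF X amodule_subspace[OF X] order_refl]
  note RS = epart_subspace[OF X rad_subspace[OF X] rad_sub[OF X]]
  note RD = vs_subspaceD[OF vector_space_axioms rad_subspace[OF X]]
  have RE: "?R i \<subseteq> ?E i" for i using rad_sub[OF X] by (auto simp: epart_def)
  have "\<exists>B C. finite B \<and> finite C \<and> B \<inter> C = {} \<and> independent (B \<union> C) \<and> span B = ?R i \<and> span (B \<union> C) = ?E i" for i
    by (rule fd_basis_pair[OF vector_space_axioms ES(2)[of i] RS(1)[of i] RE]) (intro exI conjI, assumption+)
  then obtain B C where BC: "\<And>i. finite (B i) \<and> finite (C i) \<and> B i \<inter> C i = {} \<and> independent (B i \<union> C i) \<and>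
      span (B i) = ?R i \<and> span (B i \<union> C i) = ?E i" by metis
  have CE: "C i \<subseteq> ?E i" for i using BC[of i] span_superset[of "B i \<union> C i"] by auto
  let ?G = "Sigma V C"
  have fG: "finite ?G" using finite_V BC by auto
  obtain h where h: "bij_betw h {..<card ?G} ?G"
    using ex_bij_betw_nat_finite[OF fG] by (auto simp: atLeast0LessThan)
  have hG: "h k \<in> ?G" if "k < card ?G" for k using h that by (auto simp: bij_betw_def)
  let ?i = "\<lambda>k. fst (h k)" and ?x = "\<lambda>k. snd (h k)"
  show ?thesis
  proof (intro exI[of _ "card ?G"] exI[of _ ?i] exI[of _ ?x] conjI allI impI)
    fix k assume k: "k < card ?G"
    show "?i k \<in> V" using hG[OF k] by auto
    have "?x k \<in> C (?i k)" using hG[OF k] by auto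
    then show "?x k \<in> ?E (?i k)" by (rule subsetD[OF CE])
  next
    fix U y assume U: "submodule X U" "\<forall>k<card ?G. ?x k \<in> U" and y: "y \<in> carr X"
    have sU: "subspace U" using U(1) by (simp add: submodule_def)
    have CU: "C i \<subseteq> U" if "i \<in> V" for i
    proof
      fix c assume "c \<in> C i"
      then have "(i, c) \<in> h ` {..<card ?G}" using h that by (auto simp: bij_betw_def)
      then obtain k where k: "k < card ?G" "(i, c) = h k" by auto
      from U(2)[rule_format, OF k(1)] show "c \<in> U" unfolding k(2)[symmetric] by simp
    qed
    have "\<exists>u. u \<in> U \<and> act X (e i) y - u \<in> rad X" if i: "i \<in> V" for i
    proof -
      have "act X (e i) y \<in> span (B i \<union> C i)"
        using e_act_epart[OF X submodule_carr[OF X] i y] BC[of i] by simp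
      then obtain b c where bc: "act X (e i) y = b + c" "b \<in> span (B i)" "c \<in> span (C i)"
        unfolding span_Un by auto
      have "b \<in> rad X" using bc(2) BC[of i] by (simp add: epart_def)
      moreover have "c \<in> U" using bc(3) span_minimal[OF CU[OF i] sU] by (rule rev_subsetD)
      ultimately show ?thesis by (intro exI[of _ c]) (simp add: bc(1))
    qed
    then obtain u where u: "\<And>i. i \<in> V \<Longrightarrow> u i \<in> U \<and> act X (e i) y - u i \<in> rad X" by metis
    have "(\<Sum>i\<in>V. u i) \<in> U" by (rule subspace_sum_closed[OF vector_space_axioms sU]) (use u in blast)
    moreover have "y - (\<Sum>i\<in>V. u i) = (\<Sum>i\<in>V. act X (e i) y - u i)"
      unfolding sum_subtractf by (simp flip: e_split[OF X y])
    moreover have "(\<Sum>i\<in>V. act X (e i) y - u i) \<in> rad X"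
      by (rule subspace_sum_closed[OF vector_space_axioms rad_subspace[OF X]]) (use u in blast)
    ultimately show "\<exists>u\<in>U. y - u \<in> rad X" by (intro bexI) simp_all
  next
    fix c k assume s: "(\<Sum>k<card ?G. scal X (c k) (?x k)) \<in> rad X" and k: "k < card ?G"
    let ?top = "?i k" and ?I = "{j. j < card ?G \<and> ?i j = ?i k}"
    have iV: "?top \<in> V" using hG[OF k] by auto
    have xE: "?x j \<in> ?E (?i j)" if "j < card ?G" for j
    proof -
      have "?x j \<in> C (?i j)" using hG[OF that] by auto
      then show ?thesis by (rule subsetD[OF CE])
    qed
    have ex: "act X (e ?top) (?x j) = (if ?i j = ?top then ?x j else 0)" if j: "j < card ?G" for j
    proof (cases "?i j = ?top")
      case True then show ?thesis using xE[OF j] by (simp add: epart_def)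
    next
      case False
      have xj: "?x j \<in> carr X" "act X (e (?i j)) (?x j) = ?x j" using xE[OF j] by (auto simp: epart_def)
      have "?i j \<in> V" using hG[OF j] by auto
      have "act X (e ?top) (?x j) = act X (e ?top) (act X (e (?i j)) (?x j))" using xj(2) by simp
      also have "\<dots> = act X (mu (e ?top) (e (?i j))) (?x j)" by (rule amodule_mult[OF X xj(1), symmetric])
      also have "\<dots> = 0" using False e_orth[OF iV \<open>?i j \<in> V\<close>] act_zero_alg[OF X xj(1)] by simp
      finally show ?thesis using False by simp
    qed
    have xc: "?x j \<in> carr X" if "j < card ?G" for j using xE[OF that] by (simp add: epart_def)
    have sc: "scal X (c j) (?x j) \<in> carr X" if "j < card ?G" for j
      by (rule vs_subspaceD(4)[OF vector_space_axioms amodule_subspace[OF X] xc[OF that]])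
    \<comment> \<open>Multiplication by the idempotent of the vertex of \<open>k\<close> removes the
      generators at all other vertices from the relation.\<close>
    have "act X (e ?top) (\<Sum>j<card ?G. scal X (c j) (?x j)) = (\<Sum>j<card ?G. act X (e ?top) (scal X (c j) (?x j)))"
      by (rule act_sum[OF X]) (simp add: sc)
    also have "\<dots> = (\<Sum>j<card ?G. if ?i j = ?top then scal X (c j) (?x j) else 0)"
      by (rule sum.cong[OF refl]) (simp add: amodule_scale[OF X] xc ex)
    also have "\<dots> = (\<Sum>j\<in>?I. scal X (c j) (?x j))"
      by (simp add: sum.inter_filter[symmetric])
    finally have eq: "act X (e ?top) (\<Sum>j<card ?G. scal X (c j) (?x j)) = (\<Sum>j\<in>?I. scal X (c j) (?x j))" .
    have inR: "(\<Sum>j\<in>?I. scal X (c j) (?x j)) \<in> ?R ?top"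
      unfolding eq[symmetric] by (rule e_act_epart[OF X rad_submodule[OF X] iV s])
    have bij: "bij_betw ?x ?I (C ?top)"
      unfolding bij_betw_def
    proof
      have hinj: "j = l" if "j < card ?G" "l < card ?G" "h j = h l" for j l
        using h that by (auto simp: bij_betw_def inj_on_def)
      show "inj_on ?x ?I"
      proof (rule inj_onI)
        fix j l assume jl: "j \<in> ?I" "l \<in> ?I" "?x j = ?x l"
        then have "h j = h l" by (intro prod_eqI) simp_all
        then show "j = l" using jl(1,2) by (intro hinj) simp_all
      qed
      show "?x ` ?I = C ?top"
      proof (intro equalityI subsetI)
        fix y assume "y \<in> ?x ` ?I"
        then obtain j where j: "j < card ?G" "?i j = ?top" "y = ?x j" by auto
        then show "y \<in> C ?top" using hG[OF j(1)] by (auto simp: mem_Sigma_iff split_beta)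
      next
        fix y assume "y \<in> C ?top"
        then have "(?top, y) \<in> h ` {..<card ?G}" using h iV by (auto simp: bij_betw_def)
        then obtain j where j: "j < card ?G" "(?top, y) = h j" by auto
        then have "j \<in> ?I" "y = ?x j" by (auto simp: prod_eq_iff)
        then show "y \<in> ?x ` ?I" by (rule rev_image_eqI)
      qed
    qed
    let ?u = "\<lambda>y. c (the_inv_into ?I ?x y)"
    have inv: "the_inv_into ?I ?x (?x j) = j" if "j \<in> ?I" for j
      by (rule the_inv_into_f_f[OF bij_betw_imp_inj_on[OF bij] that])
    have "(\<Sum>y\<in>C ?top. scal X (?u y) y) = (\<Sum>j\<in>?I. scal X (?u (?x j)) (?x j))"
      by (rule sum.reindex_bij_betw[OF bij, symmetric])
    also have "\<dots> = (\<Sum>j\<in>?I. scal X (c j) (?x j))"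
      by (rule sum.cong[OF refl]) (simp only: inv)
    finally have "(\<Sum>y\<in>C ?top. scal X (?u y) y) \<in> span (B ?top)" using inR BC[of ?top] by simp
    moreover have kI: "k \<in> ?I" using k by simp
    then have "?x k \<in> C ?top" using bij by (auto simp: bij_betw_def)
    ultimately have "?u (?x k) = 0"
      using independent_modulo[OF vector_space_axioms, of "B ?top" "C ?top" ?u "?x k"] BC[of ?top] by simp
    then show "c k = 0" by (simp only: inv[OF kI])
  qed
qed

text \<open>The map sends \<open>\<epsilon> k\<close> to a minimal generator \<open>x k\<close>, and
  is onto by Nakayama. The coordinates of a kernel element are scalars modulo \<open>r\<close>;
  these scalars form a relation between the generators modulo \<open>rad X\<close>, so they vanish,
  and the element lies in the radical.\<close>

lemma cover_construct:
  fixes X :: "('b, 'v::ab_group_add) amod"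
  assumes X: "md X"
  obtains F :: "'b fdmod" and N \<iota> \<epsilon> \<alpha> g where "free_on F N \<iota> \<epsilon> \<alpha>" "g \<in> amod_hom F X" "g ` carr F = carr X"
    "hom_kernel F g \<subseteq> rad F"
proof -
  interpret vector_space "scal X" by (rule amodule_vector_space[OF X])
  obtain N :: nat and \<iota> x where gen: "\<forall>k<N. \<iota> k \<in> V \<and> x k \<in> epart X (carr X) (\<iota> k)"
    "\<forall>U y. submodule X U \<longrightarrow> (\<forall>k<N. x k \<in> U) \<longrightarrow> y \<in> carr X \<longrightarrow> (\<exists>u\<in>U. y - u \<in> rad X)"
    "\<forall>c. (\<Sum>k<N. scal X (c k) (x k)) \<in> rad X \<longrightarrow> (\<forall>k<N. c k = 0)"
    using minimal_generators[OF X] by (elim exE conjE) (rule that)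
  have g1: "\<iota> k \<in> V" "x k \<in> epart X (carr X) (\<iota> k)" if "k < N" for k using gen(1) that by auto
  obtain F :: "'b fdmod" and \<epsilon> \<alpha> where F: "free_on F N \<iota> \<epsilon> \<alpha>" by (rule free_exists[OF g1(1)])
  note FD = free_onD[OF F]
  let ?g = "free_lift F N \<alpha> X x"
  have g: "?g \<in> amod_hom F X" by (rule free_lift(1)[OF F X g1(2)])
  have ge: "?g (\<epsilon> k) = x k" if "k < N" for k by (rule free_lift(2)[OF F X g1(2) that])
  have xc: "x k \<in> carr X" "act X (e (\<iota> k)) (x k) = x k" if "k < N" for k using g1(2)[OF that] by (auto simp: epart_def)
  have surj: "?g ` carr F = carr X"
  proof (rule nakayama[OF X submodule_hom_image[OF FD(1) X g]])
    fix y assume y: "y \<in> carr X"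
    show "\<exists>u\<in>?g ` carr F. y - u \<in> rad X"
    proof (rule gen(2)[rule_format, OF submodule_hom_image[OF FD(1) X g] _ y])
      show "x k \<in> ?g ` carr F" if "k < N" for k
        using imageI[OF FD(3)[OF that], of ?g] by (simp only: ge[OF that])
    qed
  qed
  have "hom_kernel F ?g \<subseteq> rad F"
  proof
    fix a assume "a \<in> hom_kernel F ?g"
    then have a: "a \<in> carr F" "?g a = 0" by (auto simp: hom_kernel_def)
    \<comment> \<open>The coordinate \<open>\<alpha> k a\<close> lies in
      \<open>A e(\<iota> k)\<close>, so modulo \<open>r\<close> it is a multiple of that
      idempotent.\<close>
    have "\<exists>c \<rho>. \<rho> \<in> r \<and> \<alpha> k a = smul c (e (\<iota> k)) + \<rho>" if k: "k < N" for k
      by (rule e_right_decomp[OF FD(2)[OF k], of "\<alpha> k a"]) (use FD(6)[OF k a(1)] in auto)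
    then obtain c \<rho> where cr: "\<And>k. k < N \<Longrightarrow> \<rho> k \<in> r \<and> \<alpha> k a = smul (c k) (e (\<iota> k)) + \<rho> k" by metis
    have "0 = (\<Sum>k<N. act X (\<alpha> k a) (x k))" using a by (simp add: free_lift_def)
    also have "\<dots> = (\<Sum>k<N. scal X (c k) (x k) + act X (\<rho> k) (x k))"
    proof (rule sum.cong[OF refl])
      fix k assume "k \<in> {..<N}"
      then have k: "k < N" by simp
      show "act X (\<alpha> k a) (x k) = scal X (c k) (x k) + act X (\<rho> k) (x k)"
        using cr[OF k] amodule_add_alg[OF X xc(1)[OF k]] amodule_scale_alg[OF X xc(1)[OF k]] xc(2)[OF k] by simp
    qed
    also have "\<dots> = (\<Sum>k<N. scal X (c k) (x k)) + (\<Sum>k<N. act X (\<rho> k) (x k))" by (rule sum.distrib)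
    finally have "(\<Sum>k<N. scal X (c k) (x k)) = - (\<Sum>k<N. act X (\<rho> k) (x k))" by (simp add: eq_neg_iff_add_eq_0)
    moreover have "(\<Sum>k<N. act X (\<rho> k) (x k)) \<in> rad X"
      by (rule subspace_sum_closed[OF vector_space_axioms rad_subspace[OF X]])
        (use cr xc in \<open>auto intro!: rad_gen[OF X]\<close>)
    ultimately have "(\<Sum>k<N. scal X (c k) (x k)) \<in> rad X"
      using vs_subspaceD(5)[OF vector_space_axioms rad_subspace[OF X]] by simp
    then have c0: "c k = 0" if "k < N" for k using gen(3)[rule_format, OF _ that] by blast
    have "a = (\<Sum>k<N. act F (\<alpha> k a) (\<epsilon> k))" using FD(8)[OF a(1)] by simp
    also have "\<dots> \<in> rad F"
    proof (rule subspace_sum_closed[OF amodule_vector_space[OF FD(1)] rad_subspace[OF FD(1)]])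
      fix k assume "k \<in> {..<N}"
      then have k: "k < N" by simp
      have "\<alpha> k a \<in> r" using cr[OF k] c0[OF k] by simp
      then show "act F (\<alpha> k a) (\<epsilon> k) \<in> rad F" by (rule rad_gen[OF FD(1) _ FD(3)[OF k]])
    qed
    finally show "a \<in> rad F" .
  qed
  with F g surj show ?thesis by (rule that)
qed

lemma superfluous_of_rad:
  assumes P: "md P" and K: "K \<subseteq> rad P" and U: "submodule P U" "{x + y | x y. x \<in> U \<and> y \<in> K} = carr P"
  shows "U = carr P"
proof (rule nakayama[OF P U(1)])
  fix x assume "x \<in> carr P"
  then have "x \<in> {x + y | x y. x \<in> U \<and> y \<in> K}" using U(2) by simp
  then obtain u y where "x = u + y" "u \<in> U" "y \<in> K" by auto
  then show "\<exists>u\<in>U. x - u \<in> rad P" using K by (intro bexI[of _ u]) auto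
qed

text \<open>The cover \<open>g\<close> from a sum of modules \<open>A e_i\<close> splits by
  projectivity. Its kernel lies in the radical, so the image of the splitting is everything modulo
  the radical; by Nakayama the splitting is onto and \<open>g\<close> is an isomorphism.\<close>

lemma projective_free:
  fixes P :: "'b fdmod"
  assumes P: "projective_module smul mu P"
  obtains N \<iota> \<epsilon> \<alpha> where "free_on P N \<iota> \<epsilon> \<alpha>"
proof -
  have Pm: "md P" using P by (simp add: projective_module_def)
  obtain F :: "'b fdmod" and N \<iota> \<epsilon> \<alpha> g where F: "free_on F N \<iota> \<epsilon> \<alpha>" and g: "g \<in> amod_hom F P" "g ` carr F = carr P"
    "hom_kernel F g \<subseteq> rad F"
    by (rule cover_construct[OF Pm])
  have Fm: "md F" by (rule free_onD(1)[OF F])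
  let ?id = "\<lambda>x. if x \<in> carr P then x else 0"
  note PD = vs_subspaceD[OF amodule_vector_space[OF Pm] amodule_subspace[OF Pm]]
  have id: "?id \<in> amod_hom P P" by (rule amod_homI) (simp_all add: PD amodule_closed[OF Pm])
  have "\<forall>(X :: 'b fdmod) (Y :: 'b fdmod). md X \<and> md Y \<longrightarrow>
      (\<forall>p\<in>amod_hom X Y. p ` carr X = carr Y \<longrightarrow>
        (\<forall>f\<in>amod_hom P Y. \<exists>g\<in>amod_hom P X. \<forall>x\<in>carr P. p (g x) = f x))"
    using P unfolding projective_module_def by (rule conjunct2)
  from this[rule_format, OF conjI[OF Fm Pm] g(1,2) id]
  obtain s where s: "s \<in> amod_hom P F" and s': "\<forall>x\<in>carr P. g (s x) = ?id x" by (elim bexE) (rule that)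
  have gs: "g (s x) = x" if "x \<in> carr P" for x using s' that by simp
  note gD = lin_on_props[OF amodule_vector_space[OF Fm] amodule_vector_space[OF Pm] amodule_subspace[OF Fm] amod_homD(2)[OF g(1)]]
  note FDs = vs_subspaceD[OF amodule_vector_space[OF Fm] amodule_subspace[OF Fm]]
  have sur: "s ` carr P = carr F"
  proof (rule nakayama[OF Fm submodule_hom_image[OF Pm Fm s(1)]])
    fix x assume x: "x \<in> carr F"
    have gx: "g x \<in> carr P" by (rule amod_homD(1)[OF g(1) x])
    have sx: "s (g x) \<in> carr F" by (rule amod_homD(1)[OF s(1) gx])
    have "g (x - s (g x)) = 0" using gD(4)[OF x sx] gs[OF gx] by simp
    then have "x - s (g x) \<in> hom_kernel F g" using FDs(3)[OF x sx] by (simp add: hom_kernel_def)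
    then show "\<exists>u\<in>s ` carr P. x - u \<in> rad F" using g(3) gx by (intro bexI[of _ "s (g x)"]) auto
  qed
  have sg: "s (g x) = x" if "x \<in> carr F" for x
  proof -
    have "x \<in> s ` carr P" using that sur by simp
    then obtain y where "y \<in> carr P" "x = s y" by auto
    then show ?thesis using gs by simp
  qed
  have "free_on P N \<iota> (\<lambda>k. g (\<epsilon> k)) (\<lambda>k t. \<alpha> k (s t))"
    by (rule free_iso[OF F Pm g(1) s(1)]) (rule gs sg, assumption)+
  then show ?thesis by (rule that)
qed

lemma cover_kernel_rad:
  fixes M :: "('b, 'v::ab_group_add) amod"
  assumes M: "md M" and P: "projective_cover smul mu P M p"
  shows "hom_kernel P p \<subseteq> rad P"
proof (rule ccontr)
  have Pm: "md P" and p: "p \<in> amod_hom P M"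
    and sf: "\<And>U. submodule P U \<Longrightarrow> {x + y | x y. x \<in> U \<and> y \<in> hom_kernel P p} = carr P \<Longrightarrow> U = carr P"
    using P by (auto simp: projective_cover_def projective_module_def)
  interpret vector_space "scal P" by (rule amodule_vector_space[OF Pm])
  note PD = vs_subspaceD[OF vector_space_axioms amodule_subspace[OF Pm]]
  have K: "submodule P (hom_kernel P p)" by (rule submodule_hom_kernel[OF Pm M p])
  then have Ks: "subspace (hom_kernel P p)" "hom_kernel P p \<subseteq> carr P"
    "\<And>a x. x \<in> hom_kernel P p \<Longrightarrow> act P a x \<in> hom_kernel P p"
    by (auto simp: submodule_def)
  assume "\<not> hom_kernel P p \<subseteq> rad P"
  then obtain z where z: "z \<in> hom_kernel P p" "z \<notin> rad P" by blast
  have zc: "z \<in> carr P" using z Ks by blast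
  have "\<exists>i\<in>V. act P (e i) z \<notin> rad P"
  proof (rule ccontr)
    assume "\<not> ?thesis"
    then have "(\<Sum>i\<in>V. act P (e i) z) \<in> rad P"
      by (intro subspace_sum_closed[OF vector_space_axioms rad_subspace[OF Pm]]) auto
    then show False using z(2) e_split[OF Pm zc] by simp
  qed
  then obtain i where i: "i \<in> V" "act P (e i) z \<notin> rad P" by blast
  let ?z = "act P (e i) z"
  obtain l :: "_ \<Rightarrow> complex" where l: "Vector_Spaces.linear (scal P) (*) l" "\<forall>u\<in>rad P. l u = 0" "l ?z = 1"
    by (rule separating_functional[OF vector_space_axioms rad_subspace[OF Pm] i(2)])
  interpret l: Vector_Spaces.linear "scal P" "(*)" l by (rule l(1))
  \<comment> \<open>A subspace of codimension one. It is a submodule because \<open>e i\<close>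
    times an element of the algebra is a multiple of \<open>e i\<close> modulo \<open>r\<close>, and
    \<open>l\<close> vanishes on the radical.\<close>
  let ?U = "{x \<in> carr P. l (act P (e i) x) = 0}"
  have zz: "?z \<in> carr P" "act P (e i) ?z = ?z" "?z \<in> hom_kernel P p"
    using amodule_closed[OF Pm zc] amodule_mult[OF Pm zc, of "e i" "e i"] e_idem[OF i(1)] Ks(3)[OF z(1)] by auto
  have "submodule P ?U"
    unfolding submodule_def
  proof (intro conjI allI ballI)
    show "subspace ?U"
      by (rule subspaceI) (auto simp: PD act_zero[OF Pm] amodule_add[OF Pm] amodule_scale[OF Pm] l.add l.scale)
    fix a x assume x: "x \<in> ?U"
    then have xc: "x \<in> carr P" by simp
    obtain c \<rho> where c: "\<rho> \<in> r" "mu (e i) a = smul c (e i) + \<rho>" by (rule e_left_decomp[OF i(1)])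
    have "act P (e i) (act P a x) = scal P c (act P (e i) x) + act P \<rho> x"
      unfolding amodule_mult[OF Pm xc, symmetric] c(2) amodule_add_alg[OF Pm xc] amodule_scale_alg[OF Pm xc] ..
    then have "l (act P (e i) (act P a x)) = c * l (act P (e i) x) + l (act P \<rho> x)"
      by (simp add: l.add l.scale)
    then show "act P a x \<in> ?U" using x bspec[OF l(2) rad_gen[OF Pm c(1) xc]] amodule_closed[OF Pm xc] by simp
  qed auto
  moreover have "{x + y | x y. x \<in> ?U \<and> y \<in> hom_kernel P p} = carr P"
  proof (intro equalityI subsetI)
    fix x assume "x \<in> {x + y | x y. x \<in> ?U \<and> y \<in> hom_kernel P p}"
    then show "x \<in> carr P" using Ks(2) PD(2) by auto
  next
    fix x assume x: "x \<in> carr P"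
    \<comment> \<open>The multiple of \<open>?z\<close> with the same value under the functional
      that defines \<open>?U\<close>.\<close>
    let ?y = "scal P (l (act P (e i) x)) ?z"
    have y: "?y \<in> hom_kernel P p" "?y \<in> carr P"
      using vs_subspaceD(4)[OF vector_space_axioms Ks(1) zz(3)] Ks(2) by auto
    have "x - ?y \<in> ?U"
      using PD(3)[OF x y(2)] act_diff[OF Pm x y(2), of "e i"] amodule_scale[OF Pm zz(1)] zz(2)
      by (simp add: l.diff l.scale l(3))
    then show "x \<in> {x + y | x y. x \<in> ?U \<and> y \<in> hom_kernel P p}"
      using y(1) by (intro CollectI exI[of _ "x - ?y"] exI[of _ ?y]) simp
  qed
  ultimately have "?U = carr P" by (rule sf)
  then have "?z \<in> ?U" using zz(1) by simp
  then show False using zz(2) l(3) by simp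
qed

lemma projective_cover_exists:
  fixes X :: "('b, 'v::ab_group_add) amod"
  assumes X: "md X" obtains P p where "projective_cover smul mu P X p"
proof -
  obtain F :: "'b fdmod" and N \<iota> \<epsilon> \<alpha> g where F: "free_on F N \<iota> \<epsilon> \<alpha>" and g: "g \<in> amod_hom F X" "g ` carr F = carr X"
    "hom_kernel F g \<subseteq> rad F"
    by (rule cover_construct[OF X])
  have "projective_cover smul mu F X g"
    unfolding projective_cover_def
    using free_projective[OF F] g superfluous_of_rad[OF free_onD(1)[OF F] g(3)] by (intro conjI allI impI) auto
  then show ?thesis by (rule that)
qed

section \<open>Duality into the algebra, and existence of transposes\<close>

lemma op_amodule_star:
  fixes P :: "('b, 'v::ab_group_add) amod"
  assumes P: "md P" shows "amodule smul (\<lambda>a b. mu b a) (star_module smul mu P)"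
proof -
  have sc: "scal (star_module smul mu P) = pointwise_scale smul"
    by (simp add: star_module_def pointwise_scale_def)
  have car: "carr (star_module smul mu P) = amod_hom P reg" by (simp add: star_module_def)
  have ac: "act (star_module smul mu P) = (\<lambda>b f x. mu (f x) b)" by (simp add: star_module_def)
  show ?thesis
  proof (rule amoduleI, unfold sc car ac)
    show "vector_space (pointwise_scale smul)" by (rule vector_space_pointwise_scale[OF smul_vs])
    show "fd_subspace (pointwise_scale smul) (amod_hom P reg)"
      using amod_hom_fd[OF P reg_amodule] by simp
    fix f b assume f: "f \<in> amod_hom P reg"
    show "(\<lambda>x. mu (f x) b) \<in> amod_hom P reg"
      by (rule amod_homI)
        (use amod_homD[OF f] in \<open>auto simp: lin_on_def mu_add_left mu_smul_left mu_assoc\<close>)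
  qed (auto simp: fun_eq_iff mu_add_left mu_add_right mu_smul_left mu_smul_right mu_assoc mu_one_right pointwise_scale_def)
qed

lemma star_hom:
  fixes f :: "'v::ab_group_add \<Rightarrow> 'w::ab_group_add"
  assumes P: "md P" and P': "md P'" and f: "f \<in> amod_hom P' P"
  shows "(\<lambda>\<phi>. \<phi> \<circ> f) ` carr (star_module smul mu P) \<subseteq> carr (star_module smul mu P')"
    "submodule (star_module smul mu P') ((\<lambda>\<phi>. \<phi> \<circ> f) ` carr (star_module smul mu P))"
proof -
  have sc: "scal (star_module smul mu Q) = pointwise_scale smul" for Q :: "('b, 'q::ab_group_add) amod"
    by (simp add: star_module_def pointwise_scale_def)
  have car: "carr (star_module smul mu Q) = amod_hom Q reg" for Q :: "('b, 'q::ab_group_add) amod" by (simp add: star_module_def)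
  have ac: "act (star_module smul mu Q) = (\<lambda>b f x. mu (f x) b)" for Q :: "('b, 'q::ab_group_add) amod" by (simp add: star_module_def)
  have cf: "\<phi> \<circ> f \<in> amod_hom P' reg" if "\<phi> \<in> amod_hom P reg" for \<phi>
    by (rule amod_homI)
      (use amod_homD[OF f] amod_homD[OF that] amod_hom_zero[OF P reg_amodule that] in \<open>auto simp: lin_on_def\<close>)
  then show sub: "(\<lambda>\<phi>. \<phi> \<circ> f) ` carr (star_module smul mu P) \<subseteq> carr (star_module smul mu P')"
    unfolding car by blast
  show "submodule (star_module smul mu P') ((\<lambda>\<phi>. \<phi> \<circ> f) ` carr (star_module smul mu P))"
    unfolding submodule_def
  proof (intro conjI allI ballI)
    show "module.subspace (scal (star_module smul mu P')) ((\<lambda>\<phi>. \<phi> \<circ> f) ` carr (star_module smul mu P))"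
      by (rule subspace_image_lin_on(1)[OF amodule_vector_space[OF op_amodule_star[OF P]] amodule_vector_space[OF op_amodule_star[OF P']]
         amodule_subspace[OF op_amodule_star[OF P]]])
        (rule lin_onI, auto simp: sc pointwise_scale_def fun_eq_iff)
    fix a \<psi> assume "\<psi> \<in> (\<lambda>\<phi>. \<phi> \<circ> f) ` carr (star_module smul mu P)"
    then obtain \<phi> where \<phi>: "\<phi> \<in> carr (star_module smul mu P)" "\<psi> = \<phi> \<circ> f" by auto
    have "act (star_module smul mu P') a \<psi> = act (star_module smul mu P) a \<phi> \<circ> f"
      by (auto simp: ac \<phi>(2) fun_eq_iff)
    then show "act (star_module smul mu P') a \<psi> \<in> (\<lambda>\<phi>. \<phi> \<circ> f) ` carr (star_module smul mu P)"
      using imageI[OF amodule_closed[OF op_amodule_star[OF P] \<phi>(1)], of "\<lambda>\<phi>. \<phi> \<circ> f"] by simp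
  qed (use sub in auto)
qed

text \<open>Since the transpose is a choice, this is the sole access to it. Covers of
  \<open>X\<close> and of the kernel of the first cover give the presentation, and the cokernel is
  realised on coordinates.\<close>

lemma transpose_exists:
  fixes X :: "('b, 'v::ab_group_add) amod"
  assumes X: "md X" shows "is_transpose smul mu X (transpose_module smul mu X)"
proof -
  obtain P0 g where P0: "projective_cover smul mu P0 X g" by (rule projective_cover_exists[OF X])
  have P0m: "md P0" and g: "g \<in> amod_hom P0 X" using P0 by (auto simp: projective_cover_def projective_module_def)
  let ?\<Omega> = "P0\<lparr>carr := hom_kernel P0 g\<rparr>"
  have \<Omega>: "md ?\<Omega>" by (rule submodule_amodule[OF P0m submodule_hom_kernel[OF P0m X g]])
  obtain P1 f where P1: "projective_cover smul mu P1 ?\<Omega> f" by (rule projective_cover_exists[OF \<Omega>])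
  have P1m: "md P1" and f: "f \<in> amod_hom P1 ?\<Omega>" using P1 by (auto simp: projective_cover_def projective_module_def)
  have f': "f \<in> amod_hom P1 P0" using f by (auto simp: amod_hom_def hom_kernel_def)
  obtain T :: "'b fdmod" and q where T: "amodule smul (\<lambda>a b. mu b a) T" "q \<in> amod_hom (star_module smul mu P1) T"
      "q ` carr (star_module smul mu P1) = carr T"
      "hom_kernel (star_module smul mu P1) q = (\<lambda>\<phi>. \<phi> \<circ> f) ` carr (star_module smul mu P0)"
    by (rule quotient_module_exists[OF op_amodule_star[OF P1m] star_hom(2)[OF P0m P1m f']])
  have "is_transpose smul mu X T"
    unfolding is_transpose_def minimal_projective_presentation_def is_cokernel_def
    using T P0 P1 by (intro conjI exI[of _ P1] exI[of _ P0] exI[of _ f] exI[of _ g] bexI[of _ q]) auto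
  then show ?thesis unfolding transpose_module_def by (rule someI)
qed

end

section \<open>Homomorphisms into the dual of the transpose\<close>

lemma dual_simps:
  "carr (dual_module M) = functionals (scal M) (carr M) {}" "scal (dual_module M) = cscale"
  "act (dual_module M) = (\<lambda>a \<phi> x. if x \<in> carr M then \<phi> (act M a x) else 0)"
  by (auto simp: dual_module_def functionals_def lin_on_def)

lemma functionalsD:
  assumes "\<phi> \<in> functionals s S U"
  shows "lin_on s (*) S \<phi>" "x \<notin> S \<Longrightarrow> \<phi> x = 0" "u \<in> U \<Longrightarrow> \<phi> u = 0"
  using assms by (auto simp: functionals_def)

lemma dual_amodule:
  assumes M: "amodule smul mu M" shows "amodule smul (\<lambda>a b. mu b a) (dual_module M)"
proof (rule amoduleI, unfold dual_simps)
  note MD = vs_subspaceD[OF amodule_vector_space[OF M] amodule_subspace[OF M]]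
  interpret vector_space "scal M" by (rule amodule_vector_space[OF M])
  show "vector_space cscale" by (rule vector_space_cscale)
  \<comment> \<open>The dimension result asks for a subspace, so the empty set is replaced by zero,
    where linear maps vanish anyway.\<close>
  have "functionals (scal M) (carr M) {} = functionals (scal M) (carr M) {0}"
  proof (intro equalityI subsetI)
    fix \<phi> assume "\<phi> \<in> functionals (scal M) (carr M) {}"
    then show "\<phi> \<in> functionals (scal M) (carr M) {0}"
      using lin_on_props(1)[OF amodule_vector_space[OF M] vector_space_times amodule_subspace[OF M], of \<phi>]
      by (auto simp: functionals_def)
  qed (auto simp: functionals_def)
  then show "fd_subspace cscale (functionals (scal M) (carr M) {})"
    using dim_functionals(2)[OF amodule_vector_space[OF M] amodule_fd[OF M] subspace_single_0] MD(1) by simp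
  fix a \<phi> assume p: "\<phi> \<in> functionals (scal M) (carr M) {}"
  show "(\<lambda>x. if x \<in> carr M then \<phi> (act M a x) else 0) \<in> functionals (scal M) (carr M) {}"
    using p MD amodule_closed[OF M] amodule_add[OF M] amodule_scale[OF M]
    by (auto simp: functionals_def lin_on_def)
  note l = functionalsD[OF p] and fD = functionalsD(1)[OF p, unfolded lin_on_def]
  show "(\<lambda>x. if x \<in> carr M then \<phi> (act M 1 x) else 0) = \<phi>"
    using l(2) amodule_one[OF M] by (auto simp: fun_eq_iff)
  show "(\<lambda>x. if x \<in> carr M then \<phi> (act M (a + b) x) else 0) =
    (\<lambda>x. if x \<in> carr M then \<phi> (act M a x) else 0) + (\<lambda>x. if x \<in> carr M then \<phi> (act M b x) else 0)" for b
    using fD amodule_add_alg[OF M] amodule_closed[OF M] by (auto simp: fun_eq_iff)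
  show "(\<lambda>x. if x \<in> carr M then \<phi> (act M (smul c a) x) else 0) =
    cscale c (\<lambda>x. if x \<in> carr M then \<phi> (act M a x) else 0)" for c
    using fD amodule_scale_alg[OF M] amodule_closed[OF M] by (auto simp: fun_eq_iff cscale_apply)
  show "(\<lambda>x. if x \<in> carr M then \<phi> (act M (mu b a) x) else 0) =
     (\<lambda>x. if x \<in> carr M then if act M a x \<in> carr M then \<phi> (act M b (act M a x)) else 0 else 0)" for b
    using amodule_mult[OF M] amodule_closed[OF M] by (auto simp: fun_eq_iff)
qed (auto simp: fun_eq_iff cscale_apply)

section \<open>Multiplicities in projective modules\<close>

context basic_algebra begin

text \<open>Evaluation at the generators identifies the maps from \<open>A e(\<iota> k)\<close> to
  \<open>Y\<close> with \<open>e(\<iota> k) Y\<close>; \<open>free_lift\<close> is the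
  inverse.\<close>

lemma dim_hom_free:
  fixes Y :: "('b, 'w::ab_group_add) amod" and P :: "('b, 'v::ab_group_add) amod"
  assumes F: "free_on P N \<iota> \<epsilon> \<alpha>" and Y: "md Y"
  shows "amod_hom_dim P Y = (\<Sum>k<N. vector_space.dim (scal Y) (epart Y (carr Y) (\<iota> k)))"
proof -
  interpret Yv: vector_space "scal Y" by (rule amodule_vector_space[OF Y])
  note FD = free_onD[OF F]
  note ES = epart_subspace[OF Y amodule_subspace[OF Y] order_refl]
  let ?S = "\<lambda>k. epart Y (carr Y) (\<iota> k)"
  have vp: "vector_space (pointwise_scale (scal Y) :: _ \<Rightarrow> ('k \<Rightarrow> 'w) \<Rightarrow> _)"
    by (rule vector_space_pointwise_scale[OF amodule_vector_space[OF Y]])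
  have "amod_hom_dim P Y = vector_space.dim (pointwise_scale (scal Y)) (fun_space {..<N} ?S)"
    unfolding amod_hom_dim_eq
  proof (rule dim_iso[where f = "\<lambda>h k. if k < N then h (\<epsilon> k) else 0" and g = "free_lift P N \<alpha> Y"])
    show "module.subspace (pointwise_scale (scal Y)) (amod_hom P Y)"
      by (rule subspace_fd[OF vp amod_hom_fd[OF FD(1) Y]])
    show "lin_on (pointwise_scale (scal Y)) (pointwise_scale (scal Y)) (amod_hom P Y) (\<lambda>h k. if k < N then h (\<epsilon> k) else 0)"
      by (intro lin_onI) (auto simp: pointwise_scale_def fun_eq_iff)
  next
    fix h assume h: "h \<in> amod_hom P Y"
    have e: "h (\<epsilon> k) \<in> ?S k" if "k < N" for k
      using amod_homD(3)[OF h FD(3)[OF that], of "e (\<iota> k)"] amod_homD(1)[OF h FD(3)[OF that]] FD(4)[OF that]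
      by (simp add: epart_def)
    then show "(\<lambda>k. if k < N then h (\<epsilon> k) else 0) \<in> fun_space {..<N} ?S" by (simp add: fun_space_def)
    show "free_lift P N \<alpha> Y (\<lambda>k. if k < N then h (\<epsilon> k) else 0) = h"
    proof
      fix x show "free_lift P N \<alpha> Y (\<lambda>k. if k < N then h (\<epsilon> k) else 0) x = h x"
      proof (cases "x \<in> carr P")
        case True
        then show ?thesis unfolding hom_free_unique[OF F Y h True] by (simp add: free_lift_def)
      qed (simp add: free_lift_def amod_homD(4)[OF h])
    qed
  next
    fix y assume "y \<in> fun_space {..<N} ?S"
    then have y: "\<And>k. k < N \<Longrightarrow> y k \<in> ?S k" "\<And>k. \<not> k < N \<Longrightarrow> y k = 0" by (auto simp: fun_space_def)
    show "free_lift P N \<alpha> Y y \<in> amod_hom P Y" by (rule free_lift(1)[OF F Y y(1)])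
    show "(\<lambda>k. if k < N then free_lift P N \<alpha> Y y (\<epsilon> k) else 0) = y"
      using free_lift(2)[OF F Y y(1)] y(2) by (auto simp: fun_eq_iff)
  qed (rule vp)+
  then show ?thesis
    using fun_space_finite[OF amodule_vector_space[OF Y], of "{..<N}" ?S] ES(2) by simp
qed

text \<open>Together with \<open>rad_free\<close> this describes \<open>rad P\<close> as the set of
  elements all of whose coordinates lie in \<open>r\<close>.\<close>

lemma alpha_rad:
  assumes F: "free_on P N \<iota> \<epsilon> \<alpha>" and k: "k < N" and x: "x \<in> rad P" shows "\<alpha> k x \<in> r"
proof -
  have "rad reg \<subseteq> r"
    by (rule rad_induct[OF reg_amodule]) (simp_all add: r_subspace r_right)
  then show ?thesis using rad_hom[OF free_onD(1)[OF F] reg_amodule free_onD(5)[OF F k] x] by blast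
qed

lemma rad_free:
  assumes F: "free_on P N \<iota> \<epsilon> \<alpha>" and x: "x \<in> carr P" "\<And>k. k < N \<Longrightarrow> \<alpha> k x \<in> r" shows "x \<in> rad P"
proof -
  note FD = free_onD[OF F]
  have "(\<Sum>k<N. act P (\<alpha> k x) (\<epsilon> k)) \<in> rad P"
    by (rule subspace_sum_closed[OF amodule_vector_space[OF FD(1)] rad_subspace[OF FD(1)]])
      (use x(2) FD(3) in \<open>auto intro!: rad_gen[OF FD(1)]\<close>)
  then show ?thesis using FD(8)[OF x(1)] by simp
qed

text \<open>The top of \<open>A e_j\<close> is one-dimensional and supported at \<open>j\<close>, so
  \<open>e_i (P / rad P)\<close> has one dimension for each summand with
  \<open>\<iota> k = i\<close>. This expresses multiplicities by dimensions that behave well under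
  maps.\<close>

lemma dim_epart_free:
  fixes P :: "('b, 'v::ab_group_add) amod"
  assumes F: "free_on P N \<iota> \<epsilon> \<alpha>" and i: "i \<in> V"
  shows "vector_space.dim (scal P) (epart P (carr P) i) =
    card {k. k < N \<and> \<iota> k = i} + vector_space.dim (scal P) (epart P (rad P) i)"
proof -
  note FD = free_onD[OF F]
  note ES = epart_subspace[OF FD(1) amodule_subspace[OF FD(1)] order_refl]
  note PD = vs_subspaceD[OF amodule_vector_space[OF FD(1)] amodule_subspace[OF FD(1)]]
  let ?K = "{k. k < N \<and> \<iota> k = i}" and ?E = "epart P (carr P) i"
  \<comment> \<open>\<open>\<theta>\<close> reads off the coefficient of \<open>e i\<close> modulo
    \<open>r\<close>. Applied to the coordinates at \<open>?K\<close> it realises the projection to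
    the top.\<close>
  obtain \<theta> :: "'b \<Rightarrow> complex" where \<theta>: "Vector_Spaces.linear smul (*) \<theta>" "\<forall>u\<in>r. \<theta> u = 0" "\<theta> (e i) = 1"
    by (rule separating_functional[OF smul_vs r_subspace e_notin_r[OF i]])
  interpret \<theta>: Vector_Spaces.linear smul "(*)" \<theta> by (rule \<theta>(1))
  let ?f = "\<lambda>x k. if k \<in> ?K then \<theta> (\<alpha> k x) else 0"
  have lin: "lin_on (scal P) cscale ?E ?f"
  proof (rule lin_onI)
    fix x y assume "x \<in> ?E" "y \<in> ?E"
    then have xy: "x \<in> carr P" "y \<in> carr P" by (auto simp: epart_def)
    have "\<alpha> k (x + y) = \<alpha> k x + \<alpha> k y" if "k < N" for k
      using amod_homD(2)[OF FD(5)[OF that]] xy unfolding lin_on_def by blast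
    then show "?f (x + y) = ?f x + ?f y" by (auto simp: fun_eq_iff \<theta>.add)
  next
    fix c x assume "x \<in> ?E"
    then have x: "x \<in> carr P" by (auto simp: epart_def)
    have "\<alpha> k (scal P c x) = smul c (\<alpha> k x)" if "k < N" for k
      using amod_homD(2)[OF FD(5)[OF that]] x unfolding lin_on_def by simp
    then show "?f (scal P c x) = cscale c (?f x)" by (auto simp: fun_eq_iff \<theta>.scale cscale_apply)
  qed
  have "?f ` ?E = supp_on ?K"
  proof (intro equalityI subsetI)
    fix t assume t: "t \<in> supp_on ?K"
    let ?x = "\<Sum>k\<in>?K. scal P (t k) (\<epsilon> k)"
    have ec: "scal P (t k) (\<epsilon> k) \<in> carr P" if "k \<in> ?K" for k using FD(3) PD(4) that by auto
    have xc: "?x \<in> carr P"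
      by (rule subspace_sum_closed[OF amodule_vector_space[OF FD(1)] amodule_subspace[OF FD(1)] ec])
    have "act P (e i) ?x = (\<Sum>k\<in>?K. act P (e i) (scal P (t k) (\<epsilon> k)))" by (rule act_sum[OF FD(1) ec])
    also have "\<dots> = ?x"
      by (rule sum.cong[OF refl]) (use FD(3,4) in \<open>auto simp: amodule_scale[OF FD(1)]\<close>)
    finally have xE: "?x \<in> ?E" using xc by (simp add: epart_def)
    have "?f ?x = t"
    proof
      fix l
      show "?f ?x l = t l"
      proof (cases "l \<in> ?K")
        case True
        then have l: "l < N" "\<iota> l = i" by auto
        have "\<alpha> l ?x = (\<Sum>k\<in>?K. \<alpha> l (scal P (t k) (\<epsilon> k)))"
          by (rule amod_hom_sum[OF FD(1) reg_amodule FD(5)[OF l(1)] ec])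
        also have "\<dots> = (\<Sum>k\<in>?K. if l = k then smul (t k) (e i) else 0)"
        proof (rule sum.cong[OF refl])
          fix k assume "k \<in> ?K"
          then have k: "k < N" by simp
          have "\<alpha> l (scal P (t k) (\<epsilon> k)) = smul (t k) (\<alpha> l (\<epsilon> k))"
            using amod_homD(2)[OF FD(5)[OF l(1)]] FD(3)[OF k] unfolding lin_on_def by simp
          then show "\<alpha> l (scal P (t k) (\<epsilon> k)) = (if l = k then smul (t k) (e i) else 0)"
            using FD(7)[OF l(1) k] l(2) by (cases "l = k") auto
        qed
        also have "\<dots> = smul (t l) (e i)" using True by (simp add: sum.delta')
        finally show ?thesis using True \<theta>(3) by (simp add: \<theta>.scale)
      qed (use t in \<open>auto simp: supp_on_def\<close>)
    qed
    then show "t \<in> ?f ` ?E" using xE by (rule image_eqI[OF sym])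
  qed (auto simp: supp_on_def)
  moreover have "{x \<in> ?E. ?f x = 0} = epart P (rad P) i"
  proof (intro equalityI subsetI)
    fix x assume "x \<in> {x \<in> ?E. ?f x = 0}"
    then have x: "x \<in> carr P" "act P (e i) x = x" "?f x = 0" by (auto simp: epart_def)
    have "\<alpha> k x \<in> r" if k: "k < N" for k
    proof -
      have a1: "mu (e i) (\<alpha> k x) = \<alpha> k x" using amod_homD(3)[OF FD(5)[OF k] x(1), of "e i"] x(2) by simp
      have a2: "mu (\<alpha> k x) (e (\<iota> k)) = \<alpha> k x" by (rule FD(6)[OF k x(1)])
      obtain c \<rho> where c: "\<rho> \<in> r" "mu (e i) (\<alpha> k x) = smul c (e i) + \<rho>" by (rule e_left_decomp[OF i])
      have a3: "\<alpha> k x = smul c (mu (e i) (e (\<iota> k))) + mu \<rho> (e (\<iota> k))"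
      proof -
        have "mu (\<alpha> k x) (e (\<iota> k)) = mu (smul c (e i) + \<rho>) (e (\<iota> k))" using a1 c(2) by simp
        then show ?thesis unfolding a2 by (simp add: mu_add_left mu_smul_left)
      qed
      show ?thesis
      proof (cases "\<iota> k = i")
        case True
        then have "\<alpha> k x = smul c (e i) + mu \<rho> (e i)" using a3 e_idem[OF i] by simp
        moreover have "\<theta> (\<alpha> k x) = 0" using fun_cong[OF x(3), of k] k True by simp
        ultimately have "c = 0" using bspec[OF \<theta>(2) r_right[OF c(1), of "e i"]] \<theta>(3)
          by (simp add: \<theta>.add \<theta>.scale)
        then show ?thesis using a3 r_right[OF c(1)] by simp
      next
        \<comment> \<open>Orthogonality puts \<open>e_i A e_j\<close> inside \<open>r\<close> for
          different vertices, so these coordinates contribute nothing to the top.\<close>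
        case False
        then show ?thesis using a3 e_orth[OF i FD(2)[OF k]] r_right[OF c(1)] by simp
      qed
    qed
    then show "x \<in> epart P (rad P) i" using rad_free[OF F x(1)] x(2) by (simp add: epart_def)
  next
    fix x assume "x \<in> epart P (rad P) i"
    then have x: "x \<in> rad P" "act P (e i) x = x" by (auto simp: epart_def)
    have "?f x = 0" using alpha_rad[OF F _ x(1)] \<theta>(2) by (auto simp: fun_eq_iff)
    then show "x \<in> {x \<in> ?E. ?f x = 0}" using x rad_sub[OF FD(1)] by (auto simp: epart_def)
  qed
  moreover have "finite ?K" by simp
  ultimately show ?thesis
    using rank_nullity[OF amodule_vector_space[OF FD(1)] vector_space_cscale ES(2) lin] supp_on_finite(2)[of ?K]
    by simp
qed

text \<open>The right module \<open>e_i r\<close>, encoded as a module for the opposite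
  multiplication. Its dual is a left module that does not depend on the point of the
  variety.\<close>

definition er_module :: "nat \<Rightarrow> ('b, 'b) amod" where
  "er_module i = \<lparr>carr = {\<rho> \<in> r. mu (e i) \<rho> = \<rho>}, scal = smul, act = \<lambda>b \<rho>. mu \<rho> b\<rparr>"

lemma er_simps:
  "carr (er_module i) = {\<rho> \<in> r. mu (e i) \<rho> = \<rho>}" "scal (er_module i) = smul" "act (er_module i) = (\<lambda>b \<rho>. mu \<rho> b)"
  by (simp_all add: er_module_def)

lemma er_amodule: "amodule smul (\<lambda>a b. mu b a) (er_module i)"
proof (rule amoduleI, unfold er_simps)
  show "vector_space smul" by (rule smul_vs)
  have "alg.subspace {\<rho> \<in> r. mu (e i) \<rho> = \<rho>}"
    by (rule alg.subspaceI) (auto simp: r_zero r_add r_smul mu_add_right mu_smul_right)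
  then show "fd_subspace smul {\<rho> \<in> r. mu (e i) \<rho> = \<rho>}"
    by (rule fd_subset(1)[OF smul_vs alg_fd]) simp
qed (auto simp: mu_add_left mu_add_right mu_smul_left mu_smul_right mu_one_right r_right mu_assoc simp flip: mu_assoc)

end

lemma functional_lin:
  assumes "vector_space s" "module.subspace s S" "\<phi> \<in> functionals s S U"
  shows "x \<in> S \<Longrightarrow> y \<in> S \<Longrightarrow> \<phi> (x + y) = \<phi> x + \<phi> y" "x \<in> S \<Longrightarrow> \<phi> (s c x) = c * \<phi> x"
    "x \<in> S \<Longrightarrow> y \<in> S \<Longrightarrow> \<phi> (x - y) = \<phi> x - \<phi> y" "(\<And>k. k \<in> K \<Longrightarrow> v k \<in> S) \<Longrightarrow> \<phi> (\<Sum>k\<in>K. v k) = (\<Sum>k\<in>K. \<phi> (v k))"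
    "\<phi> 0 = 0"
proof -
  note p = lin_on_props[OF assms(1) vector_space_times assms(2) functionalsD(1)[OF assms(3)]]
  show "x \<in> S \<Longrightarrow> y \<in> S \<Longrightarrow> \<phi> (x + y) = \<phi> x + \<phi> y" by (rule p(2))
  show "x \<in> S \<Longrightarrow> \<phi> (s c x) = c * \<phi> x" by (rule p(3))
  show "x \<in> S \<Longrightarrow> y \<in> S \<Longrightarrow> \<phi> (x - y) = \<phi> x - \<phi> y" by (rule p(4))
  show "(\<And>k. k \<in> K \<Longrightarrow> v k \<in> S) \<Longrightarrow> \<phi> (\<Sum>k\<in>K. v k) = (\<Sum>k\<in>K. \<phi> (v k))" by (rule p(5))
  show "\<phi> 0 = 0" by (rule p(1))
qed

section \<open>Balanced forms as functionals\<close>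

context basic_algebra begin

text \<open>For \<open>X = P / \<Omega>\<close> with \<open>P\<close> projective, balanced forms on \<open>e\<^sub>i r \<times> X\<close> are functionals on
  \<open>e\<^sub>i rad P / e\<^sub>i rad \<Omega>\<close>, because \<open>e\<^sub>i r \<otimes> P \<rightarrow> e\<^sub>i P\<close> is injective.\<close>

lemma dim_hom_dual_er:
  fixes P :: "('b, 'u::ab_group_add) amod" and X :: "('b, 'v::ab_group_add) amod"
  assumes F: "free_on P N \<iota> \<epsilon> \<alpha>" and X: "md X" and g: "g \<in> amod_hom P X" "g ` carr P = carr X" and i: "i \<in> V"
  defines "\<Omega> \<equiv> P\<lparr>carr := hom_kernel P g\<rparr>"
  shows "amod_hom_dim X (dual_module (er_module i)) + vector_space.dim (scal P) (epart P (rad \<Omega>) i) =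
    vector_space.dim (scal P) (epart P (rad P) i)"
proof -
  note FD = free_onD[OF F]
  have P: "md P" by (rule FD(1))
  interpret Pv: vector_space "scal P" by (rule amodule_vector_space[OF P])
  note PD = vs_subspaceD[OF amodule_vector_space[OF P] amodule_subspace[OF P]]
  have K: "submodule P (hom_kernel P g)" by (rule submodule_hom_kernel[OF P X g(1)])
  have \<Omega>: "md \<Omega>" unfolding \<Omega>_def by (rule submodule_amodule[OF P K])
  have \<Omega>s: "carr \<Omega> = hom_kernel P g" "scal \<Omega> = scal P" "act \<Omega> = act P" by (simp_all add: \<Omega>_def)
  have radO: "Pv.subspace (rad \<Omega>)" "rad \<Omega> \<subseteq> hom_kernel P g" "rad \<Omega> \<subseteq> rad P"
  proof -
    show 1: "Pv.subspace (rad \<Omega>)" using rad_subspace[OF \<Omega>] by (simp only: \<Omega>s)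
    show "rad \<Omega> \<subseteq> hom_kernel P g" using rad_sub[OF \<Omega>] by (simp only: \<Omega>s)
    show "rad \<Omega> \<subseteq> rad P"
    proof (rule rad_induct[OF \<Omega>], unfold \<Omega>s)
      show "Pv.subspace (rad P)" by (rule rad_subspace[OF P])
      show "act P \<rho> x \<in> rad P" if "\<rho> \<in> r" "x \<in> hom_kernel P g" for \<rho> x
        using that by (intro rad_gen[OF P]) (auto simp: hom_kernel_def)
    qed
  qed
  let ?W = "er_module i" and ?A = "epart P (rad P) i" and ?B = "epart P (rad \<Omega>) i"
  have A: "Pv.subspace ?A" "fd_subspace (scal P) ?A" by (rule epart_subspace[OF P rad_subspace[OF P] rad_sub[OF P]])+
  have Osub: "rad \<Omega> \<subseteq> carr P" using radO(3) rad_sub[OF P] by (rule order_trans)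
  have B: "Pv.subspace ?B" by (rule epart_subspace[OF P radO(1) Osub])
  have BA: "?B \<subseteq> ?A" using radO(3) by (auto simp: epart_def)
  let ?D = "functionals (scal P) ?A ?B"
  have AP: "?A \<subseteq> carr P" using rad_sub[OF P] by (auto simp: epart_def)
  have dW: "md (dual_module ?W)" using dual_amodule[OF er_amodule[of i]] by simp
  have rA: "act P \<rho> p \<in> ?A" if "\<rho> \<in> carr ?W" "p \<in> carr P" for \<rho> p
  proof -
    have \<rho>: "\<rho> \<in> r" "mu (e i) \<rho> = \<rho>" using that(1) by (auto simp: er_simps)
    then show ?thesis using rad_gen[OF P \<rho>(1) that(2)] amodule_mult[OF P that(2), of "e i" \<rho>] by (simp add: epart_def)
  qed
  have rB: "act P \<rho> p \<in> ?B" if "\<rho> \<in> carr ?W" "p \<in> hom_kernel P g" for \<rho> p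
  proof -
    have \<rho>: "\<rho> \<in> r" "mu (e i) \<rho> = \<rho>" using that(1) by (auto simp: er_simps)
    have p: "p \<in> carr P" using that(2) by (simp add: hom_kernel_def)
    have "act \<Omega> \<rho> p \<in> rad \<Omega>" by (rule rad_gen[OF \<Omega> \<rho>(1)]) (simp add: \<Omega>s that)
    then show ?thesis using amodule_mult[OF P p, of "e i" \<rho>] \<rho> by (simp add: epart_def \<Omega>s)
  qed
  have aW: "\<alpha> k q \<in> carr ?W" if "k < N" "q \<in> ?A" for k q
  proof -
    have q: "q \<in> rad P" "act P (e i) q = q" using that(2) by (auto simp: epart_def)
    have qc: "q \<in> carr P" using that(2) AP by blast
    show ?thesis using alpha_rad[OF F that(1) q(1)] amod_homD(3)[OF FD(5)[OF that(1)] qc, of "e i"] q(2)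
      by (simp add: er_simps)
  qed
  \<comment> \<open>A set-theoretic section of \<open>g\<close>, neither linear nor equivariant;
    \<open>key\<close> shows that functionals vanishing on \<open>?B\<close> do not notice the
    choice.\<close>
  define s where "s x = (SOME p. p \<in> carr P \<and> g p = x)" for x
  have s: "s x \<in> carr P" "g (s x) = x" if "x \<in> carr X" for x
  proof -
    have "x \<in> g ` carr P" using that g(2) by simp
    then have "\<exists>p. p \<in> carr P \<and> g p = x" by auto
    from someI_ex[OF this] show "s x \<in> carr P" "g (s x) = x" by (simp_all add: s_def)
  qed
  note gD = lin_on_props[OF amodule_vector_space[OF P] amodule_vector_space[OF X] amodule_subspace[OF P] amod_homD(2)[OF g(1)]]
  \<comment> \<open>\<open>?f\<close> turns a functional into the form sending
    \<open>(x, \<rho>)\<close> to its value at \<open>\<rho>\<close> times a lift of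
    \<open>x\<close>. Conversely, \<open>?h\<close> evaluates a form on the expansion of
    \<open>q\<close> in the generators, whose coefficients \<open>\<alpha> k q\<close> lie in
    \<open>e_i r\<close>.\<close>
  let ?f = "\<lambda>\<phi> x \<rho>. if x \<in> carr X \<and> \<rho> \<in> carr ?W then \<phi> (act P \<rho> (s x)) else 0 :: complex"
  let ?h = "\<lambda>h q. if q \<in> ?A then \<Sum>k<N. h (g (\<epsilon> k)) (\<alpha> k q) else 0 :: complex"
  have key: "?f \<phi> (g p) \<rho> = \<phi> (act P \<rho> p)" if \<phi>: "\<phi> \<in> ?D" and p: "p \<in> carr P" and \<rho>: "\<rho> \<in> carr ?W" for \<phi> p \<rho>
  proof -
    note fD = functional_lin[OF Pv.vector_space_axioms A(1) \<phi>]
    have gp: "g p \<in> carr X" by (rule amod_homD(1)[OF g(1) p])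
    have "s (g p) - p \<in> hom_kernel P g" using s[OF gp] p PD(3) gD(4) by (simp add: hom_kernel_def)
    then have "\<phi> (act P \<rho> (s (g p) - p)) = 0" using functionalsD(3)[OF \<phi> rB[OF \<rho>]] by blast
    then show ?thesis
      using act_diff[OF P s(1)[OF gp] p, of \<rho>] fD(3)[OF rA[OF \<rho> s(1)[OF gp]] rA[OF \<rho> p]] gp \<rho> by simp
  qed
  have XD: "carr X = g ` carr P" by (rule g(2)[symmetric])
  have Wc: "\<rho> \<in> carr ?W \<Longrightarrow> mu \<rho> a \<in> carr ?W" for \<rho> a
    using amodule_closed[OF er_amodule] by (simp add: er_simps(3))
  note WD = vs_subspaceD[OF amodule_vector_space[OF er_amodule[of i]] amodule_subspace[OF er_amodule[of i]], unfolded er_simps(2)]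
  have "cdim ?D = vector_space.dim (pointwise_scale cscale) (amod_hom X (dual_module ?W))"
  proof (rule dim_iso[where f = ?f and g = ?h])
    show "vector_space cscale" by (rule vector_space_cscale)
    show "vector_space (pointwise_scale cscale)" by (rule vector_space_pointwise_scale[OF vector_space_cscale])
    show "cf.subspace ?D"
      by (rule subspace_fd[OF vector_space_cscale dim_functionals(2)[OF Pv.vector_space_axioms A(2) B BA]])
    show "lin_on cscale (pointwise_scale cscale) ?D ?f"
      by (rule lin_onI) (auto simp: fun_eq_iff cscale_apply pointwise_scale_def)
  next
    fix \<phi> assume \<phi>: "\<phi> \<in> ?D"
    note fD = functional_lin[OF Pv.vector_space_axioms A(1) \<phi>]
    show fh: "?f \<phi> \<in> amod_hom X (dual_module ?W)"
    proof (rule amod_homI)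
      fix x assume "x \<in> carr X"
      then obtain p where p: "p \<in> carr P" "x = g p" unfolding XD by auto
      have fx: "?f \<phi> x = (\<lambda>\<rho>. if \<rho> \<in> carr ?W then \<phi> (act P \<rho> p) else 0)"
      proof
        fix \<rho> show "?f \<phi> x \<rho> = (if \<rho> \<in> carr ?W then \<phi> (act P \<rho> p) else 0)"
        proof (cases "\<rho> \<in> carr ?W")
          case True
          have "?f \<phi> x \<rho> = \<phi> (act P \<rho> p)" unfolding p(2) by (rule key[OF \<phi> p(1) True])
          then show ?thesis by (rule trans) (simp add: True)
        qed simp
      qed
      show "?f \<phi> x \<in> carr (dual_module ?W)"
        unfolding fx dual_simps functionals_def
      proof (intro CollectI conjI allI ballI impI lin_onI, unfold er_simps(2))
        fix \<rho> \<rho>' assume \<rho>: "\<rho> \<in> carr ?W" "\<rho>' \<in> carr ?W"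
        show "(if \<rho> + \<rho>' \<in> carr ?W then \<phi> (act P (\<rho> + \<rho>') p) else 0) =
          (if \<rho> \<in> carr ?W then \<phi> (act P \<rho> p) else 0) + (if \<rho>' \<in> carr ?W then \<phi> (act P \<rho>' p) else 0)"
          using \<rho> WD(2)[OF \<rho>] amodule_add_alg[OF P p(1)] fD(1)[OF rA[OF \<rho>(1) p(1)] rA[OF \<rho>(2) p(1)]] by simp
      next
        fix c \<rho> assume \<rho>: "\<rho> \<in> carr ?W"
        show "(if smul c \<rho> \<in> carr ?W then \<phi> (act P (smul c \<rho>) p) else 0) =
          c * (if \<rho> \<in> carr ?W then \<phi> (act P \<rho> p) else 0)"
          using \<rho> WD(4)[OF \<rho>] amodule_scale_alg[OF P p(1)] fD(2)[OF rA[OF \<rho> p(1)]] by simp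
      qed simp_all
      show "?f \<phi> (act X a x) = act (dual_module ?W) a (?f \<phi> x)" for a
      proof
        fix \<rho>
        show "?f \<phi> (act X a x) \<rho> = act (dual_module ?W) a (?f \<phi> x) \<rho>"
        proof (cases "\<rho> \<in> carr ?W")
          case True
          have "?f \<phi> (act X a x) \<rho> = ?f \<phi> (g (act P a p)) \<rho>" by (simp only: amod_homD(3)[OF g(1) p(1)] p(2))
          also have "\<dots> = \<phi> (act P \<rho> (act P a p))" by (rule key[OF \<phi> amodule_closed[OF P p(1)] True])
          also have "\<dots> = \<phi> (act P (mu \<rho> a) p)" by (simp only: amodule_mult[OF P p(1)])
          also have "\<dots> = ?f \<phi> x (mu \<rho> a)" unfolding p(2) by (rule key[OF \<phi> p(1) Wc[OF True], symmetric])
          finally show ?thesis by (rule trans) (simp add: True dual_simps er_simps(3))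
        qed (simp add: dual_simps)
      qed
      show "?f \<phi> (scal X c x) = scal (dual_module ?W) c (?f \<phi> x)" for c
      proof
        fix \<rho>
        show "?f \<phi> (scal X c x) \<rho> = scal (dual_module ?W) c (?f \<phi> x) \<rho>"
        proof (cases "\<rho> \<in> carr ?W")
          case True
          have "?f \<phi> (scal X c x) \<rho> = ?f \<phi> (g (scal P c p)) \<rho>" by (simp only: gD(3)[OF p(1)] p(2))
          also have "\<dots> = \<phi> (act P \<rho> (scal P c p))" by (rule key[OF \<phi> PD(4)[OF p(1)] True])
          also have "\<dots> = c * \<phi> (act P \<rho> p)" using amodule_scale[OF P p(1), of \<rho> c] fD(2)[OF rA[OF True p(1)]] by simp
          also have "\<phi> (act P \<rho> p) = ?f \<phi> x \<rho>" unfolding p(2) by (rule key[OF \<phi> p(1) True, symmetric])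
          finally show ?thesis by (rule trans) (simp only: dual_simps cscale_apply)
        qed (simp add: dual_simps cscale_apply)
      qed
      fix x' assume "x' \<in> carr X"
      then obtain p' where p': "p' \<in> carr P" "x' = g p'" unfolding XD by auto
      show "?f \<phi> (x + x') = ?f \<phi> x + ?f \<phi> x'"
      proof
        fix \<rho>
        show "?f \<phi> (x + x') \<rho> = (?f \<phi> x + ?f \<phi> x') \<rho>"
        proof (cases "\<rho> \<in> carr ?W")
          case True
          have "?f \<phi> (x + x') \<rho> = ?f \<phi> (g (p + p')) \<rho>" by (simp only: gD(2)[OF p(1) p'(1)] p(2) p'(2))
          also have "\<dots> = \<phi> (act P \<rho> (p + p'))" by (rule key[OF \<phi> PD(2)[OF p(1) p'(1)] True])
          also have "\<dots> = \<phi> (act P \<rho> p) + \<phi> (act P \<rho> p')"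
            using amodule_add[OF P p(1) p'(1), of \<rho>] fD(1)[OF rA[OF True p(1)] rA[OF True p'(1)]] by simp
          also have "\<phi> (act P \<rho> p) = ?f \<phi> x \<rho>" unfolding p(2) by (rule key[OF \<phi> p(1) True, symmetric])
          also have "\<phi> (act P \<rho> p') = ?f \<phi> x' \<rho>" unfolding p'(2) by (rule key[OF \<phi> p'(1) True, symmetric])
          finally show ?thesis by (rule trans) (simp only: plus_fun_apply)
        qed simp
      qed
    qed (auto simp: fun_eq_iff)
    show "?h (?f \<phi>) = \<phi>"
    proof
      fix q show "?h (?f \<phi>) q = \<phi> q"
      proof (cases "q \<in> ?A")
        case True
        then have qc: "q \<in> carr P" using AP by blast
        have "(\<Sum>k<N. ?f \<phi> (g (\<epsilon> k)) (\<alpha> k q)) = (\<Sum>k<N. \<phi> (act P (\<alpha> k q) (\<epsilon> k)))"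
          by (rule sum.cong[OF refl]) (rule key[OF \<phi> FD(3) aW[OF _ True]], auto)
        also have "\<dots> = \<phi> (\<Sum>k<N. act P (\<alpha> k q) (\<epsilon> k))"
          by (rule fD(4)[symmetric]) (rule rA[OF aW[OF _ True] FD(3)], auto)
        also have "\<dots> = \<phi> q" by (simp only: FD(8)[OF qc])
        finally show ?thesis by (simp only: True if_True)
      qed (simp add: functionalsD(2)[OF \<phi>])
    qed
  next
    fix h assume h: "h \<in> amod_hom X (dual_module ?W)"
    have hd: "h x \<in> functionals smul (carr ?W) {}" if "x \<in> carr X" for x
      using amod_homD(1)[OF h that] by (simp only: dual_simps er_simps(2))
    note hl = functional_lin[OF smul_vs amodule_subspace[OF er_amodule, unfolded er_simps(2)] hd]
    have bal: "h (act X a x) \<rho> = h x (mu \<rho> a)" if "x \<in> carr X" "\<rho> \<in> carr ?W" for a x \<rho>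
      using amod_homD(3)[OF h that(1), of a] that(2) by (simp add: dual_simps er_simps(3))
    have gec: "g (\<epsilon> k) \<in> carr X" if "k < N" for k by (rule amod_homD(1)[OF g(1) FD(3)[OF that]])
    \<comment> \<open>Balancedness moves the coordinates \<open>\<alpha> k p\<close> over to
      \<open>X\<close>, where they recombine to \<open>g p\<close>.\<close>
    have val: "(\<Sum>k<N. h (g (\<epsilon> k)) (mu \<rho> (\<alpha> k p))) = h (g p) \<rho>" if p: "p \<in> carr P" and \<rho>: "\<rho> \<in> carr ?W" for p \<rho>
    proof -
      have "(\<Sum>k<N. h (g (\<epsilon> k)) (mu \<rho> (\<alpha> k p))) = (\<Sum>k<N. h (act X (\<alpha> k p) (g (\<epsilon> k))) \<rho>)"
        by (rule sum.cong[OF refl]) (use bal[OF gec \<rho>] in auto)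
      also have "\<dots> = (\<Sum>k<N. h (act X (\<alpha> k p) (g (\<epsilon> k)))) \<rho>" by simp
      also have "(\<Sum>k<N. h (act X (\<alpha> k p) (g (\<epsilon> k)))) = h (\<Sum>k<N. act X (\<alpha> k p) (g (\<epsilon> k)))"
        by (rule amod_hom_sum[OF X dW h, symmetric]) (use gec amodule_closed[OF X] in auto)
      also have "(\<Sum>k<N. act X (\<alpha> k p) (g (\<epsilon> k))) = g p" by (rule hom_free_unique[OF F X g(1) p, symmetric])
      finally show ?thesis .
    qed
    show "?h h \<in> ?D"
      unfolding functionals_def
    proof (intro CollectI conjI allI ballI impI)
      have aadd: "\<alpha> k (x + y) = \<alpha> k x + \<alpha> k y" if "k < N" "x \<in> ?A" "y \<in> ?A" for k x y
        using amod_homD(2)[OF FD(5)[OF that(1)]] that AP unfolding lin_on_def by blast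
      have ascal: "\<alpha> k (scal P c x) = smul c (\<alpha> k x)" if "k < N" "x \<in> ?A" for k x c
        using amod_homD(2)[OF FD(5)[OF that(1)]] subsetD[OF AP that(2)] unfolding lin_on_def by simp
      note AD = vs_subspaceD[OF Pv.vector_space_axioms A(1)]
      show "lin_on (scal P) (*) ?A (?h h)"
      proof (rule lin_onI)
        fix x y assume xy: "x \<in> ?A" "y \<in> ?A"
        have "(\<Sum>k<N. h (g (\<epsilon> k)) (\<alpha> k (x + y))) = (\<Sum>k<N. h (g (\<epsilon> k)) (\<alpha> k x) + h (g (\<epsilon> k)) (\<alpha> k y))"
          by (rule sum.cong[OF refl]) (use hl(1)[OF gec aW[OF _ xy(1)] aW[OF _ xy(2)]] aadd[OF _ xy] in auto)
        then show "?h h (x + y) = ?h h x + ?h h y" using xy AD(2) by (simp add: sum.distrib)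
      next
        fix c x assume x: "x \<in> ?A"
        have "(\<Sum>k<N. h (g (\<epsilon> k)) (\<alpha> k (scal P c x))) = (\<Sum>k<N. c * h (g (\<epsilon> k)) (\<alpha> k x))"
          by (rule sum.cong[OF refl]) (use hl(2)[OF gec aW[OF _ x]] ascal[OF _ x] in auto)
        then show "?h h (scal P c x) = c * ?h h x" using x AD(4) by (simp add: sum_distrib_left)
      qed
      show "?h h x = 0" if "x \<notin> ?A" for x using that by simp
      fix u assume u: "u \<in> ?B"
      have eW: "mu (e i) (\<alpha> k x) \<in> carr ?W" if "k < N" "x \<in> rad P" for k x
        using r_left[OF alpha_rad[OF F that], of "e i"] mu_assoc[of "e i" "e i" "\<alpha> k x"] e_idem[OF i]
        by (simp add: er_simps)
      \<comment> \<open>The factor \<open>e i\<close> is inserted because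
        \<open>rad \<Omega>\<close> is spanned by products that \<open>e i\<close> need not fix,
        while \<open>h\<close> is controlled only on \<open>e_i r\<close>. On \<open>?B\<close> the
        factor disappears again.\<close>
      let ?S = "{x \<in> rad P. (\<Sum>k<N. h (g (\<epsilon> k)) (mu (e i) (\<alpha> k x))) = 0}"
      note RD = vs_subspaceD[OF Pv.vector_space_axioms rad_subspace[OF P]]
      have "rad \<Omega> \<subseteq> ?S"
      proof (rule rad_induct[OF \<Omega>], unfold \<Omega>s)
        have aadd: "\<alpha> k (x + y) = \<alpha> k x + \<alpha> k y" if "k < N" "x \<in> rad P" "y \<in> rad P" for k x y
          using amod_homD(2)[OF FD(5)[OF that(1)]] that rad_sub[OF P] unfolding lin_on_def by blast
        have ascal: "\<alpha> k (scal P c x) = smul c (\<alpha> k x)" if "k < N" "x \<in> rad P" for k x c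
          using amod_homD(2)[OF FD(5)[OF that(1)]] subsetD[OF rad_sub[OF P] that(2)] unfolding lin_on_def by simp
        have az: "\<alpha> k 0 = 0" if "k < N" for k by (rule amod_hom_zero[OF P reg_amodule FD(5)[OF that]])
        show "Pv.subspace ?S"
        proof (rule Pv.subspaceI)
          show "0 \<in> ?S" using RD(1) az hl(5)[OF gec] by (auto intro!: sum.neutral)
          fix x y assume xy: "x \<in> ?S" "y \<in> ?S"
          then have xr: "x \<in> rad P" "y \<in> rad P" by auto
          have "(\<Sum>k<N. h (g (\<epsilon> k)) (mu (e i) (\<alpha> k (x + y)))) =
              (\<Sum>k<N. h (g (\<epsilon> k)) (mu (e i) (\<alpha> k x)) + h (g (\<epsilon> k)) (mu (e i) (\<alpha> k y)))"
            by (rule sum.cong[OF refl])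
              (use hl(1)[OF gec eW[OF _ xr(1)] eW[OF _ xr(2)]] aadd[OF _ xr] in \<open>auto simp: mu_add_right\<close>)
          then show "x + y \<in> ?S" using xy RD(2) by (simp add: sum.distrib)
        next
          fix c x assume x: "x \<in> ?S"
          then have xr: "x \<in> rad P" by auto
          have "(\<Sum>k<N. h (g (\<epsilon> k)) (mu (e i) (\<alpha> k (scal P c x)))) = (\<Sum>k<N. c * h (g (\<epsilon> k)) (mu (e i) (\<alpha> k x)))"
            by (rule sum.cong[OF refl]) (use hl(2)[OF gec eW[OF _ xr]] ascal[OF _ xr] in \<open>auto simp: mu_smul_right\<close>)
          then show "scal P c x \<in> ?S" using x RD(4) by (simp flip: sum_distrib_left)
        qed
        fix \<rho> x assume \<rho>: "\<rho> \<in> r" and x: "x \<in> hom_kernel P g"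
        then have xc: "x \<in> carr P" "g x = 0" by (auto simp: hom_kernel_def)
        have e\<rho>: "mu (e i) \<rho> \<in> carr ?W"
          using r_left[OF \<rho>, of "e i"] mu_assoc[of "e i" "e i" \<rho>] e_idem[OF i] by (simp add: er_simps)
        have "(\<Sum>k<N. h (g (\<epsilon> k)) (mu (e i) (\<alpha> k (act P \<rho> x)))) = (\<Sum>k<N. h (g (\<epsilon> k)) (mu (mu (e i) \<rho>) (\<alpha> k x)))"
          by (rule sum.cong[OF refl]) (use amod_homD(3)[OF FD(5) xc(1), of _ \<rho>] in \<open>auto simp: mu_assoc\<close>)
        also have "\<dots> = h (g x) (mu (e i) \<rho>)" by (rule val[OF xc(1) e\<rho>])
        also have "\<dots> = 0" using xc(2) amod_hom_zero[OF X dW h] by simp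
        finally show "act P \<rho> x \<in> ?S" using rad_gen[OF P \<rho> xc(1)] by simp
      qed
      then have "(\<Sum>k<N. h (g (\<epsilon> k)) (mu (e i) (\<alpha> k u))) = 0" using u by (auto simp: epart_def)
      moreover have uA: "u \<in> ?A" using u BA by blast
      moreover have "mu (e i) (\<alpha> k u) = \<alpha> k u" if "k < N" for k
        using aW[OF that uA] by (simp add: er_simps)
      ultimately show "?h h u = 0" by simp
    qed
    then have hD: "?h h \<in> ?D" .
    show "?f (?h h) = h"
    proof (intro ext)
      fix x \<rho>
      show "?f (?h h) x \<rho> = h x \<rho>"
      proof (cases "x \<in> carr X")
        case x: True
        show ?thesis
        proof (cases "\<rho> \<in> carr ?W")
          case True
          have q: "act P \<rho> (s x) \<in> ?A" by (rule rA[OF True s(1)[OF x]])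
          have "?f (?h h) x \<rho> = (\<Sum>k<N. h (g (\<epsilon> k)) (\<alpha> k (act P \<rho> (s x))))" using x True q by simp
          also have "\<dots> = (\<Sum>k<N. h (g (\<epsilon> k)) (mu \<rho> (\<alpha> k (s x))))"
            by (rule sum.cong[OF refl]) (use amod_homD(3)[OF FD(5) s(1)[OF x], of _ \<rho>] in auto)
          also have "\<dots> = h (g (s x)) \<rho>" by (rule val[OF s(1)[OF x] True])
          finally show ?thesis using s(2)[OF x] by simp
        next
          case False
          then show ?thesis using functionalsD(2)[OF hd[OF x]] by simp
        qed
      qed (simp add: amod_homD(4)[OF h])
    qed
  qed
  then show ?thesis
    using dim_functionals(1)[OF Pv.vector_space_axioms A(2) B BA]
    by (simp add: amod_hom_dim_eq dual_simps)
qed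

end

context basic_algebra begin

lemma star_simps:
  "carr (star_module smul mu P) = amod_hom P reg" "scal (star_module smul mu P) = pointwise_scale smul"
  "act (star_module smul mu P) = (\<lambda>b f x. mu (f x) b)"
  by (simp_all add: star_module_def pointwise_scale_def)

lemma act_diff_alg: assumes "md X" "x \<in> carr X" shows "act X (a - b) x = act X a x - act X b x"
  using amodule_add_alg[OF assms, of "a - b" b] by (simp add: algebra_simps)

lemma ev_hom:
  assumes P: "md P" and Y: "md Y" and b: "\<beta> \<in> amod_hom P reg" and y: "y \<in> carr Y"
  shows "(\<lambda>p. act Y (\<beta> p) y) \<in> amod_hom P Y"
proof (rule amod_homI)
  show "act Y (\<beta> x) y = 0" if "x \<notin> carr P" for x
    using amod_homD(4)[OF b that] act_zero_alg[OF Y y] by simp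
qed (use amod_homD[OF b] amodule_closed[OF Y y] amodule_add_alg[OF Y y] amodule_scale_alg[OF Y y] amodule_mult[OF Y y]
     in \<open>auto simp: lin_on_def\<close>)

text \<open>Balanced forms on \<open>P\<^sup>* \<times> Y\<close> are functionals on \<open>Hom(P, Y)\<close>; those that factor through the
  cokernel of \<open>P0\<^sup>* \<rightarrow> P1\<^sup>*\<close> are the ones that vanish on the maps factoring through \<open>f\<close>.\<close>

lemma dim_hom_dual_transpose:
  fixes P0 :: "('b, 'u::ab_group_add) amod" and P1 :: "('b, 'v::ab_group_add) amod"
    and Y :: "('b, 'w::ab_group_add) amod" and T :: "('b, 't::ab_group_add) amod"
  assumes F1: "free_on P1 N \<iota> \<epsilon> \<alpha>" and F0: "free_on P0 N0 \<iota>0 \<epsilon>0 \<alpha>0" and f: "f \<in> amod_hom P1 P0"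
    and T: "amodule smul (\<lambda>a b. mu b a) T" and q: "q \<in> amod_hom (star_module smul mu P1) T"
      "q ` carr (star_module smul mu P1) = carr T"
      "hom_kernel (star_module smul mu P1) q = (\<lambda>\<phi>. \<phi> \<circ> f) ` carr (star_module smul mu P0)"
    and Y: "md Y"
  shows "amod_hom_dim Y (dual_module T) +
      vector_space.dim (pointwise_scale (scal Y)) ((\<lambda>u. u \<circ> f) ` amod_hom P0 Y) = amod_hom_dim P1 Y"
proof -
  note FD = free_onD[OF F1]
  note FD0 = free_onD[OF F0]
  have P1: "md P1" and P0: "md P0" by (rule FD(1), rule FD0(1))
  let ?s = "pointwise_scale (scal Y)" and ?H = "amod_hom P1 Y" and ?B = "(\<lambda>u. u \<circ> f) ` amod_hom P0 Y"
  let ?P = "star_module smul mu P1"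
  interpret Yv: vector_space "scal Y" by (rule amodule_vector_space[OF Y])
  have vp: "vector_space (pointwise_scale (scal Y) :: _ \<Rightarrow> ('k \<Rightarrow> 'w) \<Rightarrow> _)"
    by (rule vector_space_pointwise_scale[OF Yv.vector_space_axioms])
  have st: "amodule smul (\<lambda>a b. mu b a) ?P" by (rule op_amodule_star[OF P1])
  note YD = vs_subspaceD[OF Yv.vector_space_axioms amodule_subspace[OF Y]]
  note stD = vs_subspaceD[OF amodule_vector_space[OF st] amodule_subspace[OF st], unfolded star_simps]
  note TD = vs_subspaceD[OF amodule_vector_space[OF T] amodule_subspace[OF T]]
  note fz = amod_hom_zero[OF P1 P0 f]
  have dT: "md (dual_module T)" using dual_amodule[OF T] by simp
  have fdH: "fd_subspace ?s ?H" by (rule amod_hom_fd[OF P1 Y])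
  have H: "module.subspace ?s ?H" by (rule subspace_fd[OF vp fdH])
  have H0: "module.subspace ?s (amod_hom P0 Y)" by (rule subspace_fd[OF vp amod_hom_fd[OF P0 Y]])
  have B: "module.subspace ?s ?B"
    by (rule subspace_image_lin_on(1)[OF vp vp H0]) (rule lin_onI, auto simp: pointwise_scale_def fun_eq_iff)
  have BH: "?B \<subseteq> ?H"
  proof
    fix v assume "v \<in> ?B"
    then obtain u where u: "u \<in> amod_hom P0 Y" "v = u \<circ> f" by auto
    show "v \<in> ?H" unfolding u(2)
      by (rule amod_homI)
        (use amod_homD[OF f] amod_homD[OF u(1)] amod_hom_zero[OF P0 Y u(1)] in \<open>auto simp: lin_on_def\<close>)
  qed
  note HD = vs_subspaceD[OF vp H]
  let ?D = "functionals ?s ?H ?B"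
  \<comment> \<open>The image of the tensor of \<open>\<beta>\<close> and \<open>y\<close> in
    \<open>Hom(P1, Y)\<close>. By \<open>expandv\<close> every homomorphism is a sum of such
    maps.\<close>
  let ?ev = "\<lambda>\<beta> y p. act Y (\<beta> p) y"
  have ev: "?ev \<beta> y \<in> ?H" if "\<beta> \<in> amod_hom P1 reg" "y \<in> carr Y" for \<beta> y by (rule ev_hom[OF P1 Y that])
  define s where "s t = (SOME \<beta>. \<beta> \<in> amod_hom P1 reg \<and> q \<beta> = t)" for t
  have s: "s t \<in> amod_hom P1 reg" "q (s t) = t" if "t \<in> carr T" for t
  proof -
    have "t \<in> q ` carr ?P" using that q(2) by simp
    then have "\<exists>\<beta>. \<beta> \<in> amod_hom P1 reg \<and> q \<beta> = t" unfolding star_simps by auto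
    from someI_ex[OF this] show "s t \<in> amod_hom P1 reg" "q (s t) = t" by (simp_all add: s_def)
  qed
  have TE: "carr T = q ` amod_hom P1 reg" using q(2) unfolding star_simps by simp
  note qD = lin_on_props[OF amodule_vector_space[OF st] amodule_vector_space[OF T] amodule_subspace[OF st] amod_homD(2)[OF q(1)], unfolded star_simps]
  have qT: "q \<beta> \<in> carr T" if "\<beta> \<in> amod_hom P1 reg" for \<beta> using amod_homD(1)[OF q(1)] that unfolding star_simps by blast
  have qact: "q (\<lambda>x. mu (\<beta> x) a) = act T a (q \<beta>)" if "\<beta> \<in> amod_hom P1 reg" for \<beta> a
    using amod_homD(3)[OF q(1), of \<beta> a] that unfolding star_simps by blast
  have stact: "(\<lambda>x. mu (\<beta> x) a) \<in> amod_hom P1 reg" if "\<beta> \<in> amod_hom P1 reg" for \<beta> a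
    using amodule_closed[OF st, of \<beta> a] that unfolding star_simps by blast
  \<comment> \<open>\<open>?f\<close> evaluates a functional at \<open>?ev \<beta> y\<close>, where
    \<open>\<beta>\<close> is a lift of \<open>t\<close> to the dual of \<open>P1\<close>. The
    inverse \<open>?h\<close> evaluates a form on the terms of the expansion
    \<open>expandv\<close>.\<close>
  let ?f = "\<lambda>\<psi> y t. if y \<in> carr Y \<and> t \<in> carr T then \<psi> (?ev (s t) y) else 0 :: complex"
  let ?h = "\<lambda>h v. if v \<in> ?H then \<Sum>k<N. h (v (\<epsilon> k)) (q (\<alpha> k)) else 0 :: complex"
  have key: "?f \<psi> y (q \<beta>) = \<psi> (?ev \<beta> y)" if \<psi>: "\<psi> \<in> ?D" and b: "\<beta> \<in> amod_hom P1 reg" and y: "y \<in> carr Y" for \<psi> \<beta> y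
  proof -
    note fD = functional_lin[OF vp H \<psi>]
    let ?b = "s (q \<beta>)"
    have sb: "?b \<in> amod_hom P1 reg" "q ?b = q \<beta>" by (rule s[OF qT[OF b]])+
    have "?b - \<beta> \<in> hom_kernel ?P q" using stD(3)[OF sb(1) b] qD(4)[OF sb(1) b] sb(2) by (simp add: hom_kernel_def star_simps)
    \<comment> \<open>Two lifts of an element of the cokernel differ by some
      \<open>\<gamma> \<circ> f\<close>, and the evaluation maps of this difference factor through
      \<open>f\<close>, where \<open>\<psi>\<close> vanishes.\<close>
    then obtain \<gamma> where \<gamma>: "\<gamma> \<in> amod_hom P0 reg" "?b - \<beta> = \<gamma> \<circ> f" unfolding q(3) star_simps by auto
    have "?ev ?b y - ?ev \<beta> y = (\<lambda>p. act Y (\<gamma> p) y) \<circ> f"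
    proof
      fix x
      have "?b x - \<beta> x = \<gamma> (f x)" using fun_cong[OF \<gamma>(2), of x] by simp
      then show "(?ev ?b y - ?ev \<beta> y) x = ((\<lambda>p. act Y (\<gamma> p) y) \<circ> f) x"
        using act_diff_alg[OF Y y, of "?b x" "\<beta> x"] by simp
    qed
    also have "\<dots> \<in> ?B" by (rule imageI[OF ev_hom[OF P0 Y \<gamma>(1) y]])
    finally have "\<psi> (?ev ?b y - ?ev \<beta> y) = 0" by (rule functionalsD(3)[OF \<psi>])
    then have "\<psi> (?ev ?b y) = \<psi> (?ev \<beta> y)" using fD(3)[OF ev[OF sb(1) y] ev[OF b y]] by simp
    then show ?thesis using y qT[OF b] by simp
  qed
  have expand: "\<beta> = (\<Sum>k<N. (\<lambda>x. mu (\<alpha> k x) (\<beta> (\<epsilon> k))))" if b: "\<beta> \<in> amod_hom P1 reg" for \<beta>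
  proof
    fix x show "\<beta> x = (\<Sum>k<N. (\<lambda>x. mu (\<alpha> k x) (\<beta> (\<epsilon> k)))) x"
    proof (cases "x \<in> carr P1")
      case True then show ?thesis using hom_free_unique[OF F1 reg_amodule b True] by simp
    next
      case False
      have "(\<Sum>k<N. mu (\<alpha> k x) (\<beta> (\<epsilon> k))) = 0"
        by (rule sum.neutral) (use amod_homD(4)[OF FD(5) False] in auto)
      then show ?thesis using amod_homD(4)[OF b False] by simp
    qed
  qed
  have expandv: "v = (\<Sum>k<N. ?ev (\<alpha> k) (v (\<epsilon> k)))" if v: "v \<in> ?H" for v
  proof
    fix x show "v x = (\<Sum>k<N. ?ev (\<alpha> k) (v (\<epsilon> k))) x"
    proof (cases "x \<in> carr P1")
      case True then show ?thesis using hom_free_unique[OF F1 Y v True] by simp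
    next
      case False
      have "(\<Sum>k<N. act Y (\<alpha> k x) (v (\<epsilon> k))) = 0"
        by (rule sum.neutral) (use amod_homD(4)[OF FD(5) False] act_zero_alg[OF Y amod_homD(1)[OF v FD(3)]] in auto)
      then show ?thesis using amod_homD(4)[OF v False] by simp
    qed
  qed
  have "cdim ?D = vector_space.dim (pointwise_scale cscale) (amod_hom Y (dual_module T))"
  proof (rule dim_iso[where f = ?f and g = ?h])
    show "vector_space cscale" by (rule vector_space_cscale)
    show "vector_space (pointwise_scale cscale)" by (rule vector_space_pointwise_scale[OF vector_space_cscale])
    show "cf.subspace ?D"
      by (rule subspace_fd[OF vector_space_cscale dim_functionals(2)[OF vp fdH B BH]])
    show "lin_on cscale (pointwise_scale cscale) ?D ?f"
      by (rule lin_onI) (auto simp: fun_eq_iff cscale_apply pointwise_scale_def)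
  next
    fix \<psi> assume \<psi>: "\<psi> \<in> ?D"
    note fD = functional_lin[OF vp H \<psi>]
    show "?f \<psi> \<in> amod_hom Y (dual_module T)"
    proof (rule amod_homI)
      fix y assume y: "y \<in> carr Y"
      show "?f \<psi> y \<in> carr (dual_module T)"
        unfolding dual_simps functionals_def
      proof (intro CollectI conjI allI ballI impI lin_onI)
        fix t t' assume t: "t \<in> carr T" "t' \<in> carr T"
        note b = s[OF t(1)] and b' = s[OF t(2)]
        have "?f \<psi> y (t + t') = ?f \<psi> y (q (s t + s t'))" by (simp only: qD(2)[OF b(1) b'(1)] b(2) b'(2))
        also have "\<dots> = \<psi> (?ev (s t + s t') y)" by (rule key[OF \<psi> stD(2)[OF b(1) b'(1)] y])
        also have "?ev (s t + s t') y = ?ev (s t) y + ?ev (s t') y" by (rule ext) (simp add: amodule_add_alg[OF Y y])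
        also have "\<psi> \<dots> = \<psi> (?ev (s t) y) + \<psi> (?ev (s t') y)" by (rule fD(1)[OF ev[OF b(1) y] ev[OF b'(1) y]])
        finally show "?f \<psi> y (t + t') = ?f \<psi> y t + ?f \<psi> y t'" by (rule trans) (simp add: y t)
      next
        fix c t assume t: "t \<in> carr T"
        note b = s[OF t]
        have "?f \<psi> y (scal T c t) = ?f \<psi> y (q (pointwise_scale smul c (s t)))" by (simp only: qD(3)[OF b(1)] b(2))
        also have "\<dots> = \<psi> (?ev (pointwise_scale smul c (s t)) y)" by (rule key[OF \<psi> stD(4)[OF b(1)] y])
        also have "?ev (pointwise_scale smul c (s t)) y = ?s c (?ev (s t) y)"
          by (rule ext) (simp add: amodule_scale_alg[OF Y y] pointwise_scale_def)
        also have "\<psi> \<dots> = c * \<psi> (?ev (s t) y)" by (rule fD(2)[OF ev[OF b(1) y]])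
        finally show "?f \<psi> y (scal T c t) = c * ?f \<psi> y t" by (rule trans) (simp add: y t)
      qed auto
      show "?f \<psi> (act Y a y) = act (dual_module T) a (?f \<psi> y)" for a
      proof
        fix t
        show "?f \<psi> (act Y a y) t = act (dual_module T) a (?f \<psi> y) t"
        proof (cases "t \<in> carr T")
          case t: True
          note b = s[OF t]
          have ev_act: "?ev (s t) (act Y a y) = ?ev (\<lambda>x. mu (s t x) a) y" by (rule ext) (simp add: amodule_mult[OF Y y])
          have "?f \<psi> (act Y a y) t = \<psi> (?ev (\<lambda>x. mu (s t x) a) y)"
            unfolding ev_act[symmetric] using amodule_closed[OF Y y, of a] t by simp
          also have "\<dots> = ?f \<psi> y (q (\<lambda>x. mu (s t x) a))" by (rule key[OF \<psi> stact[OF b(1)] y, symmetric])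
          also have "\<dots> = ?f \<psi> y (act T a t)" by (simp only: qact[OF b(1)] b(2))
          finally show ?thesis by (rule trans) (simp add: dual_simps t)
        qed (simp add: dual_simps)
      qed
      show "?f \<psi> (scal Y c y) = scal (dual_module T) c (?f \<psi> y)" for c
      proof
        fix t
        show "?f \<psi> (scal Y c y) t = scal (dual_module T) c (?f \<psi> y) t"
        proof (cases "t \<in> carr T")
          case t: True
          have ev_scal: "?ev (s t) (scal Y c y) = ?s c (?ev (s t) y)"
            by (rule ext) (simp add: amodule_scale[OF Y y] pointwise_scale_def)
          have "?f \<psi> (scal Y c y) t = \<psi> (?s c (?ev (s t) y))"
            unfolding ev_scal[symmetric] using YD(4)[OF y, of c] t by simp
          also have "\<dots> = c * \<psi> (?ev (s t) y)" by (rule fD(2)[OF ev[OF s(1)[OF t] y]])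
          finally show ?thesis by (rule trans) (simp add: dual_simps cscale_apply t y)
        qed (simp add: dual_simps cscale_apply)
      qed
      fix y' assume y': "y' \<in> carr Y"
      show "?f \<psi> (y + y') = ?f \<psi> y + ?f \<psi> y'"
      proof
        fix t
        show "?f \<psi> (y + y') t = (?f \<psi> y + ?f \<psi> y') t"
        proof (cases "t \<in> carr T")
          case t: True
          have ev_add: "?ev (s t) (y + y') = ?ev (s t) y + ?ev (s t) y'"
            by (rule ext) (simp add: amodule_add[OF Y y y'])
          have "?f \<psi> (y + y') t = \<psi> (?ev (s t) y + ?ev (s t) y')"
            unfolding ev_add[symmetric] using YD(2)[OF y y'] t by simp
          also have "\<dots> = \<psi> (?ev (s t) y) + \<psi> (?ev (s t) y')" by (rule fD(1)[OF ev[OF s(1)[OF t] y] ev[OF s(1)[OF t] y']])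
          finally show ?thesis by (rule trans) (simp add: t y y')
        qed simp
      qed
    qed (auto simp: fun_eq_iff)
    show "?h (?f \<psi>) = \<psi>"
    proof
      fix v show "?h (?f \<psi>) v = \<psi> v"
      proof (cases "v \<in> ?H")
        case True
        have vc: "v (\<epsilon> k) \<in> carr Y" if "k < N" for k by (rule amod_homD(1)[OF True FD(3)[OF that]])
        have "(\<Sum>k<N. ?f \<psi> (v (\<epsilon> k)) (q (\<alpha> k))) = (\<Sum>k<N. \<psi> (?ev (\<alpha> k) (v (\<epsilon> k))))"
          by (rule sum.cong[OF refl]) (rule key[OF \<psi> FD(5) vc], auto)
        also have "\<dots> = \<psi> (\<Sum>k<N. ?ev (\<alpha> k) (v (\<epsilon> k)))"
          by (rule fD(4)[symmetric]) (rule ev[OF FD(5) vc], auto)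
        also have "\<dots> = \<psi> v" by (simp only: expandv[OF True, symmetric])
        finally show ?thesis by (simp only: True if_True)
      qed (simp add: functionalsD(2)[OF \<psi>])
    qed
  next
    fix h assume h: "h \<in> amod_hom Y (dual_module T)"
    have hd: "h y \<in> functionals (scal T) (carr T) {}" if "y \<in> carr Y" for y
      using amod_homD(1)[OF h that] by (simp only: dual_simps)
    note hl = functional_lin[OF amodule_vector_space[OF T] amodule_subspace[OF T] hd]
    note hlin = lin_on_props[OF Yv.vector_space_axioms amodule_vector_space[OF dT] amodule_subspace[OF Y] amod_homD(2)[OF h], unfolded dual_simps]
    have bal: "h (act Y a y) t = h y (act T a t)" if "y \<in> carr Y" "t \<in> carr T" for a y t
      using amod_homD(3)[OF h that(1), of a] that(2) by (simp add: dual_simps)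
    \<comment> \<open>Balancedness moves \<open>\<beta> (\<epsilon> k)\<close> to the other
      argument, where the expansion of \<open>\<beta>\<close> in the coordinates
      \<open>\<alpha> k\<close> is recovered.\<close>
    have val: "(\<Sum>k<N. h (act Y (\<beta> (\<epsilon> k)) y) (q (\<alpha> k))) = h y (q \<beta>)" if b: "\<beta> \<in> amod_hom P1 reg" and y: "y \<in> carr Y" for \<beta> y
    proof -
      have "(\<Sum>k<N. h (act Y (\<beta> (\<epsilon> k)) y) (q (\<alpha> k))) = (\<Sum>k<N. h y (q (\<lambda>x. mu (\<alpha> k x) (\<beta> (\<epsilon> k)))))"
        by (rule sum.cong[OF refl]) (use bal[OF y qT[OF FD(5)]] qact[OF FD(5)] in auto)
      also have "\<dots> = h y (\<Sum>k<N. q (\<lambda>x. mu (\<alpha> k x) (\<beta> (\<epsilon> k))))"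
        by (rule hl(4)[OF y, symmetric]) (rule qT[OF stact[OF FD(5)]], auto)
      also have "(\<Sum>k<N. q (\<lambda>x. mu (\<alpha> k x) (\<beta> (\<epsilon> k)))) = q (\<Sum>k<N. (\<lambda>x. mu (\<alpha> k x) (\<beta> (\<epsilon> k))))"
        by (rule qD(5)[symmetric]) (rule stact[OF FD(5)], auto)
      also have "\<dots> = q \<beta>" by (simp only: expand[OF b, symmetric])
      finally show ?thesis .
    qed
    show "?h h \<in> ?D"
      unfolding functionals_def
    proof (intro CollectI conjI allI ballI impI)
      show "lin_on ?s (*) ?H (?h h)"
      proof (rule lin_onI)
        fix v v' assume v: "v \<in> ?H" "v' \<in> ?H"
        have "(\<Sum>k<N. h ((v + v') (\<epsilon> k)) (q (\<alpha> k))) = (\<Sum>k<N. h (v (\<epsilon> k)) (q (\<alpha> k)) + h (v' (\<epsilon> k)) (q (\<alpha> k)))"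
        proof (rule sum.cong[OF refl])
          fix k assume "k \<in> {..<N}"
          then have ek: "\<epsilon> k \<in> carr P1" using FD(3) by simp
          show "h ((v + v') (\<epsilon> k)) (q (\<alpha> k)) = h (v (\<epsilon> k)) (q (\<alpha> k)) + h (v' (\<epsilon> k)) (q (\<alpha> k))"
            using hlin(2)[OF amod_homD(1)[OF v(1) ek] amod_homD(1)[OF v(2) ek]] by simp
        qed
        then show "?h h (v + v') = ?h h v + ?h h v'" using v HD(2)[OF v] by (simp add: sum.distrib)
      next
        fix c v assume v: "v \<in> ?H"
        have "(\<Sum>k<N. h (?s c v (\<epsilon> k)) (q (\<alpha> k))) = (\<Sum>k<N. c * h (v (\<epsilon> k)) (q (\<alpha> k)))"
        proof (rule sum.cong[OF refl])
          fix k assume "k \<in> {..<N}"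
          then have ek: "\<epsilon> k \<in> carr P1" using FD(3) by simp
          show "h (?s c v (\<epsilon> k)) (q (\<alpha> k)) = c * h (v (\<epsilon> k)) (q (\<alpha> k))"
            using hlin(3)[OF amod_homD(1)[OF v(1) ek], of c] by (simp add: pointwise_scale_def cscale_apply)
        qed
        then show "?h h (?s c v) = c * ?h h v" using v HD(4)[OF v] by (simp add: sum_distrib_left)
      qed
      show "?h h v = 0" if "v \<notin> ?H" for v using that by simp
      fix v assume v: "v \<in> ?B"
      then obtain u where u: "u \<in> amod_hom P0 Y" "v = u \<circ> f" by auto
      have vH: "v \<in> ?H" using v BH by blast
      have uc: "u (\<epsilon>0 l) \<in> carr Y" if "l < N0" for l by (rule amod_homD(1)[OF u(1) FD0(3)[OF that]])
      have af: "\<alpha>0 l \<circ> f \<in> amod_hom P1 reg" "q (\<alpha>0 l \<circ> f) = 0" if "l < N0" for l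
      proof -
        have "\<alpha>0 l \<circ> f \<in> hom_kernel ?P q" unfolding q(3) star_simps by (rule imageI[OF FD0(5)[OF that]])
        then show "\<alpha>0 l \<circ> f \<in> amod_hom P1 reg" "q (\<alpha>0 l \<circ> f) = 0" by (simp_all add: hom_kernel_def star_simps)
      qed
      \<comment> \<open>Expanding \<open>u\<close> in the generators of \<open>P0\<close> turns
        \<open>v\<close> into a sum of evaluation maps of \<open>\<alpha>0 l \<circ> f\<close>, and
        these elements vanish in the cokernel.\<close>
      have "(\<Sum>k<N. h (v (\<epsilon> k)) (q (\<alpha> k))) = (\<Sum>k<N. \<Sum>l<N0. h (act Y ((\<alpha>0 l \<circ> f) (\<epsilon> k)) (u (\<epsilon>0 l))) (q (\<alpha> k)))"
      proof (rule sum.cong[OF refl])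
        fix k assume "k \<in> {..<N}"
        then have fe: "f (\<epsilon> k) \<in> carr P0" using FD(3) amod_homD(1)[OF f] by simp
        have "h (v (\<epsilon> k)) = h (\<Sum>l<N0. act Y ((\<alpha>0 l \<circ> f) (\<epsilon> k)) (u (\<epsilon>0 l)))"
          using hom_free_unique[OF F0 Y u(1) fe] u(2) by simp
        also have "\<dots> = (\<Sum>l<N0. h (act Y ((\<alpha>0 l \<circ> f) (\<epsilon> k)) (u (\<epsilon>0 l))))"
          by (rule amod_hom_sum[OF Y dT h]) (use uc amodule_closed[OF Y] in auto)
        finally show "h (v (\<epsilon> k)) (q (\<alpha> k)) = (\<Sum>l<N0. h (act Y ((\<alpha>0 l \<circ> f) (\<epsilon> k)) (u (\<epsilon>0 l))) (q (\<alpha> k)))"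
          by (simp only: sum_fun_apply)
      qed
      also have "\<dots> = (\<Sum>l<N0. \<Sum>k<N. h (act Y ((\<alpha>0 l \<circ> f) (\<epsilon> k)) (u (\<epsilon>0 l))) (q (\<alpha> k)))" by (rule sum.swap)
      also have "\<dots> = (\<Sum>l<N0. 0)"
      proof (rule sum.cong[OF refl])
        fix l assume "l \<in> {..<N0}"
        then have l: "l < N0" by simp
        show "(\<Sum>k<N. h (act Y ((\<alpha>0 l \<circ> f) (\<epsilon> k)) (u (\<epsilon>0 l))) (q (\<alpha> k))) = 0"
          unfolding val[OF af(1)[OF l] uc[OF l]] af(2)[OF l] by (rule hl(5)[OF uc[OF l]])
      qed
      finally show "?h h v = 0" using vH by simp
    qed
    show "?f (?h h) = h"
    proof (intro ext)
      fix y t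
      show "?f (?h h) y t = h y t"
      proof (cases "y \<in> carr Y")
        case y: True
        show ?thesis
        proof (cases "t \<in> carr T")
          case t: True
          have "?f (?h h) y t = (\<Sum>k<N. h (act Y (s t (\<epsilon> k)) y) (q (\<alpha> k)))" using y t ev[OF s(1)[OF t] y] by simp
          also have "\<dots> = h y (q (s t))" by (rule val[OF s(1)[OF t] y])
          finally show ?thesis using s(2)[OF t] by (simp only:)
        next
          case False
          then show ?thesis using functionalsD(2)[OF hd[OF y]] by simp
        qed
      qed (simp add: amod_homD(4)[OF h])
    qed
  qed
  then show ?thesis
    using dim_functionals(1)[OF vp fdH B BH] by (simp add: amod_hom_dim_eq dual_simps)
qed

text \<open>Left exactness of \<open>Hom(-, Y)\<close>: composition with \<open>g\<close> identifies
  \<open>Hom(X, Y)\<close> with the kernel of composition with \<open>f\<close>, and rank-nullity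
  for the latter map gives the equation.\<close>

lemma dim_hom_cokernel:
  fixes P0 :: "('b, 'u::ab_group_add) amod" and P1 :: "('b, 'v::ab_group_add) amod"
    and X :: "('b, 'x::ab_group_add) amod" and Y :: "('b, 'w::ab_group_add) amod"
  assumes P0: "md P0" and X: "md X" and Y: "md Y" and g: "g \<in> amod_hom P0 X" "g ` carr P0 = carr X"
    and f: "f ` carr P1 = hom_kernel P0 g" "\<And>x. x \<notin> carr P1 \<Longrightarrow> f x = 0"
  shows "amod_hom_dim P0 Y =
    vector_space.dim (pointwise_scale (scal Y)) ((\<lambda>u. u \<circ> f) ` amod_hom P0 Y) + amod_hom_dim X Y"
proof -
  let ?s = "pointwise_scale (scal Y)"
  have vp: "vector_space (pointwise_scale (scal Y) :: _ \<Rightarrow> ('k \<Rightarrow> 'w) \<Rightarrow> _)"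
    by (rule vector_space_pointwise_scale[OF amodule_vector_space[OF Y]])
  note PD = vs_subspaceD[OF amodule_vector_space[OF P0] amodule_subspace[OF P0]]
  note gD = lin_on_props[OF amodule_vector_space[OF P0] amodule_vector_space[OF X] amodule_subspace[OF P0] amod_homD(2)[OF g(1)]]
  define s where "s x = (SOME p. p \<in> carr P0 \<and> g p = x)" for x
  have s: "s x \<in> carr P0" "g (s x) = x" if "x \<in> carr X" for x
  proof -
    have "x \<in> g ` carr P0" using that g(2) by simp
    then have "\<exists>p. p \<in> carr P0 \<and> g p = x" by auto
    from someI_ex[OF this] show "s x \<in> carr P0" "g (s x) = x" by (simp_all add: s_def)
  qed
  let ?K = "{u \<in> amod_hom P0 Y. u \<circ> f = 0}"
  let ?h = "\<lambda>u x. if x \<in> carr X then u (s x) else 0"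
  have key: "u (s (g p)) = u p" if u: "u \<in> ?K" and p: "p \<in> carr P0" for u p
  proof -
    have uh: "u \<in> amod_hom P0 Y" using u by simp
    note uD = lin_on_props[OF amodule_vector_space[OF P0] amodule_vector_space[OF Y] amodule_subspace[OF P0] amod_homD(2)[OF uh]]
    have gp: "g p \<in> carr X" by (rule amod_homD(1)[OF g(1) p])
    have "s (g p) - p \<in> hom_kernel P0 g" using s[OF gp] p PD(3) gD(4) by (simp add: hom_kernel_def)
    then have "s (g p) - p \<in> f ` carr P1" by (simp only: f(1))
    then obtain z where z: "s (g p) - p = f z" by auto
    have "(u \<circ> f) z = 0" using u by simp
    then show ?thesis using uD(4)[OF s(1)[OF gp] p] z by simp
  qed
  have lin: "lin_on ?s ?s (amod_hom P0 Y) (\<lambda>u. u \<circ> f)"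
    by (rule lin_onI) (auto simp: pointwise_scale_def fun_eq_iff)
  have sH: "module.subspace ?s (amod_hom X Y)" by (rule subspace_fd[OF vp amod_hom_fd[OF X Y]])
  have "vector_space.dim ?s (amod_hom X Y) = vector_space.dim ?s ?K"
  proof (rule dim_iso[OF vp vp sH, where f = "\<lambda>v. v \<circ> g" and g = ?h])
    show "lin_on ?s ?s (amod_hom X Y) (\<lambda>v. v \<circ> g)"
      by (rule lin_onI) (auto simp: pointwise_scale_def fun_eq_iff)
    fix v assume v: "v \<in> amod_hom X Y"
    have v0: "v 0 = 0" by (rule amod_hom_zero[OF X Y v])
    have "v \<circ> g \<in> amod_hom P0 Y"
      by (rule amod_homI) (use amod_homD[OF g(1)] amod_homD[OF v] v0 in \<open>auto simp: lin_on_def\<close>)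
    moreover have "(v \<circ> g) \<circ> f = 0"
    proof
      fix z
      have "g (f z) = 0"
      proof (cases "z \<in> carr P1")
        case True
        then have "f z \<in> hom_kernel P0 g" using f(1) by (metis imageI)
        then show ?thesis by (simp add: hom_kernel_def)
      qed (simp add: f(2) gD(1))
      then show "((v \<circ> g) \<circ> f) z = 0 z" using v0 by simp
    qed
    ultimately show "v \<circ> g \<in> ?K" by simp
    show "?h (v \<circ> g) = v"
      using s(2) amod_homD(4)[OF v] by (auto simp: fun_eq_iff)
  next
    fix u assume u: "u \<in> ?K"
    then have uh: "u \<in> amod_hom P0 Y" by simp
    note uD = lin_on_props[OF amodule_vector_space[OF P0] amodule_vector_space[OF Y] amodule_subspace[OF P0] amod_homD(2)[OF uh]]
    note XD = vs_subspaceD[OF amodule_vector_space[OF X] amodule_subspace[OF X]]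
    show "?h u \<in> amod_hom X Y"
    proof (rule amod_homI)
      fix x assume x: "x \<in> carr X"
      note sx = s[OF x]
      show "?h u x \<in> carr Y" using x amod_homD(1)[OF uh sx(1)] by simp
      show "?h u (scal X c x) = scal Y c (?h u x)" for c
        using x XD(4)[OF x, of c] key[OF u PD(4)[OF sx(1), of c]] gD(3)[OF sx(1), of c] sx(2) uD(3)[OF sx(1), of c] by simp
      show "?h u (act X a x) = act Y a (?h u x)" for a
        using x amodule_closed[OF X x, of a] key[OF u amodule_closed[OF P0 sx(1), of a]] amod_homD(3)[OF g(1) sx(1), of a]
          sx(2) amod_homD(3)[OF uh sx(1), of a] by simp
      fix y assume y: "y \<in> carr X"
      note sy = s[OF y]
      show "?h u (x + y) = ?h u x + ?h u y"
        using x y XD(2)[OF x y] key[OF u PD(2)[OF sx(1) sy(1)]] gD(2)[OF sx(1) sy(1)] sx(2) sy(2) uD(2)[OF sx(1) sy(1)] by simp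
    qed simp
    show "?h u \<circ> g = u"
    proof
      fix p show "(?h u \<circ> g) p = u p"
      proof (cases "p \<in> carr P0")
        case True
        then show ?thesis using key[OF u True] amod_homD(1)[OF g(1) True] by simp
      next
        case False
        \<comment> \<open>Off the carrier both sides are zero: \<open>g p\<close> is zero, and
          \<open>key\<close> at \<open>0\<close> gives the value \<open>u 0\<close>.\<close>
        have "g p = g 0" using amod_homD(4)[OF g(1) False] gD(1) by simp
        then have "(?h u \<circ> g) p = u (s (g 0))" using XD(1) gD(1) by simp
        also have "\<dots> = 0" using key[OF u PD(1)] uD(1) by simp
        finally show ?thesis using amod_homD(4)[OF uh False] by simp
      qed
    qed
  qed
  then show ?thesis
    using rank_nullity[OF vp vp amod_hom_fd[OF P0 Y] lin] by (simp add: amod_hom_dim_eq)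
qed

text \<open>Multiplication by an idempotent is exact: \<open>e_i f(S) = f(e_i S)\<close>, so
  rank-nullity holds at each vertex separately.\<close>

lemma dim_epart_image:
  fixes M :: "('b, 'u::ab_group_add) amod" and N :: "('b, 'v::ab_group_add) amod"
  assumes M: "md M" and N: "md N" and f: "f \<in> amod_hom M N" and S: "submodule M S" and i: "i \<in> V"
  shows "vector_space.dim (scal M) (epart M S i) =
    vector_space.dim (scal N) (epart N (f ` S) i) + vector_space.dim (scal M) {x \<in> epart M S i. f x = 0}"
proof -
  have Ss: "module.subspace (scal M) S" "S \<subseteq> carr M" using S by (auto simp: submodule_def)
  note ES = epart_subspace[OF M Ss, of i]
  have lin: "lin_on (scal M) (scal N) (epart M S i) f"
    using amod_homD(2)[OF f] ES(3) unfolding lin_on_def by blast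
  have "f ` epart M S i = epart N (f ` S) i"
  proof (intro equalityI subsetI)
    fix y assume "y \<in> f ` epart M S i"
    then obtain x where x: "x \<in> S" "act M (e i) x = x" "y = f x" by (auto simp: epart_def)
    then have "act N (e i) y = y" using amod_homD(3)[OF f, of x "e i"] Ss(2) by auto
    then show "y \<in> epart N (f ` S) i" using x by (auto simp: epart_def)
  next
    fix y assume "y \<in> epart N (f ` S) i"
    then obtain x where x: "x \<in> S" "y = f x" "act N (e i) y = y" by (auto simp: epart_def)
    then have "y = f (act M (e i) x)" using amod_homD(3)[OF f, of x "e i"] Ss(2) by auto
    then show "y \<in> f ` epart M S i" using e_act_epart[OF M S i x(1)] by (rule image_eqI)
  qed
  then show ?thesis
    using rank_nullity[OF amodule_vector_space[OF M] amodule_vector_space[OF N] ES(2) lin] by simp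
qed

lemma dim_hom_transpose:
  fixes X :: "('b, 'v::ab_group_add) amod" and Y :: "('b, 'w::ab_group_add) amod"
  assumes X: "md X" and Y: "md Y" and tr: "is_transpose smul mu X T"
  shows "int (amod_hom_dim Y (dual_module T)) = int (amod_hom_dim X Y) +
    (\<Sum>i\<in>V. int (vector_space.dim (scal Y) (epart Y (carr Y) i)) *
       (int (amod_hom_dim X (dual_module (er_module i))) - int (vector_space.dim (scal X) (epart X (carr X) i))))"
proof -
  let ?dY = "\<lambda>i. vector_space.dim (scal Y) (epart Y (carr Y) i)"
  obtain P1 P0 f g q where T: "amodule smul (\<lambda>a b. mu b a) T" and c0: "projective_cover smul mu P0 X g"
    and c1: "projective_cover smul mu P1 (P0\<lparr>carr := hom_kernel P0 g\<rparr>) f"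
    and q: "q \<in> amod_hom (star_module smul mu P1) T" "q ` carr (star_module smul mu P1) = carr T"
      "hom_kernel (star_module smul mu P1) q = (\<lambda>\<phi>. \<phi> \<circ> f) ` carr (star_module smul mu P0)"
    using tr unfolding is_transpose_def minimal_projective_presentation_def is_cokernel_def by auto
  let ?\<Omega> = "P0\<lparr>carr := hom_kernel P0 g\<rparr>"
  have p0: "projective_module smul mu P0" "g \<in> amod_hom P0 X" "g ` carr P0 = carr X"
    using c0 by (auto simp: projective_cover_def)
  have p1: "projective_module smul mu P1" "f \<in> amod_hom P1 ?\<Omega>" "f ` carr P1 = carr ?\<Omega>"
    using c1 unfolding projective_cover_def by blast+
  obtain N0 \<iota>0 \<epsilon>0 \<alpha>0 where F0: "free_on P0 N0 \<iota>0 \<epsilon>0 \<alpha>0" by (rule projective_free[OF p0(1)])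
  obtain N1 \<iota>1 \<epsilon>1 \<alpha>1 where F1: "free_on P1 N1 \<iota>1 \<epsilon>1 \<alpha>1" by (rule projective_free[OF p1(1)])
  have P0: "md P0" and P1: "md P1" by (rule free_onD(1)[OF F0], rule free_onD(1)[OF F1])
  have K: "submodule P0 (hom_kernel P0 g)" by (rule submodule_hom_kernel[OF P0 X p0(2)])
  have \<Omega>: "md ?\<Omega>" by (rule submodule_amodule[OF P0 K])
  have f': "f \<in> amod_hom P1 P0" using p1(2) by (auto simp: amod_hom_def hom_kernel_def)
  have e\<Omega>: "epart ?\<Omega> S i = epart P0 S i" for S i by (simp add: epart_def)
  have fim: "f ` carr P1 = hom_kernel P0 g" using p1(3) by simp
  \<comment> \<open>The dimension of the space of maps factoring through \<open>f\<close> enters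
    both equations and cancels.\<close>
  have main: "int (amod_hom_dim Y (dual_module T)) = int (amod_hom_dim P1 Y) - int (amod_hom_dim P0 Y) + int (amod_hom_dim X Y)"
    using dim_hom_dual_transpose[OF F1 F0 f' T q Y]
      dim_hom_cokernel[OF P0 X Y p0(2,3) fim amod_homD(4)[OF f']] by simp
  have free: "int (amod_hom_dim P Y) = (\<Sum>i\<in>V. int (?dY i) *
      (int (vector_space.dim (scal P) (epart P (carr P) i)) - int (vector_space.dim (scal P) (epart P (rad P) i))))"
    if F: "free_on P N \<iota> \<epsilon> \<alpha>" for P :: "('b, nat \<Rightarrow> complex) amod" and N \<iota> \<epsilon> \<alpha>
  proof -
    have "amod_hom_dim P Y = (\<Sum>k<N. ?dY (\<iota> k))" by (rule dim_hom_free[OF F Y])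
    also have "\<dots> = (\<Sum>i\<in>V. \<Sum>k\<in>{k \<in> {..<N}. \<iota> k = i}. ?dY (\<iota> k))"
      by (rule sum.group[symmetric]) (use finite_V free_onD(2)[OF F] in auto)
    also have "\<dots> = (\<Sum>i\<in>V. ?dY i * card {k. k < N \<and> \<iota> k = i})"
      by (rule sum.cong[OF refl]) simp
    finally have "int (amod_hom_dim P Y) = (\<Sum>i\<in>V. int (?dY i) * int (card {k. k < N \<and> \<iota> k = i}))" by simp
    also have "\<dots> = (\<Sum>i\<in>V. int (?dY i) *
      (int (vector_space.dim (scal P) (epart P (carr P) i)) - int (vector_space.dim (scal P) (epart P (rad P) i))))"
      by (rule sum.cong[OF refl]) (simp add: dim_epart_free[OF F])
    finally show ?thesis .
  qed
  have top: "(int (vector_space.dim (scal P1) (epart P1 (carr P1) i)) - int (vector_space.dim (scal P1) (epart P1 (rad P1) i))) -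
     (int (vector_space.dim (scal P0) (epart P0 (carr P0) i)) - int (vector_space.dim (scal P0) (epart P0 (rad P0) i))) =
     int (amod_hom_dim X (dual_module (er_module i))) - int (vector_space.dim (scal X) (epart X (carr X) i))" if i: "i \<in> V" for i
  proof -
    have k1: "hom_kernel P1 f \<subseteq> rad P1" by (rule cover_kernel_rad[OF \<Omega> c1])
    have a1: "vector_space.dim (scal P1) (epart P1 (carr P1) i) = vector_space.dim (scal P0) (epart P0 (hom_kernel P0 g) i)
        + vector_space.dim (scal P1) {x \<in> epart P1 (carr P1) i. f x = 0}"
      using dim_epart_image[OF P1 \<Omega> p1(2) submodule_carr[OF P1] i] fim by (simp add: e\<Omega>)
    have a2: "vector_space.dim (scal P1) (epart P1 (rad P1) i) = vector_space.dim (scal P0) (epart P0 (rad ?\<Omega>) i)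
        + vector_space.dim (scal P1) {x \<in> epart P1 (rad P1) i. f x = 0}"
      using dim_epart_image[OF P1 \<Omega> p1(2) rad_submodule[OF P1] i] rad_hom_surj[OF P1 \<Omega> p1(2,3)] by (simp add: e\<Omega>)
    \<comment> \<open>Minimality of the presentation enters here: \<open>hom_kernel P1 f\<close>
      lies in \<open>rad P1\<close>, so the kernels of \<open>f\<close> on \<open>e_i P1\<close> and
      on \<open>e_i rad P1\<close> coincide and cancel.\<close>
    have "{x \<in> epart P1 (carr P1) i. f x = 0} = {x \<in> epart P1 (rad P1) i. f x = 0}"
      using k1 rad_sub[OF P1] by (auto simp: epart_def hom_kernel_def)
    note a3 = this
    have a4: "vector_space.dim (scal P0) (epart P0 (carr P0) i) = vector_space.dim (scal X) (epart X (carr X) i)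
        + vector_space.dim (scal P0) {x \<in> epart P0 (carr P0) i. g x = 0}"
      using dim_epart_image[OF P0 X p0(2) submodule_carr[OF P0] i] p0(3) by simp
    have a5: "{x \<in> epart P0 (carr P0) i. g x = 0} = epart P0 (hom_kernel P0 g) i"
      by (auto simp: epart_def hom_kernel_def)
    have a6: "amod_hom_dim X (dual_module (er_module i)) + vector_space.dim (scal P0) (epart P0 (rad ?\<Omega>) i) =
        vector_space.dim (scal P0) (epart P0 (rad P0) i)"
      by (rule dim_hom_dual_er[OF F0 X p0(2,3) i])
    show ?thesis using a1 a2 a4 a6 unfolding a3 a5 by linarith
  qed
  have "int (amod_hom_dim P1 Y) - int (amod_hom_dim P0 Y) = (\<Sum>i\<in>V. int (?dY i) *
     (int (amod_hom_dim X (dual_module (er_module i))) - int (vector_space.dim (scal X) (epart X (carr X) i))))"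
    unfolding free[OF F1] free[OF F0] sum_subtractf[symmetric]
  proof (rule sum.cong[OF refl])
    fix i assume i: "i \<in> V"
    show "int (?dY i) * (int (vector_space.dim (scal P1) (epart P1 (carr P1) i)) - int (vector_space.dim (scal P1) (epart P1 (rad P1) i))) -
       int (?dY i) * (int (vector_space.dim (scal P0) (epart P0 (carr P0) i)) - int (vector_space.dim (scal P0) (epart P0 (rad P0) i))) =
       int (?dY i) * (int (amod_hom_dim X (dual_module (er_module i))) - int (vector_space.dim (scal X) (epart X (carr X) i)))"
      unfolding right_diff_distrib[symmetric] top[OF i] ..
  qed
  with main show ?thesis by linarith
qed

end

section \<open>Modules given by matrices\<close>

definition comb :: "('b, 'v::ab_group_add) amod \<Rightarrow> 'i set \<Rightarrow> ('i \<Rightarrow> 'v) \<Rightarrow> ('i \<Rightarrow> complex) \<Rightarrow> 'v" where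
  "comb M I b c = (\<Sum>i\<in>I. scal M (c i) (b i))"

text \<open>Column \<open>j\<close> of \<open>\<alpha> a\<close> holds the coordinates of
  \<open>a\<close> applied to the basis vector \<open>b j\<close>. The index type is free, so that
  representations keep pairs of vertex and position as indices while auxiliary modules use
  numbers.\<close>

definition matrix_form :: "('b, 'v::ab_group_add) amod \<Rightarrow> 'i set \<Rightarrow> ('i \<Rightarrow> 'v) \<Rightarrow> ('b \<Rightarrow> 'i \<Rightarrow> 'i \<Rightarrow> complex) \<Rightarrow> bool" where
  "matrix_form M I b \<alpha> \<longleftrightarrow> finite I \<and> (\<forall>c. comb M I b c \<in> carr M) \<and>
     (\<forall>x\<in>carr M. \<exists>c\<in>supp_on I. x = comb M I b c) \<and>
     (\<forall>c. comb M I b c = 0 \<longrightarrow> (\<forall>i\<in>I. c i = 0)) \<and>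
     (\<forall>a. \<forall>j\<in>I. act M a (b j) = comb M I b (\<lambda>k. \<alpha> a k j))"

definition crd :: "('b, 'v::ab_group_add) amod \<Rightarrow> 'i set \<Rightarrow> ('i \<Rightarrow> 'v) \<Rightarrow> 'v \<Rightarrow> 'i \<Rightarrow> complex" where
  "crd M I b x = (SOME c. c \<in> supp_on I \<and> x = comb M I b c)"

lemma matrix_formD:
  assumes "matrix_form M I b \<alpha>"
  shows "finite I" "comb M I b c \<in> carr M" "comb M I b c = 0 \<Longrightarrow> i \<in> I \<Longrightarrow> c i = 0"
    "j \<in> I \<Longrightarrow> act M a (b j) = comb M I b (\<lambda>k. \<alpha> a k j)"
  using assms unfolding matrix_form_def by (blast, blast, blast, blast)

lemma crd_props:
  assumes "matrix_form M I b \<alpha>" "x \<in> carr M" shows "crd M I b x \<in> supp_on I" "comb M I b (crd M I b x) = x"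
proof -
  have "\<forall>x\<in>carr M. \<exists>c\<in>supp_on I. x = comb M I b c"
    using assms(1) unfolding matrix_form_def by (elim conjE)
  from bspec[OF this assms(2)] have "\<exists>c. c \<in> supp_on I \<and> x = comb M I b c" by auto
  from someI_ex[OF this] show "crd M I b x \<in> supp_on I" "comb M I b (crd M I b x) = x" by (simp_all add: crd_def)
qed

lemma comb_lin:
  assumes "vector_space (scal M)"
  shows "comb M I b (\<lambda>i. c i + c' i) = comb M I b c + comb M I b c'" "comb M I b (\<lambda>i. c i - c' i) = comb M I b c - comb M I b c'"
    "comb M I b (\<lambda>i. z * c i) = scal M z (comb M I b c)"
proof -
  interpret vector_space "scal M" by fact
  show "comb M I b (\<lambda>i. c i + c' i) = comb M I b c + comb M I b c'"
    by (simp add: comb_def scale_left_distrib sum.distrib)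
  show "comb M I b (\<lambda>i. c i - c' i) = comb M I b c - comb M I b c'"
    by (simp add: comb_def scale_left_diff_distrib sum_subtractf)
  show "comb M I b (\<lambda>i. z * c i) = scal M z (comb M I b c)"
    by (simp add: comb_def scale_sum_right)
qed

lemma crd_comb:
  assumes v: "vector_space (scal M)" and m: "matrix_form M I b \<alpha>" and i: "i \<in> I"
  shows "crd M I b (comb M I b c) i = c i"
proof -
  let ?d = "crd M I b (comb M I b c)"
  have "comb M I b ?d = comb M I b c" by (rule crd_props(2)[OF m matrix_formD(2)[OF m]])
  then have "comb M I b (\<lambda>i. ?d i - c i) = 0" unfolding comb_lin[OF v] by simp
  from matrix_formD(3)[OF m this i] show ?thesis by simp
qed

lemma crd_ext:
  assumes m: "matrix_form M I b \<alpha>" and x: "x \<in> carr M" "y \<in> carr M"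
    and e: "\<And>i. i \<in> I \<Longrightarrow> crd M I b x i = crd M I b y i"
  shows "x = y"
proof -
  have "comb M I b (crd M I b x) = comb M I b (crd M I b y)" unfolding comb_def by (rule sum.cong[OF refl]) (simp add: e)
  then show ?thesis unfolding crd_props(2)[OF m x(1)] crd_props(2)[OF m x(2)] .
qed

lemma crd_outside: "matrix_form M I b \<alpha> \<Longrightarrow> x \<in> carr M \<Longrightarrow> i \<notin> I \<Longrightarrow> crd M I b x i = 0"
  using crd_props(1) by (fastforce simp: supp_on_def)

lemma crd_lin:
  assumes M: "amodule smul mu M" and m: "matrix_form M I b \<alpha>"
  shows "lin_on (scal M) cscale (carr M) (crd M I b)"
proof (rule lin_onI)
  note v = amodule_vector_space[OF M]
  note MD = vs_subspaceD[OF v amodule_subspace[OF M]]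
  fix x y assume xy: "x \<in> carr M" "y \<in> carr M"
  show "crd M I b (x + y) = crd M I b x + crd M I b y"
  proof
    fix i show "crd M I b (x + y) i = (crd M I b x + crd M I b y) i"
    proof (cases "i \<in> I")
      case True
      have "x + y = comb M I b (\<lambda>i. crd M I b x i + crd M I b y i)"
        unfolding comb_lin[OF v] crd_props(2)[OF m xy(1)] crd_props(2)[OF m xy(2)] ..
      then have "crd M I b (x + y) i = crd M I b (comb M I b (\<lambda>i. crd M I b x i + crd M I b y i)) i" by (rule arg_cong)
      also have "\<dots> = crd M I b x i + crd M I b y i" by (rule crd_comb[OF v m True])
      finally show ?thesis by simp
    qed (simp add: crd_outside[OF m] xy MD)
  qed
next
  note v = amodule_vector_space[OF M]
  note MD = vs_subspaceD[OF v amodule_subspace[OF M]]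
  fix c x assume x: "x \<in> carr M"
  show "crd M I b (scal M c x) = cscale c (crd M I b x)"
  proof
    fix i show "crd M I b (scal M c x) i = cscale c (crd M I b x) i"
    proof (cases "i \<in> I")
      case True
      have "scal M c x = comb M I b (\<lambda>i. c * crd M I b x i)"
        unfolding comb_lin[OF v] crd_props(2)[OF m x] ..
      then have "crd M I b (scal M c x) i = crd M I b (comb M I b (\<lambda>i. c * crd M I b x i)) i" by (rule arg_cong)
      also have "\<dots> = c * crd M I b x i" by (rule crd_comb[OF v m True])
      finally show ?thesis by (simp add: cscale_apply)
    qed (simp add: crd_outside[OF m] x MD cscale_apply)
  qed
qed

lemma matrix_form_basis:
  assumes v: "vector_space (scal M)" and m: "matrix_form M I b \<alpha>" and i: "i \<in> I"
  shows "b i \<in> carr M" "j \<in> I \<Longrightarrow> crd M I b (b i) j = (if j = i then 1 else 0)"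
proof -
  interpret vector_space "scal M" by fact
  have "comb M I b (\<lambda>j. if j = i then 1 else 0) = (\<Sum>j\<in>I. if j = i then b i else 0)"
    unfolding comb_def by (rule sum.cong[OF refl]) simp
  also have "\<dots> = b i" using i matrix_formD(1)[OF m] by simp
  finally have e: "comb M I b (\<lambda>j. if j = i then 1 else 0) = b i" .
  show "b i \<in> carr M" using matrix_formD(2)[OF m, of "\<lambda>j. if j = i then 1 else 0"] e by simp
  show "crd M I b (b i) j = (if j = i then 1 else 0)" if "j \<in> I"
    using crd_comb[OF v m that, of "\<lambda>j. if j = i then 1 else 0"] unfolding e .
qed

lemma crd_hom:
  assumes M: "amodule smul mu M" and m: "matrix_form M I b \<alpha>" and N: "amodule smul' mu' N" and n: "matrix_form N J d \<beta>"
    and u: "lin_on (scal M) (scal N) (carr M) u" "\<And>x. x \<in> carr M \<Longrightarrow> u x \<in> carr N" and x: "x \<in> carr M"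
  shows "crd N J d (u x) j = (\<Sum>i\<in>I. crd N J d (u (b i)) j * crd M I b x i)"
proof -
  note vM = amodule_vector_space[OF M] and vN = amodule_vector_space[OF N]
  have bc: "b i \<in> carr M" if "i \<in> I" for i by (rule matrix_form_basis(1)[OF vM m that])
  have ux: "u x = (\<Sum>i\<in>I. scal N (crd M I b x i) (u (b i)))"
    using lin_on_sum[OF vM amodule_subspace[OF M] vN u(1), of I b "crd M I b x"] bc crd_props(2)[OF m x]
    by (simp add: comb_def)
  have "crd N J d (\<Sum>i\<in>I. scal N (crd M I b x i) (u (b i))) = (\<Sum>i\<in>I. cscale (crd M I b x i) (crd N J d (u (b i))))"
    by (rule lin_on_sum[OF vN amodule_subspace[OF N] vector_space_cscale crd_lin[OF N n]]) (rule u(2)[OF bc])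
  then show ?thesis unfolding ux[symmetric] by (simp add: cscale_apply mult.commute)
qed

lemma crd_act:
  assumes M: "amodule smul mu M" and m: "matrix_form M I b \<alpha>" and x: "x \<in> carr M" and j: "j \<in> I"
  shows "crd M I b (act M a x) j = (\<Sum>i\<in>I. \<alpha> a j i * crd M I b x i)"
proof -
  have "crd M I b (act M a x) j = (\<Sum>i\<in>I. crd M I b (act M a (b i)) j * crd M I b x i)"
    by (rule crd_hom[OF M m M m amodule_lin_on[OF M] amodule_closed[OF M] x])
  also have "\<dots> = (\<Sum>i\<in>I. \<alpha> a j i * crd M I b x i)"
  proof (rule sum.cong[OF refl])
    fix i assume i: "i \<in> I"
    show "crd M I b (act M a (b i)) j * crd M I b x i = \<alpha> a j i * crd M I b x i"
      unfolding matrix_formD(4)[OF m i] crd_comb[OF amodule_vector_space[OF M] m j] ..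
  qed
  finally show ?thesis .
qed

section \<open>Intertwining matrices and duality\<close>

definition hom_matrices :: "'i set \<Rightarrow> 'j set \<Rightarrow> ('b \<Rightarrow> 'i \<Rightarrow> 'i \<Rightarrow> complex) \<Rightarrow> ('b \<Rightarrow> 'j \<Rightarrow> 'j \<Rightarrow> complex) \<Rightarrow> ('j \<times> 'i \<Rightarrow> complex) set" where
  "hom_matrices I J \<alpha> \<beta> = {h \<in> supp_on (J \<times> I). \<forall>a. \<forall>j\<in>J. \<forall>i\<in>I.
     (\<Sum>k\<in>I. h (j, k) * \<alpha> a k i) = (\<Sum>k\<in>J. \<beta> a j k * h (k, i))}"

lemma subspace_hom_matrices: "cf.subspace (hom_matrices I J \<alpha> \<beta>)"
  by (rule cf.subspaceI)
    (auto simp: hom_matrices_def supp_on_def cscale_apply algebra_simps sum.distrib simp flip: sum_distrib_left)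

lemma amod_hom_dim_matrices:
  assumes M: "amodule smul mu M" and m: "matrix_form M I b \<alpha>" and N: "amodule smul' mu' N" and n: "matrix_form N J d \<beta>"
  shows "amod_hom_dim M N = cdim (hom_matrices I J \<alpha> \<beta>)"
  unfolding amod_hom_dim_eq
proof -
  note vM = amodule_vector_space[OF M] and vN = amodule_vector_space[OF N]
  have vp: "vector_space (pointwise_scale (scal N))" by (rule vector_space_pointwise_scale[OF vN])
  let ?c = "crd M I b" and ?e = "crd N J d"
  let ?f = "\<lambda>u (j, i). if j \<in> J \<and> i \<in> I then ?e (u (b i)) j else 0"
  let ?g = "\<lambda>h x. if x \<in> carr M then comb N J d (\<lambda>j. \<Sum>i\<in>I. h (j, i) * ?c x i) else 0"
  note MD = vs_subspaceD[OF vM amodule_subspace[OF M]]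
  have bc: "b i \<in> carr M" if "i \<in> I" for i by (rule matrix_form_basis(1)[OF vM m that])
  have el: "?e (x + y) = ?e x + ?e y" "?e (scal N c x) = cscale c (?e x)" if "x \<in> carr N" "y \<in> carr N" for x y c
    using crd_lin[OF N n] that unfolding lin_on_def by auto
  have cl: "?c (x + y) = ?c x + ?c y" "?c (scal M c x) = cscale c (?c x)" if "x \<in> carr M" "y \<in> carr M" for x y c
    using crd_lin[OF M m] that unfolding lin_on_def by auto
  show "vector_space.dim (pointwise_scale (scal N)) (amod_hom M N) = cdim (hom_matrices I J \<alpha> \<beta>)"
  proof (rule dim_iso[OF vp vector_space_cscale, where f = ?f and g = ?g])
    show "module.subspace (pointwise_scale (scal N)) (amod_hom M N)"
      by (rule subspace_fd[OF vp amod_hom_fd[OF M N]])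
    show "lin_on (pointwise_scale (scal N)) cscale (amod_hom M N) ?f"
    proof (rule lin_onI)
      fix u v assume u: "u \<in> amod_hom M N" and v: "v \<in> amod_hom M N"
      show "?f (u + v) = ?f u + ?f v"
        using el(1)[OF amod_homD(1)[OF u bc] amod_homD(1)[OF v bc]] by (auto simp: fun_eq_iff)
    next
      fix c u assume u: "u \<in> amod_hom M N"
      show "?f (pointwise_scale (scal N) c u) = cscale c (?f u)"
        using el(2)[OF amod_homD(1)[OF u bc] amod_homD(1)[OF u bc]] by (auto simp: fun_eq_iff cscale_apply pointwise_scale_def)
    qed
  next
    fix u assume u: "u \<in> amod_hom M N"
    have ch: "?e (u x) j = (\<Sum>i\<in>I. ?e (u (b i)) j * ?c x i)" if "x \<in> carr M" for x j
      by (rule crd_hom[OF M m N n amod_homD(2)[OF u] amod_homD(1)[OF u] that])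
    show "?f u \<in> hom_matrices I J \<alpha> \<beta>"
      unfolding hom_matrices_def
    proof (intro CollectI conjI allI ballI)
      show "?f u \<in> supp_on (J \<times> I)" by (auto simp: supp_on_def)
      fix a j i assume j: "j \<in> J" and i: "i \<in> I"
      have "(\<Sum>k\<in>I. ?f u (j, k) * \<alpha> a k i) = (\<Sum>k\<in>I. ?e (u (b k)) j * ?c (act M a (b i)) k)"
      proof (rule sum.cong[OF refl])
        fix k assume k: "k \<in> I"
        show "?f u (j, k) * \<alpha> a k i = ?e (u (b k)) j * ?c (act M a (b i)) k"
          unfolding matrix_formD(4)[OF m i] crd_comb[OF vM m k] using j k by simp
      qed
      also have "\<dots> = ?e (u (act M a (b i))) j" by (rule ch[symmetric]) (rule amodule_closed[OF M bc[OF i]])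
      also have "\<dots> = ?e (act N a (u (b i))) j" by (simp only: amod_homD(3)[OF u bc[OF i]])
      also have "\<dots> = (\<Sum>k\<in>J. \<beta> a j k * ?e (u (b i)) k)" by (rule crd_act[OF N n amod_homD(1)[OF u bc[OF i]] j])
      also have "\<dots> = (\<Sum>k\<in>J. \<beta> a j k * ?f u (k, i))" by (rule sum.cong[OF refl]) (simp add: i)
      finally show "(\<Sum>k\<in>I. ?f u (j, k) * \<alpha> a k i) = (\<Sum>k\<in>J. \<beta> a j k * ?f u (k, i))" .
    qed
    show "?g (?f u) = u"
    proof
      fix x show "?g (?f u) x = u x"
      proof (cases "x \<in> carr M")
        case True
        have "comb N J d (\<lambda>j. \<Sum>i\<in>I. ?f u (j, i) * ?c x i) = comb N J d (?e (u x))"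
          unfolding comb_def
        proof (rule sum.cong[OF refl])
          fix j assume j: "j \<in> J"
          have "(\<Sum>i\<in>I. ?f u (j, i) * ?c x i) = (\<Sum>i\<in>I. ?e (u (b i)) j * ?c x i)"
            by (rule sum.cong[OF refl]) (simp add: j)
          also have "\<dots> = ?e (u x) j" by (rule ch[OF True, symmetric])
          finally show "scal N (\<Sum>i\<in>I. ?f u (j, i) * ?c x i) (d j) = scal N (?e (u x) j) (d j)" by (simp only:)
        qed
        also have "\<dots> = u x" by (rule crd_props(2)[OF n amod_homD(1)[OF u True]])
        finally show ?thesis by (simp only: True if_True)
      qed (simp add: amod_homD(4)[OF u])
    qed
  next
    fix h assume h: "h \<in> hom_matrices I J \<alpha> \<beta>"
    have rel: "(\<Sum>k\<in>I. h (j, k) * \<alpha> a k i) = (\<Sum>k\<in>J. \<beta> a j k * h (k, i))" if "j \<in> J" "i \<in> I" for a j i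
      using h that unfolding hom_matrices_def by blast
    have cg: "?g h x \<in> carr N" "j \<in> J \<Longrightarrow> ?e (?g h x) j = (\<Sum>i\<in>I. h (j, i) * ?c x i)" if x: "x \<in> carr M" for x j
      using x matrix_formD(2)[OF n] crd_comb[OF vN n] by simp_all
    show "?g h \<in> amod_hom M N"
    proof (rule amod_homI)
      fix x assume x: "x \<in> carr M"
      show "?g h x \<in> carr N" by (rule cg(1)[OF x])
      show "?g h (scal M c x) = scal N c (?g h x)" for c
        using x MD(4)[OF x, of c] by (simp add: cl(2)[OF x x] cscale_apply comb_lin(3)[OF vN, symmetric] sum_distrib_left mult.left_commute)
      show "?g h (act M a x) = act N a (?g h x)" for a
      proof (rule crd_ext[OF n])
        show "?g h (act M a x) \<in> carr N" by (rule cg(1)[OF amodule_closed[OF M x]])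
        show "act N a (?g h x) \<in> carr N" by (rule amodule_closed[OF N cg(1)[OF x]])
        fix j assume j: "j \<in> J"
        have "?e (?g h (act M a x)) j = (\<Sum>k\<in>I. h (j, k) * ?c (act M a x) k)" by (rule cg(2)[OF amodule_closed[OF M x] j])
        also have "\<dots> = (\<Sum>k\<in>I. \<Sum>i\<in>I. h (j, k) * \<alpha> a k i * ?c x i)"
          by (rule sum.cong[OF refl]) (simp add: crd_act[OF M m x] sum_distrib_left mult.assoc)
        also have "\<dots> = (\<Sum>i\<in>I. \<Sum>k\<in>I. h (j, k) * \<alpha> a k i * ?c x i)" by (rule sum.swap)
        also have "\<dots> = (\<Sum>i\<in>I. \<Sum>k\<in>J. \<beta> a j k * h (k, i) * ?c x i)"
          by (rule sum.cong[OF refl]) (simp add: rel[OF j] flip: sum_distrib_right)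
        also have "\<dots> = (\<Sum>k\<in>J. \<Sum>i\<in>I. \<beta> a j k * h (k, i) * ?c x i)" by (rule sum.swap)
        also have "\<dots> = (\<Sum>k\<in>J. \<beta> a j k * ?e (?g h x) k)"
        proof (rule sum.cong[OF refl])
          fix k assume k: "k \<in> J"
          show "(\<Sum>i\<in>I. \<beta> a j k * h (k, i) * ?c x i) = \<beta> a j k * ?e (?g h x) k"
            unfolding cg(2)[OF x k] by (simp add: sum_distrib_left mult.assoc)
        qed
        also have "\<dots> = ?e (act N a (?g h x)) j" by (rule crd_act[OF N n cg(1)[OF x] j, symmetric])
        finally show "?e (?g h (act M a x)) j = ?e (act N a (?g h x)) j" .
      qed
      fix y assume y: "y \<in> carr M"
      show "?g h (x + y) = ?g h x + ?g h y"
        using x y MD(2)[OF x y] by (simp add: cl(1)[OF x y] comb_lin(1)[OF vN, symmetric] sum.distrib distrib_left)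
    qed simp
    show "?f (?g h) = h"
    proof (intro ext, clarify)
      fix j i
      show "(if j \<in> J \<and> i \<in> I then ?e (?g h (b i)) j else 0) = h (j, i)"
      proof (cases "j \<in> J \<and> i \<in> I")
        case True
        then have ji: "j \<in> J" "i \<in> I" by auto
        have "?e (?g h (b i)) j = (\<Sum>k\<in>I. h (j, k) * ?c (b i) k)" by (rule cg(2)[OF bc[OF ji(2)] ji(1)])
        also have "\<dots> = (\<Sum>k\<in>I. if k = i then h (j, i) else 0)"
          by (rule sum.cong[OF refl]) (simp add: matrix_form_basis(2)[OF vM m ji(2)])
        also have "\<dots> = h (j, i)" using ji(2) matrix_formD(1)[OF m] by simp
        finally show ?thesis using True by (simp only: if_True simp_thms)
      next
        case False
        then show ?thesis using h by (auto simp: hom_matrices_def supp_on_def)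
      qed
    qed
  qed
qed

text \<open>Transposing \<open>h \<alpha> = \<beta> h\<close> yields the intertwining equation for
  the transposed actions with source and target exchanged.\<close>

lemma cdim_hom_matrices_transpose:
  "cdim (hom_matrices J I (\<lambda>a k j. \<beta> a j k) (\<lambda>a k j. \<alpha> a j k)) = cdim (hom_matrices I J \<alpha> \<beta>)"
proof (rule dim_iso[OF vector_space_cscale vector_space_cscale subspace_hom_matrices, where f = "\<lambda>h (j, i). h (i, j)" and g = "\<lambda>h (j, i). h (i, j)"])
  show "lin_on cscale cscale (hom_matrices J I (\<lambda>a k j. \<beta> a j k) (\<lambda>a k j. \<alpha> a j k)) (\<lambda>h (j, i). h (i, j))"
    by (rule lin_onI) (auto simp: fun_eq_iff cscale_apply)
  fix h assume "h \<in> hom_matrices J I (\<lambda>a k j. \<beta> a j k) (\<lambda>a k j. \<alpha> a j k)"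
  then show "(\<lambda>(j, i). h (i, j)) \<in> hom_matrices I J \<alpha> \<beta>"
    by (auto simp: hom_matrices_def supp_on_def mult.commute)
  show "(\<lambda>(j, i). (\<lambda>(j, i). h (i, j)) (i, j)) = h" by auto
next
  fix h assume "h \<in> hom_matrices I J \<alpha> \<beta>"
  then show "(\<lambda>(j, i). h (i, j)) \<in> hom_matrices J I (\<lambda>a k j. \<beta> a j k) (\<lambda>a k j. \<alpha> a j k)"
    by (auto simp: hom_matrices_def supp_on_def mult.commute)
  show "(\<lambda>(j, i). (\<lambda>(j, i). h (i, j)) (i, j)) = h" by auto
qed

lemma matrix_form_exists:
  assumes M: "amodule smul mu M" obtains n :: nat and b \<alpha> where "matrix_form M {..<n} b \<alpha>"
proof -
  interpret vector_space "scal M" by (rule amodule_vector_space[OF M])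
  obtain B where B: "finite B" "independent B" "span B = carr M" "card B = dim (carr M)"
    by (rule fd_basis[OF vector_space_axioms amodule_fd[OF M]])
  obtain h where h: "bij_betw h {..<card B} B"
    using ex_bij_betw_nat_finite[OF B(1)] by (auto simp: atLeast0LessThan)
  let ?I = "{..<card B}"
  have BM: "B \<subseteq> carr M" unfolding B(3)[symmetric] by (rule span_superset)
  have comb: "comb M ?I h c = (\<Sum>v\<in>B. scal M (c (the_inv_into ?I h v)) v)" for c
  proof -
    have "(\<Sum>v\<in>B. scal M (c (the_inv_into ?I h v)) v) = (\<Sum>i\<in>?I. scal M (c (the_inv_into ?I h (h i))) (h i))"
      by (rule sum.reindex_bij_betw[OF h, symmetric])
    also have "\<dots> = comb M ?I h c"
      unfolding comb_def by (rule sum.cong[OF refl]) (simp add: the_inv_into_f_f[OF bij_betw_imp_inj_on[OF h]])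
    finally show ?thesis by simp
  qed
  have cin: "comb M ?I h c \<in> carr M" for c
    unfolding comb B(3)[symmetric] by (intro span_sum span_scale span_base)
  have ex: "\<exists>c\<in>supp_on ?I. x = comb M ?I h c" if "x \<in> carr M" for x
  proof -
    have "x \<in> span B" using that B(3) by simp
    then obtain u where u: "x = (\<Sum>v\<in>B. scal M (u v) v)" unfolding span_finite[OF B(1)] by auto
    let ?c = "\<lambda>i. if i \<in> ?I then u (h i) else 0"
    have "x = (\<Sum>i\<in>?I. scal M (u (h i)) (h i))" unfolding u by (rule sum.reindex_bij_betw[OF h, symmetric])
    also have "\<dots> = comb M ?I h ?c" unfolding comb_def by (rule sum.cong[OF refl]) simp
    finally show ?thesis by (intro bexI[of _ ?c]) (auto simp: supp_on_def)
  qed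
  have indep: "c i = 0" if "comb M ?I h c = 0" "i \<in> ?I" for c i
  proof -
    have "h i \<in> B" using h that(2) by (auto simp: bij_betw_def)
    from independentD[OF B(2,1) order_refl that(1)[unfolded comb] this]
    show ?thesis by (simp only: the_inv_into_f_f[OF bij_betw_imp_inj_on[OF h] that(2)])
  qed
  define \<alpha> where "\<alpha> a k j = (SOME c. act M a (h j) = comb M ?I h c) k" for a k j
  have act: "act M a (h j) = comb M ?I h (\<lambda>k. \<alpha> a k j)" if "j \<in> ?I" for a j
  proof -
    have "h j \<in> carr M" using h that BM by (auto simp: bij_betw_def)
    then have "act M a (h j) \<in> carr M" by (rule amodule_closed[OF M])
    from ex[OF this] have "\<exists>c. act M a (h j) = comb M ?I h c" by auto
    from someI_ex[OF this] show ?thesis by (simp only: \<alpha>_def)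
  qed
  have "matrix_form M ?I h \<alpha>"
    unfolding matrix_form_def
  proof (intro conjI allI ballI impI)
    show "finite ?I" by simp
    show "comb M ?I h c \<in> carr M" for c by (rule cin)
    show "\<exists>c\<in>supp_on ?I. x = comb M ?I h c" if "x \<in> carr M" for x by (rule ex[OF that])
    show "c i = 0" if "comb M ?I h c = 0" "i \<in> ?I" for c i by (rule indep[OF that])
    show "act M a (h j) = comb M ?I h (\<lambda>k. \<alpha> a k j)" if "j \<in> ?I" for a j by (rule act[OF that])
  qed
  then show ?thesis by (rule that)
qed

text \<open>The basis is the dual basis, formed by the coordinate functions extended by zero; in it
  the action is transposed.\<close>

lemma matrix_form_dual:
  assumes M: "amodule smul mu M" and m: "matrix_form M I b \<alpha>"
  shows "matrix_form (dual_module M) I (\<lambda>i x. if x \<in> carr M then crd M I b x i else 0) (\<lambda>a k j. \<alpha> a j k)"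
    (is "matrix_form _ _ ?b ?\<alpha>")
proof -
  note v = amodule_vector_space[OF M]
  have bc: "b i \<in> carr M" if "i \<in> I" for i by (rule matrix_form_basis(1)[OF v m that])
  have ev: "comb (dual_module M) I ?b c x = (if x \<in> carr M then \<Sum>i\<in>I. c i * crd M I b x i else 0)" for c x
    by (simp add: comb_def dual_simps cscale_apply)
  note MD = vs_subspaceD[OF v amodule_subspace[OF M]]
  have cl: "crd M I b (x + y) = crd M I b x + crd M I b y" "crd M I b (scal M c x) = cscale c (crd M I b x)"
    if "x \<in> carr M" "y \<in> carr M" for x y c
    using crd_lin[OF M m] that unfolding lin_on_def by auto
  show ?thesis
    unfolding matrix_form_def
  proof (intro conjI allI ballI impI)
    show "finite I" by (rule matrix_formD(1)[OF m])
    show "comb (dual_module M) I ?b c \<in> carr (dual_module M)" for c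
      unfolding dual_simps functionals_def
    proof (intro CollectI conjI allI ballI impI lin_onI, unfold ev)
      fix x y assume xy: "x \<in> carr M" "y \<in> carr M"
      show "(if x + y \<in> carr M then \<Sum>i\<in>I. c i * crd M I b (x + y) i else 0) =
         (if x \<in> carr M then \<Sum>i\<in>I. c i * crd M I b x i else 0) + (if y \<in> carr M then \<Sum>i\<in>I. c i * crd M I b y i else 0)"
        using xy MD(2)[OF xy] by (simp add: cl(1)[OF xy] distrib_left sum.distrib)
    next
      fix z x assume x: "x \<in> carr M"
      show "(if scal M z x \<in> carr M then \<Sum>i\<in>I. c i * crd M I b (scal M z x) i else 0) =
         z * (if x \<in> carr M then \<Sum>i\<in>I. c i * crd M I b x i else 0)"
        using x MD(4)[OF x] by (simp add: cl(2)[OF x x] cscale_apply sum_distrib_left mult.left_commute)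
    qed simp_all
    fix \<phi> assume "\<phi> \<in> carr (dual_module M)"
    then have \<phi>: "\<phi> \<in> functionals (scal M) (carr M) {}" by (simp only: dual_simps)
    let ?c = "\<lambda>i. if i \<in> I then \<phi> (b i) else 0"
    show "\<exists>c\<in>supp_on I. \<phi> = comb (dual_module M) I ?b c"
    proof (rule bexI[of _ ?c])
      show "\<phi> = comb (dual_module M) I ?b ?c"
      proof
        fix x show "\<phi> x = comb (dual_module M) I ?b ?c x"
        proof (cases "x \<in> carr M")
          case True
          have "\<phi> x = \<phi> (\<Sum>i\<in>I. scal M (crd M I b x i) (b i))" using crd_props(2)[OF m True] by (simp add: comb_def)
          also have "\<dots> = (\<Sum>i\<in>I. crd M I b x i * \<phi> (b i))"
            by (rule lin_on_sum[OF v amodule_subspace[OF M] vector_space_times functionalsD(1)[OF \<phi>] bc])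
          also have "\<dots> = comb (dual_module M) I ?b ?c x"
            unfolding ev using True by (simp add: mult.commute)
          finally show ?thesis .
        qed (simp add: ev functionalsD(2)[OF \<phi>])
      qed
    qed (simp add: supp_on_def)
  next
    fix c i assume z: "comb (dual_module M) I ?b c = 0" and i: "i \<in> I"
    have "0 = comb (dual_module M) I ?b c (b i)" unfolding z by simp
    also have "\<dots> = (\<Sum>k\<in>I. c k * crd M I b (b i) k)" unfolding ev using bc[OF i] by simp
    also have "\<dots> = (\<Sum>k\<in>I. if k = i then c i else 0)"
      by (rule sum.cong[OF refl]) (simp add: matrix_form_basis(2)[OF v m i])
    also have "\<dots> = c i" using i matrix_formD(1)[OF m] by simp
    finally show "c i = 0" by simp
  next
    fix a j assume j: "j \<in> I"
    show "act (dual_module M) a (?b j) = comb (dual_module M) I ?b (\<lambda>k. \<alpha> a j k)"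
    proof
      fix x show "act (dual_module M) a (?b j) x = comb (dual_module M) I ?b (\<lambda>k. \<alpha> a j k) x"
        unfolding ev using amodule_closed[OF M, of x a] crd_act[OF M m _ j, of x a] by (simp add: dual_simps)
    qed
  qed
qed

text \<open>Both sides are spaces of intertwining matrices exchanged by transposition, which avoids
  any comparison of a module with its bidual.\<close>

lemma amod_hom_dim_dual:
  assumes M: "amodule smul mu M" and N: "amodule smul mu' N"
  shows "amod_hom_dim (dual_module N) (dual_module M) = amod_hom_dim M N"
proof -
  obtain m :: nat and b \<alpha> where m: "matrix_form M {..<m} b \<alpha>" by (rule matrix_form_exists[OF M])
  obtain n :: nat and d \<beta> where n: "matrix_form N {..<n} d \<beta>" by (rule matrix_form_exists[OF N])
  show ?thesis
    unfolding amod_hom_dim_matrices[OF M m N n]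
      amod_hom_dim_matrices[OF dual_amodule[OF N] matrix_form_dual[OF N n] dual_amodule[OF M] matrix_form_dual[OF M m]]
    by (rule cdim_hom_matrices_transpose)
qed

section \<open>Semicontinuity in families of modules given by matrices\<close>

lemma usc_amod_hom_dim:
  assumes IJ: "finite I" "finite J"
    and M: "\<And>x. x \<in> X \<Longrightarrow> amodule smul mu (M x) \<and> matrix_form (M x) I (b x) (\<alpha> x)"
    and N: "\<And>x. x \<in> X \<Longrightarrow> amodule smul mu (N x) \<and> matrix_form (N x) J (d x) (\<beta> x)"
    and reg: "\<And>a k i. k \<in> I \<Longrightarrow> i \<in> I \<Longrightarrow> regular_on C X (\<lambda>x. \<alpha> x a k i)"
      "\<And>a k j. k \<in> J \<Longrightarrow> j \<in> J \<Longrightarrow> regular_on C X (\<lambda>x. \<beta> x a k j)"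
  shows "usc_on C X (\<lambda>x. int (amod_hom_dim (M x) (N x)))"
proof -
  let ?R = "UNIV \<times> J \<times> I"
  let ?F = "\<lambda>x (a, j, i) h. (\<Sum>k\<in>I. h (j, k) * \<alpha> x a k i) - (\<Sum>k\<in>J. \<beta> x a j k * h (k, i))"
  have "usc_on C X (\<lambda>x. int (cdim {h \<in> supp_on (J \<times> I). \<forall>r\<in>?R. ?F x r h = 0}))"
  proof (rule usc_dim_solutions)
    show "finite (J \<times> I)" using IJ by simp
    show "lin_on cscale (*) (supp_on (J \<times> I)) (?F x r)" for x r
      by (cases r, rule lin_onI) (auto simp: cscale_apply algebra_simps sum.distrib sum_distrib_left)
    show "regular_on C X (\<lambda>x. ?F x r h)" if "r \<in> ?R" for r h
      using that by (cases r) (auto intro!: regular_diff regular_sum regular_mult reg)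
  qed
  moreover have "amod_hom_dim (M x) (N x) = cdim {h \<in> supp_on (J \<times> I). \<forall>r\<in>?R. ?F x r h = 0}" if "x \<in> X" for x
  proof -
    have "amod_hom_dim (M x) (N x) = cdim (hom_matrices I J (\<alpha> x) (\<beta> x))"
      using M[OF that] N[OF that] amod_hom_dim_matrices by blast
    also have "hom_matrices I J (\<alpha> x) (\<beta> x) = {h \<in> supp_on (J \<times> I). \<forall>r\<in>?R. ?F x r h = 0}"
      by (auto simp: hom_matrices_def)
    finally show ?thesis .
  qed
  ultimately show ?thesis by (subst usc_cong) auto
qed

text \<open>In a basis where the element acts as a diagonal projection, its fixed vectors are those
  with coordinates supported in \<open>I'\<close>. The dimension \<open>dim e_i X\<close> is thereby
  constant along a variety of representations.\<close>

lemma dim_epart_matrix: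
  assumes M: "amodule smul mu M" and m: "matrix_form M I b \<alpha>" and I': "I' \<subseteq> I"
    and d: "\<And>k j. k \<in> I \<Longrightarrow> j \<in> I \<Longrightarrow> \<alpha> a k j = (if k = j \<and> k \<in> I' then 1 else 0)"
  shows "vector_space.dim (scal M) {x \<in> carr M. act M a x = x} = card I'"
proof -
  note v = amodule_vector_space[OF M]
  interpret vector_space "scal M" by (rule v)
  note MD = vs_subspaceD[OF v amodule_subspace[OF M]]
  have fI: "finite I'" using I' matrix_formD(1)[OF m] by (rule finite_subset)
  have ca: "crd M I b (act M a x) j = (if j \<in> I' then crd M I b x j else 0)" if "x \<in> carr M" "j \<in> I" for x j
  proof -
    have "crd M I b (act M a x) j = (\<Sum>i\<in>I. if j = i then (if j \<in> I' then crd M I b x j else 0) else 0)"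
      unfolding crd_act[OF M m that] by (rule sum.cong[OF refl]) (simp add: d that(2))
    also have "\<dots> = (if j \<in> I' then crd M I b x j else 0)" using that(2) matrix_formD(1)[OF m] by simp
    finally show ?thesis .
  qed
  have "vector_space.dim (scal M) {x \<in> carr M. act M a x = x} = cdim (supp_on I' :: (_ \<Rightarrow> complex) set)"
  proof (rule dim_iso[OF v vector_space_cscale, where f = "crd M I b" and g = "comb M I b"])
    show "subspace {x \<in> carr M. act M a x = x}"
      by (rule subspaceI) (auto simp: MD act_zero[OF M] amodule_add[OF M] amodule_scale[OF M])
    show "lin_on (scal M) cscale {x \<in> carr M. act M a x = x} (crd M I b)"
      using crd_lin[OF M m] unfolding lin_on_def by blast
  next
    fix x assume "x \<in> {x \<in> carr M. act M a x = x}"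
    then have x: "x \<in> carr M" "act M a x = x" by auto
    show "comb M I b (crd M I b x) = x" by (rule crd_props(2)[OF m x(1)])
    have "crd M I b x j = 0" if "j \<notin> I'" for j
      using ca[OF x(1), of j] x(2) that crd_outside[OF m x(1), of j] by (cases "j \<in> I") auto
    then show "crd M I b x \<in> supp_on I'" by (simp add: supp_on_def)
  next
    fix c :: "_ \<Rightarrow> complex" assume c: "c \<in> supp_on I'"
    let ?x = "comb M I b c"
    have xc: "?x \<in> carr M" by (rule matrix_formD(2)[OF m])
    have cc: "crd M I b ?x j = c j" for j
      using crd_comb[OF v m, of j c] crd_outside[OF m xc, of j] c I' by (cases "j \<in> I") (auto simp: supp_on_def)
    then show "crd M I b ?x = c" by (rule ext)
    have "act M a ?x = ?x"
      by (rule crd_ext[OF m amodule_closed[OF M xc] xc])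
        (use c in \<open>auto simp: ca[OF xc] cc supp_on_def\<close>)
    then show "?x \<in> {x \<in> carr M. act M a x = x}" using xc by simp
  qed
  then show ?thesis using supp_on_finite(2)[OF fI] by simp
qed

lemma (in basic_algebra) opposite: "basic_algebra smul (\<lambda>a b. mu b a) V e r"
proof -
  \<comment> \<open>A product in the opposite algebra is the product of the reversed list, so the
    same nilpotency exponent serves.\<close>
  have rev: "foldr (\<lambda>a b. mu b a) as 1 = foldr mu (rev as) 1" for as
    by (induction as) (simp_all add: foldr_mu_append[symmetric] del: foldr_append)
  obtain k where k: "\<forall>as. length as = k \<and> set as \<subseteq> r \<longrightarrow> foldr mu as 1 = 0" using r_nilpotent by blast
  have "foldr (\<lambda>a b. mu b a) as 1 = 0" if "length as = k" "set as \<subseteq> r" for as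
    unfolding rev using k that by simp
  then show ?thesis
    by unfold_locales
      (auto simp: mu_add_left mu_add_right mu_smul_left mu_smul_right mu_assoc mu_one_left mu_one_right
        smul_vs alg_fd finite_V e_idem e_orth e_sum r_subspace r_left r_right e_notin_r alg_decomp)
qed

text \<open>With \<open>dA\<close> and \<open>dB\<close> constant on \<open>X\<close>, the only
  subtracted terms of the dimension formula are constants and the varying Hom dimensions carry
  factors \<open>dB i\<close>. The formula holds for every transpose, so no regularity of
  \<open>T\<close> in \<open>x\<close> enters.\<close>

lemma (in basic_algebra) usc_hom_transpose:
  fixes A :: "'x \<Rightarrow> ('b, 'v::ab_group_add) amod" and B :: "'x \<Rightarrow> ('b, 'w::ab_group_add) amod"
    and T :: "'x \<Rightarrow> 'b fdmod"
  assumes IJ: "finite I" "finite J"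
    and A: "\<And>x. x \<in> X \<Longrightarrow> amodule smul mu (A x) \<and> matrix_form (A x) I (b x) (\<alpha> x)"
    and B: "\<And>x. x \<in> X \<Longrightarrow> amodule smul mu (B x) \<and> matrix_form (B x) J (c x) (\<beta> x)"
    and reg: "\<And>a k i. k \<in> I \<Longrightarrow> i \<in> I \<Longrightarrow> regular_on C X (\<lambda>x. \<alpha> x a k i)"
      "\<And>a k j. k \<in> J \<Longrightarrow> j \<in> J \<Longrightarrow> regular_on C X (\<lambda>x. \<beta> x a k j)"
    and dA: "\<And>x i. x \<in> X \<Longrightarrow> i \<in> V \<Longrightarrow> vector_space.dim (scal (A x)) {y \<in> carr (A x). act (A x) (e i) y = y} = dA i"
    and dB: "\<And>x i. x \<in> X \<Longrightarrow> i \<in> V \<Longrightarrow> vector_space.dim (scal (B x)) {y \<in> carr (B x). act (B x) (e i) y = y} = dB i"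
    and T: "\<And>x. x \<in> X \<Longrightarrow> is_transpose smul mu (A x) (T x)"
  shows "usc_on C X (\<lambda>x. int (amod_hom_dim (B x) (dual_module (T x))))"
proof -
  have er: "amodule smul mu (dual_module (er_module i))" for i
    using dual_amodule[OF er_amodule[of i]] by simp
  have u1: "usc_on C X (\<lambda>x. int (amod_hom_dim (A x) (B x)))"
    by (rule usc_amod_hom_dim[OF IJ A B reg])
  have u2: "usc_on C X (\<lambda>x. int (amod_hom_dim (A x) (dual_module (er_module i))))" for i
  proof -
    obtain n :: nat and d \<delta> where n: "matrix_form (dual_module (er_module i)) {..<n} d \<delta>"
      by (rule matrix_form_exists[OF er])
    have E: "amodule smul mu (dual_module (er_module i)) \<and> matrix_form (dual_module (er_module i)) {..<n} d \<delta>"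
      using er n by blast
    show ?thesis
      by (rule usc_amod_hom_dim[where \<alpha> = \<alpha> and \<beta> = "\<lambda>_. \<delta>" and b = b and d = "\<lambda>_. d", OF IJ(1) _ A E reg(1)]) auto
  qed
  have "usc_on C X (\<lambda>x. int (amod_hom_dim (A x) (B x)) +
      (\<Sum>i\<in>V. int (dB i) * (int (amod_hom_dim (A x) (dual_module (er_module i))) + (- int (dA i)))))"
    by (intro usc_add usc_sum usc_nat_mult usc_const u1 u2)
  moreover have "int (amod_hom_dim (B x) (dual_module (T x))) = int (amod_hom_dim (A x) (B x)) +
      (\<Sum>i\<in>V. int (dB i) * (int (amod_hom_dim (A x) (dual_module (er_module i))) + (- int (dA i))))"
    if x: "x \<in> X" for x
  proof -
    have Ax: "amodule smul mu (A x)" and Bx: "amodule smul mu (B x)" using A[OF x] B[OF x] by auto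
    show ?thesis
      unfolding dim_hom_transpose[OF Ax Bx T[OF x]] epart_def
      using dA[OF x] dB[OF x] by simp
  qed
  ultimately show ?thesis by (subst usc_cong) auto
qed

section \<open>Path algebras\<close>

locale path_algebra_presentation = fin_digraph Q for Q :: "(nat, 'c) pre_digraph" +
  fixes smul :: "complex \<Rightarrow> 'b::ring_1 \<Rightarrow> 'b" and \<pi> :: "('c qpath \<Rightarrow> complex) \<Rightarrow> 'b"
  assumes fd: "fd_algebra smul" and adm: "admissible_presentation smul Q \<pi>"
begin

abbreviation PA where "PA \<equiv> path_algebra Q"
abbreviation vtx :: "nat \<Rightarrow> 'c qpath \<Rightarrow> complex" where "vtx i \<equiv> indicator {(i, [])}"
abbreviation rr where "rr \<equiv> \<pi> ` arrow_ideal PA"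

lemma \<pi>_props:
  shows \<pi>_add: "x \<in> PA \<Longrightarrow> y \<in> PA \<Longrightarrow> \<pi> (x + y) = \<pi> x + \<pi> y"
    and \<pi>_mult: "x \<in> PA \<Longrightarrow> y \<in> PA \<Longrightarrow> \<pi> (pmult Q x y) = \<pi> x * \<pi> y"
    and \<pi>_scale: "x \<in> PA \<Longrightarrow> \<pi> (cscale c x) = smul c (\<pi> x)"
    and \<pi>_one: "\<pi> (pone Q) = 1" and \<pi>_surj: "\<pi> ` PA = UNIV"
    and \<pi>_nil: "\<exists>k\<ge>2. ideal_power Q PA (arrow_ideal PA) k \<subseteq> presentation_kernel Q \<pi>"
    and \<pi>_ker: "presentation_kernel Q \<pi> \<subseteq> ideal_power Q PA (arrow_ideal PA) 2"
  using adm unfolding admissible_presentation_def by (simp_all only: ball_simps)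

lemma PA_subspace: "cf.subspace PA"
proof (rule cf.subspaceI)
  show "0 \<in> PA" by (simp add: path_algebra_def complete_path_algebra_def)
next
  fix x y assume xy: "x \<in> PA" "y \<in> PA"
  have "{p. (x + y) p \<noteq> 0} \<subseteq> {p. x p \<noteq> 0} \<union> {p. y p \<noteq> 0}" by auto
  then have "finite {p. (x + y) p \<noteq> 0}" using xy unfolding path_algebra_def by (auto intro: finite_subset)
  then show "x + y \<in> PA" using xy by (simp add: path_algebra_def complete_path_algebra_def)
next
  fix c x assume x: "x \<in> PA"
  have "{p. cscale c x p \<noteq> 0} \<subseteq> {p. x p \<noteq> 0}" by (auto simp: cscale_apply)
  then have "finite {p. cscale c x p \<noteq> 0}" using x unfolding path_algebra_def by (auto intro: finite_subset)
  then show "cscale c x \<in> PA" using x by (simp add: path_algebra_def complete_path_algebra_def cscale_apply)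
qed

lemmas PAD = vs_subspaceD[OF vector_space_cscale PA_subspace]

lemma \<pi>_zero: "\<pi> 0 = 0" using \<pi>_add[OF PAD(1) PAD(1)] by simp

lemma \<pi>_sum: "(\<And>i. i \<in> I \<Longrightarrow> f i \<in> PA) \<Longrightarrow> \<pi> (\<Sum>i\<in>I. f i) = (\<Sum>i\<in>I. \<pi> (f i))"
proof (induction I rule: infinite_finite_induct)
  case (insert i I)
  have fi: "f i \<in> PA" and fI: "(\<Sum>i\<in>I. f i) \<in> PA"
    using insert.prems by (auto intro!: subspace_sum_closed[OF vector_space_cscale PA_subspace])
  have IH: "\<pi> (\<Sum>i\<in>I. f i) = (\<Sum>i\<in>I. \<pi> (f i))" using insert.prems by (intro insert.IH) blast
  show ?case by (simp only: sum.insert[OF insert.hyps(1,2)] \<pi>_add[OF fi fI] IH)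
qed (simp_all add: \<pi>_zero)

lemma PA_vtx: "i \<in> verts Q \<Longrightarrow> vtx i \<in> PA"
proof -
  assume i: "i \<in> verts Q"
  have "{p. vtx i p \<noteq> 0} = {(i, [])}" by (auto simp: indicator_def)
  moreover have "(i, []) \<in> qpaths Q" using i by (auto simp: qpaths_def awalk_Nil_iff)
  then have "vtx i \<in> complete_path_algebra Q" by (auto simp: complete_path_algebra_def indicator_def)
  ultimately show ?thesis by (simp add: path_algebra_def)
qed

lemma PA_pone: "pone Q = (\<Sum>i\<in>verts Q. vtx i)" "pone Q \<in> PA"
proof -
  show eq: "pone Q = (\<Sum>i\<in>verts Q. vtx i)"
  proof
    fix z :: "nat \<times> 'c list"
    obtain u p where z: "z = (u, p)" by (cases z)
    have "(\<Sum>i\<in>verts Q. vtx i) z = (\<Sum>i\<in>verts Q. if i = u then (if p = [] then 1 else 0) else 0)"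
      unfolding sum_fun_apply z by (rule sum.cong[OF refl]) (auto simp: indicator_def)
    then show "pone Q z = (\<Sum>i\<in>verts Q. vtx i) z" by (simp add: z pone_def)
  qed
  show "pone Q \<in> PA" unfolding eq
    by (rule subspace_sum_closed[OF vector_space_cscale PA_subspace PA_vtx])
qed

lemma PA_bound: assumes "x \<in> PA" obtains D where "\<And>u p. x (u, p) \<noteq> 0 \<Longrightarrow> length p \<le> D"
proof -
  have "finite ((\<lambda>z. length (snd z)) ` {z. x z \<noteq> 0})" using assms by (simp add: path_algebra_def)
  then obtain D where "\<forall>n\<in>(\<lambda>z. length (snd z)) ` {z. x z \<noteq> 0}. n \<le> D" using finite_nat_set_iff_bounded_le by blast
  then show ?thesis using that[of D] by force
qed

lemma PA_I:
  assumes "x \<in> complete_path_algebra Q" "\<And>u p. x (u, p) \<noteq> 0 \<Longrightarrow> length p \<le> D" shows "x \<in> PA"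
proof -
  have "{z. x z \<noteq> 0} \<subseteq> verts Q \<times> {p. set p \<subseteq> arcs Q \<and> length p \<le> D}"
  proof
    fix z assume z: "z \<in> {z. x z \<noteq> 0}"
    obtain u p where up: "z = (u, p)" by (cases z)
    have "(u, p) \<in> qpaths Q" using assms(1) z up unfolding complete_path_algebra_def by auto
    then have "u \<in> verts Q" "set p \<subseteq> arcs Q" unfolding qpaths_def by (auto simp: awalk_def)
    then show "z \<in> verts Q \<times> {p. set p \<subseteq> arcs Q \<and> length p \<le> D}" using assms(2)[of u p] z up by auto
  qed
  moreover have "finite (verts Q \<times> {p. set p \<subseteq> arcs Q \<and> length p \<le> D})"
    using finite_lists_length_le[OF finite_arcs] by simp
  ultimately have "finite {z. x z \<noteq> 0}" by (rule finite_subset)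
  then show ?thesis using assms(1) by (simp add: path_algebra_def)
qed

lemma PA_pmult: assumes "x \<in> PA" "y \<in> PA" shows "pmult Q x y \<in> PA"
proof -
  obtain D where D: "\<And>u p. x (u, p) \<noteq> 0 \<Longrightarrow> length p \<le> D" by (rule PA_bound[OF assms(1)]) auto
  obtain E where E: "\<And>u p. y (u, p) \<noteq> 0 \<Longrightarrow> length p \<le> E" by (rule PA_bound[OF assms(2)]) auto
  show ?thesis
  proof (rule PA_I)
    show "pmult Q x y \<in> complete_path_algebra Q"
      by (rule pmult_in_complete_path_algebra) (use assms wf_digraph in \<open>auto simp: path_algebra_def\<close>)
    fix u p assume "pmult Q x y (u, p) \<noteq> 0"
    then obtain k where "k \<le> length p" "x (last (awalk_verts u (take k p)), drop k p) * y (u, take k p) \<noteq> 0"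
      unfolding pmult_def by (auto elim: sum.not_neutral_contains_not_neutral)
    then have "length (drop k p) \<le> D" "length (take k p) \<le> E" "k \<le> length p"
      using D E by (auto simp del: length_drop length_take)
    then show "length p \<le> D + E" by simp
  qed
qed

lemma pmult_trivial: "pmult Q x y (u, []) = x (u, []) * y (u, [])" by (simp add: pmult_def)

lemma vtx_mult: "pmult Q (vtx i) (vtx j) = (if i = j then vtx i else 0)"
proof
  fix z :: "nat \<times> 'c list"
  obtain u p where z: "z = (u, p)" by (cases z)
  show "pmult Q (vtx i) (vtx j) z = (if i = j then vtx i else 0) z"
  proof (cases "p = []")
    case True
    then show ?thesis by (auto simp: z pmult_trivial indicator_def)
  next
    case False
    have "(\<Sum>k\<le>length p. vtx i (last (awalk_verts u (take k p)), drop k p) * vtx j (u, take k p)) = 0"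
      using False by (intro sum.neutral) (auto simp: indicator_def)
    then show ?thesis using False by (auto simp: z pmult_def indicator_def)
  qed
qed

lemma arrow_ideal_iff: "x \<in> arrow_ideal PA \<longleftrightarrow> x \<in> PA \<and> (\<forall>u. x (u, []) = 0)"
  by (auto simp: arrow_ideal_def)

text \<open>Each half of admissibility supplies one axiom: a power of the arrow ideal in the kernel
  makes \<open>rr\<close> nilpotent, and a kernel inside the square of the arrow ideal keeps the
  vertex idempotents out of \<open>rr\<close>. The decomposition modulo \<open>rr\<close> splits off
  the trivial paths.\<close>

lemma basic_algebra_times: "basic_algebra smul times (verts Q) (\<lambda>i. \<pi> (vtx i)) rr"
proof -
  obtain Bs where "finite_dimensional_vector_space smul Bs" using fd by (auto simp: fd_algebra_def)
  then interpret F: finite_dimensional_vector_space smul Bs .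
  have "\<forall>c x y. smul c (x * y) = smul c x * y \<and> smul c (x * y) = x * smul c y"
    using fd unfolding fd_algebra_def by (rule conjunct2)
  then have sm1: "smul c (x * y) = smul c x * y" and sm2: "smul c (x * y) = x * smul c y" for c x y
    by iprover+
  have sur: "\<exists>x. x \<in> PA \<and> \<pi> x = a" for a
  proof -
    have "a \<in> \<pi> ` PA" using \<pi>_surj by simp
    then show ?thesis by auto
  qed
  have AI: "cf.subspace (arrow_ideal PA)"
    by (rule cf.subspaceI) (auto simp: arrow_ideal_iff PAD cscale_apply)
  show ?thesis
  proof unfold_locales
    show "fd_subspace smul UNIV"
      unfolding fd_subspace_def by (rule exI[of _ Bs]) (simp add: F.finite_Basis F.span_Basis)
    show "smul z a * b = smul z (a * b)" for z a b by (rule sm1[symmetric])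
    show "a * smul z b = smul z (a * b)" for z a b by (rule sm2[symmetric])
    show "finite (verts Q)" by simp
    show "\<pi> (vtx i) * \<pi> (vtx i) = \<pi> (vtx i)" if "i \<in> verts Q" for i
      using \<pi>_mult[OF PA_vtx[OF that] PA_vtx[OF that]] by (simp add: vtx_mult)
    show "\<pi> (vtx i) * \<pi> (vtx j) = 0" if "i \<in> verts Q" "j \<in> verts Q" "i \<noteq> j" for i j
      using \<pi>_mult[OF PA_vtx[OF that(1)] PA_vtx[OF that(2)]] that(3) by (simp add: vtx_mult \<pi>_zero)
    show "(\<Sum>i\<in>verts Q. \<pi> (vtx i)) = 1"
      by (simp only: \<pi>_sum[of "verts Q" vtx, OF PA_vtx, symmetric] PA_pone(1)[symmetric] \<pi>_one)
    have lin: "lin_on cscale smul (arrow_ideal PA) \<pi>"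
      by (rule lin_onI) (auto simp: arrow_ideal_iff \<pi>_add \<pi>_scale)
    show "F.subspace rr"
      by (rule subspace_image_lin_on(1)[OF vector_space_cscale F.vector_space_axioms AI lin])
    fix a
    obtain x where x: "x \<in> PA" "\<pi> x = a" using sur by blast
    show "a * \<rho> \<in> rr" "\<rho> * a \<in> rr" if \<rho>: "\<rho> \<in> rr" for \<rho>
    proof -
      obtain y where y: "y \<in> arrow_ideal PA" "\<rho> = \<pi> y" using \<rho> by auto
      then have yP: "y \<in> PA" by (simp add: arrow_ideal_iff)
      have "pmult Q x y \<in> arrow_ideal PA" "pmult Q y x \<in> arrow_ideal PA"
        using y PA_pmult[OF x(1) yP] PA_pmult[OF yP x(1)] by (auto simp: arrow_ideal_iff pmult_trivial)
      moreover have "a * \<rho> = \<pi> (pmult Q x y)" "\<rho> * a = \<pi> (pmult Q y x)"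
        using \<pi>_mult[OF x(1) yP] \<pi>_mult[OF yP x(1)] x(2) y(2) by simp_all
      ultimately show "a * \<rho> \<in> rr" "\<rho> * a \<in> rr" by auto
    qed
    \<comment> \<open>The part of \<open>x\<close> supported on trivial paths; what remains lies in
      the arrow ideal.\<close>
    let ?s = "\<Sum>i\<in>verts Q. cscale (x (i, [])) (vtx i)"
    have cP: "cscale (x (i, [])) (vtx i) \<in> PA" if "i \<in> verts Q" for i by (rule PAD(4)[OF PA_vtx[OF that]])
    have sP: "?s \<in> PA" by (rule subspace_sum_closed[OF vector_space_cscale PA_subspace cP])
    have "?s (u, []) = x (u, [])" for u
    proof -
      have "?s (u, []) = (\<Sum>i\<in>verts Q. if i = u then x (u, []) else 0)"
        unfolding sum_fun_apply by (rule sum.cong[OF refl]) (auto simp: cscale_apply indicator_def)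
      also have "\<dots> = x (u, [])"
      proof (cases "u \<in> verts Q")
        case False
        then have "(u, []) \<notin> qpaths Q" by (auto simp: qpaths_def awalk_Nil_iff)
        then have "x (u, []) = 0" using x(1) by (simp add: path_algebra_def complete_path_algebra_def)
        then show ?thesis by simp
      qed simp
      finally show ?thesis .
    qed
    then have "(x - ?s) (u, []) = 0" for u unfolding minus_apply by (simp only: diff_self)
    then have "x - ?s \<in> arrow_ideal PA" using PAD(3)[OF x(1) sP] unfolding arrow_ideal_iff by blast
    moreover have "\<pi> x = \<pi> (x - ?s) + \<pi> ?s"
      unfolding \<pi>_add[OF PAD(3)[OF x(1) sP] sP, symmetric] diff_add_cancel ..
    moreover have "\<pi> ?s = (\<Sum>i\<in>verts Q. smul (x (i, [])) (\<pi> (vtx i)))"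
    proof -
      have "\<pi> ?s = (\<Sum>i\<in>verts Q. \<pi> (cscale (x (i, [])) (vtx i)))" by (rule \<pi>_sum) (rule cP)
      also have "\<dots> = (\<Sum>i\<in>verts Q. smul (x (i, [])) (\<pi> (vtx i)))"
        by (rule sum.cong[OF refl]) (rule \<pi>_scale[OF PA_vtx])
      finally show ?thesis .
    qed
    ultimately have "a - (\<Sum>i\<in>verts Q. smul (x (i, [])) (\<pi> (vtx i))) = \<pi> (x - ?s)" "x - ?s \<in> arrow_ideal PA"
      using x(2) by (simp_all only: add_diff_cancel_right')
    then have "a - (\<Sum>i\<in>verts Q. smul (x (i, [])) (\<pi> (vtx i))) \<in> rr" by (rule image_eqI)
    then show "\<exists>c. a - (\<Sum>i\<in>verts Q. smul (c i) (\<pi> (vtx i))) \<in> rr" by (rule exI[of _ "\<lambda>i. x (i, [])"])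
  next
    fix i assume i: "i \<in> verts Q"
    show "\<pi> (vtx i) \<notin> rr"
    proof
      assume "\<pi> (vtx i) \<in> rr"
      then obtain y where y: "y \<in> arrow_ideal PA" "\<pi> (vtx i) = \<pi> y" by auto
      then have yP: "y \<in> PA" "y (i, []) = 0" by (auto simp: arrow_ideal_iff)
      \<comment> \<open>The difference would lie in the kernel, hence in the square of the arrow
        ideal, although its trivial component at \<open>i\<close> is \<open>1\<close>.\<close>
      have d: "vtx i - y \<in> PA" by (rule PAD(3)[OF PA_vtx[OF i] yP(1)])
      have "\<pi> (vtx i - y) = 0" using \<pi>_add[OF d yP(1)] y(2) by simp
      then have "vtx i - y \<in> ideal_power Q PA (arrow_ideal PA) 2" using d \<pi>_ker by (auto simp: presentation_kernel_def)
      from arrow_square_no_trivial[OF this, of i] show False using yP(2) by simp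
    qed
  next
    obtain k where k: "ideal_power Q PA (arrow_ideal PA) k \<subseteq> presentation_kernel Q \<pi>" using \<pi>_nil by blast
    have "\<exists>z. z \<in> PA \<and> z \<in> ideal_power Q PA (arrow_ideal PA) (length as) \<and> foldr (*) as 1 = \<pi> z"
      if "set as \<subseteq> rr" for as
      using that
    proof (induction as)
      case Nil
      show ?case by (rule exI[of _ "pone Q"]) (simp add: PA_pone(2) \<pi>_one)
    next
      case (Cons a as)
      then obtain z where z: "z \<in> PA" "z \<in> ideal_power Q PA (arrow_ideal PA) (length as)" "foldr (*) as 1 = \<pi> z" by auto
      obtain x where x: "x \<in> arrow_ideal PA" "a = \<pi> x" using Cons.prems by auto
      then have xP: "x \<in> PA" by (simp add: arrow_ideal_iff)
      have "pmult Q x z \<in> ideal_prod Q (arrow_ideal PA) (ideal_power Q PA (arrow_ideal PA) (length as))"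
        unfolding ideal_prod_def
        by (intro CollectI exI[of _ 1] exI[of _ "\<lambda>_. x"] exI[of _ "\<lambda>_. z"]) (simp add: x(1) z(2))
      then show ?case using z x PA_pmult[OF xP z(1)] \<pi>_mult[OF xP z(1)] by (intro exI[of _ "pmult Q x z"]) simp
    qed
    then show "\<exists>k. \<forall>as. length as = k \<and> set as \<subseteq> rr \<longrightarrow> foldr (*) as 1 = 0"
      using k by (intro exI[of _ k]) (fastforce simp: presentation_kernel_def)
  qed (auto simp: algebra_simps)
qed

section \<open>The action of the path algebra on a representation\<close>

lemma path_matrix_append:
  assumes "awalk u p v" "c < d u"
  shows "path_matrix Q d M u (p @ q) r c = (\<Sum>j<d v. path_matrix Q d M v q r j * path_matrix Q d M u p j c)"
  using assms
proof (induction p arbitrary: u c)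
  case Nil
  then have uv: "u = v" by (simp add: awalk_Nil_iff)
  have "(\<Sum>j<d v. path_matrix Q d M v q r j * path_matrix Q d M u [] j c) = (\<Sum>j<d v. if j = c then path_matrix Q d M v q r c else 0)"
    by (rule sum.cong[OF refl]) (simp add: uv)
  also have "\<dots> = path_matrix Q d M u ([] @ q) r c" using Nil.prems(2) uv by simp
  finally show ?case by simp
next
  case (Cons a p)
  let ?h = "head Q a"
  have a: "awalk ?h p v" using Cons.prems(1) by (simp add: awalk_Cons_iff)
  have "path_matrix Q d M u ((a # p) @ q) r c = (\<Sum>i<d ?h. path_matrix Q d M ?h (p @ q) r i * M (a, i, c))" by simp
  also have "\<dots> = (\<Sum>i<d ?h. \<Sum>j<d v. path_matrix Q d M v q r j * path_matrix Q d M ?h p j i * M (a, i, c))"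
    by (rule sum.cong[OF refl]) (simp add: Cons.IH[OF a] sum_distrib_right)
  also have "\<dots> = (\<Sum>j<d v. \<Sum>i<d ?h. path_matrix Q d M v q r j * path_matrix Q d M ?h p j i * M (a, i, c))" by (rule sum.swap)
  also have "\<dots> = (\<Sum>j<d v. path_matrix Q d M v q r j * path_matrix Q d M u (a # p) j c)"
    by (rule sum.cong[OF refl]) (simp add: sum_distrib_left mult.assoc)
  finally show ?case .
qed

lemma rep_act_PA:
  assumes "\<forall>u p. x (u, p) \<noteq> 0 \<longrightarrow> length p \<le> D"
  shows "rep_act Q d M x u v r c = (\<Sum>p | awalk u p v \<and> length p \<le> D. x (u, p) * path_matrix Q d M u p r c)"
  by (rule rep_act_bounded[OF fin_digraph_axioms]) (use assms in force)

lemma rep_act_lin: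
  assumes x: "x \<in> PA" and y: "y \<in> PA"
  shows "rep_act Q d M (x + y) u v r c = rep_act Q d M x u v r c + rep_act Q d M y u v r c"
    "rep_act Q d M (cscale z x) u v r c = z * rep_act Q d M x u v r c"
proof -
  obtain D where D: "\<And>u p. x (u, p) \<noteq> 0 \<Longrightarrow> length p \<le> D" by (rule PA_bound[OF x]) auto
  obtain E where E: "\<And>u p. y (u, p) \<noteq> 0 \<Longrightarrow> length p \<le> E" by (rule PA_bound[OF y]) auto
  have D': "\<forall>u p. x (u, p) \<noteq> 0 \<longrightarrow> length p \<le> D + E"
    and E': "\<forall>u p. y (u, p) \<noteq> 0 \<longrightarrow> length p \<le> D + E" using D E by (auto intro: le_trans[OF _ le_add1] le_trans[OF _ le_add2])
  have S: "\<forall>u p. (x + y) (u, p) \<noteq> 0 \<longrightarrow> length p \<le> D + E"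
  proof (intro allI impI)
    fix u p assume "(x + y) (u, p) \<noteq> 0"
    then have "x (u, p) \<noteq> 0 \<or> y (u, p) \<noteq> 0" by auto
    then show "length p \<le> D + E" using D' E' by blast
  qed
  have D0: "\<forall>u p. x (u, p) \<noteq> 0 \<longrightarrow> length p \<le> D" using D by blast
  have Z: "\<forall>u p. cscale z x (u, p) \<noteq> 0 \<longrightarrow> length p \<le> D" using D by (auto simp: cscale_apply)
  show "rep_act Q d M (x + y) u v r c = rep_act Q d M x u v r c + rep_act Q d M y u v r c"
    by (simp only: rep_act_PA[OF S] rep_act_PA[OF D'] rep_act_PA[OF E'] plus_fun_apply distrib_right sum.distrib)
  show "rep_act Q d M (cscale z x) u v r c = z * rep_act Q d M x u v r c"
    by (simp only: rep_act_PA[OF Z] rep_act_PA[OF D0] cscale_apply sum_distrib_left mult.assoc)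
qed

text \<open>A walk from \<open>u\<close> to \<open>w\<close> with a cutting position is the same as
  two walks composable at some vertex \<open>v\<close>. This turns the convolution in
  \<open>pmult\<close> into a product of block matrices.\<close>

lemma rep_act_mult:
  assumes x: "x \<in> PA" and y: "y \<in> PA" and c: "c < d u"
  shows "rep_act Q d M (pmult Q x y) u w r c =
    (\<Sum>v\<in>verts Q. \<Sum>j<d v. rep_act Q d M x v w r j * rep_act Q d M y u v j c)"
proof -
  obtain D0 where D0: "\<And>u p. x (u, p) \<noteq> 0 \<Longrightarrow> length p \<le> D0" by (rule PA_bound[OF x]) auto
  obtain E0 where E0: "\<And>u p. y (u, p) \<noteq> 0 \<Longrightarrow> length p \<le> E0" by (rule PA_bound[OF y]) auto
  define D where "D = D0 + E0"
  have D: "length p \<le> D" if "x (u, p) \<noteq> 0" for u p using D0[OF that] by (simp add: D_def)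
  have E: "length p \<le> D" if "y (u, p) \<noteq> 0" for u p using E0[OF that] by (simp add: D_def)
  have DE: "length p \<le> D + D" if nz: "pmult Q x y (u, p) \<noteq> 0" for u p
  proof -
    obtain k where "k \<le> length p" "x (last (awalk_verts u (take k p)), drop k p) * y (u, take k p) \<noteq> 0"
      using nz unfolding pmult_def by (auto elim: sum.not_neutral_contains_not_neutral)
    then have "length (drop k p) \<le> D" "length (take k p) \<le> D" "k \<le> length p"
      using D E by (auto simp del: length_drop length_take)
    then show ?thesis by simp
  qed
  have Do: "\<forall>u p. x (u, p) \<noteq> 0 \<longrightarrow> length p \<le> D" and Eo: "\<forall>u p. y (u, p) \<noteq> 0 \<longrightarrow> length p \<le> D"
    and DEo: "\<forall>u p. pmult Q x y (u, p) \<noteq> 0 \<longrightarrow> length p \<le> D + D" using D E DE by blast+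
  let ?W = "\<lambda>u v n. {p. awalk u p v \<and> length p \<le> n}"
  have fW: "finite (?W u v n)" for u v n by (rule finite_bounded_walks[OF fin_digraph_axioms])
  let ?F = "\<lambda>(p, k). x (last (awalk_verts u (take k p)), drop k p) * y (u, take k p) * path_matrix Q d M u p r c"
  let ?G = "\<lambda>(v, p1, p2). x (v, p2) * y (u, p1) * path_matrix Q d M u (p1 @ p2) r c"
  let ?A = "Sigma (?W u w (D + D)) (\<lambda>p. {..length p})"
  \<comment> \<open>Only cuts with both halves within the common length bound \<open>D\<close> can
    contribute, and exactly these correspond to \<open>?B\<close>.\<close>
  let ?A' = "{(p, k) \<in> ?A. length (take k p) \<le> D \<and> length (drop k p) \<le> D}"
  let ?B = "Sigma (verts Q) (\<lambda>v. ?W u v D \<times> ?W v w D)"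
  have "rep_act Q d M (pmult Q x y) u w r c = (\<Sum>p\<in>?W u w (D + D). pmult Q x y (u, p) * path_matrix Q d M u p r c)"
    by (rule rep_act_PA[OF DEo])
  also have "\<dots> = (\<Sum>p\<in>?W u w (D + D). \<Sum>k\<le>length p. ?F (p, k))"
    by (rule sum.cong[OF refl]) (simp add: pmult_def sum_distrib_right)
  also have "\<dots> = (\<Sum>z\<in>?A. ?F z)"
    using sum.Sigma[OF fW, of u w "D + D" "\<lambda>p. {..length p}" "\<lambda>p k. ?F (p, k)"] by simp
  also have "\<dots> = (\<Sum>z\<in>?A'. ?F z)"
  proof (rule sum.mono_neutral_right)
    show "finite ?A" using fW by auto
    show "\<forall>z\<in>?A - ?A'. ?F z = 0"
    proof
      fix z assume z: "z \<in> ?A - ?A'"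
      obtain p k where pk: "z = (p, k)" by (cases z)
      then have "\<not> length (take k p) \<le> D \<or> \<not> length (drop k p) \<le> D" using z by auto
      then have "y (u, take k p) = 0 \<or> x (last (awalk_verts u (take k p)), drop k p) = 0" using D E by blast
      then show "?F z = 0" using pk by auto
    qed
  qed auto
  also have "\<dots> = (\<Sum>z\<in>?B. ?G z)"
  proof (rule sum.reindex_bij_witness[where i = "\<lambda>(v, p1, p2). (p1 @ p2, length p1)"
        and j = "\<lambda>(p, k). (last (awalk_verts u (take k p)), take k p, drop k p)"], goal_cases)
    case (1 z)
    then show ?case by auto
  next
    case (2 z)
    obtain p k where pk: "z = (p, k)" by (cases z)
    have w: "awalk u (take k p @ drop k p) w" using 2 pk by simp
    then have "awalk u (take k p) (last (awalk_verts u (take k p)))" "awalk (last (awalk_verts u (take k p))) (drop k p) w"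
      unfolding awalk_append_iff by auto
    then show ?case using 2 pk awalk_last_in_verts by auto
  next
    case (3 z)
    then show ?case by auto
  next
    case (4 z)
    obtain v p1 p2 where z: "z = (v, p1, p2)" by (cases z)
    have a: "awalk u p1 v" "awalk v p2 w" "length p1 \<le> D" "length p2 \<le> D" using 4 z by auto
    have "awalk u (p1 @ p2) w" by (rule awalk_appendI[OF a(1,2)])
    then show ?case using a z by auto
  next
    case (5 z)
    then show ?case by auto
  qed
  also have "\<dots> = (\<Sum>v\<in>verts Q. \<Sum>p1\<in>?W u v D. \<Sum>p2\<in>?W v w D. ?G (v, p1, p2))"
    by (simp add: sum.Sigma fW sum.cartesian_product)
  also have "\<dots> = (\<Sum>v\<in>verts Q. \<Sum>j<d v. rep_act Q d M x v w r j * rep_act Q d M y u v j c)"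
  proof (rule sum.cong[OF refl])
    fix v assume v: "v \<in> verts Q"
    have "(\<Sum>j<d v. rep_act Q d M x v w r j * rep_act Q d M y u v j c) =
      (\<Sum>j<d v. \<Sum>p1\<in>?W u v D. \<Sum>p2\<in>?W v w D. x (v, p2) * path_matrix Q d M v p2 r j * (y (u, p1) * path_matrix Q d M u p1 j c))"
      unfolding rep_act_PA[OF Do] rep_act_PA[OF Eo] sum_product by (rule sum.cong[OF refl]) (rule sum.swap)
    also have "\<dots> = (\<Sum>p1\<in>?W u v D. \<Sum>j<d v. \<Sum>p2\<in>?W v w D. x (v, p2) * path_matrix Q d M v p2 r j * (y (u, p1) * path_matrix Q d M u p1 j c))"
      by (rule sum.swap)
    also have "\<dots> = (\<Sum>p1\<in>?W u v D. \<Sum>p2\<in>?W v w D. \<Sum>j<d v. x (v, p2) * path_matrix Q d M v p2 r j * (y (u, p1) * path_matrix Q d M u p1 j c))"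
      by (rule sum.cong[OF refl]) (rule sum.swap)
    also have "\<dots> = (\<Sum>p1\<in>?W u v D. \<Sum>p2\<in>?W v w D. ?G (v, p1, p2))"
    proof (intro sum.cong[OF refl])
      fix p1 p2 assume "p1 \<in> ?W u v D"
      then have w: "awalk u p1 v" by simp
      show "(\<Sum>j<d v. x (v, p2) * path_matrix Q d M v p2 r j * (y (u, p1) * path_matrix Q d M u p1 j c)) = ?G (v, p1, p2)"
        by (simp add: path_matrix_append[of u p1 v c d M p2 r, OF w c] sum_distrib_left mult_ac)
    qed
    finally show "(\<Sum>p1\<in>?W u v D. \<Sum>p2\<in>?W v w D. ?G (v, p1, p2)) =
      (\<Sum>j<d v. rep_act Q d M x v w r j * rep_act Q d M y u v j c)" by simp
  qed
  finally show ?thesis .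
qed

lemma rep_act_vtx:
  assumes "c < d u"
  shows "rep_act Q d M (vtx i) u v r c = (if u = v \<and> u = i \<and> u \<in> verts Q \<and> r = c then 1 else 0)"
proof -
  have l: "\<forall>u p. vtx i (u, p) \<noteq> 0 \<longrightarrow> length p \<le> 0" by (auto simp: indicator_def)
  have "rep_act Q d M (vtx i) u v r c = (\<Sum>p | awalk u p v \<and> length p \<le> 0. vtx i (u, p) * path_matrix Q d M u p r c)"
    by (rule rep_act_PA[OF l])
  also have "{p. awalk u p v \<and> length p \<le> 0} = (if u = v \<and> u \<in> verts Q then {[]} else {})"
    by (auto simp: awalk_Nil_iff)
  also have "(\<Sum>p\<in>(if u = v \<and> u \<in> verts Q then {[]} else {}). vtx i (u, p) * path_matrix Q d M u p r c) =
      (if u = v \<and> u = i \<and> u \<in> verts Q \<and> r = c then 1 else 0)"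
    using assms by (cases "u = v \<and> u \<in> verts Q") (auto simp: indicator_def)
  finally show ?thesis .
qed

end

section \<open>Modules attached to the points of a representation variety\<close>

lemma prod_coords_intros:
  shows "f \<in> C \<Longrightarrow> (\<lambda>x. f (fst x)) \<in> prod_coords C D" and "g \<in> D \<Longrightarrow> (\<lambda>x. g (snd x)) \<in> prod_coords C D"
proof -
  show "(\<lambda>x. f (fst x)) \<in> prod_coords C D" if "f \<in> C"
    unfolding prod_coords_def by (rule UnI1, rule image_eqI[OF _ that]) (simp add: comp_def)
  show "(\<lambda>x. g (snd x)) \<in> prod_coords C D" if "g \<in> D"
    unfolding prod_coords_def by (rule UnI2, rule image_eqI[OF _ that]) (simp add: comp_def)
qed

lemma rep_coords_intro: "(\<lambda>M. M k) \<in> rep_coords"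
  by (auto simp: rep_coords_def)

lemma decRep_coords_intro: "(\<lambda>x. fst x k) \<in> decRep_coords"
  unfolding decRep_coords_def by (rule prod_coords_intros(1)[OF rep_coords_intro])

lemma matrix_module:
  fixes \<alpha> :: "'b::ring_1 \<Rightarrow> 'i \<Rightarrow> 'i \<Rightarrow> complex" and M :: "('b, 'i \<Rightarrow> complex) amod"
  assumes I: "finite I"
    and M: "carr M = supp_on I" "scal M = cscale"
      "\<And>a x. act M a x = (\<lambda>k. if k \<in> I then \<Sum>j\<in>I. \<alpha> a k j * x j else 0)"
    and \<alpha>: "\<And>a b k j. \<alpha> (a + b) k j = \<alpha> a k j + \<alpha> b k j" "\<And>z a k j. \<alpha> (smul z a) k j = z * \<alpha> a k j"
      "\<And>a b k j. k \<in> I \<Longrightarrow> j \<in> I \<Longrightarrow> \<alpha> (mu a b) k j = (\<Sum>i\<in>I. \<alpha> a k i * \<alpha> b i j)"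
      "\<And>k j. k \<in> I \<Longrightarrow> j \<in> I \<Longrightarrow> \<alpha> 1 k j = (if k = j then 1 else 0)"
  shows "amodule smul mu M" "matrix_form M I (\<lambda>j. indicator {j}) \<alpha>"
proof -
  show "amodule smul mu M"
  proof (rule amoduleI, unfold M(1,2))
    show "vector_space cscale" by (rule vector_space_cscale)
    show "fd_subspace cscale (supp_on I)" by (rule supp_on_finite(1)[OF I])
    fix a b :: 'b and x y :: "'i \<Rightarrow> complex" and z :: complex
    assume x: "x \<in> supp_on I"
    show "act M a x \<in> supp_on I" by (simp add: M(3) supp_on_def)
    show "act M (a + b) x = act M a x + act M b x"
      by (rule ext) (simp add: M(3) \<alpha>(1) distrib_right sum.distrib)
    show "act M (smul z a) x = cscale z (act M a x)"
      by (rule ext) (simp add: M(3) \<alpha>(2) cscale_apply sum_distrib_left mult.assoc)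
    show "act M a (cscale z x) = cscale z (act M a x)"
      by (rule ext) (simp add: M(3) cscale_apply sum_distrib_left mult_ac)
    show "act M (mu a b) x = act M a (act M b x)"
    proof
      fix k
      show "act M (mu a b) x k = act M a (act M b x) k"
      proof (cases "k \<in> I")
        case True
        have "act M (mu a b) x k = (\<Sum>j\<in>I. \<Sum>i\<in>I. \<alpha> a k i * \<alpha> b i j * x j)"
          using True by (simp add: M(3) \<alpha>(3) sum_distrib_right)
        also have "\<dots> = (\<Sum>i\<in>I. \<Sum>j\<in>I. \<alpha> a k i * \<alpha> b i j * x j)" by (rule sum.swap)
        also have "\<dots> = act M a (act M b x) k"
          using True by (simp add: M(3) sum_distrib_left mult.assoc)
        finally show ?thesis .
      qed (simp add: M(3))
    qed
    show "act M 1 x = x"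
    proof
      fix k
      show "act M 1 x k = x k"
      proof (cases "k \<in> I")
        case True
        have "act M 1 x k = (\<Sum>j\<in>I. if k = j then x k else 0)"
          unfolding M(3) using True by (auto simp: \<alpha>(4) intro!: sum.cong)
        then show ?thesis using True I by simp
      qed (use x in \<open>simp add: M(3) supp_on_def\<close>)
    qed
  next
    fix a :: 'b and x y :: "'i \<Rightarrow> complex"
    show "act M a (x + y) = act M a x + act M a y"
      by (rule ext) (simp add: M(3) distrib_left sum.distrib)
  qed
  have comb: "comb M I (\<lambda>j. indicator {j}) c = (\<lambda>k. if k \<in> I then c k else 0)" for c
  proof
    fix k
    have "comb M I (\<lambda>j. indicator {j}) c k = (\<Sum>j\<in>I. if k = j then c k else 0)"
      unfolding comb_def M(2) sum_fun_apply by (rule sum.cong[OF refl]) (simp add: cscale_apply indicator_def)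
    then show "comb M I (\<lambda>j. indicator {j}) c k = (if k \<in> I then c k else 0)" using I by simp
  qed
  show "matrix_form M I (\<lambda>j. indicator {j}) \<alpha>"
    unfolding matrix_form_def comb M(1)
  proof (intro conjI allI ballI impI)
    show "finite I" by fact
    show "(\<lambda>k. if k \<in> I then c k else 0) \<in> supp_on I" for c by (simp add: supp_on_def)
    show "\<exists>c\<in>supp_on I. x = (\<lambda>k. if k \<in> I then c k else 0)" if "x \<in> supp_on I" for x
      using that by (intro bexI[of _ x]) (auto simp: supp_on_def)
    show "c i = 0" if "(\<lambda>k. if k \<in> I then c k else 0) = 0" "i \<in> I" for c i
      using fun_cong[OF that(1), of i] that(2) by simp
    fix a :: 'b and j assume j: "j \<in> I"
    show "act M a (indicator {j}) = (\<lambda>k. if k \<in> I then \<alpha> a k j else 0)"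
    proof
      fix k
      have "(\<Sum>i\<in>I. \<alpha> a k i * indicator {j} i) = (\<Sum>i\<in>I. if i = j then \<alpha> a k j else 0)"
        by (rule sum.cong[OF refl]) (simp add: indicator_def)
      then show "act M a (indicator {j}) k = (if k \<in> I then \<alpha> a k j else 0)"
        using j I by (simp add: M(3))
    qed
  qed
qed

context path_algebra_presentation
begin

abbreviation rep where "rep \<equiv> Rep_fd Q (presentation_kernel Q \<pi>)"
abbreviation lift where "lift \<equiv> inv_into PA \<pi>"
abbreviation basis_index where "basis_index d \<equiv> SIGMA i:verts Q. {..<d i :: nat}"

definition rep_matrix :: "(nat \<Rightarrow> nat) \<Rightarrow> 'c rep \<Rightarrow> 'b \<Rightarrow> nat \<times> nat \<Rightarrow> nat \<times> nat \<Rightarrow> complex" where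
  "rep_matrix d M b k j = rep_act Q d M (lift b) (fst j) (fst k) (snd k) (snd j)"

lemma lift_props: "lift b \<in> PA" "\<pi> (lift b) = b"
  using inv_into_into[of b \<pi> PA] f_inv_into_f[of b \<pi> PA] \<pi>_surj by simp_all

text \<open>Two preimages of an element of the algebra differ by an element of the kernel, which
  annihilates \<open>M\<close>. So the arbitrary preimage \<open>lift b\<close> may be replaced by
  any convenient one.\<close>

lemma rep_act_lift:
  assumes M: "M \<in> rep d" and x: "x \<in> PA"
  shows "rep_act Q d M (lift (\<pi> x)) u v r c = rep_act Q d M x u v r c"
proof -
  let ?y = "lift (\<pi> x)"
  have d: "?y - x \<in> PA" by (rule PAD(3)[OF lift_props(1) x])
  have "\<pi> (?y - x + x) = \<pi> (?y - x) + \<pi> x" by (rule \<pi>_add[OF d x])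
  then have "\<pi> (?y - x) = 0" by (simp only: diff_add_cancel lift_props(2)) simp
  then have "rep_act Q d M (?y - x) u v r c = 0"
    using M d by (auto simp: Rep_fd_def annihilates_def presentation_kernel_def)
  moreover have "rep_act Q d M (?y - x + x) u v r c = rep_act Q d M (?y - x) u v r c + rep_act Q d M x u v r c"
    by (rule rep_act_lin(1)[OF d x])
  ultimately show ?thesis by (simp only: diff_add_cancel) simp
qed

lemma rep_matrix_\<pi>:
  "M \<in> rep d \<Longrightarrow> x \<in> PA \<Longrightarrow> rep_matrix d M (\<pi> x) k j = rep_act Q d M x (fst j) (fst k) (snd k) (snd j)"
  by (simp only: rep_matrix_def rep_act_lift)

lemma rep_matrix_vtx:
  assumes M: "M \<in> rep d" and i: "i \<in> verts Q" and j: "j \<in> basis_index d"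
  shows "rep_matrix d M (\<pi> (vtx i)) k j = (if k = j \<and> k \<in> {i} \<times> {..<d i} then 1 else 0)"
  using i j by (cases k; cases j) (auto simp: rep_matrix_\<pi>[OF M PA_vtx[OF i]] rep_act_vtx simp del: indicator_simps)

lemma finite_basis_index: "finite (basis_index d)" by simp

lemma rep_module_props:
  assumes M: "M \<in> rep d"
  shows "amodule smul times (rep_module Q \<pi> d M)"
    and "matrix_form (rep_module Q \<pi> d M) (basis_index d) (\<lambda>j. indicator {j}) (rep_matrix d M)"
proof -
  have c: "carr (rep_module Q \<pi> d M) = supp_on (basis_index d)"
    by (auto simp: rep_module_def supp_on_def)
  have s: "scal (rep_module Q \<pi> d M) = cscale" by (simp add: rep_module_def)
  have a: "act (rep_module Q \<pi> d M) b x = (\<lambda>k. if k \<in> basis_index d then \<Sum>j\<in>basis_index d. rep_matrix d M b k j * x j else 0)" for b x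
  proof
    fix k :: "nat \<times> nat"
    obtain v r where k: "k = (v, r)" by (cases k)
    have "(\<Sum>j\<in>basis_index d. rep_matrix d M b k j * x j) =
        (\<Sum>u\<in>verts Q. \<Sum>c<d u. rep_matrix d M b k (u, c) * x (u, c))"
      by (subst sum.Sigma) (auto intro!: sum.cong)
    then show "act (rep_module Q \<pi> d M) b x k = (if k \<in> basis_index d then \<Sum>j\<in>basis_index d. rep_matrix d M b k j * x j else 0)"
      by (simp add: rep_module_def k rep_matrix_def)
  qed
  have add: "rep_matrix d M (b + b') k j = rep_matrix d M b k j + rep_matrix d M b' k j" for b b' k j
  proof -
    have "rep_matrix d M (\<pi> (lift b + lift b')) k j = rep_matrix d M b k j + rep_matrix d M b' k j"
      by (subst rep_matrix_\<pi>[OF M PAD(2)[OF lift_props(1) lift_props(1)]])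
        (simp only: rep_act_lin(1)[OF lift_props(1) lift_props(1)] rep_matrix_def)
    then show ?thesis by (simp only: \<pi>_add[OF lift_props(1) lift_props(1)] lift_props(2))
  qed
  have scale: "rep_matrix d M (smul z b) k j = z * rep_matrix d M b k j" for z b k j
  proof -
    have "rep_matrix d M (\<pi> (cscale z (lift b))) k j = z * rep_matrix d M b k j"
      by (subst rep_matrix_\<pi>[OF M PAD(4)[OF lift_props(1)]])
        (simp only: rep_act_lin(2)[OF lift_props(1) lift_props(1)] rep_matrix_def)
    then show ?thesis by (simp only: \<pi>_scale[OF lift_props(1)] lift_props(2))
  qed
  have mult: "rep_matrix d M (b * b') k j = (\<Sum>i\<in>basis_index d. rep_matrix d M b k i * rep_matrix d M b' i j)"
    if j: "j \<in> basis_index d" for b b' k j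
  proof -
    have cj: "snd j < d (fst j)" using j by auto
    have "rep_matrix d M (\<pi> (pmult Q (lift b) (lift b'))) k j =
        (\<Sum>v\<in>verts Q. \<Sum>i<d v. rep_matrix d M b k (v, i) * rep_matrix d M b' (v, i) j)"
      unfolding rep_matrix_\<pi>[OF M PA_pmult[OF lift_props(1) lift_props(1)]]
        rep_act_mult[where d = d, OF lift_props(1) lift_props(1) cj]
      by (simp add: rep_matrix_def)
    also have "\<dots> = (\<Sum>i\<in>basis_index d. rep_matrix d M b k i * rep_matrix d M b' i j)"
      by (subst sum.Sigma) (auto intro!: sum.cong)
    finally show ?thesis by (simp only: \<pi>_mult[OF lift_props(1) lift_props(1)] lift_props(2))
  qed
  have sum: "rep_matrix d M (\<Sum>i\<in>V. f i) k j = (\<Sum>i\<in>V. rep_matrix d M (f i) k j)" if "finite V" for V :: "nat set" and f k j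
    using that
  proof (induction V rule: finite_induct)
    case empty
    show ?case using add[of 0 0 k j] by simp
  qed (simp add: add)
  have one: "rep_matrix d M 1 k j = (if k = j then 1 else 0)" if k: "k \<in> basis_index d" and j: "j \<in> basis_index d" for k j
  proof -
    \<comment> \<open>The preimage \<open>lift 1\<close> is arbitrary; writing \<open>1\<close> as
      the sum of the vertex idempotents makes its matrix computable.\<close>
    have "1 = (\<Sum>i\<in>verts Q. \<pi> (vtx i))"
      by (simp only: \<pi>_sum[of "verts Q" vtx, OF PA_vtx, symmetric] PA_pone(1)[symmetric] \<pi>_one)
    then have "rep_matrix d M 1 k j = (\<Sum>i\<in>verts Q. rep_matrix d M (\<pi> (vtx i)) k j)"
      using sum[OF finite_verts, of "\<lambda>i. \<pi> (vtx i)" k j] by simp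
    also have "\<dots> = (\<Sum>i\<in>verts Q. if i = fst k then (if k = j then 1 else 0) else 0)"
      by (rule sum.cong[OF refl]) (use k in \<open>auto simp: rep_matrix_vtx[OF M _ j]\<close>)
    also have "\<dots> = (if k = j then 1 else 0)" using k by auto
    finally show ?thesis .
  qed
  note mm = matrix_module[OF finite_basis_index c s a add scale mult one]
  show "amodule smul times (rep_module Q \<pi> d M)" by (rule mm(1))
  show "matrix_form (rep_module Q \<pi> d M) (basis_index d) (\<lambda>j. indicator {j}) (rep_matrix d M)" by (rule mm(2))
qed

text \<open>The vertex idempotent is the projection to the block at \<open>i\<close>, a diagonal
  matrix and hence unchanged by transposition.\<close>

lemma dim_epart_rep:
  assumes M: "M \<in> rep d" and i: "i \<in> verts Q"
  shows "vector_space.dim (scal (rep_module Q \<pi> d M))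
      {y \<in> carr (rep_module Q \<pi> d M). act (rep_module Q \<pi> d M) (\<pi> (vtx i)) y = y} = d i" (is ?th1)
    and "vector_space.dim (scal (dual_module (rep_module Q \<pi> d M)))
      {y \<in> carr (dual_module (rep_module Q \<pi> d M)). act (dual_module (rep_module Q \<pi> d M)) (\<pi> (vtx i)) y = y} = d i" (is ?th2)
proof -
  note m = rep_module_props[OF M]
  have I': "{i} \<times> {..<d i} \<subseteq> basis_index d" using i by auto
  have c: "card ({i} \<times> {..<d i}) = d i" by (simp add: card_cartesian_product)
  have "vector_space.dim (scal (rep_module Q \<pi> d M))
      {y \<in> carr (rep_module Q \<pi> d M). act (rep_module Q \<pi> d M) (\<pi> (vtx i)) y = y} = card ({i} \<times> {..<d i})"
    by (rule dim_epart_matrix[OF m I']) (rule rep_matrix_vtx[OF M i])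
  then show ?th1 by (simp only: c)
  have "vector_space.dim (scal (dual_module (rep_module Q \<pi> d M)))
      {y \<in> carr (dual_module (rep_module Q \<pi> d M)). act (dual_module (rep_module Q \<pi> d M)) (\<pi> (vtx i)) y = y} = card ({i} \<times> {..<d i})"
  proof (rule dim_epart_matrix[OF dual_amodule[OF m(1)] matrix_form_dual[OF m] I'])
    fix k j assume "k \<in> basis_index d" "j \<in> basis_index d"
    then show "rep_matrix d M (\<pi> (vtx i)) j k = (if k = j \<and> k \<in> {i} \<times> {..<d i} then 1 else 0)"
      using rep_matrix_vtx[OF M i, of k j] by auto
  qed
  then show ?th2 by (simp only: c)
qed

text \<open>For fixed \<open>b\<close> the preimage \<open>lift b\<close> is the same for all points
  and involves paths of bounded length only, so its action is polynomial in the matrix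
  entries.\<close>

lemma regular_rep_matrix:
  assumes "\<And>k. regular_on C X (\<lambda>x. m x k)" shows "regular_on C X (\<lambda>x. rep_matrix d (m x) b k j)"
proof -
  obtain D where "\<And>u p. lift b (u, p) \<noteq> 0 \<Longrightarrow> length p \<le> D" by (rule PA_bound[OF lift_props(1)]) auto
  then have D: "\<forall>u p. lift b (u, p) \<noteq> 0 \<longrightarrow> length p \<le> D" by blast
  show ?thesis unfolding rep_matrix_def rep_act_PA[OF D]
    by (intro regular_sum regular_mult regular_const regular_path_matrix assms)
qed

text \<open>The first claim is the formula for the algebra itself. For the second, duality rewrites
  \<open>Hom(Tr D A, B)\<close> as \<open>Hom(D B, D Tr D A)\<close>, which is the same kind of
  space over the opposite algebra for the modules \<open>D A\<close> and \<open>D B\<close>.\<close>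

lemma usc_hom_AR:
  assumes m: "\<And>k. regular_on C X (\<lambda>x. m x k)" "\<And>x. x \<in> X \<Longrightarrow> m x \<in> rep d"
    and n: "\<And>k. regular_on C X (\<lambda>x. n x k)" "\<And>x. x \<in> X \<Longrightarrow> n x \<in> rep d'"
  shows "usc_on C X (\<lambda>x. int (amod_hom_dim (rep_module Q \<pi> d' (n x)) (AR_translate smul (rep_module Q \<pi> d (m x)))))"
    and "usc_on C X (\<lambda>x. int (amod_hom_dim (AR_translate_inv smul (rep_module Q \<pi> d (m x))) (rep_module Q \<pi> d' (n x))))"
proof -
  interpret B: basic_algebra smul times "verts Q" "\<lambda>i. \<pi> (vtx i)" rr by (rule basic_algebra_times)
  interpret O: basic_algebra smul "\<lambda>a b. b * a" "verts Q" "\<lambda>i. \<pi> (vtx i)" rr by (rule B.opposite)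
  let ?A = "\<lambda>x. rep_module Q \<pi> d (m x)" and ?B = "\<lambda>x. rep_module Q \<pi> d' (n x)"
  let ?ind = "\<lambda>j. indicator {j} :: nat \<times> nat \<Rightarrow> complex"
  have A: "amodule smul times (?A x) \<and> matrix_form (?A x) (basis_index d) ?ind (rep_matrix d (m x))" if "x \<in> X" for x
    using rep_module_props[OF m(2)[OF that]] by blast
  have B: "amodule smul times (?B x) \<and> matrix_form (?B x) (basis_index d') ?ind (rep_matrix d' (n x))" if "x \<in> X" for x
    using rep_module_props[OF n(2)[OF that]] by blast
  show "usc_on C X (\<lambda>x. int (amod_hom_dim (?B x) (AR_translate smul (?A x))))"
    unfolding AR_translate_def
    by (rule B.usc_hom_transpose[where b = "\<lambda>_. ?ind" and c = "\<lambda>_. ?ind" and dA = d and dB = d',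
          OF finite_basis_index[of d] finite_basis_index[of d'] A B])
      (auto intro: regular_rep_matrix m n dim_epart_rep B.transpose_exists A[THEN conjunct1])
  let ?T = "\<lambda>x. transpose_module smul (\<lambda>a b. b * a) (dual_module (?A x))"
  have T: "is_transpose smul (\<lambda>a b. b * a) (dual_module (?A x)) (?T x)" if "x \<in> X" for x
    by (rule O.transpose_exists[OF dual_amodule[OF A[OF that, THEN conjunct1]]])
  let ?bA = "\<lambda>x i y. if y \<in> carr (?A x) then crd (?A x) (basis_index d) ?ind y i else 0"
  let ?bB = "\<lambda>x i y. if y \<in> carr (?B x) then crd (?B x) (basis_index d') ?ind y i else 0"
  have DA: "amodule smul (\<lambda>a b. b * a) (dual_module (?A x)) \<and>
      matrix_form (dual_module (?A x)) (basis_index d) (?bA x) (\<lambda>a k j. rep_matrix d (m x) a j k)" if "x \<in> X" for x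
    by (intro conjI dual_amodule[OF A[OF that, THEN conjunct1]]
        matrix_form_dual[OF A[OF that, THEN conjunct1] A[OF that, THEN conjunct2]])
  have DB: "amodule smul (\<lambda>a b. b * a) (dual_module (?B x)) \<and>
      matrix_form (dual_module (?B x)) (basis_index d') (?bB x) (\<lambda>a k j. rep_matrix d' (n x) a j k)" if "x \<in> X" for x
    by (intro conjI dual_amodule[OF B[OF that, THEN conjunct1]]
        matrix_form_dual[OF B[OF that, THEN conjunct1] B[OF that, THEN conjunct2]])
  have "usc_on C X (\<lambda>x. int (amod_hom_dim (dual_module (?B x)) (dual_module (?T x))))"
    by (rule O.usc_hom_transpose[where b = ?bA and c = ?bB and dA = d and dB = d',
          OF finite_basis_index[of d] finite_basis_index[of d'] DA DB])
      (auto intro: regular_rep_matrix m n dim_epart_rep T)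
  moreover have "amod_hom_dim (dual_module (?B x)) (dual_module (?T x)) = amod_hom_dim (AR_translate_inv smul (?A x)) (?B x)"
    if x: "x \<in> X" for x
  proof -
    \<comment> \<open>The transpose over the opposite algebra is a left module for the original
      multiplication.\<close>
    have "amodule smul (\<lambda>a b. a * b) (?T x)" using T[OF x] unfolding is_transpose_def by blast
    from amod_hom_dim_dual[OF this B[OF x, THEN conjunct1]] show ?thesis
      unfolding AR_translate_inv_def op_mult_def .
  qed
  ultimately show "usc_on C X (\<lambda>x. int (amod_hom_dim (AR_translate_inv smul (?A x)) (?B x)))"
    by (subst usc_cong) auto
qed

end

theorem theorem1p9:
  fixes n m :: nat
    and Q :: "(nat, 'a) pre_digraph" and J :: "('a qpath \<Rightarrow> complex) set"
    and smul :: "complex \<Rightarrow> 'b::ring_1 \<Rightarrow> 'b"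
    and QA :: "(nat, 'c) pre_digraph" and \<pi> :: "('c qpath \<Rightarrow> complex) \<Rightarrow> 'b"
  assumes "n \<ge> 1"
  shows
    "(quiver n m Q \<and>
      two_sided_ideal Q (complete_path_algebra Q) J \<and>
      J \<subseteq> ideal_power Q (complete_path_algebra Q) (arrow_ideal (complete_path_algebra Q)) 2 \<and>
      closedin (adic_topology Q) J \<longrightarrow>
      (\<forall>d \<in> nat_vectors n. \<forall>v \<in> nat_vectors n. \<forall>d' \<in> nat_vectors n. \<forall>v' \<in> nat_vectors n.
         upper_semicontinuous (zariski_topology decRep_coords (decRep Q J d v))
           (\<lambda>M. E_invariant n Q J d M d M) \<and>
         upper_semicontinuous
           (zariski_topology (prod_coords decRep_coords decRep_coords)
              (decRep Q J d v \<times> decRep Q J d' v'))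
           (\<lambda>(M, N). E_invariant n Q J d M d' N)))
     \<and>
     (fd_algebra smul \<and> quiver n 0 QA \<and> admissible_presentation smul QA \<pi> \<longrightarrow>
      (\<forall>d \<in> nat_vectors n. \<forall>d' \<in> nat_vectors n.
         let I = presentation_kernel QA \<pi>;
             X = zariski_topology rep_coords (Rep_fd QA I d);
             XX = zariski_topology (prod_coords rep_coords rep_coords)
                    (Rep_fd QA I d \<times> Rep_fd QA I d');
             mk = rep_module QA \<pi>;
             tau = AR_translate smul;
             tau_inv = AR_translate_inv smul
         in
         upper_semicontinuous X
           (\<lambda>M. int (amod_hom_dim (tau_inv (mk d M)) (mk d M))) \<and>
         upper_semicontinuous XX
           (\<lambda>(M, N). int (amod_hom_dim (tau_inv (mk d' N)) (mk d M))) \<and>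
         upper_semicontinuous X
           (\<lambda>M. int (amod_hom_dim (mk d M) (tau (mk d M)))) \<and>
         upper_semicontinuous XX
           (\<lambda>(M, N). int (amod_hom_dim (mk d' N) (tau (mk d M))))))"
proof (intro conjI impI; elim conjE)
  let ?m = "arrow_ideal (complete_path_algebra Q)"
  assume Q: "quiver n m Q" and J: "J \<subseteq> ideal_power Q (complete_path_algebra Q) ?m 2"
  have Q': "fin_digraph Q" "{1..n} \<subseteq> verts Q" using Q by (auto simp: quiver_def)
  show "\<forall>d \<in> nat_vectors n. \<forall>v \<in> nat_vectors n. \<forall>d' \<in> nat_vectors n. \<forall>v' \<in> nat_vectors n.
         upper_semicontinuous (zariski_topology decRep_coords (decRep Q J d v))
           (\<lambda>M. E_invariant n Q J d M d M) \<and>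
         upper_semicontinuous
           (zariski_topology (prod_coords decRep_coords decRep_coords)
              (decRep Q J d v \<times> decRep Q J d' v'))
           (\<lambda>(M, N). E_invariant n Q J d M d' N)"
  proof (intro ballI conjI)
    fix d v d' v' :: "nat \<Rightarrow> nat"
    note c = regular_coord[OF decRep_coords_intro] regular_coord[OF prod_coords_intros(1)[OF decRep_coords_intro]]
      regular_coord[OF prod_coords_intros(2)[OF decRep_coords_intro]]
    \<comment> \<open>On the diagonal both families are the same point, and the decoration is
      constantly \<open>v\<close>.\<close>
    have "usc_on decRep_coords (decRep Q J d v) (\<lambda>x. E_invariant n Q J d (fst x, snd x) d (fst x, snd x))"
      by (rule usc_E_invariant[OF Q' J, where ?w0.0 = v]) (rule c | force simp: decRep_def)+
    then show "usc_on decRep_coords (decRep Q J d v) (\<lambda>M. E_invariant n Q J d M d M)" by simp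
    have "usc_on (prod_coords decRep_coords decRep_coords) (decRep Q J d v \<times> decRep Q J d' v')
        (\<lambda>x. E_invariant n Q J d (fst (fst x), snd (fst x)) d' (fst (snd x), snd (snd x)))"
      by (rule usc_E_invariant[OF Q' J, where ?w0.0 = v']) (rule c | force simp: decRep_def)+
    then show "usc_on (prod_coords decRep_coords decRep_coords) (decRep Q J d v \<times> decRep Q J d' v')
        (\<lambda>(M, N). E_invariant n Q J d M d' N)" by (simp add: case_prod_unfold)
  qed
next
  assume A: "fd_algebra smul" "quiver n 0 QA" "admissible_presentation smul QA \<pi>"
  interpret path_algebra_presentation QA smul \<pi>
    using A by (simp add: path_algebra_presentation_def path_algebra_presentation_axioms_def quiver_def)
  note r = regular_coord[OF rep_coords_intro] regular_coord[OF prod_coords_intros(1)[OF rep_coords_intro]]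
    regular_coord[OF prod_coords_intros(2)[OF rep_coords_intro]]
  show "\<forall>d \<in> nat_vectors n. \<forall>d' \<in> nat_vectors n.
         let I = presentation_kernel QA \<pi>;
             X = zariski_topology rep_coords (Rep_fd QA I d);
             XX = zariski_topology (prod_coords rep_coords rep_coords)
                    (Rep_fd QA I d \<times> Rep_fd QA I d');
             mk = rep_module QA \<pi>;
             tau = AR_translate smul;
             tau_inv = AR_translate_inv smul
         in
         upper_semicontinuous X
           (\<lambda>M. int (amod_hom_dim (tau_inv (mk d M)) (mk d M))) \<and>
         upper_semicontinuous XX
           (\<lambda>(M, N). int (amod_hom_dim (tau_inv (mk d' N)) (mk d M))) \<and>
         upper_semicontinuous X
           (\<lambda>M. int (amod_hom_dim (mk d M) (tau (mk d M)))) \<and>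
         upper_semicontinuous XX
           (\<lambda>(M, N). int (amod_hom_dim (mk d' N) (tau (mk d M))))"
    unfolding Let_def case_prod_beta
  proof (intro ballI conjI)
    fix d d' :: "nat \<Rightarrow> nat"
    show "usc_on rep_coords (rep d) (\<lambda>M. int (amod_hom_dim (AR_translate_inv smul (rep_module QA \<pi> d M)) (rep_module QA \<pi> d M)))"
      by (rule usc_hom_AR(2)) (rule r | force)+
    show "usc_on rep_coords (rep d) (\<lambda>M. int (amod_hom_dim (rep_module QA \<pi> d M) (AR_translate smul (rep_module QA \<pi> d M))))"
      by (rule usc_hom_AR(1)) (rule r | force)+
    show "usc_on (prod_coords rep_coords rep_coords) (rep d \<times> rep d')
        (\<lambda>x. int (amod_hom_dim (AR_translate_inv smul (rep_module QA \<pi> d' (snd x))) (rep_module QA \<pi> d (fst x))))"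
      \<comment> \<open>The families are the two projections: the translated module is the second
        component here, and the first one for \<open>AR_translate\<close>.\<close>
      by (rule usc_hom_AR(2)) (rule r | force)+
    show "usc_on (prod_coords rep_coords rep_coords) (rep d \<times> rep d')
        (\<lambda>x. int (amod_hom_dim (rep_module QA \<pi> d' (snd x)) (AR_translate smul (rep_module QA \<pi> d (fst x)))))"
      by (rule usc_hom_AR(1)) (rule r | force)+
  qed
qed

end
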